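(* Let $G$ be a reductive (possibly non-connected) linear algebraic group over an algebraically closed field $k$, let $t$ be a positive integer, and let $M,H_1,\ldots,H_t$ be closed subgroups of $G$ such that $M$ is reductive. Let $A$ be the set of all $(g_1,\ldots,g_t)\in G^t$ such that the group $M\cap g_1H_1g_1^{-1}\cap\cdots\cap g_tH_tg_t^{-1}$ is reductive and has minimal dimension (minimal among the dimensions of all the groups $M\cap x_1H_1x_1^{-1}\cap\cdots\cap x_tH_tx_t^{-1}$ with $(x_1,\ldots,x_t)\in G^t$). Then $A$ is open in $G^t$.
   Context: Varieties are identified with their sets of $k$-points; intersections of subgroups are taken as closed (reduced) subgroups. A linear algebraic group is reductive if its unipotent radical (largest connected normal unipotent closed subgroup) is trivial; connectedness is not required. *)

theory Defs
  imports
    "HOL-Analysis.Analysis"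
    "HOL-Algebra.Coset"
    "HOL-Computational_Algebra.Polynomial"
    "HOL-Library.Extended_Nat"
begin

section \<open>Zariski topology\<close>

text \<open>
  Affine space is modelled by a type together with a set of coordinate functions on it. Over an
  infinite field, in particular over an algebraically closed one, the functions below are exactly
  the polynomials in the coordinates.
\<close>

inductive_set polynomial_functions :: "('v \<Rightarrow> 'k::comm_ring_1) set \<Rightarrow> ('v \<Rightarrow> 'k) set"
  for X :: "('v \<Rightarrow> 'k) set" where
  const: "(\<lambda>_. c) \<in> polynomial_functions X"
| coord: "f \<in> X \<Longrightarrow> f \<in> polynomial_functions X"
| add: "\<lbrakk>f \<in> polynomial_functions X; g \<in> polynomial_functions X\<rbrakk>
    \<Longrightarrow> (\<lambda>v. f v + g v) \<in> polynomial_functions X"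
| mult: "\<lbrakk>f \<in> polynomial_functions X; g \<in> polynomial_functions X\<rbrakk>
    \<Longrightarrow> (\<lambda>v. f v * g v) \<in> polynomial_functions X"

definition zero_locus :: "('v \<Rightarrow> 'k::zero) set \<Rightarrow> 'v set" where
  "zero_locus P = {v. \<forall>f\<in>P. f v = 0}"

definition zariski_topology :: "('v \<Rightarrow> 'k::idom) set \<Rightarrow> 'v topology" where
  "zariski_topology X =
     topology (\<lambda>U. \<exists>P. P \<subseteq> polynomial_functions X \<and> U = - zero_locus P)"

lemma istopology_zariski:
  fixes X :: "('v \<Rightarrow> 'k::idom) set"
  shows "istopology (\<lambda>U. \<exists>P. P \<subseteq> polynomial_functions X \<and> U = - zero_locus P)"
  unfolding istopology_def
proof (intro conjI allI impI)
  fix S T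
  assume "\<exists>P. P \<subseteq> polynomial_functions X \<and> S = - zero_locus P"
    and "\<exists>P. P \<subseteq> polynomial_functions X \<and> T = - zero_locus P"
  then obtain P Q where P: "P \<subseteq> polynomial_functions X" "S = - zero_locus P"
    and Q: "Q \<subseteq> polynomial_functions X" "T = - zero_locus Q" by blast
  let ?R = "{(\<lambda>v. f v * g v) | f g. f \<in> P \<and> g \<in> Q}"
  have "?R \<subseteq> polynomial_functions X"
    using P(1) Q(1) by (auto intro: polynomial_functions.mult)
  moreover have "S \<inter> T = - zero_locus ?R"
    unfolding P(2) Q(2) zero_locus_def by fastforce
  ultimately show "\<exists>P. P \<subseteq> polynomial_functions X \<and> S \<inter> T = - zero_locus P" by blast
next
  fix K
  assume "\<forall>S\<in>K. \<exists>P. P \<subseteq> polynomial_functions X \<and> S = - zero_locus P"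
  then obtain F where F: "\<And>S. S \<in> K \<Longrightarrow> F S \<subseteq> polynomial_functions X"
      "\<And>S. S \<in> K \<Longrightarrow> S = - zero_locus (F S)" by metis
  have "\<Union>K = (\<Union>S\<in>K. - zero_locus (F S))"
    using F(2) by auto
  also have "\<dots> = - zero_locus (\<Union>(F ` K))"
    unfolding zero_locus_def by auto
  finally show "\<exists>P. P \<subseteq> polynomial_functions X \<and> \<Union>K = - zero_locus P"
    using F(1) by (intro exI[of _ "\<Union>(F ` K)"]) auto
qed

lemma closedin_zariski_iff:
  "closedin (zariski_topology X) C \<longleftrightarrow> (\<exists>P. P \<subseteq> polynomial_functions X \<and> C = zero_locus P)"
proof -
  have op: "openin (zariski_topology X) U
      \<longleftrightarrow> (\<exists>P. P \<subseteq> polynomial_functions X \<and> U = - zero_locus P)" for U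
    unfolding zariski_topology_def topology_inverse'[OF istopology_zariski] ..
  have "(\<lambda>_. 1) \<in> polynomial_functions X"
    by (rule polynomial_functions.const)
  then have "openin (zariski_topology X) UNIV"
    unfolding op by (intro exI[of _ "{\<lambda>_. 1}"]) (auto simp: zero_locus_def)
  then have "topspace (zariski_topology X) = UNIV"
    using openin_subset by blast
  then show ?thesis
    unfolding closedin_def op by (auto simp: Compl_eq_Diff_UNIV[symmetric])
qed

definition matrix_zariski :: "('k::field ^ 'n ^ 'n) topology" where
  "matrix_zariski = zariski_topology (range (\<lambda>(i, j) A. A $ i $ j))"

text \<open>
  The Zariski topology on \<open>t\<close>-tuples of matrices, in which all \<open>t n\<^sup>2\<close> entries are coordinates; it is
  not the product of the Zariski topologies. Only the values of a tuple on \<open>{1..t}\<close> matter: tuples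
  are taken from extensional products over \<open>{1..t}\<close>.
\<close>

definition tuple_zariski :: "nat \<Rightarrow> (nat \<Rightarrow> 'k::field ^ 'n ^ 'n) topology" where
  "tuple_zariski t =
     zariski_topology ((\<lambda>(s, i, j) g. g s $ i $ j) ` ({1..t} \<times> UNIV \<times> UNIV))"

section \<open>Dimension\<close>

definition irreducible_subset :: "'a topology \<Rightarrow> 'a set \<Rightarrow> bool" where
  "irreducible_subset X S \<longleftrightarrow> S \<subseteq> topspace X \<and> S \<noteq> {} \<and>
     (\<forall>C D. closedin X C \<and> closedin X D \<and> S \<subseteq> C \<union> D \<longrightarrow> S \<subseteq> C \<or> S \<subseteq> D)"

text \<open>
  Krull dimension: the supremum of the lengths of strict chains of irreducible closed subsets.
  Only nonempty spaces are of interest; the empty one gets dimension 0 here.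
\<close>

definition krull_dimension :: "'a topology \<Rightarrow> enat" where
  "krull_dimension X = Sup {enat m | m. \<exists>Z :: nat \<Rightarrow> 'a set.
     (\<forall>i\<le>m. closedin X (Z i) \<and> irreducible_subset X (Z i)) \<and> (\<forall>i<m. Z i \<subset> Z (Suc i))}"

section \<open>Linear algebraic groups\<close>

definition GL :: "('k::field ^ 'n ^ 'n) monoid" where
  "GL = \<lparr>carrier = {A. invertible A}, mult = (**), one = mat 1\<rparr>"

lemma group_GL: "group (GL :: ('k::field ^ 'n ^ 'n) monoid)"
proof (rule groupI)
  fix x :: "'k ^ 'n ^ 'n"
  assume "x \<in> carrier GL"
  then obtain y where "x ** y = mat 1" "y ** x = mat 1"
    unfolding GL_def invertible_def by auto
  then show "\<exists>y\<in>carrier GL. y \<otimes>\<^bsub>GL\<^esub> x = \<one>\<^bsub>GL\<^esub>"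
    unfolding GL_def invertible_def by auto
next
  fix x y :: "'k ^ 'n ^ 'n"
  assume "x \<in> carrier GL" "y \<in> carrier GL"
  then obtain x' y' where "x ** x' = mat 1" "x' ** x = mat 1" "y ** y' = mat 1" "y' ** y = mat 1"
    unfolding GL_def invertible_def by auto
  then have "(x ** y) ** (y' ** x') = mat 1" "(y' ** x') ** (x ** y) = mat 1"
    by (metis matrix_mul_assoc matrix_mul_rid)+
  then show "x \<otimes>\<^bsub>GL\<^esub> y \<in> carrier GL"
    unfolding GL_def invertible_def by auto
qed (auto simp: GL_def matrix_mul_assoc invertible_def intro: exI[of _ "mat 1"])

definition closed_subgroup :: "('k::field ^ 'n ^ 'n) set \<Rightarrow> ('k ^ 'n ^ 'n) set \<Rightarrow> bool" where
  "closed_subgroup G H \<longleftrightarrow>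
     subgroup H (GL\<lparr>carrier := G\<rparr>) \<and> closedin (subtopology matrix_zariski G) H"

text \<open>
  A linear algebraic group is a Zariski-closed subgroup of some \<open>GL\<close>, identified with its set of
  points over the field of matrix entries.
\<close>

definition linear_algebraic_group :: "('k::field ^ 'n ^ 'n) set \<Rightarrow> bool" where
  "linear_algebraic_group G \<longleftrightarrow> closed_subgroup (carrier GL) G"

definition group_dimension :: "('k::field ^ 'n ^ 'n) set \<Rightarrow> enat" where
  "group_dimension H = krull_dimension (subtopology matrix_zariski H)"

text \<open>
  A matrix is unipotent if \<open>g - 1\<close> is nilpotent. The iteration below spells out matrix powers, since
  \<open>^\<close> on this type refers to the entrywise product.
\<close>

definition unipotent :: "'k::field ^ 'n ^ 'n \<Rightarrow> bool" where
  "unipotent g \<longleftrightarrow> (\<exists>m. (((**) (g - mat 1)) ^^ m) (mat 1) = 0)"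

definition unipotent_radical :: "('k::field ^ 'n ^ 'n) set \<Rightarrow> ('k ^ 'n ^ 'n) set" where
  "unipotent_radical H = (GREATEST U. closed_subgroup H U \<and> U \<lhd> GL\<lparr>carrier := H\<rparr> \<and>
     connectedin matrix_zariski U \<and> (\<forall>u\<in>U. unipotent u))"

definition reductive_group :: "('k::field ^ 'n ^ 'n) set \<Rightarrow> bool" where
  "reductive_group H \<longleftrightarrow> linear_algebraic_group H \<and> unipotent_radical H = {mat 1}"

section \<open>Intersections with conjugates\<close>

definition conjugate_subgroup ::
  "'k::field ^ 'n ^ 'n \<Rightarrow> ('k ^ 'n ^ 'n) set \<Rightarrow> ('k ^ 'n ^ 'n) set" where
  "conjugate_subgroup g H = (\<lambda>h. g \<otimes>\<^bsub>GL\<^esub> h \<otimes>\<^bsub>GL\<^esub> inv\<^bsub>GL\<^esub> g) ` H"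

definition conjugate_intersection ::
  "nat \<Rightarrow> ('k::field ^ 'n ^ 'n) set \<Rightarrow> (nat \<Rightarrow> ('k ^ 'n ^ 'n) set) \<Rightarrow>
   (nat \<Rightarrow> 'k ^ 'n ^ 'n) \<Rightarrow> ('k ^ 'n ^ 'n) set" where
  "conjugate_intersection t M H g = M \<inter> (\<Inter>s\<in>{1..t}. conjugate_subgroup (g s) (H s))"

end

theory Submission
 imports Defs
begin

text \<open>
 Write \<open>K g\<close> for the intersection of \<open>M\<close> with the conjugates \<open>g\<^sub>s H\<^sub>s g\<^sub>s\<^sup>-\<^sup>1\<close>. It is isomorphic to the stabilizer of
 \<open>g\<close> under the action of \<open>M \<times> H\<^sub>1 \<times> \<dots> \<times> H\<^sub>t\<close> by \<open>g\<^sub>s \<mapsto> m g\<^sub>s h\<^sub>s\<close>. The dimension of the orbit is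
 the number of algebraically independent entries of the orbit map, hence lower semicontinuous
 in \<open>g\<close>, so \<open>dim (K g)\<close> is upper semicontinuous and minimal on an open set. On that set, \<open>K g\<close> is not
 reductive if and only if some conjugate of a parabolic subgroup \<open>P\<close> of the general linear group meets
 \<open>K g\<close> in full dimension and the same conjugate of the unipotent radical of \<open>P\<close> meets it in positive
 dimension: one direction takes the stabilizer of the flag of successive fixed spaces of the
 unipotent radical of \<open>K g\<close> (Kolchin), the other holds because \<open>P\<close> then contains the identity component. By
 semicontinuity for \<open>t + 1\<close> factors, both conditions are closed in \<open>(g, b)\<close>, where \<open>b\<close> is the conjugating
 matrix. They depend on \<open>b\<close> only modulo \<open>P\<close>, and projecting \<open>b\<close> away preserves closedness by completeness
 of the flag variety. Up to conjugacy there are finitely many \<open>P\<close>.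

 Dimensions are measured by the growth of the space of polynomial functions of degree at most \<open>N\<close>.
\<close>

text \<open>The dimension arguments compare closed groups with open pieces of them, slices, fibres
  and finite unions. Growth makes sense for arbitrary sets of points, passes along maps with
  polynomial coordinates, and is bounded below by exhibiting independent monomials; Krull dimension
  is needed only to read the statement. Semicontinuity asks for more than the dimension of one
  orbit, since algebraic independence is an infinite set of conditions on g. It becomes an open
  condition because the entries of the orbit map have degree 2 for every g, and for functions of
  bounded degree one fixed box of exponents detects every algebraic relation. All parameter spaces
  consist of tuples of invertible matrices, although the g_s are taken from G: the matrix b that
  conjugates the parabolic subgroup has to run through the whole general linear group. Restriction
  to G is the last step. Completeness is obtained without projective varieties, by writing the
  general linear group as a product of minimal parabolic subgroups and saturating along one
  projective line at a time.\<close>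

abbreviation "PF \<equiv> polynomial_functions"

abbreviation "minv \<equiv> matrix_inv"

lemmas PF_const = polynomial_functions.const
lemmas PF_coord = polynomial_functions.coord
lemmas PF_add = polynomial_functions.add
lemmas PF_mult = polynomial_functions.mult

abbreviation (input) "cf \<pi> j \<equiv> \<lambda>v. coeff (\<pi> v) j"

section \<open>Polynomial functions and degree bounds\<close>

lemma PF_mono: "f \<in> PF X \<Longrightarrow> X \<subseteq> Y \<Longrightarrow> f \<in> PF Y"
 by (induction rule: polynomial_functions.induct) (auto intro: polynomial_functions.intros)

lemma PF_trans: "f \<in> PF X \<Longrightarrow> X \<subseteq> PF Y \<Longrightarrow> f \<in> PF Y"
 by (induction rule: polynomial_functions.induct) (auto intro: polynomial_functions.intros)

lemma PF_sum: "(\<And>i. i \<in> I \<Longrightarrow> f i \<in> PF X) \<Longrightarrow> (\<lambda>v. \<Sum>i\<in>I. f i v) \<in> PF X"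
 by (induction I rule: infinite_finite_induct) (auto intro: polynomial_functions.intros)

lemma PF_prod: "(\<And>i. i \<in> I \<Longrightarrow> f i \<in> PF X) \<Longrightarrow> (\<lambda>v. \<Prod>i\<in>I. f i v) \<in> PF X"
 by (induction I rule: infinite_finite_induct) (auto intro: polynomial_functions.intros)

lemma PF_power: "f \<in> PF X \<Longrightarrow> (\<lambda>v. f v ^ n) \<in> PF X"
 by (induction n) (auto intro: polynomial_functions.intros)

lemma PF_uminus: "f \<in> PF X \<Longrightarrow> (\<lambda>v. - f v) \<in> PF X"
 using PF_mult[OF PF_const[of "-1"], of f X] by simp

lemma PF_diff: "f \<in> PF X \<Longrightarrow> g \<in> PF X \<Longrightarrow> (\<lambda>v. f v - g v) \<in> PF X"
 using PF_add[OF _ PF_uminus, of f X g] by simp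

lemma PF_if: "(P \<Longrightarrow> f \<in> PF X) \<Longrightarrow> (\<not> P \<Longrightarrow> g \<in> PF X) \<Longrightarrow> (\<lambda>v. if P then f v else g v) \<in> PF X"
 by (cases P) auto

lemmas PF_intros = PF_const PF_add PF_mult
 PF_sum PF_prod PF_power PF_uminus PF_diff PF_if

lemma PF_comp:
 "f \<in> PF X \<Longrightarrow> (\<And>x. x \<in> X \<Longrightarrow> (\<lambda>w. x (h w)) \<in> PF Y) \<Longrightarrow> (\<lambda>w. f (h w)) \<in> PF Y"
 by (induction rule: polynomial_functions.induct) (auto intro: polynomial_functions.intros)

lemma PF_eq: "f \<in> PF X \<Longrightarrow> (\<And>x. x \<in> X \<Longrightarrow> x v = x w) \<Longrightarrow> f v = f w"
 by (induction rule: polynomial_functions.induct) auto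

inductive poly_degree :: "('v \<Rightarrow> 'k::comm_ring_1) set \<Rightarrow> nat \<Rightarrow> ('v \<Rightarrow> 'k) \<Rightarrow> bool"
 for X :: "('v \<Rightarrow> 'k) set" where
 const: "poly_degree X N (\<lambda>_. c)"
| coord: "f \<in> X \<Longrightarrow> poly_degree X (Suc N) f"
| add: "poly_degree X N f \<Longrightarrow> poly_degree X N g \<Longrightarrow> poly_degree X N (\<lambda>v. f v + g v)"
| mult: "poly_degree X N f \<Longrightarrow> poly_degree X M g \<Longrightarrow> poly_degree X (N + M) (\<lambda>v. f v * g v)"

lemma poly_degree_PF: "poly_degree X N f \<Longrightarrow> f \<in> PF X"
 by (induction rule: poly_degree.induct) (auto intro: polynomial_functions.intros)

lemma poly_degree_le: "poly_degree X N f \<Longrightarrow> N \<le> M \<Longrightarrow> poly_degree X M f"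
proof (induction arbitrary: M rule: poly_degree.induct)
 case (coord f N)
 then show ?case by (metis Suc_le_D poly_degree.coord)
next
 case (mult N f K g)
 then show ?case
  using poly_degree.mult[OF mult.IH(1)[OF order.refl] mult.IH(2)[of "M - N"]] by simp
qed (auto intro: poly_degree.intros)

lemma PF_poly_degree: "f \<in> PF X \<Longrightarrow> \<exists>N. poly_degree X N f"
proof (induction rule: polynomial_functions.induct)
 case (add f g)
 then obtain N M where "poly_degree X N f" "poly_degree X M g" by auto
 then have "poly_degree X (max N M) f" "poly_degree X (max N M) g"
  by (auto elim: poly_degree_le)
 then show ?case by (blast intro: poly_degree.add)
qed (blast intro: poly_degree.intros)+

lemma finite_poly_degree:
 assumes "finite A" "\<And>f. f \<in> A \<Longrightarrow> f \<in> PF X"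
 shows "\<exists>N. \<forall>f\<in>A. poly_degree X N f"
 using assms
proof (induction rule: finite_induct)
 case (insert f A)
 then obtain N where N: "\<forall>f\<in>A. poly_degree X N f" by auto
 obtain M where "poly_degree X M f" using PF_poly_degree insert.prems by blast
 then have "\<forall>g\<in>insert f A. poly_degree X (max N M) g"
  using N poly_degree_le by (metis insert_iff max.cobounded1 max.cobounded2)
 then show ?case by blast
qed auto

lemma poly_degree_mono: "poly_degree X N f \<Longrightarrow> X \<subseteq> Y \<Longrightarrow> poly_degree Y N f"
 by (induction rule: poly_degree.induct) (auto intro: poly_degree.intros)

lemma poly_degree_sum:
 "(\<And>i. i \<in> I \<Longrightarrow> poly_degree X N (f i)) \<Longrightarrow> poly_degree X N (\<lambda>v. \<Sum>i\<in>I. f i v)"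
 by (induction I rule: infinite_finite_induct) (auto intro: poly_degree.intros)

lemma poly_degree_prod:
 "(\<And>i. i \<in> I \<Longrightarrow> poly_degree X (N i) (f i)) \<Longrightarrow> poly_degree X (sum N I) (\<lambda>v. \<Prod>i\<in>I. f i v)"
 by (induction I rule: infinite_finite_induct) (auto intro: poly_degree.intros)

lemma poly_degree_power: "poly_degree X N f \<Longrightarrow> poly_degree X (n * N) (\<lambda>v. f v ^ n)"
 by (induction n) (auto intro: poly_degree.intros)

lemma poly_degree_uminus: "poly_degree X N f \<Longrightarrow> poly_degree X N (\<lambda>v. - f v)"
 using poly_degree.mult[OF poly_degree.const[of X 0 "-1"], of N f] by simp

lemma poly_degree_diff:
 "poly_degree X N f \<Longrightarrow> poly_degree X N g \<Longrightarrow> poly_degree X N (\<lambda>v. f v - g v)"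
 using poly_degree.add[OF _ poly_degree_uminus, of X N f g] by simp

text \<open>Substitution multiplies degrees, hence one \<open>\<delta>\<close> common to all
  generators. Equality is asked on \<open>K\<close> only, because a generator may be expressible
  through \<open>\<psi>\<close> there and nowhere else.\<close>

lemma poly_degree_pullback:
 assumes "poly_degree Z N f"
  and "\<And>z. z \<in> Z \<Longrightarrow> \<exists>\<zeta>. poly_degree X \<delta> \<zeta> \<and> (\<forall>k\<in>K. z k = \<zeta> (\<psi> k))"
 shows "\<exists>\<zeta>. poly_degree X (\<delta> * N) \<zeta> \<and> (\<forall>k\<in>K. f k = \<zeta> (\<psi> k))"
 using assms(1)
proof (induction rule: poly_degree.induct)
 case (const N c)
 then show ?case by (intro exI[of _ "\<lambda>_. c"]) (auto intro: poly_degree.const)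
next
 case (coord f N)
 then show ?case using assms(2)[OF coord] poly_degree_le[of X \<delta> _ "\<delta> * Suc N"] by auto
next
 case (add N f g)
 then obtain \<zeta> \<xi> where "poly_degree X (\<delta> * N) \<zeta>" "\<forall>k\<in>K. f k = \<zeta> (\<psi> k)"
  "poly_degree X (\<delta> * N) \<xi>" "\<forall>k\<in>K. g k = \<xi> (\<psi> k)" by blast
 then show ?case by (intro exI[of _ "\<lambda>v. \<zeta> v + \<xi> v"]) (auto intro: poly_degree.add)
next
 case (mult N f M g)
 then obtain \<zeta> \<xi> where "poly_degree X (\<delta> * N) \<zeta>" "\<forall>k\<in>K. f k = \<zeta> (\<psi> k)"
  "poly_degree X (\<delta> * M) \<xi>" "\<forall>k\<in>K. g k = \<xi> (\<psi> k)" by blast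
 then show ?case
  by (intro exI[of _ "\<lambda>v. \<zeta> v * \<xi> v"]) (auto intro: poly_degree.mult simp: distrib_left)
qed

text \<open>
 Polynomials in one distinguished function are represented by functions with values in the type of
 univariate polynomials.
\<close>

lemma poly_degree_insert:
 fixes f :: "'v \<Rightarrow> 'k::idom"
 assumes "poly_degree (insert \<alpha> F) N f"
 shows "\<exists>\<pi>. (\<forall>v. degree (\<pi> v) \<le> N) \<and> (\<forall>j. poly_degree F N (\<lambda>v. coeff (\<pi> v) j)) \<and>
  (\<forall>v. f v = poly (\<pi> v) (\<alpha> v))"
 using assms
proof (induction rule: poly_degree.induct)
 case (const N c)
 show ?case by (rule exI[of _ "\<lambda>_. [:c:]"]) (auto intro: poly_degree.const)
next
 case (coord x N)
 show ?case
 proof (cases "x = \<alpha>")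
  case True
  then show ?thesis by (intro exI[of _ "\<lambda>_. [:0, 1:]"]) (auto intro: poly_degree.const)
 next
  case False
  have "poly_degree F (Suc N) (\<lambda>v. coeff [:x v:] j)" for j
   using False coord by (cases j) (auto intro: poly_degree.intros)
  then show ?thesis by (intro exI[of _ "\<lambda>v. [:x v:]"]) auto
 qed
next
 case (add N f g)
 then obtain p q where "\<forall>v. degree (p v) \<le> N" "\<forall>j. poly_degree F N (\<lambda>v. coeff (p v) j)"
  "\<forall>v. f v = poly (p v) (\<alpha> v)" "\<forall>v. degree (q v) \<le> N"
  "\<forall>j. poly_degree F N (\<lambda>v. coeff (q v) j)" "\<forall>v. g v = poly (q v) (\<alpha> v)" by metis
 then show ?case
  by (intro exI[of _ "\<lambda>v. p v + q v"]) (auto intro: poly_degree.add degree_add_le)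
next
 case (mult N f M g)
 then obtain p q where p: "\<forall>v. degree (p v) \<le> N" "\<forall>j. poly_degree F N (\<lambda>v. coeff (p v) j)"
  "\<forall>v. f v = poly (p v) (\<alpha> v)" and q: "\<forall>v. degree (q v) \<le> M"
  "\<forall>j. poly_degree F M (\<lambda>v. coeff (q v) j)" "\<forall>v. g v = poly (q v) (\<alpha> v)" by metis
 have "degree (p v * q v) \<le> N + M" for v
  using degree_mult_le[of "p v" "q v"] p(1) q(1) by (meson add_mono order_trans)
 moreover have "poly_degree F (N + M) (\<lambda>v. coeff (p v * q v) j)" for j
  unfolding coeff_mult using p q by (intro poly_degree_sum poly_degree.mult) auto
 ultimately show ?case using p q by (intro exI[of _ "\<lambda>v. p v * q v"]) auto
qed

lemma PF_insert:
 fixes f :: "'v \<Rightarrow> 'k::idom"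
 assumes "f \<in> PF (insert \<alpha> F)"
 shows "\<exists>\<pi> D. (\<forall>v. degree (\<pi> v) \<le> D) \<and> (\<forall>j. cf \<pi> j \<in> PF F) \<and>
  (\<forall>v. f v = poly (\<pi> v) (\<alpha> v))"
proof -
 obtain N where "poly_degree (insert \<alpha> F) N f" using PF_poly_degree[OF assms] by blast
 from poly_degree_insert[OF this] show ?thesis using poly_degree_PF by metis
qed

lemma poly_of_coeffs: "degree (p :: 'a::comm_ring_1 poly) \<le> D \<Longrightarrow> poly p x = (\<Sum>j\<le>D. coeff p j * x ^ j)"
 unfolding poly_altdef by (rule sum.mono_neutral_left) (auto simp: coeff_eq_0)

lemma PF_poly:
 assumes "\<And>j. cf \<pi> j \<in> PF F" "\<And>v. degree (\<pi> v) \<le> D" "\<alpha> \<in> PF F"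
 shows "(\<lambda>v. poly (\<pi> v) (\<alpha> v)) \<in> PF F"
 unfolding poly_of_coeffs[OF assms(2)] by (intro PF_intros assms)

section \<open>Linear dependence and spanning for functions on a set\<close>

lemma homogeneous_system:
 fixes M :: "'i \<Rightarrow> 'b \<Rightarrow> 'k::field"
 assumes "finite B" "finite I" "card B < card I"
 shows "\<exists>l. (\<exists>i\<in>I. l i \<noteq> 0) \<and> (\<forall>b\<in>B. (\<Sum>i\<in>I. l i * M i b) = 0)"
 using assms
proof (induction B arbitrary: I M rule: finite_induct)
 case empty
 then have "I \<noteq> {}" by auto
 then show ?case by (intro exI[of _ "\<lambda>_. 1"]) auto
next
 case (insert b B)
 show ?case
 proof (cases "\<forall>i\<in>I. M i b = 0")
  case True
  then show ?thesis using insert.IH[of I M] insert by auto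
 next
  case False
  then obtain r where r: "r \<in> I" "M r b \<noteq> 0" by blast
  \<comment> \<open>Equation \<open>b\<close> is solved for the unknown \<open>r\<close> and
    substituted into the others, which leaves one unknown and one equation fewer.\<close>
  define J where "J = I - {r}"
  have J: "finite J" "r \<notin> J" "I = insert r J" unfolding J_def using r insert.prems by auto
  then have "card B < card J" using insert by auto
  from insert.IH[OF J(1) this, of "\<lambda>i c. M i c - M i b / M r b * M r c"]
  obtain l where l: "\<exists>i\<in>J. l i \<noteq> 0"
   "\<And>c. c \<in> B \<Longrightarrow> (\<Sum>i\<in>J. l i * (M i c - M i b / M r b * M r c)) = 0" by blast
  define m where "m = l(r := - (\<Sum>i\<in>J. l i * M i b) / M r b)"
  have sumI: "(\<Sum>i\<in>I. m i * M i c) = m r * M r c + (\<Sum>i\<in>J. l i * M i c)" for c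
  proof -
   have "(\<Sum>i\<in>J. m i * M i c) = (\<Sum>i\<in>J. l i * M i c)"
    by (rule sum.cong) (use J in \<open>auto simp: m_def\<close>)
   then show ?thesis unfolding J(3) using J by simp
  qed
  have "(\<Sum>i\<in>I. m i * M i c) = 0" if "c \<in> insert b B" for c
  proof (cases "c = b")
   case True
   then show ?thesis unfolding sumI by (simp add: m_def r)
  next
   case False
   then have c: "c \<in> B" using that by auto
   have "(\<Sum>i\<in>J. l i * M i c) = (\<Sum>i\<in>J. l i * M i b) / M r b * M r c"
    using l(2)[OF c]
    by (simp add: algebra_simps sum_subtractf sum_distrib_left sum_divide_distrib)
   then show ?thesis unfolding sumI by (simp add: m_def)
  qed
  moreover have "\<exists>i\<in>I. m i \<noteq> 0" using l(1) J unfolding m_def by auto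
  ultimately show ?thesis by blast
 qed
qed

text \<open>The members of \<open>B\<close> are arbitrary functions, not only polynomial ones: later
  spanning sets contain denominators and functions cut off outside a subset.\<close>

definition spanned :: "'v set \<Rightarrow> ('v \<Rightarrow> 'k::field) set \<Rightarrow> ('v \<Rightarrow> 'k) \<Rightarrow> bool" where
 "spanned S B f \<longleftrightarrow> (\<exists>m. \<forall>v\<in>S. f v = (\<Sum>b\<in>B. m b * b v))"

lemma spanned_base: "finite B \<Longrightarrow> b \<in> B \<Longrightarrow> spanned S B b"
 unfolding spanned_def by (rule exI[of _ "\<lambda>c. if c = b then 1 else 0"]) (auto simp: if_distrib[of "\<lambda>x. x * _"] cong: if_cong)

lemma spanned_zero: "spanned S B (\<lambda>_. 0)"
 unfolding spanned_def by (rule exI[of _ "\<lambda>_. 0"]) auto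

lemma spanned_add: "spanned S B f \<Longrightarrow> spanned S B g \<Longrightarrow> spanned S B (\<lambda>v. f v + g v)"
proof -
 assume "spanned S B f" "spanned S B g"
 then obtain m n where "\<forall>v\<in>S. f v = (\<Sum>b\<in>B. m b * b v)" "\<forall>v\<in>S. g v = (\<Sum>b\<in>B. n b * b v)"
  unfolding spanned_def by blast
 then show ?thesis unfolding spanned_def
  by (intro exI[of _ "\<lambda>b. m b + n b"]) (auto simp: distrib_right sum.distrib)
qed

lemma spanned_scale: "spanned S B f \<Longrightarrow> spanned S B (\<lambda>v. c * f v)"
proof -
 assume "spanned S B f"
 then obtain m where "\<forall>v\<in>S. f v = (\<Sum>b\<in>B. m b * b v)" unfolding spanned_def by blast
 then show ?thesis unfolding spanned_def
  by (intro exI[of _ "\<lambda>b. c * m b"]) (auto simp: sum_distrib_left mult.assoc)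
qed

lemma spanned_sum: "(\<And>i. i \<in> I \<Longrightarrow> spanned S B (f i)) \<Longrightarrow> spanned S B (\<lambda>v. \<Sum>i\<in>I. f i v)"
 by (induction I rule: infinite_finite_induct) (auto intro: spanned_zero spanned_add)

lemma spanned_cong: "spanned S B f \<Longrightarrow> (\<And>v. v \<in> S \<Longrightarrow> f v = g v) \<Longrightarrow> spanned S B g"
 unfolding spanned_def by auto

text \<open>A family rather than a set, so that two indices with the same function count as
  dependent.\<close>

definition lin_indep :: "'v set \<Rightarrow> 'e set \<Rightarrow> ('e \<Rightarrow> 'v \<Rightarrow> 'k::field) \<Rightarrow> bool" where
 "lin_indep S E u \<longleftrightarrow> (\<forall>l. (\<forall>v\<in>S. (\<Sum>e\<in>E. l e * u e v) = 0) \<longrightarrow> (\<forall>e\<in>E. l e = 0))"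

lemma lin_indep_card_le:
 assumes "lin_indep S E u" "finite E" "finite B" "\<And>e. e \<in> E \<Longrightarrow> spanned S B (u e)"
 shows "card E \<le> card B"
proof (rule ccontr)
 assume "\<not> ?thesis"
 then have less: "card B < card E" by simp
 obtain M where M: "\<And>e v. e \<in> E \<Longrightarrow> v \<in> S \<Longrightarrow> u e v = (\<Sum>b\<in>B. M e b * b v)"
  using assms(4) unfolding spanned_def by metis
 obtain l where l: "\<exists>e\<in>E. l e \<noteq> 0" "\<forall>b\<in>B. (\<Sum>e\<in>E. l e * M e b) = 0"
  using homogeneous_system[OF assms(3,2) less, of M] by blast
 have "(\<Sum>e\<in>E. l e * u e v) = 0" if "v \<in> S" for v
 proof -
  have "(\<Sum>e\<in>E. l e * u e v) = (\<Sum>e\<in>E. \<Sum>b\<in>B. l e * M e b * b v)"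
   using M that by (simp add: sum_distrib_left mult.assoc)
  also have "\<dots> = (\<Sum>b\<in>B. (\<Sum>e\<in>E. l e * M e b) * b v)"
   by (subst sum.swap) (simp add: sum_distrib_right)
  finally show ?thesis using l(2) by simp
 qed
 then show False using assms(1) l(1) unfolding lin_indep_def by blast
qed

text \<open>Sizes of independent sets being bounded, a largest one exists, and by maximality it
  spans.\<close>

lemma bounded_rank_spanned:
 fixes P :: "('v \<Rightarrow> 'k::field) \<Rightarrow> bool"
 assumes "\<And>I. finite I \<Longrightarrow> (\<And>f. f \<in> I \<Longrightarrow> P f) \<Longrightarrow> lin_indep S I (\<lambda>f. f) \<Longrightarrow> card I \<le> C"
 shows "\<exists>B. finite B \<and> card B \<le> C \<and> (\<forall>f. P f \<longrightarrow> spanned S B f)"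
proof -
 define Q where "Q n \<longleftrightarrow> (\<exists>I. finite I \<and> (\<forall>f\<in>I. P f) \<and> lin_indep S I (\<lambda>f. f) \<and> card I = n)" for n
 have Q0: "Q 0" unfolding Q_def lin_indep_def by (intro exI[of _ "{}"]) auto
 have bound: "n \<le> C" if "Q n" for n using that assms unfolding Q_def by blast
 obtain n where n: "Q n" "\<And>m. Q m \<Longrightarrow> m \<le> n"
  using GreatestI_nat[of Q, OF Q0 bound] Greatest_le_nat[of Q, OF _ bound] by blast
 then obtain I where I: "finite I" "\<And>f. f \<in> I \<Longrightarrow> P f" "lin_indep S I (\<lambda>f. f)" "card I = n"
  unfolding Q_def by blast
 have "spanned S I f" if f: "P f" for f
 proof (cases "f \<in> I")
  case True
  then show ?thesis using I(1) spanned_base by blast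
 next
  case False
  then have "\<not> Q (Suc n) " using n(2) by force
  then have "\<not> lin_indep S (insert f I) (\<lambda>f. f)"
   unfolding Q_def using I f False by (metis card_insert_disjoint finite_insert insert_iff)
  then obtain l g where l: "\<And>v. v \<in> S \<Longrightarrow> (\<Sum>g\<in>insert f I. l g * g v) = 0"
   and g: "g \<in> insert f I" "l g \<noteq> 0"
   unfolding lin_indep_def by blast
  have eq: "l f * f v + (\<Sum>g\<in>I. l g * g v) = 0" if "v \<in> S" for v
   using l[OF that] I(1) False by simp
  have "l f \<noteq> 0"
  proof
   assume "l f = 0"
   then have "\<forall>v\<in>S. (\<Sum>g\<in>I. l g * g v) = 0" using eq by auto
   then have "\<forall>g\<in>I. l g = 0" using I(3) unfolding lin_indep_def by blast
   then show False using g \<open>l f = 0\<close> by auto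
  qed
  have "f v = (\<Sum>g\<in>I. (- l g / l f) * g v)" if "v \<in> S" for v
  proof -
   have "(\<Sum>g\<in>I. (- l g / l f) * g v) = - (\<Sum>g\<in>I. l g * g v) / l f"
    by (simp add: sum_negf sum_divide_distrib)
   also have "\<dots> = f v" using eq[OF that] \<open>l f \<noteq> 0\<close> by (simp add: field_simps add_eq_0_iff)
   finally show ?thesis by simp
  qed
  then show ?thesis unfolding spanned_def by (intro exI[of _ "\<lambda>g. - l g / l f"]) blast
 qed
 then show ?thesis using I bound n(1) by blast
qed

section \<open>Growth of function algebras\<close>

text \<open>A bound for the Hilbert function of the algebra of functions on \<open>S\<close>
  generated by \<open>F\<close>; for finite \<open>F\<close> the least such \<open>d\<close> is the
  dimension of the Zariski closure of \<open>S\<close>. Only upper bounds are expressed this way;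
  lower bounds appear as \<open>\<not> growth\<close> or come from independent families.\<close>

definition growth :: "'v set \<Rightarrow> ('v \<Rightarrow> 'k::field) set \<Rightarrow> nat \<Rightarrow> bool" where
 "growth S F d \<longleftrightarrow> (\<exists>c. \<forall>N. \<exists>B. finite B \<and> card B \<le> c * (N + 1) ^ d \<and>
  (\<forall>f. poly_degree F N f \<longrightarrow> spanned S B f))"

lemma growthI:
 assumes "\<And>N. \<exists>B. finite B \<and> card B \<le> c * (N + 1) ^ d \<and> (\<forall>f. poly_degree F N f \<longrightarrow> spanned S B f)"
 shows "growth S F d"
 using assms unfolding growth_def by blast

lemma growthE:
 assumes "growth S F d"
 obtains c B where "\<And>N. finite (B N)" "\<And>N. card (B N) \<le> c * (N + 1) ^ d"
  "\<And>N f. poly_degree F N f \<Longrightarrow> spanned S (B N) f"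
 using assms unfolding growth_def by metis

lemma growth_constant:
 assumes "\<And>x v w. x \<in> R \<Longrightarrow> v \<in> S \<Longrightarrow> w \<in> S \<Longrightarrow> x v = x w"
 shows "growth S R 0"
proof (rule growthI[of 1])
 fix N
 have "spanned S {\<lambda>_. 1} f" if "poly_degree R N f" for f
 proof (cases "S = {}")
  case True
  then show ?thesis unfolding spanned_def by auto
 next
  case False
  then obtain w where "w \<in> S" by auto
  have "f \<in> PF R" using poly_degree_PF[OF that] .
  then have "f v = f w" if "v \<in> S" for v
   using assms \<open>w \<in> S\<close> that by (intro PF_eq[of f R]) auto
  then show ?thesis unfolding spanned_def by (intro exI[of _ "\<lambda>_. f w"]) auto
 qed
 then show "\<exists>B. finite B \<and> card B \<le> 1 * (N + 1) ^ 0 \<and> (\<forall>f. poly_degree R N f \<longrightarrow> spanned S B f)"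
  by (intro exI[of _ "{\<lambda>_. 1}"]) auto
qed

lemma growth_mono: "growth S F d \<Longrightarrow> d \<le> e \<Longrightarrow> growth S F e"
proof -
 assume gr: "growth S F d" and "d \<le> e"
 from gr obtain c B where B: "\<And>N. finite (B N)" "\<And>N. card (B N) \<le> c * (N + 1) ^ d"
  "\<And>N f. poly_degree F N f \<Longrightarrow> spanned S (B N) f" by (rule growthE) (rule that)
 have "c * (N + 1) ^ d \<le> c * (N + 1) ^ e" for N
  using \<open>d \<le> e\<close> by (intro mult_left_mono power_increasing) auto
 then show ?thesis using B by (intro growthI[of c]) (meson order_trans)
qed

lemma growth_subset: "growth S F d \<Longrightarrow> T \<subseteq> S \<Longrightarrow> G \<subseteq> F \<Longrightarrow> growth T G d"
 unfolding growth_def spanned_def by (meson poly_degree_mono subsetD)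

text \<open>An expression of degree at most \<open>N\<close> involves only the \<open>N + 1\<close>
  powers of the new generator up to \<open>N\<close>, which costs one factor
  \<open>N + 1\<close>.\<close>

lemma growth_insert:
 assumes "growth S F d"
 shows "growth S (insert \<alpha> F) (Suc d)"
proof -
 obtain c B where B: "\<And>N. finite (B N)" "\<And>N. card (B N) \<le> c * (N + 1) ^ d"
  "\<And>N f. poly_degree F N f \<Longrightarrow> spanned S (B N) f" using assms by (rule growthE) (rule that)
 show ?thesis
 proof (rule growthI[of c])
  fix N
  define C where "C = (\<lambda>(b, j) v. b v * \<alpha> v ^ j) ` (B N \<times> {..N})"
  have fin: "finite C" unfolding C_def using B(1) by auto
  have "card C \<le> card (B N \<times> {..N})" unfolding C_def using B(1) by (intro card_image_le) auto
  also have "\<dots> \<le> c * (N + 1) ^ Suc d"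
   using mult_right_mono[OF B(2)[of N], of "N + 1"] by (simp add: card_cartesian_product algebra_simps)
  finally have card: "card C \<le> c * (N + 1) ^ Suc d" .
  have "spanned S C f" if f: "poly_degree (insert \<alpha> F) N f" for f
  proof -
   obtain \<pi> where \<pi>: "\<And>v. degree (\<pi> v) \<le> N" "\<And>j. poly_degree F N (\<lambda>v. coeff (\<pi> v) j)"
    "\<And>v. f v = poly (\<pi> v) (\<alpha> v)" using poly_degree_insert[OF f] by blast
   have "\<exists>m. \<forall>v\<in>S. coeff (\<pi> v) j = (\<Sum>b\<in>B N. m b * b v)" for j
    using B(3)[OF \<pi>(2)[of j]] unfolding spanned_def .
   then obtain m where m: "\<And>j v. v \<in> S \<Longrightarrow> coeff (\<pi> v) j = (\<Sum>b\<in>B N. m j b * b v)" by metis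
   have "spanned S C (\<lambda>v. \<Sum>j\<le>N. \<Sum>b\<in>B N. m j b * (b v * \<alpha> v ^ j))"
    by (intro spanned_sum spanned_scale spanned_base[OF fin]) (auto simp: C_def image_iff intro!: bexI)
   then show ?thesis
    by (rule spanned_cong)
     (simp add: \<pi>(3) poly_of_coeffs[OF \<pi>(1)] m sum_distrib_right mult.assoc)
  qed
  then show "\<exists>B. finite B \<and> card B \<le> c * (N + 1) ^ Suc d \<and>
    (\<forall>f. poly_degree (insert \<alpha> F) N f \<longrightarrow> spanned S B f)"
   using fin card by blast
 qed
qed

text \<open>Where the leading coefficient \<open>a\<close> has no zero, powers of
  \<open>\<alpha>\<close> reduce to exponents below \<open>D\<close> at the cost of powers of
  \<open>a\<close>. After multiplication by \<open>a ^ N\<close>, a function of degree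
  \<open>N\<close> is a combination of \<open>D\<close> powers of \<open>\<alpha>\<close> with
  coefficients of degree linear in \<open>N\<close>; this changes the constant of the growth but not
  its exponent.\<close>

lemma growth_insert_algebraic_on:
 fixes \<pi> :: "'v \<Rightarrow> 'k::field poly"
 assumes growth: "growth W F d" and coeffs: "\<And>j. cf \<pi> j \<in> PF F"
  and deg: "\<And>v. degree (\<pi> v) \<le> D" and D: "D > 0"
  and root: "\<And>v. v \<in> W \<Longrightarrow> poly (\<pi> v) (\<alpha> v) = 0"
  and lead: "\<And>v. v \<in> W \<Longrightarrow> coeff (\<pi> v) D \<noteq> 0"
 shows "growth W (insert \<alpha> F) d"
proof -
 obtain c B where B: "\<And>N. finite (B N)" "\<And>N. card (B N) \<le> c * (N + 1) ^ d"
  "\<And>N f. poly_degree F N f \<Longrightarrow> spanned W (B N) f" using growth by (rule growthE) (rule that)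
 obtain E where "\<forall>f\<in>(\<lambda>j v. coeff (\<pi> v) j) ` {..D}. poly_degree F E f"
  using finite_poly_degree[of "(\<lambda>j v. coeff (\<pi> v) j) ` {..D}" F] coeffs by auto
 then have E: "poly_degree F E (\<lambda>v. coeff (\<pi> v) j)" for j
  using coeff_eq_0[OF le_less_trans[OF deg], of j] by (cases "j \<le> D") (auto intro: poly_degree.const)
 define a where "a v = coeff (\<pi> v) D" for v
 have aE: "poly_degree F E a" unfolding a_def by (rule E)
 have red: "\<exists>\<rho>. (\<forall>v. degree (\<rho> v) < D) \<and> (\<forall>i. poly_degree F (E * j) (\<lambda>v. coeff (\<rho> v) i)) \<and>
   (\<forall>v\<in>W. a v ^ j * \<alpha> v ^ j = poly (\<rho> v) (\<alpha> v))" for j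
 proof (induction j)
  case 0
  then show ?case using D by (intro exI[of _ "\<lambda>_. 1"]) (auto intro: poly_degree.const)
 next
  case (Suc j)
  then obtain \<rho> where \<rho>: "\<And>v. degree (\<rho> v) < D" "\<And>i. poly_degree F (E * j) (\<lambda>v. coeff (\<rho> v) i)"
   "\<And>v. v \<in> W \<Longrightarrow> a v ^ j * \<alpha> v ^ j = poly (\<rho> v) (\<alpha> v)" by blast
  \<comment> \<open>Multiplication by \<open>a\<close> and \<open>\<alpha>\<close>, followed by
    subtraction of the multiple of \<open>\<pi>\<close> that cancels the coefficient of degree
    \<open>D\<close>.\<close>
  define \<sigma> where "\<sigma> v = smult (a v) (pCons 0 (\<rho> v)) - smult (coeff (\<rho> v) (D - 1)) (\<pi> v)" for v
  have "coeff (\<sigma> v) D = 0" for v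
   unfolding \<sigma>_def a_def using D by (cases D) auto
  moreover have "degree (\<sigma> v) \<le> D" for v
   unfolding \<sigma>_def using \<rho>(1)[of v] deg[of v] D
   by (intro degree_diff_le order.trans[OF degree_smult_le])
    (auto intro: order.trans[OF degree_pCons_le])
  ultimately have "degree (\<sigma> v) < D" for v
   using D by (metis eq_zero_or_degree_less degree_0)
  moreover have "poly_degree F (E * Suc j) (\<lambda>v. coeff (\<sigma> v) i)" for i
  proof -
   have 1: "poly_degree F (E * j) (\<lambda>v. coeff (pCons 0 (\<rho> v)) i)"
    using \<rho>(2) by (cases i) (auto intro: poly_degree.const)
   have "poly_degree F (E * Suc j) (\<lambda>v. a v * coeff (pCons 0 (\<rho> v)) i)"
    using poly_degree.mult[OF aE 1] by simp
   moreover have "poly_degree F (E * Suc j) (\<lambda>v. coeff (\<rho> v) (D - 1) * coeff (\<pi> v) i)"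
    using poly_degree.mult[OF \<rho>(2) E] by (simp add: add.commute)
   ultimately show ?thesis unfolding \<sigma>_def coeff_diff coeff_smult by (rule poly_degree_diff)
  qed
  moreover have "a v ^ Suc j * \<alpha> v ^ Suc j = poly (\<sigma> v) (\<alpha> v)" if "v \<in> W" for v
   unfolding \<sigma>_def using root[OF that] \<rho>(3)[OF that] by (simp add: algebra_simps)
  ultimately show ?case by blast
 qed
 then obtain \<rho> where \<rho>: "\<And>j v. degree (\<rho> j v) < D"
  "\<And>j i. poly_degree F (E * j) (\<lambda>v. coeff (\<rho> j v) i)"
  "\<And>j v. v \<in> W \<Longrightarrow> a v ^ j * \<alpha> v ^ j = poly (\<rho> j v) (\<alpha> v)" by metis
 show ?thesis
 proof (rule growthI[of "D * (c * (1 + E) ^ d)"])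
  fix N
  \<comment> \<open>The coefficients of \<open>f\<close> have degree at most \<open>N\<close>, and
    clearing \<open>a ^ N\<close> adds \<open>E * N\<close>. The denominator \<open>a ^ N\<close> is
    then carried by the spanning functions in \<open>C\<close>.\<close>
  define M where "M = (1 + E) * N"
  define C where "C = (\<lambda>(b, i) v. b v * \<alpha> v ^ i / a v ^ N) ` (B M \<times> {..<D})"
  have fin: "finite C" unfolding C_def using B(1) by auto
  have "card C \<le> card (B M \<times> {..<D})" unfolding C_def using B(1) by (intro card_image_le) auto
  also have "\<dots> \<le> c * (M + 1) ^ d * D"
   using B(2)[of M] by (simp add: card_cartesian_product)
  also have "\<dots> \<le> c * ((1 + E) * (N + 1)) ^ d * D"
   unfolding M_def by (intro mult_right_mono mult_left_mono power_mono) auto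
  finally have card: "card C \<le> D * (c * (1 + E) ^ d) * (N + 1) ^ d"
   by (simp only: power_mult_distrib ac_simps)
  have "spanned W C f" if f: "poly_degree (insert \<alpha> F) N f" for f
  proof -
   obtain \<phi> where \<phi>: "\<And>v. degree (\<phi> v) \<le> N" "\<And>j. poly_degree F N (\<lambda>v. coeff (\<phi> v) j)"
    "\<And>v. f v = poly (\<phi> v) (\<alpha> v)" using poly_degree_insert[OF f] by blast
   define P where "P i v = (\<Sum>j\<le>N. coeff (\<phi> v) j * (a v ^ (N - j) * coeff (\<rho> j v) i))" for i v
   have "poly_degree F M (P i)" for i
    unfolding P_def
   proof (rule poly_degree_sum)
    fix j assume "j \<in> {..N}"
    then obtain k where "N = j + k" using le_Suc_ex by auto
    then have eq: "N + ((N - j) * E + E * j) = M"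
     unfolding M_def by (simp add: algebra_simps)
    show "poly_degree F M (\<lambda>v. coeff (\<phi> v) j * (a v ^ (N - j) * coeff (\<rho> j v) i))"
     unfolding eq[symmetric] by (intro poly_degree.mult poly_degree_power \<phi> \<rho> aE)
   qed
   then have "\<exists>m. \<forall>v\<in>W. P i v = (\<Sum>b\<in>B M. m b * b v)" for i
    using B(3) unfolding spanned_def by blast
   then obtain m where m: "\<And>i v. v \<in> W \<Longrightarrow> P i v = (\<Sum>b\<in>B M. m i b * b v)" by metis
   have eq: "f v = (\<Sum>i<D. \<Sum>b\<in>B M. m i b * (b v * \<alpha> v ^ i / a v ^ N))" if v: "v \<in> W" for v
   proof -
    have poly\<rho>: "poly (\<rho> j v) x = (\<Sum>i<D. coeff (\<rho> j v) i * x ^ i)" for j x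
     unfolding poly_altdef using \<rho>(1)[of j v]
     by (intro sum.mono_neutral_left) (auto simp: coeff_eq_0)
    have "a v ^ N * f v = (\<Sum>j\<le>N. coeff (\<phi> v) j * (a v ^ (N - j) * (a v ^ j * \<alpha> v ^ j)))"
     unfolding \<phi>(3) poly_of_coeffs[OF \<phi>(1)] sum_distrib_left
     by (intro sum.cong refl) (simp flip: mult.assoc power_add)
    also have "\<dots> = (\<Sum>j\<le>N. \<Sum>i<D. coeff (\<phi> v) j * (a v ^ (N - j) * coeff (\<rho> j v) i) * \<alpha> v ^ i)"
     unfolding \<rho>(3)[OF v] poly\<rho> by (simp add: sum_distrib_left mult.assoc)
    also have "\<dots> = (\<Sum>i<D. P i v * \<alpha> v ^ i)"
     unfolding P_def by (subst sum.swap) (simp add: sum_distrib_right)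
    also have "\<dots> = (\<Sum>i<D. \<Sum>b\<in>B M. m i b * (b v * \<alpha> v ^ i))"
     unfolding m[OF v] by (simp add: sum_distrib_right mult.assoc)
    finally have "f v = (\<Sum>i<D. \<Sum>b\<in>B M. m i b * (b v * \<alpha> v ^ i)) / a v ^ N"
     using lead[OF v] by (simp add: a_def field_simps)
    then show ?thesis by (simp add: sum_divide_distrib)
   qed
   have "spanned W C (\<lambda>v. \<Sum>i<D. \<Sum>b\<in>B M. m i b * (b v * \<alpha> v ^ i / a v ^ N))"
    by (intro spanned_sum spanned_scale spanned_base[OF fin]) (auto simp: C_def image_iff intro!: bexI)
   then show ?thesis by (rule spanned_cong) (simp add: eq)
  qed
  then show "\<exists>B. finite B \<and> card B \<le> D * (c * (1 + E) ^ d) * (N + 1) ^ d \<and>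
    (\<forall>f. poly_degree (insert \<alpha> F) N f \<longrightarrow> spanned W B f)"
   using fin card by blast
 qed
qed

lemma growth_Un:
 assumes "growth S F d" "growth T F d"
 shows "growth (S \<union> T) F d"
proof -
 obtain c B where B: "\<And>N. finite (B N)" "\<And>N. card (B N) \<le> c * (N + 1) ^ d"
  "\<And>N f. poly_degree F N f \<Longrightarrow> spanned S (B N) f" using assms(1) by (rule growthE) (rule that)
 obtain c' B' where B': "\<And>N. finite (B' N)" "\<And>N. card (B' N) \<le> c' * (N + 1) ^ d"
  "\<And>N f. poly_degree F N f \<Longrightarrow> spanned T (B' N) f" using assms(2) by (rule growthE) (rule that)
 show ?thesis
 proof (rule growthI[of "c + c'"])
  fix N
  \<comment> \<open>Both spanning sets are extended by zero; on the overlap of \<open>S\<close> and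
    \<open>T\<close> only the first one counts.\<close>
  define r where "r b v = (if v \<in> S then b v else 0)" for b :: "'a \<Rightarrow> 'b" and v
  define r' where "r' b v = (if v \<in> S then 0 else b v)" for b :: "'a \<Rightarrow> 'b" and v
  define C where "C = r ` B N \<union> r' ` B' N"
  have fin: "finite C" unfolding C_def using B B' by auto
  have "card C \<le> card (B N) + card (B' N)"
   unfolding C_def using B(1) B'(1) by (meson add_mono card_Un_le card_image_le order_trans)
  also have "\<dots> \<le> (c + c') * (N + 1) ^ d"
   using B(2)[of N] B'(2)[of N] by (simp add: distrib_right)
  finally have card: "card C \<le> (c + c') * (N + 1) ^ d" .
  have "spanned (S \<union> T) C f" if f: "poly_degree F N f" for f
  proof -
   obtain m m' where m: "\<And>v. v \<in> S \<Longrightarrow> f v = (\<Sum>b\<in>B N. m b * b v)"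
    "\<And>v. v \<in> T \<Longrightarrow> f v = (\<Sum>b\<in>B' N. m' b * b v)"
    using B(3)[OF f] B'(3)[OF f] unfolding spanned_def by blast
   have "spanned (S \<union> T) C (\<lambda>v. (\<Sum>b\<in>B N. m b * r b v) + (\<Sum>b\<in>B' N. m' b * r' b v))"
    by (intro spanned_add spanned_sum spanned_scale spanned_base[OF fin]) (auto simp: C_def)
   then show ?thesis
   proof (rule spanned_cong)
    fix v assume "v \<in> S \<union> T"
    then show "(\<Sum>b\<in>B N. m b * r b v) + (\<Sum>b\<in>B' N. m' b * r' b v) = f v"
     by (cases "v \<in> S") (simp_all add: r_def r'_def m)
   qed
  qed
  then show "\<exists>B. finite B \<and> card B \<le> (c + c') * (N + 1) ^ d \<and>
    (\<forall>f. poly_degree F N f \<longrightarrow> spanned (S \<union> T) B f)" using fin card by blast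
 qed
qed

lemma growth_empty: "growth {} F d"
 by (rule growthI[of 0]) (auto simp: spanned_def)

lemma growth_UN: "finite I \<Longrightarrow> (\<And>i. i \<in> I \<Longrightarrow> growth (S i) F d) \<Longrightarrow> growth (\<Union>i\<in>I. S i) F d"
 by (induction I rule: finite_induct) (auto intro: growth_empty growth_Un)

text \<open>To be read as dim \<open>K\<close> <= dim \<open>W\<close>: the coordinates
  \<open>Z\<close> of a point of \<open>K\<close> are recovered polynomially from its image under
  \<open>\<psi>\<close>.\<close>

lemma growth_pullback:
 assumes "growth W X d" "\<psi> ` K \<subseteq> W"
  and "\<And>z. z \<in> Z \<Longrightarrow> \<exists>\<zeta>. poly_degree X \<delta> \<zeta> \<and> (\<forall>k\<in>K. z k = \<zeta> (\<psi> k))"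
 shows "growth K Z d"
proof -
 obtain c B where B: "\<And>N. finite (B N)" "\<And>N. card (B N) \<le> c * (N + 1) ^ d"
  "\<And>N f. poly_degree X N f \<Longrightarrow> spanned W (B N) f" using assms(1) by (rule growthE) (rule that)
 show ?thesis
 proof (rule growthI[of "c * (\<delta> + 1) ^ d"])
  fix N
  define C where "C = (\<lambda>b k. b (\<psi> k)) ` B (\<delta> * N)"
  have fin: "finite C" unfolding C_def using B by auto
  have "card C \<le> card (B (\<delta> * N))" unfolding C_def using B(1) by (rule card_image_le)
  also have "\<dots> \<le> c * (\<delta> * N + 1) ^ d" by (rule B)
  also have "\<dots> \<le> c * ((\<delta> + 1) * (N + 1)) ^ d"
   by (intro mult_left_mono power_mono) auto
  finally have card: "card C \<le> c * (\<delta> + 1) ^ d * (N + 1) ^ d"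
   by (simp only: power_mult_distrib ac_simps)
  have "spanned K C f" if f: "poly_degree Z N f" for f
  proof -
   obtain \<zeta> where \<zeta>: "poly_degree X (\<delta> * N) \<zeta>" "\<And>k. k \<in> K \<Longrightarrow> f k = \<zeta> (\<psi> k)"
    using poly_degree_pullback[OF f assms(3)] by blast
   obtain m where m: "\<And>v. v \<in> W \<Longrightarrow> \<zeta> v = (\<Sum>b\<in>B (\<delta> * N). m b * b v)"
    using B(3)[OF \<zeta>(1)] unfolding spanned_def by blast
   have "spanned K C (\<lambda>k. \<Sum>b\<in>B (\<delta> * N). m b * b (\<psi> k))"
    by (intro spanned_sum spanned_scale spanned_base[OF fin]) (auto simp: C_def)
   then show ?thesis by (rule spanned_cong) (use \<zeta>(2) m assms(2) in auto)
  qed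
  then show "\<exists>B. finite B \<and> card B \<le> c * (\<delta> + 1) ^ d * (N + 1) ^ d \<and>
    (\<forall>f. poly_degree Z N f \<longrightarrow> spanned K B f)" using fin card by blast
 qed
qed

lemma growth_dependent:
 assumes "growth S F d"
 obtains c where "\<And>N (E :: 'e set) u. finite E \<Longrightarrow> (\<And>e. e \<in> E \<Longrightarrow> poly_degree F N (u e)) \<Longrightarrow>
  lin_indep S E u \<Longrightarrow> card E \<le> c * (N + 1) ^ d"
proof -
 obtain c B where "\<And>N. finite (B N)" "\<And>N. card (B N) \<le> c * (N + 1) ^ d"
  "\<And>N f. poly_degree F N f \<Longrightarrow> spanned S (B N) f" using assms by (rule growthE) (rule that)
 then show ?thesis by (intro that[of c]) (meson lin_indep_card_le order_trans)
qed

text \<open>With this \<open>N\<close> the left side is at most \<open>N * (N + 1) ^ d\<close>. The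
  value is explicit because the same expression serves as the exponent bound in
  \<open>uniform_relations\<close>.\<close>

lemma power_outgrows:
 fixes c \<kappa> d :: nat
 defines "N \<equiv> c * (\<kappa> + 1) ^ d"
 shows "c * (\<kappa> * N + 1) ^ d < (N + 1) ^ Suc d"
proof -
 have "c * (\<kappa> * N + 1) ^ d \<le> c * ((\<kappa> + 1) * (N + 1)) ^ d"
  by (intro mult_left_mono power_mono) auto
 also have "\<dots> = N * (N + 1) ^ d" by (simp only: N_def power_mult_distrib ac_simps)
 also have "\<dots> < (N + 1) ^ Suc d" by simp
 finally show ?thesis .
qed

lemma growth_lower_bound:
 fixes E :: "nat \<Rightarrow> 'e set"
 assumes "growth S F d"
  and "\<And>N. finite (E N)" "\<And>N. (N + 1) ^ m \<le> card (E N)"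
  and "\<And>N e. e \<in> E N \<Longrightarrow> poly_degree F (\<kappa> * N) (u N e)" "\<And>N. lin_indep S (E N) (u N)"
 shows "m \<le> d"
proof (rule ccontr)
 assume "\<not> m \<le> d"
 obtain c where c: "\<And>N (E :: 'e set) u. finite E \<Longrightarrow> (\<And>e. e \<in> E \<Longrightarrow> poly_degree F N (u e)) \<Longrightarrow>
  lin_indep S E u \<Longrightarrow> card E \<le> c * (N + 1) ^ d" using growth_dependent[OF assms(1)] by blast
 define N where "N = c * (\<kappa> + 1) ^ d"
 have "(N + 1) ^ Suc d \<le> (N + 1) ^ m" using \<open>\<not> m \<le> d\<close> by (intro power_increasing) auto
 also have "\<dots> \<le> card (E N)" by (rule assms)
 also have "\<dots> \<le> c * (\<kappa> * N + 1) ^ d" using c[OF assms(2) _ assms(5)] assms(4) by blast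
 finally show False using power_outgrows[of c \<kappa> d] unfolding N_def by simp
qed

section \<open>Irreducible sets and algebraic dependence\<close>

text \<open>The ideal of functions vanishing on \<open>S\<close> is prime. Stated through functions,
  the notion applies to open pieces, images and translates as well as to closed sets.\<close>

definition irreducible_on :: "('v \<Rightarrow> 'k::idom) set \<Rightarrow> 'v set \<Rightarrow> bool" where
 "irreducible_on X S \<longleftrightarrow> S \<noteq> {} \<and> (\<forall>f\<in>PF X. \<forall>g\<in>PF X.
  (\<forall>v\<in>S. f v * g v = 0) \<longrightarrow> (\<forall>v\<in>S. f v = 0) \<or> (\<forall>v\<in>S. g v = 0))"

lemma irreducible_onD:
 "irreducible_on X S \<Longrightarrow> f \<in> PF X \<Longrightarrow> g \<in> PF X \<Longrightarrow> \<exists>v\<in>S. f v \<noteq> 0 \<Longrightarrow> \<exists>v\<in>S. g v \<noteq> 0 \<Longrightarrow>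
  \<exists>v\<in>S. f v \<noteq> 0 \<and> g v \<noteq> 0"
proof (rule ccontr)
 assume "irreducible_on X S" "f \<in> PF X" "g \<in> PF X" and nz: "\<exists>v\<in>S. f v \<noteq> 0" "\<exists>v\<in>S. g v \<noteq> 0"
 then have "(\<forall>v\<in>S. f v * g v = 0) \<longrightarrow> (\<forall>v\<in>S. f v = 0) \<or> (\<forall>v\<in>S. g v = 0)"
  unfolding irreducible_on_def by simp
 moreover assume "\<not> (\<exists>v\<in>S. f v \<noteq> 0 \<and> g v \<noteq> 0)"
 then have "\<forall>v\<in>S. f v * g v = 0" by auto
 ultimately show False using nz by auto
qed

lemma irreducible_on_dense:
 assumes "irreducible_on X S" "f \<in> PF X" "q \<in> PF X" "\<exists>v\<in>S. q v \<noteq> 0" "\<forall>v\<in>S. q v \<noteq> 0 \<longrightarrow> f v = 0"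
 shows "\<forall>v\<in>S. f v = 0"
 using irreducible_onD[OF assms(1-3)] assms(4,5) by blast

lemma irreducible_on_subset: "irreducible_on X S \<Longrightarrow> Y \<subseteq> PF X \<Longrightarrow> irreducible_on Y S"
 unfolding irreducible_on_def by (meson PF_trans)

text \<open>Spanning functions on the open part are arbitrary and cannot be extended to
  \<open>S\<close>. What extends is a linear relation between polynomial functions, so the bound is
  carried over through the sizes of independent sets.\<close>

lemma growth_dense:
 assumes "irreducible_on X S" "F \<subseteq> PF X" "q \<in> PF X" "\<exists>v\<in>S. q v \<noteq> 0"
  and "growth {v \<in> S. q v \<noteq> 0} F d"
 shows "growth S F d"
proof -
 obtain c where c: "\<And>N (E :: ('a \<Rightarrow> 'b) set) u. finite E \<Longrightarrow> (\<And>e. e \<in> E \<Longrightarrow> poly_degree F N (u e)) \<Longrightarrow>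
  lin_indep {v \<in> S. q v \<noteq> 0} E u \<Longrightarrow> card E \<le> c * (N + 1) ^ d"
  using growth_dependent[OF assms(5)] by blast
 show ?thesis
 proof (rule growthI[of c], rule bounded_rank_spanned)
  fix N and I :: "('a \<Rightarrow> 'b) set"
  assume I: "finite I" "\<And>f. f \<in> I \<Longrightarrow> poly_degree F N f" "lin_indep S I (\<lambda>f. f)"
  have "lin_indep {v \<in> S. q v \<noteq> 0} I (\<lambda>f. f)"
   unfolding lin_indep_def
  proof (intro allI impI)
   fix l assume l: "\<forall>v\<in>{v \<in> S. q v \<noteq> 0}. (\<Sum>e\<in>I. l e * e v) = 0"
   have "(\<lambda>v. \<Sum>e\<in>I. l e * e v) \<in> PF X"
    using PF_trans[OF poly_degree_PF[OF I(2)] assms(2)] by (intro PF_intros)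
   then have "\<forall>v\<in>S. (\<Sum>e\<in>I. l e * e v) = 0"
    using l by (intro irreducible_on_dense[OF assms(1) _ assms(3,4)]) auto
   then show "\<forall>e\<in>I. l e = 0" using I(3) unfolding lin_indep_def by blast
  qed
  then show "card I \<le> c * (N + 1) ^ d" using c[where u = "\<lambda>f. f"] I by blast
 qed
qed

text \<open>The equation holds on all of \<open>S\<close> but is asked to be nontrivial at one point
  only; on an irreducible \<open>S\<close> it is then nontrivial on a dense part.\<close>

definition algebraic_over :: "'v set \<Rightarrow> ('v \<Rightarrow> 'k::idom) set \<Rightarrow> ('v \<Rightarrow> 'k) \<Rightarrow> bool" where
 "algebraic_over S F \<alpha> \<longleftrightarrow> (\<exists>\<pi> D. (\<forall>j. cf \<pi> j \<in> PF F) \<and> (\<forall>v. degree (\<pi> v) \<le> D) \<and>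
  (\<forall>v\<in>S. poly (\<pi> v) (\<alpha> v) = 0) \<and> (\<exists>v\<in>S. \<pi> v \<noteq> 0))"

text \<open>The formal degree is lowered to the largest degree occurring on \<open>S\<close>, so
  that the top coefficient is nonzero somewhere on \<open>S\<close>. Outside \<open>S\<close>, where
  no bound is given, the polynomials are cut off.\<close>

lemma truncate_to_leading_coeff:
 fixes \<pi> :: "'v \<Rightarrow> 'k::comm_ring_1 poly"
 assumes \<pi>: "\<And>j. cf \<pi> j \<in> PF F" "\<And>v. v \<in> S \<Longrightarrow> degree (\<pi> v) \<le> D0" "\<exists>v\<in>S. \<pi> v \<noteq> 0"
 obtains \<rho> D where "\<And>j. cf \<rho> j \<in> PF F" "\<And>v. degree (\<rho> v) \<le> D" "D \<le> D0"
  "\<And>v. v \<in> S \<Longrightarrow> \<rho> v = \<pi> v" "\<exists>v\<in>S. coeff (\<rho> v) D \<noteq> 0"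
proof -
 define D where "D = (LEAST D. \<forall>v\<in>S. degree (\<pi> v) \<le> D)"
 have D: "\<forall>v\<in>S. degree (\<pi> v) \<le> D"
  unfolding D_def using LeastI[of "\<lambda>D. \<forall>v\<in>S. degree (\<pi> v) \<le> D" D0] \<pi>(2) by blast
 have "D \<le> D0"
  unfolding D_def using \<pi>(2) by (intro Least_le) blast
 define \<rho> where "\<rho> v = poly_cutoff (Suc D) (\<pi> v)" for v
 have \<rho>: "\<rho> v = \<pi> v" if "v \<in> S" for v
  unfolding \<rho>_def using D that by (intro poly_eqI) (auto simp: coeff_poly_cutoff coeff_eq_0)
 have lead: "\<exists>v\<in>S. coeff (\<rho> v) D \<noteq> 0"
 proof (cases D)
  case 0
  then show ?thesis using \<pi>(3) D \<rho> by (metis leading_coeff_0_iff le_zero_eq)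
 next
  case (Suc n)
  then have "\<not> (\<forall>v\<in>S. degree (\<pi> v) \<le> n)"
   using not_less_Least[of n "\<lambda>D. \<forall>v\<in>S. degree (\<pi> v) \<le> D"] unfolding D_def by auto
  then obtain v where "v \<in> S" "degree (\<pi> v) = D" using D Suc by (metis le_SucE)
  then show ?thesis using \<rho> Suc
   by (intro bexI[of _ v]) (metis leading_coeff_0_iff degree_0 nat.distinct(1))
 qed
 have "cf \<rho> j \<in> PF F" for j
  unfolding \<rho>_def using \<pi>(1) by (cases "j < Suc D") (auto simp: coeff_poly_cutoff intro: PF_intros)
 moreover have deg: "degree (\<rho> v) \<le> D" for v
  unfolding \<rho>_def by (intro degree_le) (auto simp: coeff_poly_cutoff)
 ultimately show ?thesis using that \<rho> lead \<open>D \<le> D0\<close> by blast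
qed

lemma algebraic_overE:
 assumes "algebraic_over S F \<alpha>"
 obtains \<pi> D where "\<And>j. cf \<pi> j \<in> PF F" "\<And>v. degree (\<pi> v) \<le> D"
  "\<And>v. v \<in> S \<Longrightarrow> poly (\<pi> v) (\<alpha> v) = 0" "\<exists>v\<in>S. coeff (\<pi> v) D \<noteq> 0" "D > 0"
proof -
 obtain \<pi> D0 where \<pi>: "\<And>j. cf \<pi> j \<in> PF F" "\<And>v. degree (\<pi> v) \<le> D0"
  "\<And>v. v \<in> S \<Longrightarrow> poly (\<pi> v) (\<alpha> v) = 0" "\<exists>v\<in>S. \<pi> v \<noteq> 0"
  using assms unfolding algebraic_over_def by blast
 obtain \<rho> D where F: "\<And>j. cf \<rho> j \<in> PF F" and deg: "\<And>v. degree (\<rho> v) \<le> D"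
  and \<rho>: "\<And>v. v \<in> S \<Longrightarrow> \<rho> v = \<pi> v" and lead: "\<exists>v\<in>S. coeff (\<rho> v) D \<noteq> 0"
  by (rule truncate_to_leading_coeff[of \<pi> F S D0, OF \<pi>(1,2,4)]) (rule that)
 have "D > 0"
 proof (rule ccontr)
  assume "\<not> D > 0"
  then have "D = 0" by simp
  then obtain v where v: "v \<in> S" "coeff (\<rho> v) 0 \<noteq> 0" using lead by blast
  have "poly (\<rho> v) (\<alpha> v) = coeff (\<rho> v) 0"
   using deg[of v] \<open>D = 0\<close> by (simp add: poly_altdef)
  then show False using v \<rho> \<pi>(3) by auto
 qed
 then show ?thesis using that[of \<rho> D] F deg \<rho> \<pi>(3) lead by simp
qed

lemma growth_insert_algebraic:
 assumes "irreducible_on X S" "F \<subseteq> PF X" "\<alpha> \<in> PF X" "algebraic_over S F \<alpha>" "growth S F d"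
 shows "growth S (insert \<alpha> F) d"
proof -
 obtain \<pi> D where \<pi>: "\<And>j. cf \<pi> j \<in> PF F" "\<And>v. degree (\<pi> v) \<le> D"
  "\<And>v. v \<in> S \<Longrightarrow> poly (\<pi> v) (\<alpha> v) = 0" "\<exists>v\<in>S. coeff (\<pi> v) D \<noteq> 0" "D > 0"
  using assms(4) by (rule algebraic_overE) (rule that)
 have "growth {v \<in> S. coeff (\<pi> v) D \<noteq> 0} (insert \<alpha> F) d"
  by (rule growth_insert_algebraic_on[of _ _ _ \<pi> D]) (use \<pi> growth_subset[OF assms(5)] in auto)
 then show ?thesis
  using growth_dense[OF assms(1) _ PF_trans[OF \<pi>(1) assms(2)] \<pi>(4)] assms(2,3) by blast
qed

section \<open>Monomials and algebraic independence\<close>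

text \<open>A box of exponents, rather than a bound on the total degree, gives exactly
  \<open>(D + 1) ^ card I\<close> monomials. Exponents vanish outside \<open>I\<close> to make the
  vectors unique.\<close>

definition exponents :: "'i set \<Rightarrow> nat \<Rightarrow> ('i \<Rightarrow> nat) set" where
 "exponents I D = {e. (\<forall>i\<in>I. e i \<le> D) \<and> (\<forall>i. i \<notin> I \<longrightarrow> e i = 0)}"

lemma exponents_empty [simp]: "exponents {} D = {\<lambda>_. 0}"
 unfolding exponents_def by auto

lemma exponents_insert:
 assumes "i \<notin> I"
 shows "exponents (insert i I) D = (\<lambda>(e, j). e(i := j)) ` (exponents I D \<times> {..D})"
  and "inj_on (\<lambda>(e, j). e(i := j)) (exponents I D \<times> {..D})"
proof -
 show "exponents (insert i I) D = (\<lambda>(e, j). e(i := j)) ` (exponents I D \<times> {..D})" (is "?L = ?R")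
 proof
  show "?L \<subseteq> ?R"
  proof
   fix e assume "e \<in> ?L"
   then have "(e(i := 0), e i) \<in> exponents I D \<times> {..D}" "e = (\<lambda>(e, j). e(i := j)) (e(i := 0), e i)"
    using assms unfolding exponents_def by auto
   then show "e \<in> ?R" by blast
  qed
  show "?R \<subseteq> ?L" using assms unfolding exponents_def by auto
 qed
 show "inj_on (\<lambda>(e, j). e(i := j)) (exponents I D \<times> {..D})"
 proof (rule inj_onI, clarify)
  fix e j e' j'
  assume "e \<in> exponents I D" "e' \<in> exponents I D" and eq: "e(i := j) = e'(i := j')"
  then have "e i = 0" "e' i = 0" using assms unfolding exponents_def by auto
  then show "e = e' \<and> j = j'" using eq by (metis fun_upd_idem_iff fun_upd_upd fun_upd_same)
 qed
qed

lemma exponents_mono: "I \<subseteq> J \<Longrightarrow> exponents I D \<subseteq> exponents J D"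
 unfolding exponents_def by auto

lemma finite_exponents [simp]: "finite I \<Longrightarrow> finite (exponents I D)"
 by (induction I rule: finite_induct) (auto simp: exponents_insert(1))

lemma card_exponents: "finite I \<Longrightarrow> card (exponents I D) = (D + 1) ^ card I"
 by (induction I rule: finite_induct)
  (auto simp: exponents_insert card_image card_cartesian_product)

lemma sum_exponents_insert:
 "i \<notin> I \<Longrightarrow> (\<Sum>e\<in>exponents (insert i I) D. F e) = (\<Sum>e\<in>exponents I D. \<Sum>j\<le>D. F (e(i := j)))"
 unfolding exponents_insert(1)
 by (subst sum.reindex[OF exponents_insert(2)]) (auto simp: sum.cartesian_product split_def)

definition monomial :: "'i set \<Rightarrow> ('i \<Rightarrow> 'v \<Rightarrow> 'k::comm_ring_1) \<Rightarrow> ('i \<Rightarrow> nat) \<Rightarrow> 'v \<Rightarrow> 'k" where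
 "monomial I h e v = (\<Prod>i\<in>I. h i v ^ e i)"

lemma monomial_insert:
 assumes "i \<notin> I" "finite I" "e \<in> exponents I D"
 shows "monomial (insert i I) h (e(i := j)) v = monomial I h e v * h i v ^ j"
proof -
 have "(\<Prod>l\<in>I. h l v ^ (e(i := j)) l) = (\<Prod>l\<in>I. h l v ^ e l)"
  by (rule prod.cong) (use assms in auto)
 then show ?thesis using assms by (simp add: monomial_def mult.commute)
qed

lemma monomial_poly_degree:
 assumes "finite I" "\<And>i. i \<in> I \<Longrightarrow> poly_degree X \<delta> (h i)" "e \<in> exponents I D"
 shows "poly_degree X (card I * \<delta> * D) (monomial I h e)"
proof -
 have "poly_degree X (\<Sum>i\<in>I. e i * \<delta>) (monomial I h e)"
  unfolding monomial_def by (intro poly_degree_prod poly_degree_power assms)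
 moreover have "(\<Sum>i\<in>I. e i * \<delta>) \<le> (\<Sum>i\<in>I. D * \<delta>)"
  using assms(3) by (intro sum_mono mult_right_mono) (auto simp: exponents_def)
 ultimately show ?thesis by (rule poly_degree_le[OF _ order_trans]) (simp add: ac_simps)
qed

lemma PF_monomial: "(\<And>i. i \<in> I \<Longrightarrow> h i \<in> PF X) \<Longrightarrow> monomial I h e \<in> PF X"
 unfolding monomial_def[abs_def] by (intro PF_intros) auto

definition alg_indep :: "'v set \<Rightarrow> ('i \<Rightarrow> 'v \<Rightarrow> 'k::field) \<Rightarrow> 'i set \<Rightarrow> bool" where
 "alg_indep S h I \<longleftrightarrow> (\<forall>D. lin_indep S (exponents I D) (monomial I h))"

text \<open>Algebraic independence of \<open>Y\<close> over the algebra generated by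
  \<open>R\<close>. The coefficients are functions themselves, so the conclusion is that they vanish
  on \<open>S\<close>.\<close>

definition free_over :: "'v set \<Rightarrow> ('v \<Rightarrow> 'k::field) set \<Rightarrow> ('v \<Rightarrow> 'k) set \<Rightarrow> bool" where
 "free_over S R Y \<longleftrightarrow> (\<forall>D c. (\<forall>e\<in>exponents Y D. c e \<in> PF R) \<and>
  (\<forall>v\<in>S. (\<Sum>e\<in>exponents Y D. c e v * monomial Y (\<lambda>y. y) e v) = 0) \<longrightarrow>
  (\<forall>e\<in>exponents Y D. \<forall>v\<in>S. c e v = 0))"

text \<open>Sorted by powers of \<open>h i\<close>, a relation is a polynomial equation for
  \<open>h i\<close> over the other functions. As \<open>h i\<close> is not algebraic, each
  coefficient vanishes on \<open>S\<close>, and is itself a relation between the others.\<close>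

lemma alg_indep_insert:
 assumes "alg_indep S h I" "finite I" "i \<notin> I" "\<not> algebraic_over S (h ` I) (h i)"
 shows "alg_indep S h (insert i I)"
 unfolding alg_indep_def lin_indep_def
proof (intro allI impI ballI)
 fix D l e
 assume l: "\<forall>v\<in>S. (\<Sum>e\<in>exponents (insert i I) D. l e * monomial (insert i I) h e v) = 0"
  and e: "e \<in> exponents (insert i I) D"
 define \<pi> where "\<pi> v = (\<Sum>j\<le>D. monom (\<Sum>e\<in>exponents I D. l (e(i := j)) * monomial I h e v) j)" for v
 have coeff: "coeff (\<pi> v) j = (if j \<le> D then (\<Sum>e\<in>exponents I D. l (e(i := j)) * monomial I h e v) else 0)" for v j
  unfolding \<pi>_def by (simp add: coeff_sum coeff_monom)
 have deg: "degree (\<pi> v) \<le> D" for v by (intro degree_le) (simp add: coeff)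
 have "poly (\<pi> v) (h i v) = 0" if "v \<in> S" for v
 proof -
  have "poly (\<pi> v) (h i v) = (\<Sum>j\<le>D. \<Sum>e\<in>exponents I D. l (e(i := j)) * (monomial I h e v * h i v ^ j))"
   unfolding poly_of_coeffs[OF deg] by (simp add: coeff sum_distrib_right mult.assoc)
  also have "\<dots> = (\<Sum>e\<in>exponents (insert i I) D. l e * monomial (insert i I) h e v)"
   unfolding sum_exponents_insert[OF assms(3)]
   by (subst sum.swap) (simp add: monomial_insert[OF assms(3,2), of _ D])
  finally show ?thesis using l that by simp
 qed
 moreover have "cf \<pi> j \<in> PF (h ` I)" for j
  unfolding coeff by (intro PF_intros PF_monomial) (auto intro: PF_coord)
 ultimately have zero: "\<And>v. v \<in> S \<Longrightarrow> \<pi> v = 0"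
  using assms(4) deg unfolding algebraic_over_def by blast
 obtain e' j where e': "e = e'(i := j)" "e' \<in> exponents I D" "j \<le> D"
  using e unfolding exponents_insert(1)[OF assms(3)] by auto
 have "\<forall>v\<in>S. (\<Sum>e\<in>exponents I D. l (e(i := j)) * monomial I h e v) = 0"
 proof
  fix v assume "v \<in> S"
  then have "coeff (\<pi> v) j = 0" by (simp only: zero coeff_0)
  then show "(\<Sum>e\<in>exponents I D. l (e(i := j)) * monomial I h e v) = 0"
   using e'(3) by (simp add: coeff)
 qed
 then have "\<forall>e\<in>exponents I D. l (e(i := j)) = 0"
  using assms(1)[unfolded alg_indep_def lin_indep_def, rule_format, of "\<lambda>e. l (e(i := j))" D] by blast
 then show "l e = 0" using e' by blast
qed

text \<open>There are \<open>(N + 1) ^ card I\<close> independent monomials whose degree is at most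
  a fixed multiple of \<open>N\<close>.\<close>

lemma alg_indep_growth:
 assumes "alg_indep S h I" "finite I" "h ` I \<subseteq> PF X" "growth S X d"
 shows "card I \<le> d"
proof -
 obtain \<delta> where \<delta>: "\<forall>f\<in>h ` I. poly_degree X \<delta> f" using finite_poly_degree[of "h ` I" X] assms by auto
 show ?thesis
 proof (rule growth_lower_bound[OF assms(4), of "exponents I" "card I" "card I * \<delta>" "\<lambda>_. monomial I h"])
  fix N e assume "e \<in> exponents I N"
  then show "poly_degree X (card I * \<delta> * N) (monomial I h e)"
   using \<delta> by (intro monomial_poly_degree assms) auto
 qed (use assms in \<open>auto simp: card_exponents alg_indep_def\<close>)
qed

lemma growth_base: "finite I \<Longrightarrow> growth S (h ` I) (card I)"
proof (induction I rule: finite_induct)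
 case empty
 then show ?case using growth_constant[of "{}"] by auto
next
 case (insert i I)
 then show ?case using growth_insert by fastforce
qed

text \<open>Independence in stages: first the coefficient of each monomial in \<open>Y\<close>
  vanishes, and this coefficient is a linear relation between monomials in \<open>h\<close>.\<close>

lemma lin_indep_monomials_free:
 assumes "lin_indep S (exponents I D) (monomial I h)" "free_over S (h ` I) Y"
 shows "lin_indep S (exponents I D \<times> exponents Y D)
  (\<lambda>(\<mu>, \<nu>) v. monomial I h \<mu> v * monomial Y (\<lambda>y. y) \<nu> v)"
 unfolding lin_indep_def
proof (intro allI impI)
 fix l
 assume l: "\<forall>v\<in>S. (\<Sum>e\<in>exponents I D \<times> exponents Y D. l e *
  (case e of (\<mu>, \<nu>) \<Rightarrow> \<lambda>v. monomial I h \<mu> v * monomial Y (\<lambda>y. y) \<nu> v) v) = 0"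
 define c where "c \<nu> v = (\<Sum>\<mu>\<in>exponents I D. l (\<mu>, \<nu>) * monomial I h \<mu> v)" for \<nu> v
 have "(\<Sum>\<nu>\<in>exponents Y D. c \<nu> v * monomial Y (\<lambda>y. y) \<nu> v) = 0" if "v \<in> S" for v
  unfolding c_def sum_distrib_right
  by (subst sum.swap, subst sum.cartesian_product) (use l that in \<open>auto simp: split_def mult.assoc\<close>)
 moreover have "c \<nu> \<in> PF (h ` I)" for \<nu>
  unfolding c_def[abs_def] by (intro PF_intros PF_monomial) (auto intro: PF_coord)
 ultimately have "\<forall>\<nu>\<in>exponents Y D. \<forall>v\<in>S. c \<nu> v = 0"
  using assms(2) unfolding free_over_def by blast
 then have "l (\<mu>, \<nu>) = 0" if "\<mu> \<in> exponents I D" "\<nu> \<in> exponents Y D" for \<mu> \<nu>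
  using assms(1)[unfolded lin_indep_def, THEN spec, of "\<lambda>\<mu>. l (\<mu>, \<nu>)"] that
  unfolding c_def by blast
 then show "\<forall>e\<in>exponents I D \<times> exponents Y D. l e = 0" by auto
qed

text \<open>Additivity of transcendence degrees, by counting products of monomials of the two
  kinds.\<close>

lemma free_over_card_le:
 assumes "alg_indep S h I" "finite I" "free_over S (h ` I) Y" "finite Y" "h ` I \<subseteq> PF X" "Y \<subseteq> PF X"
  and "growth S X d"
 shows "card I + card Y \<le> d"
proof -
 obtain \<delta> where \<delta>: "\<forall>f\<in>h ` I \<union> Y. poly_degree X \<delta> f"
  using finite_poly_degree[of "h ` I \<union> Y" X] assms by auto
 show ?thesis
 proof (rule growth_lower_bound[OF assms(7), of "\<lambda>D. exponents I D \<times> exponents Y D"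
    "card I + card Y" "card I * \<delta> + card Y * \<delta>"])
  fix N e
  assume "e \<in> exponents I N \<times> exponents Y N"
  then obtain \<mu> \<nu> where e: "e = (\<mu>, \<nu>)" "\<mu> \<in> exponents I N" "\<nu> \<in> exponents Y N" by auto
  show "poly_degree X ((card I * \<delta> + card Y * \<delta>) * N)
   ((\<lambda>(\<mu>, \<nu>) v. monomial I h \<mu> v * monomial Y (\<lambda>y. y) \<nu> v) e)"
   unfolding e(1) prod.case distrib_right using e \<delta>
   by (intro poly_degree.mult monomial_poly_degree assms) auto
 next
  fix N
  show "lin_indep S (exponents I N \<times> exponents Y N)
   ((\<lambda>(\<mu>, \<nu>) v. monomial I h \<mu> v * monomial Y (\<lambda>y. y) \<nu> v))"
   using assms unfolding alg_indep_def by (intro lin_indep_monomials_free) auto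
 qed (use assms in \<open>auto simp: card_cartesian_product card_exponents power_add\<close>)
qed

lemma free_over_insert:
 assumes free: "free_over S R Y" and "Y \<subseteq> X" and "finite Y" and "x \<notin> Y"
  and na: "\<not> algebraic_over S (R \<union> X) x"
 shows "free_over S R (insert x Y)"
 unfolding free_over_def
proof (intro allI impI, elim conjE)
 fix D c
 assume c: "\<forall>e\<in>exponents (insert x Y) D. c e \<in> PF R"
  and sum: "\<forall>v\<in>S. (\<Sum>e\<in>exponents (insert x Y) D. c e v * monomial (insert x Y) (\<lambda>y. y) e v) = 0"
 define a where "a j v = (\<Sum>e\<in>exponents Y D. c (e(x := j)) v * monomial Y (\<lambda>y. y) e v)" for j v
 define \<pi> where "\<pi> v = (\<Sum>j\<le>D. monom (a j v) j)" for v
 have coeff: "coeff (\<pi> v) j = (if j \<le> D then a j v else 0)" for v j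
  unfolding \<pi>_def by (simp add: coeff_sum coeff_monom)
 have deg: "degree (\<pi> v) \<le> D" for v by (intro degree_le) (simp add: coeff)
 have cR: "c (e(x := j)) \<in> PF R" if "e \<in> exponents Y D" "j \<le> D" for e j
  using c that unfolding exponents_insert(1)[OF \<open>x \<notin> Y\<close>] by auto
 have "poly (\<pi> v) (x v) = 0" if "v \<in> S" for v
 proof -
  have "poly (\<pi> v) (x v) = (\<Sum>j\<le>D. \<Sum>e\<in>exponents Y D. c (e(x := j)) v * (monomial Y (\<lambda>y. y) e v * x v ^ j))"
   unfolding poly_of_coeffs[OF deg] by (simp add: coeff a_def sum_distrib_right mult.assoc)
  also have "\<dots> = (\<Sum>e\<in>exponents (insert x Y) D. c e v * monomial (insert x Y) (\<lambda>y. y) e v)"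
   unfolding sum_exponents_insert[OF \<open>x \<notin> Y\<close>]
   by (subst sum.swap) (simp add: monomial_insert[OF \<open>x \<notin> Y\<close> \<open>finite Y\<close>, of _ D])
  finally show ?thesis using sum that by simp
 qed
 moreover have "cf \<pi> j \<in> PF (R \<union> X)" for j
 proof (cases "j \<le> D")
  case True
  then have "a j \<in> PF (R \<union> X)" unfolding a_def[abs_def]
   using cR assms(2) True
   by (intro PF_intros PF_monomial) (auto intro: PF_mono[of _ R] PF_coord)
  then show ?thesis using True by (simp add: coeff cong: if_cong)
 qed (simp add: coeff PF_const)
 ultimately have zero: "\<And>v. v \<in> S \<Longrightarrow> \<pi> v = 0"
  using na deg unfolding algebraic_over_def by blast
 show "\<forall>e\<in>exponents (insert x Y) D. \<forall>v\<in>S. c e v = 0"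
 proof
  fix e assume "e \<in> exponents (insert x Y) D"
  then obtain e' j where e': "e = e'(x := j)" "e' \<in> exponents Y D" "j \<le> D"
   unfolding exponents_insert(1)[OF \<open>x \<notin> Y\<close>] by auto
  have "\<forall>v\<in>S. (\<Sum>e\<in>exponents Y D. c (e(x := j)) v * monomial Y (\<lambda>y. y) e v) = 0"
  proof
   fix v assume "v \<in> S"
   then have "coeff (\<pi> v) j = 0" by (simp only: zero coeff_0)
   then show "(\<Sum>e\<in>exponents Y D. c (e(x := j)) v * monomial Y (\<lambda>y. y) e v) = 0"
    using e'(3) by (simp add: coeff a_def)
  qed
  then have "\<forall>e\<in>exponents Y D. \<forall>v\<in>S. c (e(x := j)) v = 0"
   using free[unfolded free_over_def, rule_format, of D "\<lambda>e. c (e(x := j))"] cR e'(3) by blast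
  then show "\<forall>v\<in>S. c e v = 0" using e' by blast
 qed
qed

text \<open>
 A relative transcendence basis of \<open>X\<close> over \<open>R\<close>. The function \<open>q\<close> is the product of the leading
 coefficients of the relations used, so that the growth estimate survives restriction to any
 subset on which \<open>q\<close> has no zero, for instance to a fibre of \<open>R\<close>.
\<close>

lemma relative_basis:
 assumes irr: "irreducible_on \<Omega> S" and "finite X" and sub: "R \<union> X \<subseteq> PF \<Omega>"
 shows "\<exists>Y\<subseteq>X. free_over S R Y \<and> (\<exists>q\<in>PF \<Omega>. (\<exists>v\<in>S. q v \<noteq> 0) \<and>
  (\<forall>W d. W \<subseteq> S \<longrightarrow> (\<forall>v\<in>W. q v \<noteq> 0) \<longrightarrow> growth W R d \<longrightarrow> growth W (R \<union> X) (d + card Y)))"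
 using assms(2) sub
proof (induction X rule: finite_induct)
 case empty
 have "free_over S R {}" unfolding free_over_def by (auto simp: monomial_def)
 moreover have "S \<noteq> {}" using irr unfolding irreducible_on_def by blast
 ultimately show ?case
  by (intro exI[of _ "{}"]) (auto intro!: bexI[of _ "\<lambda>_. 1"] intro: PF_const)
next
 case (insert x X)
 then have "R \<union> X \<subseteq> PF \<Omega>" by auto
 from insert.IH[OF this] obtain Y where Y: "Y \<subseteq> X" "free_over S R Y"
  and "\<exists>q\<in>PF \<Omega>. (\<exists>v\<in>S. q v \<noteq> 0) \<and> (\<forall>W d. W \<subseteq> S \<longrightarrow> (\<forall>v\<in>W. q v \<noteq> 0) \<longrightarrow>
   growth W R d \<longrightarrow> growth W (R \<union> X) (d + card Y))"
  by blast
 then obtain q where q: "q \<in> PF \<Omega>" "\<exists>v\<in>S. q v \<noteq> 0"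
  and gr: "\<And>W d. W \<subseteq> S \<Longrightarrow> \<forall>v\<in>W. q v \<noteq> 0 \<Longrightarrow> growth W R d \<Longrightarrow> growth W (R \<union> X) (d + card Y)"
  by blast
 have fin: "finite Y" using Y insert finite_subset by blast
 show ?case
 proof (cases "algebraic_over S (R \<union> X) x")
  case True
  then obtain \<pi> D where \<pi>: "\<And>j. cf \<pi> j \<in> PF (R \<union> X)" "\<And>v. degree (\<pi> v) \<le> D"
   "\<And>v. v \<in> S \<Longrightarrow> poly (\<pi> v) (x v) = 0" "\<exists>v\<in>S. coeff (\<pi> v) D \<noteq> 0" "D > 0"
   by (rule algebraic_overE) (rule that)
  have a: "cf \<pi> D \<in> PF \<Omega>" by (rule PF_trans[OF \<pi>(1)]) (use insert.prems in auto)
  have "(\<lambda>v. q v * coeff (\<pi> v) D) \<in> PF \<Omega>" by (intro PF_intros q a)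
  moreover have "\<exists>v\<in>S. q v * coeff (\<pi> v) D \<noteq> 0"
   using irreducible_onD[OF irr q(1) a q(2) \<pi>(4)] by auto
  moreover have "growth W (R \<union> insert x X) (d + card Y)"
   if "W \<subseteq> S" "\<forall>v\<in>W. q v * coeff (\<pi> v) D \<noteq> 0" "growth W R d" for W d
  proof -
   have "growth W (insert x (R \<union> X)) (d + card Y)"
    by (rule growth_insert_algebraic_on[of _ _ _ \<pi> D]) (use that \<pi> gr in auto)
   then show ?thesis by simp
  qed
  ultimately have "\<exists>q\<in>PF \<Omega>. (\<exists>v\<in>S. q v \<noteq> 0) \<and> (\<forall>W d. W \<subseteq> S \<longrightarrow> (\<forall>v\<in>W. q v \<noteq> 0) \<longrightarrow>
    growth W R d \<longrightarrow> growth W (R \<union> insert x X) (d + card Y))"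
   by (intro bexI[of _ "\<lambda>v. q v * coeff (\<pi> v) D"] conjI allI impI)
  then show ?thesis using Y by (intro exI[of _ Y]) auto
 next
  case False
  have x: "x \<notin> Y" using Y insert by auto
  have "free_over S R (insert x Y)" using free_over_insert[OF Y(2,1) fin x False] .
  moreover have "growth W (R \<union> insert x X) (d + card (insert x Y))"
   if "W \<subseteq> S" "\<forall>v\<in>W. q v \<noteq> 0" "growth W R d" for W d
   using growth_insert[OF gr[OF that], of x] x fin by simp
  ultimately show ?thesis using Y q by (intro exI[of _ "insert x Y"]) blast
 qed
qed

text \<open>Adds to \<open>relative_basis\<close> the bound on the whole of \<open>S\<close>, by
  density of the points where \<open>q\<close> is nonzero.\<close>

lemma relative_basis_growth:
 assumes irr: "irreducible_on \<Omega> S" and "finite X" and sub: "R \<union> X \<subseteq> PF \<Omega>"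
 obtains Y q where "Y \<subseteq> X" "free_over S R Y" "q \<in> PF \<Omega>" "\<exists>v\<in>S. q v \<noteq> 0"
  "\<And>W d. W \<subseteq> S \<Longrightarrow> \<forall>v\<in>W. q v \<noteq> 0 \<Longrightarrow> growth W R d \<Longrightarrow> growth W (R \<union> X) (d + card Y)"
  "\<forall>d. growth S R d \<longrightarrow> growth S (R \<union> X) (d + card Y)"
proof -
 obtain Y q where Y: "Y \<subseteq> X" "free_over S R Y" and q: "q \<in> PF \<Omega>" "\<exists>v\<in>S. q v \<noteq> 0"
  and gr: "\<And>W d. W \<subseteq> S \<Longrightarrow> \<forall>v\<in>W. q v \<noteq> 0 \<Longrightarrow> growth W R d \<Longrightarrow> growth W (R \<union> X) (d + card Y)"
  using relative_basis[OF assms] by blast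
 have "growth S (R \<union> X) (d + card Y)" if "growth S R d" for d
  by (rule growth_dense[OF irr sub q], rule gr) (use growth_subset[OF that] in auto)
 then show ?thesis using that Y q gr by blast
qed

lemma free_over_empty_indep:
 assumes "free_over S {} Y" "S \<noteq> {}"
 shows "alg_indep S (\<lambda>y. y) Y"
 unfolding alg_indep_def lin_indep_def
proof (intro allI impI)
 fix D l
 assume "\<forall>v\<in>S. (\<Sum>e\<in>exponents Y D. l e * monomial Y (\<lambda>y. y) e v) = 0"
 then have "\<forall>e\<in>exponents Y D. \<forall>v\<in>S. l e = 0"
  using assms(1)[unfolded free_over_def, rule_format, of D "\<lambda>e _. l e"]
  by (auto intro: PF_const)
 then show "\<forall>e\<in>exponents Y D. l e = 0" using assms(2) by blast
qed

section \<open>A uniform bound for algebraic relations\<close>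

lemma lin_indep_monomials_subset:
 assumes "lin_indep S (exponents I D) (monomial I h)" "J \<subseteq> I" "finite I"
 shows "lin_indep S (exponents J D) (monomial J h)"
 unfolding lin_indep_def
proof (intro allI impI)
 fix l assume l: "\<forall>v\<in>S. (\<Sum>e\<in>exponents J D. l e * monomial J h e v) = 0"
 have sub: "exponents J D \<subseteq> exponents I D" using assms(2) by (rule exponents_mono)
 define m where "m e = (if e \<in> exponents J D then l e else 0)" for e
 have "monomial I h e v = monomial J h e v" if "e \<in> exponents J D" for e v
  unfolding monomial_def
  by (rule prod.mono_neutral_right) (use assms that in \<open>auto simp: exponents_def\<close>)
 then have "(\<Sum>e\<in>exponents I D. m e * monomial I h e v) = (\<Sum>e\<in>exponents J D. l e * monomial J h e v)" for v
  using assms(3) sub by (intro sum.mono_neutral_cong_right) (auto simp: m_def)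
 then have "\<forall>e\<in>exponents I D. m e = 0" using l assms(1) unfolding lin_indep_def by auto
 then have "m e = 0" if "e \<in> exponents J D" for e using sub that by blast
 then show "\<forall>e\<in>exponents J D. l e = 0" unfolding m_def by simp
qed

lemma alg_indep_subset: "alg_indep S h I \<Longrightarrow> J \<subseteq> I \<Longrightarrow> finite I \<Longrightarrow> alg_indep S h J"
 unfolding alg_indep_def using lin_indep_monomials_subset by blast

lemma alg_indep_empty: "S \<noteq> {} \<Longrightarrow> alg_indep S h {}"
 unfolding alg_indep_def lin_indep_def by (auto simp: monomial_def)

lemma maximal_alg_indep:
 assumes "finite I" "S \<noteq> {}"
 obtains J where "J \<subseteq> I" "alg_indep S h J" "\<And>i. i \<in> I - J \<Longrightarrow> algebraic_over S (h ` J) (h i)"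
proof -
 have "finite {J. J \<subseteq> I \<and> alg_indep S h J}" using assms(1) by simp
 moreover have "{} \<in> {J. J \<subseteq> I \<and> alg_indep S h J}" using alg_indep_empty[OF assms(2)] by simp
 ultimately have "\<exists>J\<in>{J. J \<subseteq> I \<and> alg_indep S h J}. {} \<subseteq> J \<and>
   (\<forall>K\<in>{J. J \<subseteq> I \<and> alg_indep S h J}. J \<subseteq> K \<longrightarrow> J = K)"
  by (rule finite_has_maximal2)
 then obtain J where J: "J \<subseteq> I" "alg_indep S h J"
  and max: "\<forall>K\<in>{J. J \<subseteq> I \<and> alg_indep S h J}. J \<subseteq> K \<longrightarrow> J = K"
  by blast
 have "algebraic_over S (h ` J) (h i)" if "i \<in> I - J" for i
  using alg_indep_insert[OF J(2) finite_subset[OF J(1) assms(1)], of i] bspec[OF max, of "insert i J"] J that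
  by auto
 then show ?thesis using that J by blast
qed

lemma transcendence_basis:
 fixes X :: "('v \<Rightarrow> 'k::field) set"
 assumes "irreducible_on X S" "finite X"
 obtains Y where "Y \<subseteq> X" "alg_indep S (\<lambda>y. y) Y" "growth S X (card Y)"
proof -
 have "{} \<union> X \<subseteq> PF X" by (auto intro: PF_coord)
 then obtain Y where Y: "Y \<subseteq> X" "free_over S {} Y"
  "\<forall>d. growth S ({} :: ('v \<Rightarrow> 'k) set) d \<longrightarrow> growth S ({} \<union> X) (d + card Y)"
  by (rule relative_basis_growth[OF assms]) (rule that)
 moreover have "growth S ({} :: ('v \<Rightarrow> 'k) set) 0" by (rule growth_constant) auto
 moreover have "S \<noteq> {}" using assms unfolding irreducible_on_def by blast
 ultimately show ?thesis
  using that[OF Y(1) free_over_empty_indep[OF Y(2)]] by (metis add_0 sup_bot_left)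
qed

text \<open>The point is that \<open>D\<close> depends on \<open>\<delta>\<close> but not on
  \<open>h\<close>. If \<open>h\<close> is dependent, some \<open>h i\<close> is algebraic over an
  independent part \<open>J\<close>, and a complement \<open>Y\<close> of these functions in
  \<open>X\<close> has at least \<open>d - card J\<close> members, where \<open>d\<close> is the
  dimension of \<open>S\<close>. Were the monomials with exponents up to \<open>D\<close>
  independent, those in \<open>insert i J\<close> times those in \<open>Y\<close> would give at
  least \<open>(D + 1) ^ (d + 1)\<close> independent functions of degree
  \<open>\<kappa> * D\<close>, more than the growth of \<open>S\<close> admits.\<close>

lemma uniform_relations:
 fixes X :: "('v \<Rightarrow> 'k::field) set" and I :: "'i set"
 assumes irr: "irreducible_on X S" and fin: "finite X" "finite I"
 shows "\<exists>D. \<forall>h. (\<forall>i\<in>I. poly_degree X \<delta> (h i)) \<longrightarrow> lin_indep S (exponents I D) (monomial I h) \<longrightarrow>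
  alg_indep S h I"
proof -
 obtain Z where Z: "Z \<subseteq> X" "alg_indep S (\<lambda>y. y) Z" "growth S X (card Z)"
  using transcendence_basis[OF irr fin(1)] .
 define d where "d = card Z"
 obtain c where c: "\<And>N (E :: (('i \<Rightarrow> nat) \<times> (('v \<Rightarrow> 'k) \<Rightarrow> nat)) set) u. finite E \<Longrightarrow>
  (\<And>e. e \<in> E \<Longrightarrow> poly_degree X N (u e)) \<Longrightarrow> lin_indep S E u \<Longrightarrow> card E \<le> c * (N + 1) ^ d"
  using growth_dependent[OF Z(3)] unfolding d_def by blast
 define \<kappa> where "\<kappa> = card I * \<delta> + card X"
 define D where "D = c * (\<kappa> + 1) ^ d"
 have D: "c * (\<kappa> * D + 1) ^ d < (D + 1) ^ Suc d" unfolding D_def by (rule power_outgrows)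
 have "alg_indep S h I"
  if deg: "\<forall>i\<in>I. poly_degree X \<delta> (h i)" and li: "lin_indep S (exponents I D) (monomial I h)" for h
 proof (rule ccontr)
  assume dep: "\<not> alg_indep S h I"
  have "S \<noteq> {}" using irr unfolding irreducible_on_def by blast
  then obtain J where J: "J \<subseteq> I" "alg_indep S h J"
   and max: "\<And>i. i \<in> I - J \<Longrightarrow> algebraic_over S (h ` J) (h i)"
   by (rule maximal_alg_indep[OF fin(2)]) (rule that)
  then have "J \<noteq> I" using dep by auto
  then obtain i where i: "i \<in> I - J" using J(1) by blast
  have finJ: "finite J" using J fin finite_subset by blast
  define R where "R = h ` insert i J"
  have hX: "h l \<in> PF X" if "l \<in> I" for l using deg that poly_degree_PF by blast
  have RX: "R \<subseteq> PF X" unfolding R_def using hX J i by auto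
  \<comment> \<open>The source of the contradiction: \<open>h i\<close> adds nothing to the
    dimension, but it adds a factor \<open>D + 1\<close> to the count of monomials below.\<close>
  have "growth S R (card J)"
   unfolding R_def image_insert
   by (rule growth_insert_algebraic[OF irr _ _ max[OF i] growth_base[OF finJ]]) (use hX J i in auto)
  moreover have "R \<union> X \<subseteq> PF X" using RX PF_coord by blast
  then obtain Y where Y: "Y \<subseteq> X" "free_over S R Y"
   "\<forall>e. growth S R e \<longrightarrow> growth S (R \<union> X) (e + card Y)"
   by (rule relative_basis_growth[OF irr fin(1)]) (rule that)
  ultimately have "growth S (R \<union> X) (card J + card Y)" by blast
  then have gX: "growth S X (card J + card Y)" by (rule growth_subset) auto
  have "finite Z" using Z(1) fin(1) by (rule finite_subset)
  then have "d \<le> card J + card Y" unfolding d_def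
   by (intro alg_indep_growth[OF Z(2) _ _ gX]) (use Z in \<open>auto intro: PF_coord\<close>)
  have finY: "finite Y" using Y fin finite_subset by blast
  define E where "E = exponents (insert i J) D \<times> exponents Y D"
  have cardE: "card E = (D + 1) ^ (Suc (card J) + card Y)"
   unfolding E_def using i finJ finY by (simp add: card_cartesian_product card_exponents power_add algebra_simps)
  have IJ: "insert i J \<subseteq> I" using J i by auto
  have "poly_degree X (\<kappa> * D) ((\<lambda>(\<mu>, \<nu>) v. monomial (insert i J) h \<mu> v * monomial Y (\<lambda>y. y) \<nu> v) e)"
   if "e \<in> E" for e
  proof -
   obtain \<mu> \<nu> where e: "e = (\<mu>, \<nu>)" "\<mu> \<in> exponents (insert i J) D" "\<nu> \<in> exponents Y D"
    using \<open>e \<in> E\<close> unfolding E_def by auto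
   have "poly_degree X (card (insert i J) * \<delta> * D + card Y * 1 * D)
     (\<lambda>v. monomial (insert i J) h \<mu> v * monomial Y (\<lambda>y. y) \<nu> v)"
    using e finJ finY deg IJ Y(1)
    by (intro poly_degree.mult monomial_poly_degree) (auto intro: poly_degree.coord[of _ _ 0, simplified])
   moreover have "card (insert i J) * \<delta> * D + card Y * 1 * D \<le> \<kappa> * D"
    using card_mono[OF fin(2) IJ] card_mono[OF fin(1) Y(1)] unfolding \<kappa>_def distrib_right
    by (intro add_mono mult_right_mono) auto
   ultimately show ?thesis unfolding e(1) prod.case by (rule poly_degree_le)
  qed
  moreover have "lin_indep S E (\<lambda>(\<mu>, \<nu>) v. monomial (insert i J) h \<mu> v * monomial Y (\<lambda>y. y) \<nu> v)"
   unfolding E_def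
   by (rule lin_indep_monomials_free[OF lin_indep_monomials_subset[OF li IJ fin(2)]])
    (use Y(2) in \<open>simp add: R_def\<close>)
  moreover have "finite E" unfolding E_def using finJ finY by auto
  ultimately have "card E \<le> c * (\<kappa> * D + 1) ^ d" by (intro c)
  moreover have "(D + 1) ^ Suc d \<le> card E"
   unfolding cardE using \<open>d \<le> card J + card Y\<close> by (intro power_increasing) auto
  ultimately show False using D by simp
 qed
 then show ?thesis by blast
qed

section \<open>Points of affine sets\<close>

lemma infinite_alg_closed_field: "infinite (UNIV :: 'k::alg_closed_field set)"
proof
 assume fin: "finite (UNIV :: 'k set)"
 define p :: "'k poly" where "p = (\<Prod>a\<in>UNIV. [:- a, 1:])"
 have "degree p = card (UNIV :: 'k set)" unfolding p_def by (subst degree_prod_eq_sum_degree) auto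
 then have deg: "degree p > 0" using fin by (simp add: finite_UNIV_card_ge_0)
 then have "degree (p + 1) = degree p" by (intro degree_add_eq_left) auto
 then obtain x where "poly (p + 1) x = 0"
  using deg alg_closed_imp_poly_has_root[of "p + 1"] by auto
 moreover have "poly p x = 0"
  unfolding p_def poly_prod using fin by (intro prod_zero) auto
 ultimately show False by simp
qed

lemma exists_nonroot:
 assumes "(p :: 'k::alg_closed_field poly) \<noteq> 0"
 obtains a where "poly p a \<noteq> 0"
 using poly_roots_finite[OF assms] infinite_alg_closed_field
 by (metis (mono_tags, lifting) Collect_cong UNIV_I finite_subset mem_Collect_eq subsetI)

text \<open>\<open>PF (coords I)\<close> plays the role of the polynomial ring with variables
  indexed by \<open>I\<close>; over an infinite field its functions and polynomials are the
  same.\<close>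

definition coords :: "'i set \<Rightarrow> (('i \<Rightarrow> 'k) \<Rightarrow> 'k) set" where
 "coords I = (\<lambda>i p. p i) ` I"

lemma coords_insert: "coords (insert i I) = insert (\<lambda>p. p i) (coords I)"
 unfolding coords_def by simp

lemma PF_coords_cong: "P \<in> PF (coords I) \<Longrightarrow> (\<And>i. i \<in> I \<Longrightarrow> p i = p' i) \<Longrightarrow> P p = P p'"
 by (rule PF_eq[of P "coords I"]) (auto simp: coords_def)

lemma PF_coords_comp:
 "P \<in> PF (coords I) \<Longrightarrow> (\<And>i. i \<in> I \<Longrightarrow> h i \<in> PF X) \<Longrightarrow> (\<lambda>v. P (\<lambda>i. h i v)) \<in> PF X"
 by (rule PF_comp[where h = "\<lambda>v i. h i v"]) (auto simp: coords_def)

lemma PF_lift: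
 assumes "f \<in> PF (h ` I)"
 obtains F where "F \<in> PF (coords I)" "\<And>v. F (\<lambda>i. h i v) = f v"
proof -
 have "\<exists>F\<in>PF (coords I). \<forall>v. F (\<lambda>i. h i v) = f v"
  using assms
 proof (induction rule: polynomial_functions.induct)
  case (const c)
  show ?case by (intro bexI[of _ "\<lambda>_. c"]) (auto intro: PF_const)
 next
  case (coord f)
  then obtain i where "i \<in> I" "f = h i" by auto
  then show ?case
   by (intro bexI[of _ "\<lambda>p. p i"]) (auto simp: coords_def intro: PF_coord)
 next
  case (add f g)
  then obtain F G where "F \<in> PF (coords I)" "\<forall>v. F (\<lambda>i. h i v) = f v"
   "G \<in> PF (coords I)" "\<forall>v. G (\<lambda>i. h i v) = g v" by auto
  then show ?case by (intro bexI[of _ "\<lambda>p. F p + G p"]) (auto intro: PF_intros)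
 next
  case (mult f g)
  then obtain F G where "F \<in> PF (coords I)" "\<forall>v. F (\<lambda>i. h i v) = f v"
   "G \<in> PF (coords I)" "\<forall>v. G (\<lambda>i. h i v) = g v" by auto
  then show ?case by (intro bexI[of _ "\<lambda>p. F p * G p"]) (auto intro: PF_intros)
 qed
 then show ?thesis using that by blast
qed

lemma PF_monomial_expansion:
 fixes h :: "'i \<Rightarrow> 'v \<Rightarrow> 'k::field"
 assumes "finite I" "f \<in> PF (h ` I)"
 shows "\<exists>D l. \<forall>v. f v = (\<Sum>e\<in>exponents I D. l e * monomial I h e v)"
 using assms
proof (induction I arbitrary: f rule: finite_induct)
 case empty
 have "f v = f w" for v w by (rule PF_eq[OF empty]) auto
 then show ?case
  by (intro exI[of _ 0] exI[of _ "\<lambda>_. f undefined"]) (auto simp: monomial_def)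
next
 case (insert i I)
 obtain \<pi> D where \<pi>: "\<And>v. degree (\<pi> v) \<le> D" "\<And>j. cf \<pi> j \<in> PF (h ` I)"
  "\<And>v. f v = poly (\<pi> v) (h i v)" using PF_insert[of f "h i" "h ` I"] insert.prems by auto
 have "\<forall>j. \<exists>D l. \<forall>v. coeff (\<pi> v) j = (\<Sum>e\<in>exponents I D. l e * monomial I h e v)"
  using insert.IH[OF \<pi>(2)] by blast
 then obtain B l where l: "\<And>j v. coeff (\<pi> v) j = (\<Sum>e\<in>exponents I (B j). l j e * monomial I h e v)"
  by metis
 define K where "K = D + (\<Sum>j\<le>D. B j)"
 have KB: "B j \<le> K" if "j \<le> D" for j
  unfolding K_def using that by (intro trans_le_add2 member_le_sum) auto
 define m where "m e = (if e i \<le> D \<and> e(i := 0) \<in> exponents I (B (e i)) then l (e i) (e(i := 0)) else 0)" for e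
 have e0: "e(i := 0) = e" if "e \<in> exponents I K" for e
  using that insert.hyps unfolding exponents_def by (auto simp: fun_eq_iff)
 have "f v = (\<Sum>e\<in>exponents (insert i I) K. m e * monomial (insert i I) h e v)" for v
 proof -
  have "(\<Sum>e\<in>exponents (insert i I) K. m e * monomial (insert i I) h e v)
   = (\<Sum>j\<le>K. \<Sum>e\<in>exponents I K. m (e(i := j)) * (monomial I h e v * h i v ^ j))"
   unfolding sum_exponents_insert[OF insert.hyps(2)]
   by (subst sum.swap) (simp add: monomial_insert[OF insert.hyps(2,1), of _ K])
  also have "\<dots> = (\<Sum>j\<le>D. \<Sum>e\<in>exponents I K. m (e(i := j)) * (monomial I h e v * h i v ^ j))"
   by (rule sum.mono_neutral_right) (auto simp: K_def m_def)
  also have "\<dots> = (\<Sum>j\<le>D. \<Sum>e\<in>exponents I (B j). l j e * (monomial I h e v * h i v ^ j))"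
  proof (rule sum.cong[OF refl])
   fix j assume j: "j \<in> {..D}"
   then have sub: "exponents I (B j) \<subseteq> exponents I K"
    using KB[of j] unfolding exponents_def by (auto intro: order_trans)
   show "(\<Sum>e\<in>exponents I K. m (e(i := j)) * (monomial I h e v * h i v ^ j))
    = (\<Sum>e\<in>exponents I (B j). l j e * (monomial I h e v * h i v ^ j))"
    by (rule sum.mono_neutral_cong_right)
     (use sub insert.hyps(1) j e0 in \<open>auto simp: m_def\<close>)
  qed
  also have "\<dots> = f v"
   unfolding \<pi>(3) poly_of_coeffs[OF \<pi>(1)] l by (simp add: sum_distrib_right mult.assoc)
  finally show ?thesis by simp
 qed
 then show ?case by blast
qed

text \<open>The coefficients of an equation for coordinate \<open>i\<close> do not change while that
  coordinate runs through the field, so a nonzero specialization would have every element as a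
  root.\<close>

lemma alg_indep_coords:
 assumes "finite I"
 shows "alg_indep UNIV (\<lambda>i (p :: 'i \<Rightarrow> 'k::alg_closed_field). p i) I"
 using assms
proof (induction I rule: finite_induct)
 case empty
 show ?case by (rule alg_indep_empty) auto
next
 case (insert i I)
 have "\<not> algebraic_over UNIV ((\<lambda>i p. p i) ` I) (\<lambda>p :: 'i \<Rightarrow> 'k. p i)"
 proof
  assume "algebraic_over UNIV ((\<lambda>i p. p i) ` I) (\<lambda>p :: 'i \<Rightarrow> 'k. p i)"
  then have "algebraic_over UNIV (coords I) (\<lambda>p :: 'i \<Rightarrow> 'k. p i)" unfolding coords_def .
  then obtain \<pi> :: "('i \<Rightarrow> 'k) \<Rightarrow> 'k poly" and D
   where \<pi>: "\<forall>j. cf \<pi> j \<in> PF (coords I)" "\<forall>v. degree (\<pi> v) \<le> D"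
   "\<forall>v\<in>UNIV. poly (\<pi> v) (v i) = 0" "\<exists>p\<in>UNIV. \<pi> p \<noteq> 0"
   unfolding algebraic_over_def by blast
  then obtain p where p: "\<pi> p \<noteq> 0" by blast
  have "\<pi> (p(i := a)) = \<pi> p" for a
   by (intro poly_eqI PF_coords_cong[OF \<pi>(1)[rule_format]]) (use insert.hyps in auto)
  then have "poly (\<pi> p) a = 0" for a using \<pi>(3)[rule_format, of "p(i := a)"] by simp
  then show False using exists_nonroot[OF p] by blast
 qed
 then show ?case by (intro alg_indep_insert insert.IH insert.hyps)
qed

text \<open>Trades monomials and exponents for polynomial relations, the form in which images and
  slices are handled.\<close>

lemma alg_indep_iff:
 fixes h :: "'i \<Rightarrow> 'v \<Rightarrow> 'k::alg_closed_field"
 assumes "finite I"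
 shows "alg_indep S h I \<longleftrightarrow> (\<forall>P\<in>PF (coords I). (\<forall>v\<in>S. P (\<lambda>i. h i v) = 0) \<longrightarrow> (\<forall>p. P p = 0))"
proof
 assume ind: "alg_indep S h I"
 show "\<forall>P\<in>PF (coords I). (\<forall>v\<in>S. P (\<lambda>i. h i v) = 0) \<longrightarrow> (\<forall>p. P p = 0)"
 proof (intro ballI impI)
  fix P :: "('i \<Rightarrow> 'k) \<Rightarrow> 'k"
  assume "P \<in> PF (coords I)" and 0: "\<forall>v\<in>S. P (\<lambda>i. h i v) = 0"
  then obtain D l where l: "\<And>p. P p = (\<Sum>e\<in>exponents I D. l e * monomial I (\<lambda>i p. p i) e p)"
   using PF_monomial_expansion[OF assms, of P "\<lambda>i p. p i"] unfolding coords_def by blast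
  then have "\<forall>v\<in>S. (\<Sum>e\<in>exponents I D. l e * monomial I h e v) = 0"
   using 0 by (simp add: monomial_def)
  then have "\<forall>e\<in>exponents I D. l e = 0" using ind unfolding alg_indep_def lin_indep_def by blast
  then show "\<forall>p. P p = 0" by (simp add: l)
 qed
next
 assume R: "\<forall>P\<in>PF (coords I). (\<forall>v\<in>S. P (\<lambda>i. h i v) = 0) \<longrightarrow> (\<forall>p. P p = 0)"
 show "alg_indep S h I"
  unfolding alg_indep_def lin_indep_def
 proof (intro allI impI)
  fix D l assume l: "\<forall>v\<in>S. (\<Sum>e\<in>exponents I D. l e * monomial I h e v) = 0"
  define P where "P p = (\<Sum>e\<in>exponents I D. l e * monomial I (\<lambda>i p. p i) e p)" for p
  have "P \<in> PF (coords I)"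
   unfolding P_def[abs_def] coords_def
   by (intro PF_intros PF_monomial) (auto intro: PF_coord)
  moreover have "\<forall>v\<in>S. P (\<lambda>i. h i v) = 0" using l unfolding P_def by (simp add: monomial_def)
  ultimately have "\<forall>p. P p = 0" using R by blast
  then show "\<forall>e\<in>exponents I D. l e = 0"
   using alg_indep_coords[OF assms] unfolding alg_indep_def lin_indep_def P_def by blast
 qed
qed

lemma alg_indepD:
 fixes h :: "'i \<Rightarrow> 'v \<Rightarrow> 'k::alg_closed_field"
 assumes "alg_indep S h I" "finite I" "P \<in> PF (coords I)" "\<And>v. v \<in> S \<Longrightarrow> P (\<lambda>i. h i v) = 0"
 shows "P p = 0"
 using assms(1)[unfolded alg_indep_iff[OF assms(2)], THEN bspec, OF assms(3)] assms(4) by simp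

lemma irreducible_on_coords:
 assumes "finite I"
 shows "irreducible_on (coords I :: (('i \<Rightarrow> 'k::alg_closed_field) \<Rightarrow> 'k) set) UNIV"
proof -
 have "\<exists>p. f p \<noteq> 0 \<and> g p \<noteq> 0" if "f \<in> PF (coords I)" "g \<in> PF (coords I)" "\<exists>p. f p \<noteq> 0" "\<exists>p. g p \<noteq> 0"
  for f g :: "('i \<Rightarrow> 'k) \<Rightarrow> 'k"
  using assms that
 proof (induction I arbitrary: f g rule: finite_induct)
  case empty
  then show ?case using PF_coords_cong[of f "{}"] PF_coords_cong[of g "{}"] by (metis empty_iff)
 next
  case (insert i I)
  obtain \<pi> \<rho> where \<pi>: "\<And>j. cf \<pi> j \<in> PF (coords I)" "\<And>v. f v = poly (\<pi> v) (v i)"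
   and \<rho>: "\<And>j. cf \<rho> j \<in> PF (coords I)" "\<And>v. g v = poly (\<rho> v) (v i)"
   using PF_insert[of f "\<lambda>p. p i" "coords I"] PF_insert[of g "\<lambda>p. p i" "coords I"] insert.prems(1,2)
   unfolding coords_insert by metis
  obtain p q where "f p \<noteq> 0" "g q \<noteq> 0" using insert.prems by blast
  then have "\<pi> p \<noteq> 0" "\<rho> q \<noteq> 0" using \<pi>(2) \<rho>(2) by auto
  then obtain j m where "coeff (\<pi> p) j \<noteq> 0" "coeff (\<rho> q) m \<noteq> 0" by (meson leading_coeff_0_iff)
  then obtain r where r: "coeff (\<pi> r) j \<noteq> 0" "coeff (\<rho> r) m \<noteq> 0"
   using insert.IH[OF \<pi>(1)[of j] \<rho>(1)[of m]] by blast
  then have "\<pi> r * \<rho> r \<noteq> 0" by auto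
  then obtain a where a: "poly (\<pi> r * \<rho> r) a \<noteq> 0" by (rule exists_nonroot)
  have "\<pi> (r(i := a)) = \<pi> r" "\<rho> (r(i := a)) = \<rho> r"
   using insert.hyps by (auto intro!: poly_eqI PF_coords_cong[OF \<pi>(1)] PF_coords_cong[OF \<rho>(1)])
  then have "f (r(i := a)) \<noteq> 0" "g (r(i := a)) \<noteq> 0" using a unfolding \<pi>(2) \<rho>(2) by auto
  then show ?case by blast
 qed
 then show ?thesis unfolding irreducible_on_def by (metis UNIV_I UNIV_not_empty mult_eq_0_iff)
qed

text \<open>
 A point is consistent if it satisfies all polynomial relations between the coordinates in \<open>I\<close>
 that hold on \<open>T\<close>; it need not lie in \<open>T\<close>, and its other coordinates are arbitrary.
\<close>

definition consistent :: "('i \<Rightarrow> 'k::comm_ring_1) set \<Rightarrow> 'i set \<Rightarrow> ('i \<Rightarrow> 'k) \<Rightarrow> bool" where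
 "consistent T I p \<longleftrightarrow> (\<forall>P\<in>PF (coords I). (\<forall>v\<in>T. P v = 0) \<longrightarrow> P p = 0)"

lemma consistentD: "consistent T I p \<Longrightarrow> P \<in> PF (coords I) \<Longrightarrow> (\<And>v. v \<in> T \<Longrightarrow> P v = 0) \<Longrightarrow> P p = 0"
 unfolding consistent_def by simp

text \<open>Each step multiplies by the leading coefficient and subtracts a multiple of
  \<open>\<pi>\<close>. Quotient, remainder and exponent are chosen uniformly in \<open>v\<close>,
  so the identity can be specialized at points that lie outside the set of interest.\<close>

lemma pseudo_division:
 fixes \<pi> \<sigma> :: "'v \<Rightarrow> 'k::field poly"
 assumes \<pi>: "\<And>j. cf \<pi> j \<in> PF F" "\<And>v. degree (\<pi> v) \<le> D" and "D > 0"
  and \<sigma>: "\<And>j. cf \<sigma> j \<in> PF F" "\<And>v. degree (\<sigma> v) \<le> n"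
 shows "\<exists>k \<tau> r. (\<forall>j. cf \<tau> j \<in> PF F) \<and> (\<forall>j. cf r j \<in> PF F) \<and>
  (\<forall>v. degree (r v) < D) \<and> (\<forall>v. degree (\<tau> v) \<le> n - D) \<and>
  (\<forall>v. smult (coeff (\<pi> v) D ^ k) (\<sigma> v) = \<tau> v * \<pi> v + r v)"
 using \<sigma>
proof (induction n arbitrary: \<sigma>)
 case 0
 have "degree (\<sigma> v) < D" for v using 0(2)[of v] assms(3) by simp
 then show ?case
  using 0 by (intro exI[of _ 0] exI[of _ "\<lambda>_. 0"] exI[of _ \<sigma>]) (auto intro: PF_intros)
next
 case (Suc n)
 show ?case
 proof (cases "D \<le> Suc n")
  case False
  have "degree (\<sigma> v) < D" for v using Suc.prems(2)[of v] False by simp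
  then show ?thesis
   using Suc.prems by (intro exI[of _ 0] exI[of _ "\<lambda>_. 0"] exI[of _ \<sigma>]) (auto intro: PF_intros)
 next
  case True
  define a where "a v = coeff (\<pi> v) D" for v
  define \<mu> where "\<mu> v = monom (coeff (\<sigma> v) (Suc n)) (Suc n - D)" for v
  define \<sigma>' where "\<sigma>' v = smult (a v) (\<sigma> v) - \<mu> v * \<pi> v" for v
  have coeff\<mu>: "coeff (\<mu> v * \<pi> v) j
    = (if j < Suc n - D then 0 else coeff (\<sigma> v) (Suc n) * coeff (\<pi> v) (j - (Suc n - D)))" for v j
   unfolding \<mu>_def by (simp add: coeff_monom_mult)
  have "coeff (\<sigma>' v) (Suc n) = 0" for v
   unfolding \<sigma>'_def a_def using True by (simp add: coeff\<mu>)
  moreover have "degree (\<sigma>' v) \<le> Suc n" for v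
  proof (rule degree_le, intro allI impI)
   fix j assume j: "Suc n < j"
   then have "coeff (\<sigma> v) j = 0" "coeff (\<pi> v) (j - (Suc n - D)) = 0"
    using Suc.prems(2)[of v] \<pi>(2)[of v] True by (auto intro!: coeff_eq_0)
   then show "coeff (\<sigma>' v) j = 0" unfolding \<sigma>'_def by (simp add: coeff\<mu>)
  qed
  ultimately have "degree (\<sigma>' v) \<le> n" for v
   by (metis degree_0 eq_zero_or_degree_less le_zero_eq less_Suc_eq_le zero_le)
  moreover have "cf \<sigma>' j \<in> PF F" for j
   unfolding \<sigma>'_def a_def coeff_diff coeff_smult coeff\<mu> by (intro PF_intros \<pi> Suc.prems)
  ultimately obtain k \<tau> r where \<tau>: "\<And>j. cf \<tau> j \<in> PF F" "\<And>v. degree (\<tau> v) \<le> n - D"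
   and r: "\<And>j. cf r j \<in> PF F" "\<And>v. degree (r v) < D"
   and eq: "\<And>v. smult (a v ^ k) (\<sigma>' v) = \<tau> v * \<pi> v + r v"
   using Suc.IH[of \<sigma>'] unfolding a_def by blast
  define \<tau>' where "\<tau>' v = \<tau> v + smult (a v ^ k) (\<mu> v)" for v
  have "smult (a v ^ Suc k) (\<sigma> v) = \<tau>' v * \<pi> v + r v" for v
  proof -
   have "smult (a v ^ Suc k) (\<sigma> v) = smult (a v ^ k) (\<sigma>' v) + smult (a v ^ k) (\<mu> v * \<pi> v)"
    unfolding \<sigma>'_def by (simp add: smult_diff_right mult.commute)
   then show ?thesis unfolding eq \<tau>'_def by (simp add: algebra_simps)
  qed
  moreover have "cf \<tau>' j \<in> PF F" for j
   unfolding \<tau>'_def a_def \<mu>_def coeff_add coeff_smult coeff_monom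
   by (intro PF_intros \<tau> \<pi> Suc.prems)
  moreover have "degree (\<tau>' v) \<le> Suc n - D" for v
   unfolding \<tau>'_def \<mu>_def using \<tau>(2)[of v]
   by (intro degree_add_le order.trans[OF degree_smult_le] degree_monom_le) auto
  ultimately show ?thesis using r unfolding a_def by blast
 qed
qed

text \<open>
 The step of Chevalley's theorem that adds one coordinate \<open>j\<close>: away from the zeros of a suitable
 \<open>q\<close>, consistent points extend, even to points at which a given \<open>g\<close> does not vanish.
\<close>

lemma consistent_extend:
 fixes T :: "('i \<Rightarrow> 'k::alg_closed_field) set"
 assumes irr: "irreducible_on (coords (insert j J)) T" and "j \<notin> J"
  and g: "g \<in> PF (coords (insert j J))" "\<exists>v\<in>T. g v \<noteq> 0"
 shows "\<exists>q\<in>PF (coords J). (\<exists>v\<in>T. q v \<noteq> 0) \<and>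
  (\<forall>p. consistent T J p \<longrightarrow> q p \<noteq> 0 \<longrightarrow> (\<exists>a. consistent T (insert j J) (p(j := a)) \<and> g (p(j := a)) \<noteq> 0))"
proof -
 have upd: "\<pi> (p(j := a)) = \<pi> p" if "\<And>i. cf \<pi> i \<in> PF (coords J)" for \<pi> p and a :: 'k
  by (intro poly_eqI PF_coords_cong[OF that]) (use \<open>j \<notin> J\<close> in auto)
 have zeroT: "\<pi> p = 0" if "\<And>i. cf \<pi> i \<in> PF (coords J)" "\<forall>v\<in>T. \<pi> v = 0" "consistent T J p"
  for \<pi> p
 proof (rule poly_eqI)
  fix i
  have "\<forall>v\<in>T. coeff (\<pi> v) i = 0" using that(2) by simp
  then show "coeff (\<pi> p) i = coeff 0 i"
   using bspec[OF that(3)[unfolded consistent_def] that(1)[of i]] by simp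
 qed
 have J: "PF (coords J) \<subseteq> PF (coords (insert j J))"
  unfolding coords_insert using PF_mono by blast
 have pj: "(\<lambda>p. p j) \<in> PF (coords (insert j J))"
  unfolding coords_insert by (auto intro: PF_coord)
 obtain \<rho> n where \<rho>: "\<And>v. degree (\<rho> v) \<le> n" "\<And>i. cf \<rho> i \<in> PF (coords J)"
  "\<And>v. g v = poly (\<rho> v) (v j)" using PF_insert[of g "\<lambda>p. p j" "coords J"] g(1) unfolding coords_insert by blast
 have evalPF: "(\<lambda>v. poly (\<sigma> v) (v j)) \<in> PF (coords (insert j J))"
  if "\<And>i. cf \<sigma> i \<in> PF (coords J)" "\<And>v. degree (\<sigma> v) \<le> m" for \<sigma> m
  by (rule PF_poly[of _ _ m]) (use that J pj in auto)
 show ?thesis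
 proof (cases "algebraic_over T (coords J) (\<lambda>p. p j)")
  case False
  obtain v where v: "v \<in> T" "g v \<noteq> 0" using g by blast
  then obtain m where m: "coeff (\<rho> v) m \<noteq> 0" using \<rho>(3) by (metis leading_coeff_0_iff poly_0)
  \<comment> \<open>Coordinate \<open>j\<close> is free over \<open>J\<close>: every coefficient of
    a relation vanishes on \<open>T\<close>, hence at \<open>p\<close>, so any \<open>a\<close> that
    is not a root of \<open>\<rho> p\<close> will do.\<close>
  have "\<exists>a. consistent T (insert j J) (p(j := a)) \<and> g (p(j := a)) \<noteq> 0"
   if p: "consistent T J p" "coeff (\<rho> p) m \<noteq> 0" for p
  proof -
   obtain a where a: "poly (\<rho> p) a \<noteq> 0" using p(2) exists_nonroot by (metis coeff_0)
   have "P (p(j := a)) = 0" if P: "P \<in> PF (coords (insert j J))" "\<forall>v\<in>T. P v = 0" for P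
   proof -
    obtain \<pi> D where \<pi>: "\<And>v. degree (\<pi> v) \<le> D" "\<And>i. cf \<pi> i \<in> PF (coords J)"
     "\<And>v. P v = poly (\<pi> v) (v j)" using PF_insert[of P "\<lambda>p. p j" "coords J"] P(1) unfolding coords_insert by blast
    have "\<forall>v\<in>T. \<pi> v = 0" using False \<pi> P(2) unfolding algebraic_over_def by metis
    then have "\<pi> p = 0" using zeroT \<pi>(2) p(1) by blast
    then show ?thesis unfolding \<pi>(3) upd[OF \<pi>(2)] by simp
   qed
   then have "consistent T (insert j J) (p(j := a))" unfolding consistent_def by blast
   moreover have "g (p(j := a)) \<noteq> 0" unfolding \<rho>(3) upd[OF \<rho>(2)] using a by simp
   ultimately show ?thesis by blast
  qed
  then show ?thesis using \<rho>(2) v m by (intro bexI[of _ "\<lambda>v. coeff (\<rho> v) m"]) auto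
 next
  case True
  \<comment> \<open>An equation for coordinate \<open>j\<close> of least degree replaces the minimal
    polynomial: the remainder of any relation modulo it vanishes on \<open>T\<close>.\<close>
  define ann where "ann D \<pi> \<longleftrightarrow> (\<forall>i. cf \<pi> i \<in> PF (coords J)) \<and> (\<forall>v. degree (\<pi> v) \<le> D) \<and>
   (\<forall>v\<in>T. poly (\<pi> v) (v j) = 0) \<and> (\<exists>v\<in>T. coeff (\<pi> v) D \<noteq> 0)" for D \<pi>
  have "\<exists>D. Ex (ann D)"
   using True by (elim algebraic_overE) (use ann_def in blast)
  then obtain D where "Ex (ann D)" and minD: "\<And>D'. D' < D \<Longrightarrow> \<not> Ex (ann D')"
   using exists_least_iff[of "\<lambda>D. Ex (ann D)"] by blast
  then obtain \<pi> where "ann D \<pi>" by blast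
  then have \<pi>: "\<And>i. cf \<pi> i \<in> PF (coords J)" "\<And>v. degree (\<pi> v) \<le> D"
   "\<And>v. v \<in> T \<Longrightarrow> poly (\<pi> v) (v j) = 0" "\<exists>v\<in>T. coeff (\<pi> v) D \<noteq> 0" unfolding ann_def by auto
  have D0: "D > 0"
  proof (rule ccontr)
   assume "\<not> D > 0"
   then have "poly (\<pi> v) x = coeff (\<pi> v) D" for v x
    using \<pi>(2)[of v] by (simp add: poly_altdef)
   then show False using \<pi>(3,4) by auto
  qed
  have min: "\<forall>v\<in>T. \<sigma> v = 0"
   if \<sigma>: "\<And>i. cf \<sigma> i \<in> PF (coords J)" "\<And>v. v \<in> T \<Longrightarrow> degree (\<sigma> v) < D"
    "\<And>v. v \<in> T \<Longrightarrow> poly (\<sigma> v) (v j) = 0" for \<sigma>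
  proof (rule ccontr)
   assume "\<not> ?thesis"
   then have nz: "\<exists>v\<in>T. \<sigma> v \<noteq> 0" by blast
   have dg: "degree (\<sigma> v) \<le> D - 1" if "v \<in> T" for v using \<sigma>(2)[OF that] by simp
   obtain \<rho> E where "\<And>i. cf \<rho> i \<in> PF (coords J)" "\<And>v. degree (\<rho> v) \<le> E" "E \<le> D - 1"
    "\<And>v. v \<in> T \<Longrightarrow> \<rho> v = \<sigma> v" "\<exists>v\<in>T. coeff (\<rho> v) E \<noteq> 0"
    by (rule truncate_to_leading_coeff[of \<sigma> "coords J" T "D - 1"]) (use \<sigma>(1) nz dg in \<open>blast intro: that\<close>)+
   then have "ann E \<rho>" "E < D" using \<sigma>(3) D0 unfolding ann_def by auto
   then show False using minD by blast
  qed
  \<comment> \<open>Multiples of \<open>g\<close> on \<open>T\<close>, written as polynomials in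
    coordinate \<open>j\<close>. One of least degree \<open>l\<close> turns out to be constant in
    \<open>j\<close>, which yields a nonzero function \<open>c\<close> of the coordinates in
    \<open>J\<close> that \<open>g\<close> divides on \<open>T\<close>; it serves as a norm of
    \<open>g\<close>.\<close>
  define mul where "mul l \<sigma> \<longleftrightarrow> (\<forall>i. cf \<sigma> i \<in> PF (coords J)) \<and> (\<forall>v. degree (\<sigma> v) \<le> l) \<and>
   (\<exists>u\<in>PF (coords (insert j J)). \<forall>v\<in>T. poly (\<sigma> v) (v j) = u v * g v) \<and>
   (\<exists>v\<in>T. coeff (\<sigma> v) l \<noteq> 0)" for l \<sigma>
  have mulI: "\<exists>E<m. Ex (mul E)"
   if \<sigma>: "\<And>i. cf \<sigma> i \<in> PF (coords J)" "\<And>v. degree (\<sigma> v) < m"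
    "u \<in> PF (coords (insert j J))" "\<And>v. v \<in> T \<Longrightarrow> poly (\<sigma> v) (v j) = u v * g v"
    and nz: "\<exists>v\<in>T. \<sigma> v \<noteq> 0" for \<sigma> m u
  proof -
   have dg: "degree (\<sigma> v) \<le> m - 1" for v using \<sigma>(2)[of v] by simp
   obtain \<rho> E where "\<And>i. cf \<rho> i \<in> PF (coords J)" "\<And>v. degree (\<rho> v) \<le> E" "E \<le> m - 1"
    "\<And>v. v \<in> T \<Longrightarrow> \<rho> v = \<sigma> v" "\<exists>v\<in>T. coeff (\<rho> v) E \<noteq> 0"
    by (rule truncate_to_leading_coeff[of \<sigma> "coords J" T "m - 1"]) (use \<sigma>(1) nz dg in \<open>blast intro: that\<close>)+
   moreover have "m > 0" using \<sigma>(2) by (metis less_nat_zero_code neq0_conv)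
   ultimately have "mul E \<rho>" "E < m" using \<sigma>(3,4) unfolding mul_def by auto
   then show ?thesis by blast
  qed
  \<comment> \<open>The remainder of \<open>g\<close> modulo \<open>\<pi>\<close> is a multiple of
    \<open>g\<close> of degree below \<open>D\<close>, nonzero where \<open>g\<close> and the
    leading coefficient of \<open>\<pi>\<close> are.\<close>
  obtain k \<tau> r where r: "\<And>i. cf r i \<in> PF (coords J)" "\<And>v. degree (r v) < D"
   and eq: "\<And>v. smult (coeff (\<pi> v) D ^ k) (\<rho> v) = \<tau> v * \<pi> v + r v"
   using pseudo_division[OF \<pi>(1,2) D0 \<rho>(2,1)] by blast
  have aPF: "cf \<pi> D \<in> PF (coords (insert j J))" using \<pi>(1) J by blast
  have rg: "poly (r v) (v j) = coeff (\<pi> v) D ^ k * g v" if "v \<in> T" for v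
   using arg_cong[OF eq[of v], of "\<lambda>p. poly p (v j)"] \<pi>(3)[OF that] \<rho>(3) by simp
  obtain v0 where "v0 \<in> T" "coeff (\<pi> v0) D \<noteq> 0" "g v0 \<noteq> 0"
   using irreducible_onD[OF irr aPF g(1) \<pi>(4) g(2)] by blast
  then have "r v0 \<noteq> 0" using rg[of v0] by auto
  then have "\<exists>v\<in>T. r v \<noteq> 0" using \<open>v0 \<in> T\<close> by blast
  then have "\<exists>E<D. Ex (mul E)" by (intro mulI[OF r PF_power[OF aPF, of k] rg])
  then obtain E0 where E0: "E0 < D" "Ex (mul E0)" by blast
  then obtain l where "Ex (mul l)" and minl: "\<And>l'. l' < l \<Longrightarrow> \<not> Ex (mul l')"
   using exists_least_iff[of "\<lambda>D. Ex (mul D)"] by blast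
  then have "l < D" using E0 by (meson le_less_trans not_le)
  obtain \<sigma> u where \<sigma>: "\<And>i. cf \<sigma> i \<in> PF (coords J)" "\<And>v. degree (\<sigma> v) \<le> l"
   "\<exists>v\<in>T. coeff (\<sigma> v) l \<noteq> 0" and u: "u \<in> PF (coords (insert j J))"
   "\<And>v. v \<in> T \<Longrightarrow> poly (\<sigma> v) (v j) = u v * g v"
   using \<open>Ex (mul l)\<close> unfolding mul_def by blast
  \<comment> \<open>Otherwise division of \<open>\<pi>\<close> by \<open>\<sigma>\<close> leaves a
    multiple of \<open>g\<close> of degree below \<open>l\<close>, hence zero on \<open>T\<close>.
    Up to a factor, \<open>\<pi>\<close> is then a product of two polynomials of degree below
    \<open>D\<close>; by irreducibility one of them annihilates coordinate \<open>j\<close>, against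
    the minimality of \<open>D\<close>.\<close>
  have "l = 0"
  proof (rule ccontr)
   assume "l \<noteq> 0"
   then have "l > 0" by simp
   obtain k \<tau> r where \<tau>: "\<And>i. cf \<tau> i \<in> PF (coords J)" "\<And>v. degree (\<tau> v) \<le> D - l"
    and r: "\<And>i. cf r i \<in> PF (coords J)" "\<And>v. degree (r v) < l"
    and eq: "\<And>v. smult (coeff (\<sigma> v) l ^ k) (\<pi> v) = \<tau> v * \<sigma> v + r v"
    using pseudo_division[OF \<sigma>(1,2) \<open>l > 0\<close> \<pi>(1,2)] by blast
   have \<tau>PF: "(\<lambda>v. poly (\<tau> v) (v j)) \<in> PF (coords (insert j J))" using evalPF \<tau> by blast
   have "poly (r v) (v j) = - (poly (\<tau> v) (v j) * u v) * g v" if "v \<in> T" for v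
    using arg_cong[OF eq[of v], of "\<lambda>p. poly p (v j)"] \<pi>(3)[OF that] u(2)[OF that]
    by (simp add: eq_neg_iff_add_eq_0 add.commute mult.assoc)
   then have "\<exists>E<l. Ex (mul E)" if "\<exists>v\<in>T. r v \<noteq> 0"
    using that by (intro mulI[OF r, of "\<lambda>v. - (poly (\<tau> v) (v j) * u v)"] PF_uminus
      PF_mult \<tau>PF u(1))
   then have r0: "\<forall>v\<in>T. r v = 0" using minl by blast
   then have eq': "smult (coeff (\<sigma> v) l ^ k) (\<pi> v) = \<tau> v * \<sigma> v" if "v \<in> T" for v
    using eq[of v] that by simp
   obtain w where w: "w \<in> T" "coeff (\<pi> w) D \<noteq> 0" "coeff (\<sigma> w) l \<noteq> 0"
    using irreducible_onD[OF irr aPF _ \<pi>(4) \<sigma>(3)] \<sigma>(1) J by blast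
   then have "\<tau> w \<noteq> 0" "\<sigma> w \<noteq> 0" using eq'[OF w(1)] by auto
   have "degree (\<tau> v) < D" for v using \<tau>(2)[of v] \<open>l < D\<close> \<open>l > 0\<close> by linarith
   then have \<tau>0: "\<exists>v\<in>T. poly (\<tau> v) (v j) \<noteq> 0"
    using min[OF \<tau>(1)] w(1) \<open>\<tau> w \<noteq> 0\<close> by blast
   have "degree (\<sigma> v) < D" for v using \<sigma>(2)[of v] \<open>l < D\<close> by linarith
   then have \<sigma>0: "\<exists>v\<in>T. poly (\<sigma> v) (v j) \<noteq> 0"
    using min[OF \<sigma>(1)] w(1) \<open>\<sigma> w \<noteq> 0\<close> by blast
   obtain x where x: "x \<in> T" "poly (\<tau> x) (x j) \<noteq> 0" "poly (\<sigma> x) (x j) \<noteq> 0"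
    using irreducible_onD[OF irr \<tau>PF evalPF[OF \<sigma>(1,2)] \<tau>0 \<sigma>0] by blast
   then show False
    using arg_cong[OF eq'[OF x(1)], of "\<lambda>p. poly p (x j)"] \<pi>(3)[OF x(1)] by simp
  qed
  define c where "c v = coeff (\<sigma> v) 0" for v
  have cu: "c v - u v * g v = 0" if "v \<in> T" for v
   using u(2)[OF that] \<sigma>(2)[of v] \<open>l = 0\<close> unfolding c_def by (simp add: poly_altdef)
  have cPF: "c \<in> PF (coords J)" unfolding c_def[abs_def] using \<sigma>(1) .
  have "\<exists>a. consistent T (insert j J) (p(j := a)) \<and> g (p(j := a)) \<noteq> 0"
   if p: "consistent T J p" "coeff (\<pi> p) D * c p \<noteq> 0" for p
  proof -
   have "degree (\<pi> p) > 0" using p(2) D0 by (metis le_degree less_le_trans mult_zero_left)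
   \<comment> \<open>Any root serves. The leading coefficient is nonzero at \<open>p\<close> and
     remainders of relations vanish there, so the extended point is consistent; and
     \<open>c p\<close> nonzero forces \<open>g\<close> to be nonzero at it.\<close>
   then obtain a where a: "poly (\<pi> p) a = 0" using alg_closed_imp_poly_has_root by blast
   have "P (p(j := a)) = 0" if P: "P \<in> PF (coords (insert j J))" "\<forall>v\<in>T. P v = 0" for P
   proof -
    obtain \<phi> m where \<phi>: "\<And>v. degree (\<phi> v) \<le> m" "\<And>i. cf \<phi> i \<in> PF (coords J)"
     "\<And>v. P v = poly (\<phi> v) (v j)" using PF_insert[of P "\<lambda>p. p j" "coords J"] P(1) unfolding coords_insert by blast
    obtain k \<tau> r where r: "\<And>i. cf r i \<in> PF (coords J)" "\<And>v. degree (r v) < D"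
     and eq: "\<And>v. smult (coeff (\<pi> v) D ^ k) (\<phi> v) = \<tau> v * \<pi> v + r v"
     using pseudo_division[OF \<pi>(1,2) D0 \<phi>(2,1)] by blast
    have "poly (r v) (v j) = 0" if "v \<in> T" for v
     using arg_cong[OF eq[of v], of "\<lambda>p. poly p (v j)"] \<pi>(3)[OF that] P(2) \<phi>(3) that by simp
    then have "r p = 0" using min[OF r(1,2)] zeroT[OF r(1) _ p(1)] by blast
    then have "coeff (\<pi> p) D ^ k * poly (\<phi> p) a = 0"
     using arg_cong[OF eq[of p], of "\<lambda>p. poly p a"] a by simp
    then show ?thesis unfolding \<phi>(3) upd[OF \<phi>(2)] using p(2) by simp
   qed
   then have cons: "consistent T (insert j J) (p(j := a))" unfolding consistent_def by blast
   have "(\<lambda>v. c v - u v * g v) \<in> PF (coords (insert j J))" using cPF J u(1) g(1) by (intro PF_intros) auto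
   then have "c (p(j := a)) = u (p(j := a)) * g (p(j := a))"
    using cons cu unfolding consistent_def by fastforce
   moreover have "c (p(j := a)) = c p" by (rule PF_coords_cong[OF cPF]) (use \<open>j \<notin> J\<close> in auto)
   ultimately show ?thesis using cons p(2) by auto
  qed
  moreover have "(\<lambda>v. coeff (\<pi> v) D * c v) \<in> PF (coords J)" by (intro PF_intros \<pi> cPF)
  moreover have "\<exists>v\<in>T. coeff (\<pi> v) D * c v \<noteq> 0"
   using irreducible_onD[OF irr aPF _ \<pi>(4), of c] cPF J \<sigma>(3) \<open>l = 0\<close> unfolding c_def by auto
  ultimately show ?thesis by (intro bexI[of _ "\<lambda>v. coeff (\<pi> v) D * c v"]) auto
 qed
qed

text \<open>Coordinates are adjoined one by one; the \<open>q\<close> that guards the last of them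
  takes the role of \<open>g\<close> for those before it.\<close>

lemma consistent_extend_finite:
 fixes T :: "('i \<Rightarrow> 'k::alg_closed_field) set"
 assumes "finite L" "irreducible_on (coords (J \<union> L)) T" "g \<in> PF (coords (J \<union> L))" "\<exists>v\<in>T. g v \<noteq> 0"
 shows "\<exists>q\<in>PF (coords J). (\<exists>v\<in>T. q v \<noteq> 0) \<and> (\<forall>p. consistent T J p \<longrightarrow> q p \<noteq> 0 \<longrightarrow>
  (\<exists>p'. (\<forall>i\<in>J. p' i = p i) \<and> consistent T (J \<union> L) p' \<and> g p' \<noteq> 0))"
 using assms
proof (induction L arbitrary: g rule: finite_induct)
 case empty
 then show ?case by (intro bexI[of _ g]) auto
next
 case (insert l L)
 have irr: "irreducible_on (coords (J \<union> L)) T"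
  by (rule irreducible_on_subset[OF insert.prems(1)]) (auto simp: coords_def intro!: PF_coord)
 show ?case
 proof (cases "l \<in> J")
  case True
  then have eq: "J \<union> insert l L = J \<union> L" by auto
  show ?thesis using insert.IH[OF irr] insert.prems(2,3) unfolding eq .
 next
  case False
  then have l: "l \<notin> J \<union> L" using insert by auto
  obtain q where q: "q \<in> PF (coords (J \<union> L))" "\<exists>v\<in>T. q v \<noteq> 0"
   and ext: "\<And>p. consistent T (J \<union> L) p \<Longrightarrow> q p \<noteq> 0 \<Longrightarrow>
    \<exists>a. consistent T (insert l (J \<union> L)) (p(l := a)) \<and> g (p(l := a)) \<noteq> 0"
   using consistent_extend[OF _ l, of T g] insert.prems by auto
  obtain q' where q': "q' \<in> PF (coords J)" "\<exists>v\<in>T. q' v \<noteq> 0"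
   and ext': "\<And>p. consistent T J p \<Longrightarrow> q' p \<noteq> 0 \<Longrightarrow>
    \<exists>p'. (\<forall>i\<in>J. p' i = p i) \<and> consistent T (J \<union> L) p' \<and> q p' \<noteq> 0"
   using insert.IH[OF irr q] by blast
  have "\<exists>p'. (\<forall>i\<in>J. p' i = p i) \<and> consistent T (J \<union> insert l L) p' \<and> g p' \<noteq> 0"
   if p: "consistent T J p" "q' p \<noteq> 0" for p
  proof -
   obtain p' where p': "\<forall>i\<in>J. p' i = p i" "consistent T (J \<union> L) p'" "q p' \<noteq> 0" using ext'[OF p] by blast
   then obtain a where "consistent T (insert l (J \<union> L)) (p'(l := a))" "g (p'(l := a)) \<noteq> 0"
    using ext by blast
   then show ?thesis using p'(1) l by (intro exI[of _ "p'(l := a)"]) auto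
  qed
  then show ?thesis using q' by blast
 qed
qed

section \<open>Affine sets and dominant maps\<close>

lemma irreducible_on_image:
 assumes "irreducible_on X S" "\<And>y. y \<in> Y \<Longrightarrow> (\<lambda>v. y (\<phi> v)) \<in> PF X"
 shows "irreducible_on Y (\<phi> ` S)"
 unfolding irreducible_on_def
proof (intro conjI ballI impI)
 show "\<phi> ` S \<noteq> {}" using assms(1) unfolding irreducible_on_def by blast
 fix f g assume "f \<in> PF Y" "g \<in> PF Y" and 0: "\<forall>v\<in>\<phi> ` S. f v * g v = 0"
 then have PF: "(\<lambda>v. f (\<phi> v)) \<in> PF X" "(\<lambda>v. g (\<phi> v)) \<in> PF X"
  using PF_comp[of _ Y \<phi> X] assms(2) by blast+
 show "(\<forall>v\<in>\<phi> ` S. f v = 0) \<or> (\<forall>v\<in>\<phi> ` S. g v = 0)"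
  using irreducible_onD[OF assms(1) PF] 0 by auto
qed

text \<open>Seen through the coordinates \<open>X\<close>, the set \<open>S\<close> contains every
  point that satisfies the polynomial relations holding on it: its image in affine space is closed.
  This is what turns a consistent point into a point of \<open>S\<close>.\<close>

definition affine_on :: "('v \<Rightarrow> 'k::comm_ring_1) set \<Rightarrow> 'v set \<Rightarrow> bool" where
 "affine_on X S \<longleftrightarrow> (\<forall>p. consistent ((\<lambda>v x. x v) ` S) X p \<longrightarrow> (\<exists>v\<in>S. \<forall>x\<in>X. x v = p x))"

lemma affine_onE:
 assumes "affine_on X S" "\<And>F. F \<in> PF (coords X) \<Longrightarrow> (\<forall>v\<in>S. F (\<lambda>x. x v) = 0) \<Longrightarrow> F p = 0"
 obtains v where "v \<in> S" "\<And>x. x \<in> X \<Longrightarrow> x v = p x"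
proof -
 have "consistent ((\<lambda>v x. x v) ` S) X p" unfolding consistent_def using assms(2) by blast
 then show ?thesis using assms(1) that unfolding affine_on_def by blast
qed

text \<open>\<open>consistent_extend_finite\<close> is applied to the graph of \<open>h\<close>,
  with the values of \<open>h\<close> as the given coordinates (\<open>Inl\<close>) and those of
  \<open>X\<close> as the ones to be found (\<open>Inr\<close>). Independence of \<open>h\<close>
  makes every \<open>p\<close> consistent for the former, and \<open>affine_on\<close> supplies the
  point of \<open>S\<close>.\<close>

theorem dominant_image:
 fixes h :: "'i \<Rightarrow> 'v \<Rightarrow> 'k::alg_closed_field"
 assumes irr: "irreducible_on X S" and aff: "affine_on X S" and fin: "finite X" "finite I"
  and h: "\<And>i. i \<in> I \<Longrightarrow> h i \<in> PF X" and ind: "alg_indep S h I"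
  and g: "g \<in> PF X" "\<exists>v\<in>S. g v \<noteq> 0"
 shows "\<exists>q\<in>PF (coords I). (\<exists>p. q p \<noteq> 0) \<and>
  (\<forall>p. q p \<noteq> 0 \<longrightarrow> (\<exists>v\<in>S. g v \<noteq> 0 \<and> (\<forall>i\<in>I. h i v = p i)))"
proof -
 define H where "H = (\<lambda>v. case_sum (\<lambda>i. h i v) (\<lambda>x. x v))"
 define T where "T = H ` S"
 define J where "J = (Inl ` I :: ('i + ('v \<Rightarrow> 'k)) set)"
 define L where "L = (Inr ` X :: ('i + ('v \<Rightarrow> 'k)) set)"
 have irrT: "irreducible_on (coords (J \<union> L)) T"
  unfolding T_def
  by (rule irreducible_on_image[OF irr])
   (auto simp: coords_def J_def L_def H_def intro: h PF_coord)
 have lift: "\<exists>F\<in>PF (coords (J \<union> L)). (\<forall>v. F (H v) = f v) \<and> (\<forall>p v. (\<forall>x\<in>X. x v = p (Inr x)) \<longrightarrow> F p = f v)"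
  if f: "f \<in> PF X" for f
 proof -
  obtain F where F: "F \<in> PF (coords X)" "\<And>v. F (\<lambda>x. x v) = f v"
   using PF_lift[of f "\<lambda>x. x" X] f by auto
  have "(\<lambda>p. F (\<lambda>x. p (Inr x))) \<in> PF (coords (J \<union> L))"
   by (rule PF_coords_comp[OF F(1)]) (auto simp: coords_def L_def intro!: PF_coord)
  moreover have "F (\<lambda>x. p (Inr x)) = f v" if "\<forall>x\<in>X. x v = p (Inr x)" for p v
   using PF_coords_cong[OF F(1), of "\<lambda>x. p (Inr x)" "\<lambda>x. x v"] that F(2) by auto
  ultimately show ?thesis
   by (intro bexI[of _ "\<lambda>p. F (\<lambda>x. p (Inr x))"]) (auto simp: H_def F(2))
 qed
 obtain G where G: "G \<in> PF (coords (J \<union> L))" "\<And>v. G (H v) = g v"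
  "\<And>p v. \<forall>x\<in>X. x v = p (Inr x) \<Longrightarrow> G p = g v" using lift[OF g(1)] by blast
 have "\<exists>v\<in>T. G v \<noteq> 0" unfolding T_def using g(2) G(2) by auto
 then obtain q where q: "q \<in> PF (coords J)" "\<exists>v\<in>T. q v \<noteq> 0"
  and ext: "\<And>p. consistent T J p \<Longrightarrow> q p \<noteq> 0 \<Longrightarrow>
   \<exists>p'. (\<forall>i\<in>J. p' i = p i) \<and> consistent T (J \<union> L) p' \<and> G p' \<noteq> 0"
  using consistent_extend_finite[OF _ irrT G(1)] fin unfolding L_def by blast
 \<comment> \<open>Functions on \<open>J\<close> ignore the remaining coordinates, which are set to
   0.\<close>
 define c :: "('i \<Rightarrow> 'k) \<Rightarrow> 'i + ('v \<Rightarrow> 'k) \<Rightarrow> 'k" where "c p = case_sum p (\<lambda>_. 0)" for p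
 have cPF: "(\<lambda>p. P (c p)) \<in> PF (coords I)" if "P \<in> PF (coords J)" for P
  by (rule PF_comp[OF that]) (auto simp: coords_def J_def c_def intro!: PF_coord)
 have cons: "consistent T J (c p)" for p
  unfolding consistent_def
 proof (intro ballI impI)
  fix P assume P: "P \<in> PF (coords J)" "\<forall>v\<in>T. P v = 0"
  have "P (c (\<lambda>i. h i v)) = P (H v)" for v
   by (rule PF_coords_cong[OF P(1)]) (auto simp: J_def c_def H_def)
  then have "\<forall>v\<in>S. P (c (\<lambda>i. h i v)) = 0" using P(2) unfolding T_def by auto
  then show "P (c p) = 0" using bspec[OF ind[unfolded alg_indep_iff[OF fin(2)]] cPF[OF P(1)]] by blast
 qed
 have "\<exists>v\<in>S. g v \<noteq> 0 \<and> (\<forall>i\<in>I. h i v = p i)" if qp: "q (c p) \<noteq> 0" for p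
 proof -
  obtain p' where p': "\<forall>i\<in>J. p' i = c p i" "consistent T (J \<union> L) p'" "G p' \<noteq> 0"
   using ext[OF cons qp] by blast
  have "F (\<lambda>x. p' (Inr x)) = 0" if F: "F \<in> PF (coords X)" "\<forall>v\<in>S. F (\<lambda>x. x v) = 0" for F
  proof -
   have "(\<lambda>p. F (\<lambda>x. p (Inr x))) \<in> PF (coords (J \<union> L))"
    by (rule PF_coords_comp[OF F(1)]) (auto simp: coords_def L_def intro!: PF_coord)
   then show ?thesis using p'(2) F(2) unfolding consistent_def T_def H_def by auto
  qed
  then obtain v where v: "v \<in> S" "\<And>x. x \<in> X \<Longrightarrow> x v = p' (Inr x)"
   using affine_onE[OF aff, of "\<lambda>x. p' (Inr x)"] by blast
  have "h i v = p i" if i: "i \<in> I" for i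
  proof -
   obtain F where F: "F \<in> PF (coords (J \<union> L))" "\<And>v. F (H v) = h i v"
    "\<And>p v. \<forall>x\<in>X. x v = p (Inr x) \<Longrightarrow> F p = h i v" using lift[OF h[OF i]] by blast
   have 1: "(\<lambda>p. F p - p (Inl i)) \<in> PF (coords (J \<union> L))"
    using i by (intro PF_intros F) (auto simp: coords_def J_def intro!: PF_coord)
   have 2: "\<forall>v\<in>T. F v - v (Inl i) = 0" unfolding T_def using F(2) by (auto simp: H_def)
   have "F p' - p' (Inl i) = 0" by (rule mp[OF bspec[OF p'(2)[unfolded consistent_def] 1] 2])
   moreover have "F p' = h i v" by (rule F(3), rule ballI, rule v(2))
   moreover have "p' (Inl i) = p i" using p'(1) i by (simp add: J_def c_def)
   ultimately show ?thesis by simp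
  qed
  then have "\<forall>i\<in>I. h i v = p i" ..
  moreover have "G p' = g v" by (rule G(3), rule ballI, rule v(2))
  then have "g v \<noteq> 0" using p'(3) by metis
  ultimately show ?thesis using v(1) by blast
 qed
 moreover have "\<exists>p. q (c p) \<noteq> 0"
 proof -
  obtain v where v: "v \<in> S" "q (H v) \<noteq> 0" using q(2) unfolding T_def by blast
  have "q (c (\<lambda>i. h i v)) = q (H v)"
   by (rule PF_coords_cong[OF q(1)]) (auto simp: J_def c_def H_def)
  then have "q (c (\<lambda>i. h i v)) \<noteq> 0" using v(2) by (simp only: not_False_eq_True)
  then show ?thesis using exI[of "\<lambda>p. q (c p) \<noteq> 0" "\<lambda>i. h i v"] by (simp only: not_False_eq_True)
 qed
 ultimately show ?thesis using cPF[OF q(1)]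
  by (intro bexI[of _ "\<lambda>p. q (c p)"] conjI allI impI)
qed

section \<open>Noetherianity\<close>

definition function_ideal :: "('v \<Rightarrow> 'k::comm_ring_1) set \<Rightarrow> ('v \<Rightarrow> 'k) set \<Rightarrow> bool" where
 "function_ideal X I \<longleftrightarrow> I \<subseteq> PF X \<and> (\<lambda>_. 0) \<in> I \<and> (\<forall>f\<in>I. \<forall>g\<in>I. (\<lambda>v. f v + g v) \<in> I) \<and>
  (\<forall>a\<in>PF X. \<forall>f\<in>I. (\<lambda>v. a v * f v) \<in> I)"

definition ideals_stabilize :: "('v \<Rightarrow> 'k::comm_ring_1) set \<Rightarrow> bool" where
 "ideals_stabilize X \<longleftrightarrow> (\<forall>I. (\<forall>n. function_ideal X (I n) \<and> I n \<subseteq> I (Suc n)) \<longrightarrow>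
  (\<exists>n. \<forall>m\<ge>n. I m = I n))"

lemma function_idealD:
 assumes "function_ideal X I"
 shows "f \<in> I \<Longrightarrow> f \<in> PF X" "(\<lambda>_. 0) \<in> I" "f \<in> I \<Longrightarrow> g \<in> I \<Longrightarrow> (\<lambda>v. f v + g v) \<in> I"
  "a \<in> PF X \<Longrightarrow> f \<in> I \<Longrightarrow> (\<lambda>v. a v * f v) \<in> I"
 using assms unfolding function_ideal_def by auto

lemma function_ideal_diff:
 assumes "function_ideal X I" "f \<in> I" "g \<in> I"
 shows "(\<lambda>v. f v - g v) \<in> I"
 using function_idealD(3)[OF assms(1,2) function_idealD(4)[OF assms(1) PF_const assms(3)],
   of "-1"] by simp

lemma ideals_stabilize_empty: "ideals_stabilize ({} :: ('v \<Rightarrow> 'k::field) set)"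
 unfolding ideals_stabilize_def
proof (intro allI impI)
 fix I :: "nat \<Rightarrow> ('v \<Rightarrow> 'k) set"
 assume I: "\<forall>n. function_ideal {} (I n) \<and> I n \<subseteq> I (Suc n)"
 have const: "f v = f w" if "f \<in> PF {}" for f :: "'v \<Rightarrow> 'k" and v w
  by (rule PF_eq[OF that]) auto
 have mono: "I n \<subseteq> I m" if "n \<le> m" for n m
  by (rule lift_Suc_mono_le[OF _ that]) (rule conjunct2[OF spec[OF I]])
 show "\<exists>n. \<forall>m\<ge>n. I m = I n"
 proof (cases "\<exists>n. \<exists>f\<in>I n. \<exists>v. f v \<noteq> 0")
  case False
  have "I n = {\<lambda>_. 0}" for n
  proof
   show "I n \<subseteq> {\<lambda>_. 0}" using False by auto
   show "{\<lambda>_. 0} \<subseteq> I n" using I function_idealD(2) by auto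
  qed
  then show ?thesis by auto
 next
  case True
  then obtain n f v where f: "f \<in> I n" "f v \<noteq> 0" by blast
  have "PF {} \<subseteq> I n"
  proof
   fix g :: "'v \<Rightarrow> 'k" assume g: "g \<in> PF {}"
   have "f \<in> PF {}" using I f function_idealD(1) by blast
   then have "g w = g v / f v * f w" for w
    using const[OF g, of w v] const[of f w v] f(2) by simp
   then have "g = (\<lambda>w. g v / f v * f w)" by (rule ext)
   moreover have "(\<lambda>w. g v / f v * f w) \<in> I n"
    using function_idealD(4)[of "{}" "I n" "\<lambda>_. g v / f v" f] I f(1) by (auto intro: PF_const)
   ultimately show "g \<in> I n" by simp
  qed
  then have "I m = I n" if "m \<ge> n" for m
   using mono[OF that] I function_idealD(1) by blast
  then show ?thesis by blast
 qed
qed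

text \<open>Hilbert's basis theorem with the ideals \<open>L d n\<close> of coefficients of degree
  \<open>d\<close>. Members of \<open>PF\<close> are polynomials modulo unknown relations, so a
  function may have several expansions in \<open>\<alpha>\<close>; \<open>rep\<close> records one of
  them, and \<open>L\<close> collects the coefficients of all.\<close>

lemma ideals_stabilize_insert:
 fixes X :: "('v \<Rightarrow> 'k::field) set"
 assumes "ideals_stabilize X"
 shows "ideals_stabilize (insert \<alpha> X)"
 unfolding ideals_stabilize_def
proof (intro allI impI)
 fix I :: "nat \<Rightarrow> ('v \<Rightarrow> 'k) set"
 assume I: "\<forall>n. function_ideal (insert \<alpha> X) (I n) \<and> I n \<subseteq> I (Suc n)"
 have idl: "function_ideal (insert \<alpha> X) (I n)" for n by (rule conjunct1[OF spec[OF I]])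
 have mono: "I n \<subseteq> I m" if "n \<le> m" for n m
  by (rule lift_Suc_mono_le[OF _ that]) (rule conjunct2[OF spec[OF I]])
 have X: "PF X \<subseteq> PF (insert \<alpha> X)" using PF_mono by blast
 have \<alpha>: "\<alpha> \<in> PF (insert \<alpha> X)" by (auto intro: PF_coord)
 define rep where "rep d f \<pi> \<longleftrightarrow> (\<forall>j. cf \<pi> j \<in> PF X) \<and> (\<forall>v. degree (\<pi> v) \<le> d) \<and>
  f = (\<lambda>v. poly (\<pi> v) (\<alpha> v))" for d f and \<pi> :: "'v \<Rightarrow> 'k poly"
 define L where "L d n = {a. \<exists>f\<in>I n. \<exists>\<pi>. rep d f \<pi> \<and> a = (\<lambda>v. coeff (\<pi> v) d)}" for d n
 have LI: "a \<in> L d n" if "f \<in> I n" "rep d f \<pi>" "a = (\<lambda>v. coeff (\<pi> v) d)" for a d n f \<pi>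
  using that unfolding L_def by blast
 have idL: "function_ideal X (L d n)" for d n
  unfolding function_ideal_def
 proof (intro conjI ballI)
  show "L d n \<subseteq> PF X" unfolding L_def rep_def by auto
  show "(\<lambda>_. 0) \<in> L d n"
   by (rule LI[OF function_idealD(2)[OF idl], where \<pi> = "\<lambda>_. 0"])
    (auto simp: rep_def intro: PF_const)
 next
  fix a b assume "a \<in> L d n" "b \<in> L d n"
  then obtain f g \<pi> \<rho> where f: "f \<in> I n" "rep d f \<pi>" "a = (\<lambda>v. coeff (\<pi> v) d)"
   and g: "g \<in> I n" "rep d g \<rho>" "b = (\<lambda>v. coeff (\<rho> v) d)" unfolding L_def by blast
  show "(\<lambda>v. a v + b v) \<in> L d n"
   by (rule LI[OF function_idealD(3)[OF idl f(1) g(1)], where \<pi> = "\<lambda>v. \<pi> v + \<rho> v"])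
    (use f g in \<open>auto simp: rep_def intro: PF_intros degree_add_le\<close>)
 next
  fix a b assume a: "a \<in> PF X" and "b \<in> L d n"
  then obtain g \<rho> where g: "g \<in> I n" "rep d g \<rho>" "b = (\<lambda>v. coeff (\<rho> v) d)" unfolding L_def by blast
  show "(\<lambda>v. a v * b v) \<in> L d n"
   by (rule LI[OF function_idealD(4)[OF idl _ g(1), of a], where \<pi> = "\<lambda>v. smult (a v) (\<rho> v)"])
    (use g a X in \<open>auto simp: rep_def intro: PF_intros order_trans[OF degree_smult_le]\<close>)
 qed
 have Ln: "L d n \<subseteq> L d m" if "n \<le> m" for d n m using mono[OF that] unfolding L_def by blast
 have LSuc: "L d n \<subseteq> L (Suc d) n" for d n
 proof
  fix a assume "a \<in> L d n"
  then obtain f \<pi> where f: "f \<in> I n" "rep d f \<pi>" "a = (\<lambda>v. coeff (\<pi> v) d)" unfolding L_def by blast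
  have "rep (Suc d) (\<lambda>v. \<alpha> v * f v) (\<lambda>v. pCons 0 (\<pi> v))"
   unfolding rep_def
  proof (intro conjI allI)
   fix j show "(\<lambda>v. coeff (pCons 0 (\<pi> v)) j) \<in> PF X"
    using f(2) by (cases j) (auto simp: rep_def intro: PF_const)
  qed (use f(2) in \<open>auto simp: rep_def intro: order_trans[OF degree_pCons_le]\<close>)
  then show "a \<in> L (Suc d) n"
   by (rule LI[OF function_idealD(4)[OF idl \<alpha> f(1)]]) (simp add: f)
 qed
 have Ld: "L d n \<subseteq> L e n" if "d \<le> e" for d e n
  by (rule lift_Suc_mono_le[of "\<lambda>d. L d n", OF LSuc that])
 have stab: "\<exists>n. \<forall>m\<ge>n. J m = J n" if "\<And>n. function_ideal X (J n)" "\<And>n. J n \<subseteq> J (Suc n)" for J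
  by (rule mp[OF spec[OF assms[unfolded ideals_stabilize_def]]]) (intro allI conjI that)
 \<comment> \<open>The diagonal controls all large \<open>d\<close> at once; the finitely many
   \<open>d < n0\<close> are stabilized one at a time.\<close>
 have "L n n \<subseteq> L (Suc n) (Suc n)" for n
  using Ln[of n "Suc n" n] LSuc[of n "Suc n"] by simp
 then have "\<exists>n. \<forall>m\<ge>n. L m m = L n n" by (intro stab[of "\<lambda>n. L n n"] idL)
 then obtain n0 where n0: "\<And>m. m \<ge> n0 \<Longrightarrow> L m m = L n0 n0" by blast
 have "\<forall>d. \<exists>n. \<forall>m\<ge>n. L d m = L d n"
  by (intro allI stab idL Ln) simp
 then obtain s where s: "\<And>d m. m \<ge> s d \<Longrightarrow> L d m = L d (s d)" by metis
 define N where "N = n0 + (\<Sum>d<n0. s d)"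
 have LN: "L d m = L d N" if "m \<ge> N" for d m
 proof (cases "d < n0")
  case True
  then have "s d \<le> N" unfolding N_def by (intro trans_le_add2 member_le_sum) auto
  then show ?thesis using s[of d m] s[of d N] that by simp
 next
  case False
  have squeeze: "L d k = L n0 n0" if "k \<ge> n0" for k
  proof
   have "L d k \<subseteq> L (d + k) (d + k)" using Ld[of d "d + k" k] Ln[of k "d + k" "d + k"] by auto
   then show "L d k \<subseteq> L n0 n0" using n0[of "d + k"] that by simp
   have "L n0 n0 \<subseteq> L d n0" using Ld False by simp
   then show "L n0 n0 \<subseteq> L d k" using Ln[OF that, of d] by blast
  qed
  have "n0 \<le> N" unfolding N_def by simp
  then show ?thesis using squeeze[of m] squeeze[of N] that by simp
 qed
 have sub: "f \<in> I N" if "m \<ge> N" "f \<in> I m" "rep d f \<pi>" for d f m \<pi>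
  using that(2,3)
 proof (induction d arbitrary: f \<pi>)
  case 0
  have eq: "f = (\<lambda>v. coeff (\<pi> v) 0)" using 0(2) unfolding rep_def by (auto simp: fun_eq_iff poly_altdef)
  then have "f \<in> L 0 N" using LI[OF 0] LN[OF that(1), of 0] by blast
  then obtain g \<rho> where g: "g \<in> I N" "rep 0 g \<rho>" "f = (\<lambda>v. coeff (\<rho> v) 0)" unfolding L_def by blast
  then have "g = f" unfolding rep_def by (auto simp: fun_eq_iff poly_altdef)
  then show ?case using g by simp
 next
  case (Suc d)
  have "(\<lambda>v. coeff (\<pi> v) (Suc d)) \<in> L (Suc d) N" using LI[OF Suc.prems] LN[OF that(1), of "Suc d"] by blast
  then obtain g \<rho> where g: "g \<in> I N" "rep (Suc d) g \<rho>"
   "(\<lambda>v. coeff (\<pi> v) (Suc d)) = (\<lambda>v. coeff (\<rho> v) (Suc d))" unfolding L_def by blast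
  have "degree (\<pi> v - \<rho> v) \<le> d" for v
  proof (rule degree_le, intro allI impI)
   fix j assume "d < j"
   show "coeff (\<pi> v - \<rho> v) j = 0"
   proof (cases "j = Suc d")
    case True
    then show ?thesis using fun_cong[OF g(3), of v] by simp
   next
    case False
    then have "j > degree (\<pi> v)" "j > degree (\<rho> v)"
     using Suc.prems(2) g(2) \<open>d < j\<close> unfolding rep_def by (metis Suc_lessI le_less_trans)+
    then show ?thesis by (simp add: coeff_eq_0)
   qed
  qed
  then have "rep d (\<lambda>v. f v - g v) (\<lambda>v. \<pi> v - \<rho> v)"
   using Suc.prems(2) g(2) unfolding rep_def by (auto intro: PF_intros)
  moreover have "(\<lambda>v. f v - g v) \<in> I m"
   by (rule function_ideal_diff[OF idl Suc.prems(1)]) (use g(1) mono[OF that(1)] in blast)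
  ultimately have "(\<lambda>v. f v - g v) \<in> I N" using Suc.IH by blast
  from function_idealD(3)[OF idl this g(1)] show ?case by simp
 qed
 have "I m = I N" if "m \<ge> N" for m
 proof
  show "I N \<subseteq> I m" using mono[OF that] .
  show "I m \<subseteq> I N"
  proof
   fix f assume f: "f \<in> I m"
   then have "f \<in> PF (insert \<alpha> X)" using function_idealD(1)[OF idl] by blast
   from PF_insert[OF this] obtain \<pi> D where "rep D f \<pi>" unfolding rep_def by blast
   then show "f \<in> I N" using sub that f by blast
  qed
 qed
 then show "\<exists>n. \<forall>m\<ge>n. I m = I n" by blast
qed

theorem hilbert_basis: "finite X \<Longrightarrow> ideals_stabilize (X :: ('v \<Rightarrow> 'k::field) set)"
 by (induction X rule: finite_induct) (auto intro: ideals_stabilize_empty ideals_stabilize_insert)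

section \<open>Closed sets and irreducible components\<close>

definition zclosed :: "('v \<Rightarrow> 'k::comm_ring_1) set \<Rightarrow> 'v set \<Rightarrow> 'v set \<Rightarrow> bool" where
 "zclosed X S C \<longleftrightarrow> (\<exists>P\<subseteq>PF X. C = {v \<in> S. \<forall>f\<in>P. f v = 0})"

lemma zclosedI: "P \<subseteq> PF X \<Longrightarrow> C = {v \<in> S. \<forall>f\<in>P. f v = 0} \<Longrightarrow> zclosed X S C"
 unfolding zclosed_def by blast

lemma zclosed_subset: "zclosed X S C \<Longrightarrow> C \<subseteq> S"
 unfolding zclosed_def by blast

lemma zclosed_refl: "zclosed X S S"
 by (rule zclosedI[of "{}"]) auto

lemma zclosed_separate: "zclosed X S C \<Longrightarrow> v \<in> S \<Longrightarrow> v \<notin> C \<Longrightarrow> \<exists>f\<in>PF X. f v \<noteq> 0 \<and> (\<forall>w\<in>C. f w = 0)"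
 unfolding zclosed_def by blast

lemma zclosed_iff:
 "zclosed X S C \<longleftrightarrow> C \<subseteq> S \<and> (\<forall>v\<in>S - C. \<exists>f\<in>PF X. f v \<noteq> 0 \<and> (\<forall>w\<in>C. f w = 0))"
proof
 assume "zclosed X S C"
 then show "C \<subseteq> S \<and> (\<forall>v\<in>S - C. \<exists>f\<in>PF X. f v \<noteq> 0 \<and> (\<forall>w\<in>C. f w = 0))"
  using zclosed_separate zclosed_subset by fast
next
 assume "C \<subseteq> S \<and> (\<forall>v\<in>S - C. \<exists>f\<in>PF X. f v \<noteq> 0 \<and> (\<forall>w\<in>C. f w = 0))"
 then show "zclosed X S C" by (intro zclosedI[of "{f \<in> PF X. \<forall>w\<in>C. f w = 0}"]) auto
qed

lemma zclosed_trans: "zclosed X S C \<Longrightarrow> zclosed X C D \<Longrightarrow> zclosed X S D"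
proof -
 assume "zclosed X S C" "zclosed X C D"
 then obtain P Q where "P \<subseteq> PF X" "C = {v \<in> S. \<forall>f\<in>P. f v = 0}" "Q \<subseteq> PF X" "D = {v \<in> C. \<forall>f\<in>Q. f v = 0}"
  unfolding zclosed_def by blast
 then show ?thesis by (intro zclosedI[of "P \<union> Q"]) auto
qed

lemma zclosed_relative: "zclosed X S C \<Longrightarrow> T \<subseteq> S \<Longrightarrow> zclosed X T (C \<inter> T)"
 unfolding zclosed_def by blast

lemma zclosed_superset: "zclosed X S C \<Longrightarrow> C \<subseteq> T \<Longrightarrow> T \<subseteq> S \<Longrightarrow> zclosed X T C"
 using zclosed_relative by (metis inf.absorb_iff1)

lemma zclosed_Int: "zclosed X S C \<Longrightarrow> zclosed X S D \<Longrightarrow> zclosed X S (C \<inter> D)"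
 using zclosed_trans zclosed_relative zclosed_subset by (metis inf_commute)

lemma zclosed_zero_set: "f \<in> PF X \<Longrightarrow> zclosed X S {v \<in> S. f v = 0}"
 by (rule zclosedI[of "{f}"]) auto

text \<open>A strictly descending chain of closed sets would give a strictly ascending chain of
  vanishing ideals.\<close>

lemma minimal_zclosed:
 fixes X :: "('v \<Rightarrow> 'k::field) set"
 assumes "finite X" "\<C> \<noteq> {}" "\<And>C. C \<in> \<C> \<Longrightarrow> zclosed X S C"
 obtains C where "C \<in> \<C>" "\<forall>D\<in>\<C>. \<not> D \<subset> C"
proof -
 define r where "r = {(D, C). zclosed X S D \<and> zclosed X S C \<and> D \<subset> C}"
 have "wf r"
  unfolding wf_iff_no_infinite_down_chain
 proof
  assume "\<exists>f. \<forall>i. (f (Suc i), f i) \<in> r"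
  then obtain Z where "\<forall>i. (Z (Suc i), Z i) \<in> r" by blast
  then have Z: "zclosed X S (Z i)" "Z (Suc i) \<subset> Z i" for i unfolding r_def by auto
  define I where "I n = {f \<in> PF X. \<forall>v\<in>Z n. f v = 0}" for n
  have "function_ideal X (I n)" for n
   unfolding function_ideal_def I_def by (auto intro: PF_intros)
  moreover have "I n \<subseteq> I (Suc n)" for n unfolding I_def using Z(2)[of n] by auto
  ultimately obtain n where n: "\<And>m. m \<ge> n \<Longrightarrow> I m = I n"
   using hilbert_basis[OF assms(1)] unfolding ideals_stabilize_def by meson
  obtain v where v: "v \<in> Z n" "v \<notin> Z (Suc n)" using Z(2)[of n] by blast
  then have "v \<in> S" using zclosed_subset[OF Z(1)] by blast
  then obtain f where "f \<in> PF X" "f v \<noteq> 0" "\<forall>w\<in>Z (Suc n). f w = 0"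
   using zclosed_separate[OF Z(1) _ v(2)] by blast
  then have "f \<in> I (Suc n)" "f \<notin> I n" using v(1) unfolding I_def by auto
  then show False using n[of "Suc n"] by simp
 qed
 obtain C0 where "C0 \<in> \<C>" using assms(2) by blast
 then obtain C where C: "C \<in> \<C>" "\<And>D. (D, C) \<in> r \<Longrightarrow> D \<notin> \<C>" using wfE_min[OF \<open>wf r\<close>] by metis
 have "\<not> D \<subset> C" if "D \<in> \<C>" for D
  using C(2)[of D] that assms(3)[OF that] assms(3)[OF C(1)] unfolding r_def by blast
 then show ?thesis using that C(1) by blast
qed

lemma irreducible_decomposition:
 fixes X :: "('v \<Rightarrow> 'k::field) set"
 assumes "finite X" "zclosed X S C"
 obtains \<D> where "finite \<D>" "\<And>D. D \<in> \<D> \<Longrightarrow> zclosed X S D" "\<And>D. D \<in> \<D> \<Longrightarrow> irreducible_on X D" "C = \<Union>\<D>"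
proof -
 define good where "good C \<longleftrightarrow> (\<exists>\<D>. finite \<D> \<and> (\<forall>D\<in>\<D>. zclosed X S D \<and> irreducible_on X D) \<and> C = \<Union>\<D>)" for C
 have "good C"
 proof (rule ccontr)
  assume "\<not> good C"
  then have "{C. zclosed X S C \<and> \<not> good C} \<noteq> {}" using assms by blast
  then obtain Z where "Z \<in> {C. zclosed X S C \<and> \<not> good C}"
   "\<forall>D\<in>{C. zclosed X S C \<and> \<not> good C}. \<not> D \<subset> Z"
   by (rule minimal_zclosed[OF assms(1), of "{C. zclosed X S C \<and> \<not> good C}" S]) auto
  then have Z: "zclosed X S Z" "\<not> good Z"
   and min: "\<And>D. zclosed X S D \<Longrightarrow> \<not> good D \<Longrightarrow> \<not> D \<subset> Z" by auto
  have "good {}" unfolding good_def by (intro exI[of _ "{}"]) auto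
  then have "Z \<noteq> {}" using Z(2) by auto
  moreover have "\<not> irreducible_on X Z"
  proof
   assume "irreducible_on X Z"
   then have "good Z" unfolding good_def using Z(1) by (intro exI[of _ "{Z}"]) auto
   then show False using Z(2) by blast
  qed
  ultimately obtain f g where fg: "f \<in> PF X" "g \<in> PF X" "\<forall>v\<in>Z. f v * g v = 0"
   "\<not> (\<forall>v\<in>Z. f v = 0)" "\<not> (\<forall>v\<in>Z. g v = 0)" unfolding irreducible_on_def by blast
  define A where "A = {v \<in> Z. f v = 0}"
  define B where "B = {v \<in> Z. g v = 0}"
  have "zclosed X S A" "zclosed X S B"
   unfolding A_def B_def using zclosed_trans[OF Z(1) zclosed_zero_set] fg by auto
  moreover have "A \<subset> Z" "B \<subset> Z" unfolding A_def B_def using fg by auto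
  ultimately have "good A" "good B" using min[of A] min[of B] by auto
  then obtain \<A> \<B> where "finite \<A>" "\<forall>D\<in>\<A>. zclosed X S D \<and> irreducible_on X D" "A = \<Union>\<A>"
   "finite \<B>" "\<forall>D\<in>\<B>. zclosed X S D \<and> irreducible_on X D" "B = \<Union>\<B>" unfolding good_def by blast
  moreover have "Z = A \<union> B" unfolding A_def B_def using fg(3) by auto
  ultimately have "good Z" unfolding good_def by (intro exI[of _ "\<A> \<union> \<B>"]) auto
  then show False using Z(2) by blast
 qed
 then show ?thesis using that unfolding good_def by blast
qed

text \<open>Quasi-compactness. Among the common zero sets of finitely many \<open>q w\<close> a
  minimal one is taken; a point \<open>v\<close> in it would give a smaller one by adding
  \<open>q v\<close>.\<close>

lemma finite_open_cover:
 fixes X :: "('v \<Rightarrow> 'k::field) set"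
 assumes "finite X" "\<And>v. v \<in> S \<Longrightarrow> q v \<in> PF X" "\<And>v. v \<in> S \<Longrightarrow> q v v \<noteq> 0"
 obtains T where "finite T" "T \<subseteq> S" "\<And>v. v \<in> S \<Longrightarrow> \<exists>w\<in>T. q w v \<noteq> 0"
proof -
 define \<C> where "\<C> = {C. \<exists>T. finite T \<and> T \<subseteq> S \<and> C = {v \<in> S. \<forall>w\<in>T. q w v = 0}}"
 have "{v \<in> S. \<forall>w\<in>{}. q w v = 0} \<in> \<C>" unfolding \<C>_def by blast
 then have "\<C> \<noteq> {}" by blast
 moreover have "zclosed X S C" if C: "C \<in> \<C>" for C
 proof -
  obtain T where "T \<subseteq> S" "C = {v \<in> S. \<forall>w\<in>T. q w v = 0}" using \<open>C \<in> \<C>\<close> unfolding \<C>_def by blast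
  then show ?thesis using assms(2) by (intro zclosedI[of "q ` T"]) auto
 qed
 ultimately obtain C where C: "C \<in> \<C>" "\<forall>D\<in>\<C>. \<not> D \<subset> C"
  by (rule minimal_zclosed[OF assms(1)]) (assumption, rule that)
 then obtain T where T: "finite T" "T \<subseteq> S" "C = {v \<in> S. \<forall>w\<in>T. q w v = 0}" unfolding \<C>_def by blast
 have "\<exists>w\<in>T. q w v \<noteq> 0" if v: "v \<in> S" for v
 proof (rule ccontr)
  assume "\<not> ?thesis"
  then have "v \<in> C" using T v by auto
  define D where "D = {u \<in> S. \<forall>w\<in>insert v T. q w u = 0}"
  have "D \<in> \<C>" unfolding \<C>_def D_def using T v by (intro CollectI exI[of _ "insert v T"]) auto
  moreover have "v \<notin> D" unfolding D_def using assms(3)[OF v] by auto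
  moreover have "D \<subseteq> C" unfolding D_def T(3) by auto
  ultimately show False using C(2) \<open>v \<in> C\<close> by blast
 qed
 then show ?thesis using that T by blast
qed

lemma irreducible_on_subset_Union:
 assumes "irreducible_on X Z" "finite \<D>" "\<And>D. D \<in> \<D> \<Longrightarrow> zclosed X S D" "Z \<subseteq> S" "Z \<subseteq> \<Union>\<D>"
 shows "\<exists>D\<in>\<D>. Z \<subseteq> D"
proof (rule ccontr)
 assume no: "\<not> ?thesis"
 have "\<exists>f\<in>PF X. (\<exists>v\<in>Z. f v \<noteq> 0) \<and> (\<forall>v\<in>D. f v = 0)" if D: "D \<in> \<D>" for D
 proof -
  obtain v where "v \<in> Z" "v \<notin> D" using no D by blast
  moreover have "v \<in> S" using \<open>v \<in> Z\<close> assms(4) by blast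
  ultimately obtain f where "f \<in> PF X" "f v \<noteq> 0" "\<forall>w\<in>D. f w = 0"
   using zclosed_separate[OF assms(3)[OF D]] by blast
  then show ?thesis using \<open>v \<in> Z\<close> by blast
 qed
 then obtain f where f: "\<And>D. D \<in> \<D> \<Longrightarrow> f D \<in> PF X" "\<And>D. D \<in> \<D> \<Longrightarrow> \<exists>v\<in>Z. f D v \<noteq> 0"
  "\<And>D v. D \<in> \<D> \<Longrightarrow> v \<in> D \<Longrightarrow> f D v = 0" by metis
 have Z: "Z \<noteq> {}" using assms(1) unfolding irreducible_on_def by blast
 have "\<exists>v\<in>Z. (\<Prod>D\<in>\<D>'. f D v) \<noteq> 0" if "\<D>' \<subseteq> \<D>" for \<D>'
  using finite_subset[OF that assms(2)] that
 proof (induction \<D>' rule: finite_induct)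
  case empty
  then show ?case using Z by auto
 next
  case (insert D \<D>')
  have "(\<lambda>v. \<Prod>D\<in>\<D>'. f D v) \<in> PF X" using insert.prems f(1) by (intro PF_intros) auto
  then show ?case
   using irreducible_onD[OF assms(1) f(1)[of D] _ f(2)[of D], of "\<lambda>v. \<Prod>D\<in>\<D>'. f D v"] insert by auto
 qed
 then obtain v where v: "v \<in> Z" "(\<Prod>D\<in>\<D>. f D v) \<noteq> 0" by blast
 then obtain D where "D \<in> \<D>" "v \<in> D" using assms(5) by blast
 then have "(\<Prod>D\<in>\<D>. f D v) = 0" using f(3) assms(2) by (intro prod_zero) auto
 then show False using v(2) by simp
qed

text \<open>In a decomposition with as few members as possible, every member has a point outside the
  others; \<open>q\<close> is a product of functions vanishing on the others but not at this point.
  It isolates an open part of \<open>S\<close> contained in \<open>D\<close>.\<close>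

lemma irreducible_component:
 fixes X :: "('v \<Rightarrow> 'k::field) set"
 assumes "finite X" "S \<noteq> {}"
 obtains D q where "zclosed X S D" "irreducible_on X D" "q \<in> PF X" "\<exists>v\<in>D. q v \<noteq> 0"
  "\<And>v. v \<in> S \<Longrightarrow> q v \<noteq> 0 \<Longrightarrow> v \<in> D"
proof -
 obtain \<D> where \<D>: "finite \<D>" "\<And>D. D \<in> \<D> \<Longrightarrow> zclosed X S D" "\<And>D. D \<in> \<D> \<Longrightarrow> irreducible_on X D" "S = \<Union>\<D>"
  by (rule irreducible_decomposition[OF assms(1) zclosed_refl]) (rule that)
 define dec where "dec \<E> \<longleftrightarrow> finite \<E> \<and> (\<forall>D\<in>\<E>. zclosed X S D \<and> irreducible_on X D) \<and> S = \<Union>\<E>" for \<E>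
 have "dec \<D>" unfolding dec_def using \<D> by blast
 then obtain \<E> where "dec \<E>" and min: "\<forall>\<F>. dec \<F> \<longrightarrow> card \<E> \<le> card \<F>"
  using ex_has_least_nat[of dec \<D> card] by blast
 then have \<E>: "finite \<E>" "\<And>D. D \<in> \<E> \<Longrightarrow> zclosed X S D \<and> irreducible_on X D" "S = \<Union>\<E>"
  unfolding dec_def by auto
 have "\<E> \<noteq> {}" using \<E>(3) assms(2) by auto
 then obtain D where D: "D \<in> \<E>" by blast
 have irr: "irreducible_on X D" using \<E> D by blast
 have "\<not> D \<subseteq> \<Union>(\<E> - {D})"
 proof
  assume "D \<subseteq> \<Union>(\<E> - {D})"
  then have "S = \<Union>(\<E> - {D})" using \<E>(3) D by blast
  then have "dec (\<E> - {D})" unfolding dec_def using \<E>(1,2) by blast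
  then have "card \<E> \<le> card (\<E> - {D})" using min by blast
  then show False using card_Diff1_less[OF \<E>(1) D] by simp
 qed
 then obtain v where v: "v \<in> D" "\<And>E. E \<in> \<E> - {D} \<Longrightarrow> v \<notin> E" by blast
 have "v \<in> S" using v(1) D \<E>(3) by blast
 then have "\<exists>f\<in>PF X. f v \<noteq> 0 \<and> (\<forall>w\<in>E. f w = 0)" if "E \<in> \<E> - {D}" for E
  using zclosed_separate[of X S E v] \<E>(2) v(2) that by blast
 then obtain f where f: "\<And>E. E \<in> \<E> - {D} \<Longrightarrow> f E \<in> PF X" "\<And>E. E \<in> \<E> - {D} \<Longrightarrow> f E v \<noteq> 0"
  "\<And>E w. E \<in> \<E> - {D} \<Longrightarrow> w \<in> E \<Longrightarrow> f E w = 0" by metis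
 define q where "q w = (\<Prod>E\<in>\<E> - {D}. f E w)" for w
 have "q \<in> PF X" unfolding q_def[abs_def] by (intro PF_intros f)
 moreover have "q v \<noteq> 0" unfolding q_def using \<E>(1) f(2) by auto
 moreover have "w \<in> D" if w: "w \<in> S" "q w \<noteq> 0" for w
 proof (rule ccontr)
  assume "w \<notin> D"
  then obtain E where "E \<in> \<E> - {D}" "w \<in> E" using \<E>(3) w(1) by blast
  then have "q w = 0" unfolding q_def using \<E>(1) f(3) by (intro prod_zero) auto
  then show False using w(2) by simp
 qed
 ultimately show ?thesis using that[of D q] \<E>(2)[OF D] v(1) by blast
qed

lemma affine_on_zclosed:
 assumes "affine_on X S" "zclosed X S C"
 shows "affine_on X C"
 unfolding affine_on_def
proof (intro allI impI)
 fix p assume p: "consistent ((\<lambda>v x. x v) ` C) X p"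
 obtain P where P: "P \<subseteq> PF X" "C = {v \<in> S. \<forall>f\<in>P. f v = 0}" using assms(2) unfolding zclosed_def by blast
 have "F p = 0" if "F \<in> PF (coords X)" "\<forall>v\<in>S. F (\<lambda>x. x v) = 0" for F
  by (rule consistentD[OF p that(1)]) (use that(2) P(2) in auto)
 then obtain v where v: "v \<in> S" "\<And>x. x \<in> X \<Longrightarrow> x v = p x" using affine_onE[OF assms(1), of p] by blast
 have "f v = 0" if f: "f \<in> P" for f
 proof -
  have "f \<in> PF ((\<lambda>x. x) ` X)" using f P(1) by auto
  then obtain F where F: "F \<in> PF (coords X)" "\<And>v. F (\<lambda>x. x v) = f v" by (rule PF_lift) (rule that)
  have "F p = 0" by (rule consistentD[OF p F(1)]) (use F(2) f P(2) in auto)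
  moreover have "F p = F (\<lambda>x. x v)" by (rule PF_coords_cong[OF F(1)]) (use v(2) in auto)
  ultimately show ?thesis using F(2) by simp
 qed
 then show "\<exists>v\<in>C. \<forall>x\<in>X. x v = p x" using v P(2) by blast
qed

section \<open>Krull dimension\<close>

lemma closedin_zariski_subtopology:
 "closedin (subtopology (zariski_topology X) S) C \<longleftrightarrow> zclosed X S C"
 unfolding closedin_subtopology closedin_zariski_iff zclosed_def zero_locus_def
 by (auto 4 4)

lemma topspace_zariski: "topspace (zariski_topology X) = UNIV"
proof -
 have "closedin (zariski_topology X) UNIV"
  unfolding closedin_zariski_iff zero_locus_def by (intro exI[of _ "{}"]) auto
 then show ?thesis using closedin_subset by blast
qed

lemma irreducible_subset_zariski:
 assumes "Z \<subseteq> S"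
 shows "irreducible_subset (subtopology (zariski_topology X) S) Z \<longleftrightarrow> irreducible_on X Z"
proof
 assume irr: "irreducible_subset (subtopology (zariski_topology X) S) Z"
 show "irreducible_on X Z"
  unfolding irreducible_on_def
 proof (intro conjI ballI impI)
  show "Z \<noteq> {}" using irr unfolding irreducible_subset_def by blast
  fix f g assume fg: "f \<in> PF X" "g \<in> PF X" "\<forall>v\<in>Z. f v * g v = 0"
  have "Z \<subseteq> {v \<in> S. f v = 0} \<union> {v \<in> S. g v = 0}" using fg(3) assms by auto
  then have "Z \<subseteq> {v \<in> S. f v = 0} \<or> Z \<subseteq> {v \<in> S. g v = 0}"
   using irr zclosed_zero_set[OF fg(1)] zclosed_zero_set[OF fg(2)]
   unfolding irreducible_subset_def closedin_zariski_subtopology by blast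
  then show "(\<forall>v\<in>Z. f v = 0) \<or> (\<forall>v\<in>Z. g v = 0)" by auto
 qed
next
 assume irr: "irreducible_on X Z"
 show "irreducible_subset (subtopology (zariski_topology X) S) Z"
  unfolding irreducible_subset_def closedin_zariski_subtopology
 proof (intro conjI allI impI)
  show "Z \<subseteq> topspace (subtopology (zariski_topology X) S)" using assms by (simp add: topspace_zariski)
  show "Z \<noteq> {}" using irr unfolding irreducible_on_def by blast
  fix C D assume CD: "zclosed X S C \<and> zclosed X S D \<and> Z \<subseteq> C \<union> D"
  then have "\<exists>E\<in>{C, D}. Z \<subseteq> E" using assms by (intro irreducible_on_subset_Union[OF irr, of _ S]) auto
  then show "Z \<subseteq> C \<or> Z \<subseteq> D" by blast
 qed
qed

lemma poly_zero_constant: "poly p x = coeff p 0 + x * poly (poly_shift 1 p) x"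
proof -
 have "p = pCons (coeff p 0) (poly_shift 1 p)"
  by (intro poly_eqI) (simp add: coeff_poly_shift coeff_pCons split: nat.split)
 then show ?thesis by (metis poly_pCons)
qed

text \<open>A transcendence basis \<open>Y\<close> for \<open>Z\<close> stays independent on
  \<open>Z'\<close>, even together with \<open>g\<close>: in an equation for \<open>g\<close> over
  \<open>Y\<close> the constant coefficient vanishes on \<open>Z\<close>, hence identically, and
  then a factor \<open>g\<close> can be cancelled on the irreducible set \<open>Z'\<close>.\<close>

lemma growth_proper_subset:
 fixes X :: "('v \<Rightarrow> 'k::alg_closed_field) set"
 assumes fin: "finite X" and irr: "irreducible_on X Z" "irreducible_on X Z'" and sub: "Z \<subseteq> Z'"
  and g: "g \<in> PF X" "\<forall>v\<in>Z. g v = 0" "\<exists>v\<in>Z'. g v \<noteq> 0" and gr: "growth Z' X d"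
 shows "\<exists>e. Suc e \<le> d \<and> growth Z X e"
proof -
 obtain Y where Y: "Y \<subseteq> X" "alg_indep Z (\<lambda>y. y) Y" "growth Z X (card Y)"
  by (rule transcendence_basis[OF irr(1) fin]) (rule that)
 have finY: "finite Y" using Y(1) fin finite_subset by blast
 have YX: "PF Y \<subseteq> PF X" using Y(1) PF_mono by blast
 have vanish: "\<forall>v. f v = 0" if f: "f \<in> PF Y" "\<forall>v\<in>Z. f v = 0" for f
 proof -
  have "f \<in> PF ((\<lambda>y. y) ` Y)" using f(1) by simp
  then obtain D l where l: "\<forall>v. f v = (\<Sum>e\<in>exponents Y D. l e * monomial Y (\<lambda>y. y) e v)"
   using PF_monomial_expansion[OF finY] by blast
  then have "\<forall>e\<in>exponents Y D. l e = 0"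
   using Y(2) f(2) unfolding alg_indep_def lin_indep_def by simp
  then show ?thesis using l by simp
 qed
 have no_relation: "\<forall>v\<in>Z'. \<pi> v = 0"
  if "\<And>j. cf \<pi> j \<in> PF Y" "\<And>v. degree (\<pi> v) \<le> D" "\<forall>v\<in>Z'. poly (\<pi> v) (g v) = 0" for \<pi> D
  using that
 proof (induction D arbitrary: \<pi>)
  case 0
  then have eq: "\<pi> v = [:coeff (\<pi> v) 0:]" for v
   using 0(2)[of v] by (metis degree_eq_zeroE le_zero_eq coeff_pCons_0)
  have "poly (\<pi> v) (g v) = coeff (\<pi> v) 0" for v
   by (subst eq) simp
  then have "coeff (\<pi> v) 0 = 0" if "v \<in> Z'" for v using 0(3) that by auto
  then show ?case using eq by (metis pCons_0_0)
 next
  case (Suc D)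
  have "\<forall>v\<in>Z. coeff (\<pi> v) 0 = 0"
   using Suc.prems(3) g(2) sub poly_zero_constant[of "\<pi> _" 0] by (metis add.right_neutral mult_zero_left subsetD)
  then have c0: "coeff (\<pi> v) 0 = 0" for v using vanish[OF Suc.prems(1)] by blast
  define \<rho> where "\<rho> v = poly_shift 1 (\<pi> v)" for v
  have \<rho>: "cf \<rho> j \<in> PF Y" for j
   unfolding \<rho>_def coeff_poly_shift using Suc.prems(1) .
  have deg: "degree (\<rho> v) \<le> D" for v
   unfolding \<rho>_def using Suc.prems(2)[of v]
   by (intro degree_le) (auto simp: coeff_poly_shift intro!: coeff_eq_0)
  have rPF: "(\<lambda>v. poly (\<rho> v) (g v)) \<in> PF X"
   by (rule PF_poly[of \<rho>, OF _ deg g(1)]) (use \<rho> YX in auto)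
  have "\<forall>v\<in>Z'. g v * poly (\<rho> v) (g v) = 0"
   using Suc.prems(3) c0 poly_zero_constant[of "\<pi> _" "g _"] unfolding \<rho>_def by simp
  then have "\<forall>v\<in>Z'. poly (\<rho> v) (g v) = 0"
   using irreducible_onD[OF irr(2) g(1) rPF g(3)] by auto
  then have "\<forall>v\<in>Z'. \<rho> v = 0" using Suc.IH[OF \<rho> deg] by blast
  moreover have "\<pi> v = pCons 0 (\<rho> v)" for v
   unfolding \<rho>_def using c0[of v]
   by (intro poly_eqI) (simp add: coeff_poly_shift coeff_pCons split: nat.split)
  ultimately show ?case by simp
 qed
 have na: "\<not> algebraic_over Z' Y g"
  using no_relation unfolding algebraic_over_def by blast
 \<comment> \<open>\<open>None\<close> is the index of \<open>g\<close>, which keeps it formally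
   apart from the members of \<open>Y\<close>.\<close>
 define h where "h = case_option g (\<lambda>y :: 'v \<Rightarrow> 'k. y)"
 have "alg_indep Z' h (Some ` Y)"
  unfolding alg_indep_iff[OF finite_imageI[OF finY]]
 proof (intro ballI impI allI)
  fix P p assume P: "P \<in> PF (coords (Some ` Y))" "\<forall>v\<in>Z'. P (\<lambda>i. h i v) = 0"
  define Q where "Q p = P (case_option 0 p)" for p
  have Q1: "Q \<in> PF (coords Y)" unfolding Q_def[abs_def]
   by (rule PF_comp[OF P(1)]) (auto simp: coords_def intro!: PF_coord)
  have Q2: "\<forall>v\<in>Z. Q (\<lambda>y. y v) = 0"
  proof
   fix v assume "v \<in> Z"
   have "Q (\<lambda>y. y v) = P (\<lambda>i. h i v)" unfolding Q_def
    by (rule PF_coords_cong[OF P(1)]) (auto simp: h_def)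
   then show "Q (\<lambda>y. y v) = 0" using P(2) \<open>v \<in> Z\<close> sub by auto
  qed
  have "Q (\<lambda>y. p (Some y)) = 0" by (rule alg_indepD[OF Y(2) finY Q1]) (rule bspec[OF Q2])
  moreover have "Q (\<lambda>y. p (Some y)) = P p" unfolding Q_def
   by (rule PF_coords_cong[OF P(1)]) auto
  ultimately show "P p = 0" by simp
 qed
 then have "alg_indep Z' h (insert None (Some ` Y))"
  by (rule alg_indep_insert) (use na finY in \<open>auto simp: h_def image_image\<close>)
 moreover have "Y \<subseteq> PF X" using Y(1) by (auto intro: PF_coord)
 ultimately have "card (insert None (Some ` Y)) \<le> d"
  using finY g(1)
  by (intro alg_indep_growth[OF _ _ _ gr]) (auto simp: h_def)
 then have "Suc (card Y) \<le> d" using finY by (simp add: card_image)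
 then show ?thesis using Y(3) by blast
qed

text \<open>If every piece had a relation of its own, the product of these would be a relation on
  the union.\<close>

lemma alg_indep_Union:
 fixes h :: "'i \<Rightarrow> 'v \<Rightarrow> 'k::alg_closed_field"
 assumes "alg_indep (\<Union>\<D>) h I" "finite \<D>" "finite I"
 shows "\<exists>D\<in>\<D>. alg_indep D h I"
proof (rule ccontr)
 assume "\<not> ?thesis"
 then have "\<forall>D\<in>\<D>. \<exists>P\<in>PF (coords I). (\<forall>v\<in>D. P (\<lambda>i. h i v) = 0) \<and> (\<exists>p. P p \<noteq> 0)"
  unfolding alg_indep_iff[OF assms(3)] by blast
 then obtain P where P: "\<And>D. D \<in> \<D> \<Longrightarrow> P D \<in> PF (coords I)"
  "\<And>D v. D \<in> \<D> \<Longrightarrow> v \<in> D \<Longrightarrow> P D (\<lambda>i. h i v) = 0" "\<And>D. D \<in> \<D> \<Longrightarrow> \<exists>p. P D p \<noteq> 0" by metis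
 have "\<exists>p. (\<Prod>D\<in>\<D>'. P D p) \<noteq> 0" if "\<D>' \<subseteq> \<D>" for \<D>'
  using finite_subset[OF that assms(2)] that
 proof (induction \<D>' rule: finite_induct)
  case (insert D \<D>')
  have "(\<lambda>p. \<Prod>D\<in>\<D>'. P D p) \<in> PF (coords I)" using insert.prems P(1) by (intro PF_intros) auto
  then show ?case
   using irreducible_onD[OF irreducible_on_coords[OF assms(3)] P(1)[of D], of "\<lambda>p. \<Prod>D\<in>\<D>'. P D p"]
    P(3)[of D] insert by auto
 qed auto
 moreover have "(\<lambda>p. \<Prod>D\<in>\<D>. P D p) \<in> PF (coords I)" by (intro PF_intros P)
 moreover have "\<forall>v\<in>\<Union>\<D>. (\<Prod>D\<in>\<D>. P D (\<lambda>i. h i v)) = 0"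
  using P(2) assms(2) by (auto intro!: prod_zero)
 ultimately show False using alg_indepD[OF assms(1,3), of "\<lambda>p. \<Prod>D\<in>\<D>. P D p"] by blast
qed

text \<open>\<open>c\<close> is chosen in the open set covered by \<open>dominant_image\<close>.
  With its coordinates in \<open>I\<close> fixed, the coordinates in \<open>J\<close> still cover a
  nonempty open set, so no nonzero polynomial in them vanishes on the slice.\<close>

lemma alg_indep_slice:
 fixes X :: "('v \<Rightarrow> 'k::alg_closed_field) set" and h :: "'i \<Rightarrow> 'v \<Rightarrow> 'k"
 assumes irr: "irreducible_on X S" and aff: "affine_on X S" and fin: "finite X" "finite I" "finite J"
  and h: "\<And>i. i \<in> I \<union> J \<Longrightarrow> h i \<in> PF X" and ind: "alg_indep S h (I \<union> J)" and disj: "I \<inter> J = {}"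
  and q: "q \<in> PF X" "\<exists>v\<in>S. q v \<noteq> 0"
 obtains c where "alg_indep {v \<in> S. q v \<noteq> 0 \<and> (\<forall>i\<in>I. h i v = c i)} h J"
proof -
 have finIJ: "finite (I \<union> J)" using fin by auto
 have "\<exists>r\<in>PF (coords (I \<union> J)). (\<exists>p. r p \<noteq> 0) \<and>
   (\<forall>p. r p \<noteq> 0 \<longrightarrow> (\<exists>v\<in>S. q v \<noteq> 0 \<and> (\<forall>i\<in>I \<union> J. h i v = p i)))"
  by (rule dominant_image[OF irr aff fin(1) finIJ h ind q])
 then obtain r c where r: "r \<in> PF (coords (I \<union> J))" "r c \<noteq> 0"
  and im: "\<And>p. r p \<noteq> 0 \<Longrightarrow> \<exists>v\<in>S. q v \<noteq> 0 \<and> (\<forall>i\<in>I \<union> J. h i v = p i)" by blast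
 define m where "m p i = (if i \<in> I then c i else p i)" for p i
 have rm: "(\<lambda>p. r (m p)) \<in> PF (coords J)"
 proof (rule PF_comp[OF r(1)])
  fix x :: "('i \<Rightarrow> 'k) \<Rightarrow> 'k" assume "x \<in> coords (I \<union> J)"
  then obtain i where i: "i \<in> I \<union> J" "x = (\<lambda>p. p i)" unfolding coords_def by blast
  show "(\<lambda>p. x (m p)) \<in> PF (coords J)"
  proof (cases "i \<in> I")
   case True
   then show ?thesis using i by (simp add: m_def PF_const)
  next
   case False
   then show ?thesis using i by (auto simp: m_def coords_def intro: PF_coord)
  qed
 qed
 have "m c = c" unfolding m_def by auto
 then have rm0: "\<exists>p\<in>UNIV. r (m p) \<noteq> 0" using r(2) by (intro bexI[of _ c]) auto
 have "alg_indep {v \<in> S. q v \<noteq> 0 \<and> (\<forall>i\<in>I. h i v = c i)} h J"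
  unfolding alg_indep_iff[OF fin(3)]
 proof (intro ballI impI)
  fix P assume P: "P \<in> PF (coords J)"
   and 0: "\<forall>v\<in>{v \<in> S. q v \<noteq> 0 \<and> (\<forall>i\<in>I. h i v = c i)}. P (\<lambda>i. h i v) = 0"
  have "P p = 0" if rp: "r (m p) \<noteq> 0" for p
  proof -
   obtain v where v: "v \<in> S" "q v \<noteq> 0" "\<forall>i\<in>I \<union> J. h i v = m p i" using im[OF rp] by blast
   then have "P (\<lambda>i. h i v) = 0" using 0 unfolding m_def by auto
   moreover have "P (\<lambda>i. h i v) = P p"
    by (rule PF_coords_cong[OF P]) (use v(3) disj in \<open>auto simp: m_def\<close>)
   ultimately show ?thesis by simp
  qed
  then show "\<forall>p. P p = 0"
   using irreducible_on_dense[OF irreducible_on_coords[OF fin(3)] P rm rm0] by blast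
 qed
 then show ?thesis using that by blast
qed

text \<open>Fixing one basis function at a suitable value leaves the others independent on the
  slice, hence on one of its components, from which the chain continues downwards.\<close>

lemma irreducible_chain:
 fixes X :: "('v \<Rightarrow> 'k::alg_closed_field) set"
 assumes "finite X" "irreducible_on X S" "affine_on X S" "Y \<subseteq> X" "alg_indep S (\<lambda>y. y) Y"
 shows "\<exists>Z. (\<forall>i\<le>card Y. zclosed X S (Z i) \<and> irreducible_on X (Z i)) \<and> (\<forall>i<card Y. Z i \<subset> Z (Suc i)) \<and>
  Z (card Y) = S"
proof -
 have "finite Y" using assms finite_subset by blast
 then show ?thesis using assms(2-)
 proof (induction Y arbitrary: S rule: finite_induct)
  case empty
  then show ?case by (intro exI[of _ "\<lambda>_. S"]) (auto intro: zclosed_refl)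
 next
  case (insert y Y)
  have "S \<noteq> {}" using insert.prems(1) unfolding irreducible_on_def by blast
  obtain c where "alg_indep {v \<in> S. 1 \<noteq> (0::'k) \<and> (\<forall>i\<in>{y}. i v = c i)} (\<lambda>y. y) Y"
   by (rule alg_indep_slice[OF insert.prems(1,2) assms(1), of "{y}" Y "\<lambda>y. y" "\<lambda>_. 1"])
    (use insert \<open>S \<noteq> {}\<close> in \<open>auto intro: PF_const PF_coord\<close>)
  then have ind: "alg_indep {v \<in> S. y v - c y = 0} (\<lambda>y. y) Y" by simp
  have yX: "(\<lambda>v. y v - c y) \<in> PF X"
   using insert.prems(3) by (intro PF_intros) (auto intro: PF_coord)
  obtain \<D> where \<D>: "finite \<D>" "\<And>D. D \<in> \<D> \<Longrightarrow> zclosed X S D" "\<And>D. D \<in> \<D> \<Longrightarrow> irreducible_on X D"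
   "{v \<in> S. y v - c y = 0} = \<Union>\<D>"
   by (rule irreducible_decomposition[OF assms(1) zclosed_zero_set[OF yX]]) (rule that)
  obtain D where D: "D \<in> \<D>" "alg_indep D (\<lambda>y. y) Y"
   using alg_indep_Union[of \<D> "\<lambda>y. y" Y] ind \<D> insert.hyps by auto
  have zD: "zclosed X S D" using \<D> D by blast
  have "D \<noteq> S"
  proof
   assume "D = S"
   then have 0: "\<forall>v\<in>S. y v - c y = 0" using \<D>(4) D(1) by blast
   have 1: "alg_indep S (\<lambda>y. y) {y}"
    by (rule alg_indep_subset[OF insert.prems(4)]) (use insert.hyps in auto)
   have 2: "(\<lambda>p. p y - c y) \<in> PF (coords {y})"
    by (intro PF_intros) (auto simp: coords_def intro: PF_coord)
   \<comment> \<open>Were \<open>y\<close> constant on \<open>S\<close>, then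
     \<open>p y - c y\<close> would be a relation; its value at \<open>c y + 1\<close> shows that it
     is not the zero polynomial.\<close>
   have "c y + 1 - c y = 0"
    by (rule alg_indepD[OF 1 _ 2, of "\<lambda>_. c y + 1"]) (use 0 in auto)
   then show False by simp
  qed
  then have "D \<subset> S" using zclosed_subset[OF zD] by blast
  obtain Z where Z: "\<And>i. i \<le> card Y \<Longrightarrow> zclosed X D (Z i) \<and> irreducible_on X (Z i)"
   "\<And>i. i < card Y \<Longrightarrow> Z i \<subset> Z (Suc i)" "Z (card Y) = D"
   using insert.IH[of D] affine_on_zclosed[OF insert.prems(2) zD] \<D>(3) D insert.prems(3) by blast
  define Z' where "Z' i = (if i \<le> card Y then Z i else S)" for i
  have "zclosed X S (Z' i) \<and> irreducible_on X (Z' i)" for i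
   unfolding Z'_def using Z(1) zclosed_trans[OF zD] insert.prems(1) zclosed_refl by auto
  moreover have "Z' i \<subset> Z' (Suc i)" if "i < Suc (card Y)" for i
   using that Z(2,3) \<open>D \<subset> S\<close> unfolding Z'_def by (cases "i = card Y") auto
  moreover have "Z' (Suc (card Y)) = S" unfolding Z'_def by simp
  ultimately show ?case using insert.hyps by (intro exI[of _ Z']) auto
 qed
qed

text \<open>Along a chain the growth exponent drops at every inclusion. Conversely, each component
  carries a chain as long as a transcendence basis of it.\<close>

theorem krull_dimension_le_iff:
 fixes X :: "('v \<Rightarrow> 'k::alg_closed_field) set"
 assumes fin: "finite X" and aff: "affine_on X S"
 shows "krull_dimension (subtopology (zariski_topology X) S) \<le> enat d \<longleftrightarrow> growth S X d"
proof
 assume gr: "growth S X d"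
 have "m \<le> d" if Z: "\<And>i. i \<le> m \<Longrightarrow> zclosed X S (Z i) \<and> irreducible_on X (Z i)"
  "\<And>i. i < m \<Longrightarrow> Z i \<subset> Z (Suc i)" for m Z
 proof -
  have "\<exists>e. e + n \<le> d \<and> growth (Z (m - n)) X e" if "n \<le> m" for n
   using that
  proof (induction n)
   case 0
   have "Z m \<subseteq> S" using Z(1)[of m] zclosed_subset by blast
   then show ?case using growth_subset[OF gr, of "Z m" X] by auto
  next
   case (Suc n)
   then obtain e where e: "e + n \<le> d" "growth (Z (m - n)) X e" by auto
   have eq: "Suc (m - Suc n) = m - n" using Suc.prems by simp
   have ss: "Z (m - Suc n) \<subset> Z (m - n)" using Z(2)[of "m - Suc n"] Suc.prems unfolding eq by simp
   then obtain v where v: "v \<in> Z (m - n)" "v \<notin> Z (m - Suc n)" by blast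
   have "v \<in> S" using v(1) Z(1)[of "m - n"] zclosed_subset by fastforce
   then obtain g where "g \<in> PF X" "g v \<noteq> 0" "\<forall>w\<in>Z (m - Suc n). g w = 0"
    using zclosed_separate[of X S "Z (m - Suc n)" v] Z(1)[of "m - Suc n"] v(2) by auto
   then obtain e' where "Suc e' \<le> e" "growth (Z (m - Suc n)) X e'"
    using growth_proper_subset[OF fin _ _ _ _ _ _ e(2), of "Z (m - Suc n)" g]
     Z(1)[of "m - n"] Z(1)[of "m - Suc n"] ss v(1) by auto
   then show ?case using e(1) by (intro exI[of _ e']) auto
  qed
  from this[of m] show ?thesis by auto
 qed
 then show "krull_dimension (subtopology (zariski_topology X) S) \<le> enat d"
  unfolding krull_dimension_def closedin_zariski_subtopology
  by (intro Sup_least) (clarsimp, metis irreducible_subset_zariski zclosed_subset)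
next
 assume kd: "krull_dimension (subtopology (zariski_topology X) S) \<le> enat d"
 obtain \<D> where \<D>: "finite \<D>" "\<And>D. D \<in> \<D> \<Longrightarrow> zclosed X S D" "\<And>D. D \<in> \<D> \<Longrightarrow> irreducible_on X D" "S = \<Union>\<D>"
  by (rule irreducible_decomposition[OF fin zclosed_refl]) (rule that)
 have "growth D X d" if D: "D \<in> \<D>" for D
 proof -
  have irr: "irreducible_on X D" using \<D>(3) D .
  obtain Y where Y: "Y \<subseteq> X" "alg_indep D (\<lambda>y. y) Y" "growth D X (card Y)"
   by (rule transcendence_basis[OF irr fin]) (rule that)
  obtain Z where Z: "\<And>i. i \<le> card Y \<Longrightarrow> zclosed X D (Z i) \<and> irreducible_on X (Z i)"
   "\<And>i. i < card Y \<Longrightarrow> Z i \<subset> Z (Suc i)"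
   using irreducible_chain[OF fin irr affine_on_zclosed[OF aff \<D>(2)[OF D]] Y(1,2)] by blast
  have "zclosed X S (Z i)" if "i \<le> card Y" for i using zclosed_trans[OF \<D>(2)[OF D]] Z(1)[OF that] by blast
  then have "enat (card Y) \<le> krull_dimension (subtopology (zariski_topology X) S)"
   unfolding krull_dimension_def closedin_zariski_subtopology
   using Z by (intro Sup_upper CollectI exI[of _ "card Y"] conjI refl exI[of _ Z] allI impI)
    (auto simp: irreducible_subset_zariski[OF zclosed_subset[of X]])
  then have "enat (card Y) \<le> enat d" using kd order_trans by blast
  then show ?thesis using growth_mono[OF Y(3)] by simp
 qed
 then have "growth (\<Union>D\<in>\<D>. D) X d" by (rule growth_UN[OF \<D>(1)])
 then show "growth S X d" using \<D>(4) by simp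
qed

section \<open>Openness of injectivity\<close>

text \<open>Column \<open>c\<close> is eliminated with a pivot row \<open>r\<close> that is nonzero
  at \<open>w0\<close>; multiplying instead of dividing keeps the entries polynomial. In the
  semicontinuity argument there is one row for each point of an irreducible set, so no determinant
  is at hand.\<close>

lemma trivial_kernel_open:
 fixes \<psi> :: "'l \<Rightarrow> 'j \<Rightarrow> 'w \<Rightarrow> 'k::field"
 assumes "finite J" "\<And>l j. l \<in> L \<Longrightarrow> j \<in> J \<Longrightarrow> \<psi> l j \<in> PF X"
  and "\<And>\<theta>. (\<And>l. l \<in> L \<Longrightarrow> (\<Sum>j\<in>J. \<theta> j * \<psi> l j w0) = 0) \<Longrightarrow> \<forall>j\<in>J. \<theta> j = 0"
 shows "\<exists>D\<in>PF X. D w0 \<noteq> 0 \<and> (\<forall>w. D w \<noteq> 0 \<longrightarrow>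
  (\<forall>\<theta>. (\<forall>l\<in>L. (\<Sum>j\<in>J. \<theta> j * \<psi> l j w) = 0) \<longrightarrow> (\<forall>j\<in>J. \<theta> j = 0)))"
 using assms
proof (induction J arbitrary: \<psi> rule: finite_induct)
 case empty
 show ?case by (intro bexI[of _ "\<lambda>_. 1"]) (auto intro: PF_const)
next
 case (insert c J)
 have "\<exists>r\<in>L. \<psi> r c w0 \<noteq> 0"
 proof (rule ccontr)
  assume no: "\<not> ?thesis"
  define e where "e j = (if j = c then 1 else 0 :: 'k)" for j
  have "(\<Sum>j\<in>insert c J. e j * \<psi> l j w0) = 0" if "l \<in> L" for l
  proof -
   have "(\<Sum>j\<in>J. e j * \<psi> l j w0) = 0"
    by (rule sum.neutral) (use insert.hyps(2) in \<open>auto simp: e_def\<close>)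
   then show ?thesis using insert.hyps no that by (simp add: e_def)
  qed
  then have "\<forall>j\<in>insert c J. e j = 0" using insert.prems(2)[of e] by blast
  then show False unfolding e_def by auto
 qed
 then obtain r where r: "r \<in> L" "\<psi> r c w0 \<noteq> 0" by blast
 define \<phi> where "\<phi> l j w = \<psi> r c w * \<psi> l j w - \<psi> l c w * \<psi> r j w" for l j w
 have sum\<phi>: "(\<Sum>j\<in>J. \<theta> j * \<phi> l j w) = \<psi> r c w * (\<Sum>j\<in>insert c J. \<theta> j * \<psi> l j w)
   - \<psi> l c w * (\<Sum>j\<in>insert c J. \<theta> j * \<psi> r j w)" for \<theta> l w
  using insert.hyps unfolding \<phi>_def
  by (simp add: algebra_simps sum_subtractf sum_distrib_left)
 have "\<exists>D\<in>PF X. D w0 \<noteq> 0 \<and> (\<forall>w. D w \<noteq> 0 \<longrightarrow>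
  (\<forall>\<theta>. (\<forall>l\<in>L. (\<Sum>j\<in>J. \<theta> j * \<phi> l j w) = 0) \<longrightarrow> (\<forall>j\<in>J. \<theta> j = 0)))"
 proof (rule insert.IH)
  fix l j assume "l \<in> L" "j \<in> J"
  then show "\<phi> l j \<in> PF X"
   unfolding \<phi>_def[abs_def] using r by (intro PF_intros insert.prems) auto
 next
  fix \<theta> assume \<theta>: "\<And>l. l \<in> L \<Longrightarrow> (\<Sum>j\<in>J. \<theta> j * \<phi> l j w0) = 0"
  \<comment> \<open>A kernel vector of the reduced system is extended to the pivot column by solving
    row \<open>r\<close> at \<open>w0\<close>.\<close>
  define \<mu> where "\<mu> = \<theta>(c := - (\<Sum>j\<in>J. \<theta> j * \<psi> r j w0) / \<psi> r c w0)"
  have \<mu>J: "(\<Sum>j\<in>J. \<mu> j * F j) = (\<Sum>j\<in>J. \<theta> j * F j)" for F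
   by (rule sum.cong) (use insert.hyps in \<open>auto simp: \<mu>_def\<close>)
  have 0: "(\<Sum>j\<in>insert c J. \<mu> j * \<psi> r j w0) = 0"
   using insert.hyps r(2) by (simp add: \<mu>J) (simp add: \<mu>_def)
  have "(\<Sum>j\<in>insert c J. \<mu> j * \<psi> l j w0) = 0" if "l \<in> L" for l
   using sum\<phi>[of \<mu> l w0] \<theta>[OF that] r(2) unfolding 0 \<mu>J by simp
  then have "\<forall>j\<in>insert c J. \<mu> j = 0" using insert.prems(2)[of \<mu>] by blast
  then have "\<mu> j = 0" if "j \<in> J" for j using that by blast
  moreover have "\<mu> j = \<theta> j" if "j \<in> J" for j using that insert.hyps(2) unfolding \<mu>_def by auto
  ultimately show "\<forall>j\<in>J. \<theta> j = 0" by metis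
 qed
 then obtain D where D: "D \<in> PF X" "D w0 \<noteq> 0"
  and ker: "\<And>w \<theta>. D w \<noteq> 0 \<Longrightarrow> \<forall>l\<in>L. (\<Sum>j\<in>J. \<theta> j * \<phi> l j w) = 0 \<Longrightarrow> \<forall>j\<in>J. \<theta> j = 0" by blast
 have "\<forall>j\<in>insert c J. \<theta> j = 0"
  if w: "\<psi> r c w * D w \<noteq> 0" and \<theta>: "\<forall>l\<in>L. (\<Sum>j\<in>insert c J. \<theta> j * \<psi> l j w) = 0" for w \<theta>
 proof -
  have "\<forall>l\<in>L. (\<Sum>j\<in>J. \<theta> j * \<phi> l j w) = 0" using \<theta> r(1) by (simp only: sum\<phi>) simp
  then have J0: "\<forall>j\<in>J. \<theta> j = 0" using ker[of w \<theta>] w by simp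
  have "(\<Sum>j\<in>insert c J. \<theta> j * \<psi> r j w) = 0" using \<theta> r(1) by blast
  then have "\<theta> c * \<psi> r c w = 0" using insert.hyps J0 by simp
  then show ?thesis using w J0 by auto
 qed
 moreover have "(\<lambda>w. \<psi> r c w * D w) \<in> PF X" using r D(1) insert.prems(1) by (intro PF_intros) auto
 ultimately show ?case using r D(2) by (intro bexI[of _ "\<lambda>w. \<psi> r c w * D w"]) auto
qed

text \<open>The Sylvester matrix of \<open>G\<close> and \<open>R\<close>, of formal degrees \<open>D\<close> and \<open>E\<close>, is injective at \<open>w0\<close>.\<close>

lemma no_common_root_open:
 fixes G R :: "'w \<Rightarrow> 'k::field poly"
 assumes G: "\<And>j. cf G j \<in> PF X" "\<And>w. degree (G w) \<le> D" "G w0 = 1"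
  and R: "\<And>j. cf R j \<in> PF X" "\<And>w. degree (R w) \<le> E" "coeff (R w0) E \<noteq> 0"
 shows "\<exists>Q\<in>PF X. Q w0 \<noteq> 0 \<and> (\<forall>w. Q w \<noteq> 0 \<longrightarrow> \<not> (\<exists>a. poly (G w) a = 0 \<and> poly (R w) a = 0))"
proof -
 define n where "n = Suc D + E"
 define \<psi> where "\<psi> l c w = coeff (case l of Inl r \<Rightarrow> monom 1 r * G w | Inr j \<Rightarrow> monom 1 j * R w) c"
  for l :: "nat + nat" and c w
 have \<psi>l: "\<psi> (Inl r) c w = (if c < r then 0 else coeff (G w) (c - r))" for r c w
  unfolding \<psi>_def by (simp add: coeff_monom_mult)
 have \<psi>r: "\<psi> (Inr r) c w = (if c < r then 0 else coeff (R w) (c - r))" for r c w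
  unfolding \<psi>_def by (simp add: coeff_monom_mult)
 have PF\<psi>: "\<psi> l c \<in> PF X" for l c
 proof (cases l)
  case (Inl r)
  then show ?thesis by (simp only: \<psi>l[abs_def]) (intro PF_if PF_const G)
 next
  case (Inr r)
  then show ?thesis by (simp only: \<psi>r[abs_def]) (intro PF_if PF_const R)
 qed
 have ker0: "\<forall>c\<in>{..<n}. \<theta> c = 0"
  if \<theta>: "\<And>l. l \<in> Inl ` {..<E} \<union> Inr ` {..<Suc D} \<Longrightarrow> (\<Sum>c<n. \<theta> c * \<psi> l c w0) = 0" for \<theta>
 proof
  fix c assume "c \<in> {..<n}"
  then show "\<theta> c = 0"
  proof (induction c rule: less_induct)
   case (less c)
   show ?case
   proof (cases "c < E")
    case True
    \<comment> \<open>At \<open>w0\<close> the shifts of \<open>G = 1\<close> are unit vectors and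
      settle the entries below \<open>E\<close>; the shifts of \<open>R\<close> are triangular with
      its nonzero top coefficient on the diagonal and settle the rest.\<close>
    have "\<psi> (Inl c) d w0 = (if d = c then 1 else 0)" for d by (simp add: \<psi>l G(3))
    then have "(\<Sum>d<n. \<theta> d * \<psi> (Inl c) d w0) = \<theta> c"
     using less.prems by (simp add: if_distrib[of "\<lambda>x. _ * x"] cong: if_cong)
    moreover have "(\<Sum>d<n. \<theta> d * \<psi> (Inl c) d w0) = 0" by (rule \<theta>) (use True in auto)
    ultimately show ?thesis by simp
   next
    case False
    define j where "j = c - E"
    have j: "j < Suc D" "c = E + j" using False less.prems unfolding j_def n_def by auto
    have zero: "\<theta> d * \<psi> (Inr j) d w0 = 0" if "d \<in> {..<n} - {c}" for d
    proof (cases "d < c")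
     case True
     then show ?thesis using less.IH that by auto
    next
     case False
     then have "degree (R w0) < d - j" using that j R(2)[of w0] by auto
     then show ?thesis by (simp add: \<psi>r coeff_eq_0)
    qed
    have "(\<Sum>d\<in>{..<n} - {c}. \<theta> d * \<psi> (Inr j) d w0) = 0"
     by (rule sum.neutral) (rule ballI, rule zero)
    then have "(\<Sum>d<n. \<theta> d * \<psi> (Inr j) d w0) = \<theta> c * \<psi> (Inr j) c w0"
     using less.prems by (subst sum.remove[of _ c]) auto
    moreover have "(\<Sum>d<n. \<theta> d * \<psi> (Inr j) d w0) = 0" by (rule \<theta>) (use j in auto)
    ultimately show ?thesis using R(3) j(2) by (simp add: \<psi>r)
   qed
  qed
 qed
 have "\<exists>Q\<in>PF X. Q w0 \<noteq> 0 \<and> (\<forall>w. Q w \<noteq> 0 \<longrightarrow>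
  (\<forall>\<theta>. (\<forall>l\<in>Inl ` {..<E} \<union> Inr ` {..<Suc D}. (\<Sum>c<n. \<theta> c * \<psi> l c w) = 0) \<longrightarrow> (\<forall>c\<in>{..<n}. \<theta> c = 0)))"
 proof (rule trivial_kernel_open)
  fix \<theta> assume "\<And>l. l \<in> Inl ` {..<E} \<union> Inr ` {..<Suc D} \<Longrightarrow> (\<Sum>c<n. \<theta> c * \<psi> l c w0) = 0"
  then show "\<forall>c\<in>{..<n}. \<theta> c = 0" by (rule ker0)
 qed (rule finite_lessThan, rule PF\<psi>)
 then obtain Q where Q: "Q \<in> PF X" "Q w0 \<noteq> 0"
  and ker': "\<forall>w. Q w \<noteq> 0 \<longrightarrow>
  (\<forall>\<theta>. (\<forall>l\<in>Inl ` {..<E} \<union> Inr ` {..<Suc D}. (\<Sum>c<n. \<theta> c * \<psi> l c w) = 0) \<longrightarrow> (\<forall>c\<in>{..<n}. \<theta> c = 0))"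
  by (elim bexE conjE)
 have ker: "\<forall>c\<in>{..<n}. \<theta> c = 0" if "Q w \<noteq> 0"
  "\<forall>l\<in>Inl ` {..<E} \<union> Inr ` {..<Suc D}. (\<Sum>c<n. \<theta> c * \<psi> l c w) = 0" for w \<theta>
  using ker' that by (elim allE impE) (assumption | rule that)+
 have "Q w = 0" if a: "poly (G w) a = 0" "poly (R w) a = 0" for w a
 proof (rule ccontr)
  assume "Q w \<noteq> 0"
  have ev: "(\<Sum>c<n. a ^ c * coeff p c) = poly p a" if "degree p < n" for p
   unfolding poly_altdef using that
   by (intro sum.mono_neutral_cong_right) (auto simp: coeff_eq_0 mult.commute)
  \<comment> \<open>The powers of a common root form a kernel vector, whose entry at 0 is 1.\<close>
  have "(\<Sum>c<n. a ^ c * \<psi> l c w) = 0" if "l \<in> Inl ` {..<E} \<union> Inr ` {..<Suc D}" for l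
  proof -
   define p where "p = (case l of Inl r \<Rightarrow> monom 1 r * G w | Inr j \<Rightarrow> monom 1 j * R w)"
   have "degree p < n"
   proof (cases l)
    case (Inl r)
    then have "r < E" using that by auto
    then show ?thesis using degree_mult_le[of "monom 1 r" "G w"] degree_monom_le[of "1::'k" r] G(2)[of w]
     unfolding p_def Inl n_def by auto
   next
    case (Inr r)
    then have "r < Suc D" using that by auto
    then show ?thesis using degree_mult_le[of "monom 1 r" "R w"] degree_monom_le[of "1::'k" r] R(2)[of w]
     unfolding p_def Inr n_def by auto
   qed
   then have "(\<Sum>c<n. a ^ c * \<psi> l c w) = poly p a" unfolding \<psi>_def p_def[symmetric] by (rule ev)
   also have "\<dots> = 0" unfolding p_def by (cases l) (auto simp: a)
   finally show ?thesis .
  qed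
  then have "\<forall>c\<in>{..<n}. a ^ c = 0" using ker[OF \<open>Q w \<noteq> 0\<close>, of "\<lambda>c. a ^ c"] by blast
  then have "a ^ 0 = (0 :: 'k)" unfolding n_def by (metis lessThan_iff zero_less_Suc add_Suc)
  then show False by simp
 qed
 then show ?thesis using Q by blast
qed

text \<open>An ideal of polynomials in one variable is generated by a member of least degree, and a
  generator without roots is constant.\<close>

lemma poly_ideal_one:
 fixes I :: "'k::alg_closed_field poly set"
 assumes add: "\<And>p q. p \<in> I \<Longrightarrow> q \<in> I \<Longrightarrow> p + q \<in> I" and mult: "\<And>p q. p \<in> I \<Longrightarrow> q * p \<in> I"
  and root: "\<And>a. \<exists>p\<in>I. poly p a \<noteq> 0"
 shows "1 \<in> I"
proof -
 obtain p0 where "p0 \<in> I \<and> p0 \<noteq> 0" using root[of 0] by force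
 then have "\<exists>p. (p \<in> I \<and> p \<noteq> 0) \<and> (\<forall>q. q \<in> I \<and> q \<noteq> 0 \<longrightarrow> degree p \<le> degree q)"
  by (rule ex_has_least_nat)
 then obtain p where p: "p \<in> I" "p \<noteq> 0" and min: "\<And>q. q \<in> I \<Longrightarrow> q \<noteq> 0 \<Longrightarrow> degree p \<le> degree q" by blast
 have "p dvd q" if q: "q \<in> I" for q
 proof -
  have "q mod p = q + (- (q div p)) * p" by (simp add: minus_div_mult_eq_mod[symmetric])
  then have "q mod p \<in> I" using add mult q p(1) by metis
  then have "q mod p = 0" using min degree_mod_less[OF p(2), of q] by fastforce
  then show ?thesis by (simp add: mod_eq_0_iff_dvd)
 qed
 then have "poly p a \<noteq> 0" for a using root[of a] by (metis dvd_def mult_zero_left poly_mult)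
 then have "degree p = 0" using alg_closed_imp_poly_has_root[of p] by auto
 then obtain c where c: "p = [:c:]" by (rule degree_eq_zeroE)
 then have "[:inverse c:] * p = 1" using p(2) by (simp add: one_pCons)
 then show ?thesis using mult[OF p(1)] by metis
qed

section \<open>Tuples of matrices\<close>

definition tuple_coords :: "nat set \<Rightarrow> ((nat \<Rightarrow> 'k ^ 'n ^ 'n) \<Rightarrow> 'k) set" where
 "tuple_coords I = (\<lambda>(s, i, j) g. g s $ i $ j) ` (I \<times> UNIV \<times> UNIV)"

definition GL_tuples :: "nat set \<Rightarrow> (nat \<Rightarrow> 'k::field ^ 'n ^ 'n) set" where
 "GL_tuples I = {g. \<forall>s\<in>I. invertible (g s)}"

lemma finite_tuple_coords: "finite I \<Longrightarrow> finite (tuple_coords I)"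
 unfolding tuple_coords_def by auto

lemma PF_tuple_entry: "s \<in> I \<Longrightarrow> (\<lambda>g. g s $ i $ j) \<in> PF (tuple_coords I)"
 by (rule PF_coord) (auto simp: tuple_coords_def image_iff)

lemma PF_tuple_subst:
 assumes "f \<in> PF (tuple_coords I)" "\<And>s i j. s \<in> I \<Longrightarrow> (\<lambda>w. T w s $ i $ j) \<in> PF Y"
 shows "(\<lambda>w. f (T w)) \<in> PF Y"
 by (rule PF_comp[OF assms(1)]) (auto simp: tuple_coords_def assms(2))

lemma PF_matrix_mult:
 assumes "\<And>i j. (\<lambda>w. A w $ i $ j) \<in> PF X" "\<And>i j. (\<lambda>w. B w $ i $ j) \<in> PF X"
 shows "(\<lambda>w. (A w ** B w) $ i $ j) \<in> PF X"
 unfolding matrix_matrix_mult_def vec_lambda_beta by (intro PF_intros assms)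

lemma PF_parameter:
 fixes F :: "'w \<Rightarrow> 'k::field \<Rightarrow> 'k"
 assumes "(\<lambda>p. F (fst p) (snd p)) \<in> PF (insert snd ((\<lambda>x p. x (fst p)) ` X))"
 shows "\<exists>\<pi> D. (\<forall>j. cf \<pi> j \<in> PF X) \<and> (\<forall>w. degree (\<pi> w) \<le> D) \<and> (\<forall>w a. F w a = poly (\<pi> w) a)"
proof -
 obtain \<pi> D where \<pi>: "\<And>p. degree (\<pi> p) \<le> D" "\<And>j. cf \<pi> j \<in> PF ((\<lambda>x p. x (fst p)) ` X)"
  "\<And>p. F (fst p) (snd p) = poly (\<pi> p) (snd p)" using PF_insert[OF assms] by blast
 \<comment> \<open>The coefficients are functions of the first component alone, so the second may be
   frozen at 0.\<close>
 have eq: "\<pi> (w, a) = \<pi> (w, 0)" for w a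
  by (intro poly_eqI PF_eq[OF \<pi>(2)]) auto
 have "F w a = poly (\<pi> (w, 0)) a" for w a
  using \<pi>(3)[of "(w, a)"] unfolding eq[of w a] by (simp only: fst_conv snd_conv)
 moreover have "(\<lambda>w. coeff (\<pi> (w, 0)) j) \<in> PF X" for j
  by (rule PF_comp[OF \<pi>(2)]) (auto intro: PF_coord)
 ultimately show ?thesis using \<pi>(1) by (intro exI[of _ "\<lambda>w. \<pi> (w, 0)"] exI[of _ D]) auto
qed

section \<open>Parabolic subgroups of the general linear group\<close>

text \<open>The stabilizer of the flag of coordinate subspaces spanned by the basis vectors of level
  at most \<open>l\<close>; for injective \<open>c\<close> it is a Borel subgroup.\<close>

definition parabolic :: "('n \<Rightarrow> nat) \<Rightarrow> ('k::field ^ 'n ^ 'n) set" where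
 "parabolic c = {p. invertible p \<and> (\<forall>i j. p $ i $ j \<noteq> 0 \<longrightarrow> c i \<le> c j)}"

lemma parabolic_mult:
 assumes "p \<in> parabolic c" "q \<in> parabolic c"
 shows "p ** q \<in> parabolic c"
proof -
 have "c i \<le> c j" if "(p ** q) $ i $ j \<noteq> 0" for i j
 proof -
  have "\<exists>k. p $ i $ k * q $ k $ j \<noteq> 0"
  proof (rule ccontr)
   assume "\<not> ?thesis"
   then have "(p ** q) $ i $ j = 0" unfolding matrix_matrix_mult_def vec_lambda_beta
    by (intro sum.neutral) blast
   then show False using that by simp
  qed
  then obtain k where "p $ i $ k \<noteq> 0" "q $ k $ j \<noteq> 0" by auto
  then have "c i \<le> c k" "c k \<le> c j" using assms unfolding parabolic_def by blast+
  then show ?thesis by simp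
 qed
 then show ?thesis using assms unfolding parabolic_def by (auto intro: invertible_mult)
qed

lemma invertible_one: "invertible (mat 1 :: 'k::field ^ 'n ^ 'n)"
 unfolding invertible_def by (intro exI[of _ "mat 1"]) simp

lemma one_parabolic: "mat 1 \<in> parabolic c"
 using invertible_one unfolding parabolic_def by (auto simp: mat_def)

text \<open>\<open>p\<close> maps each space of the flag injectively into itself, hence onto it, so
  its inverse preserves the flag too.\<close>

lemma parabolic_left_inverse:
 fixes p :: "'k::field ^ 'n ^ 'n"
 assumes p: "p \<in> parabolic c" and q: "q ** p = mat 1"
 shows "q \<in> parabolic c"
proof -
 define W where "W l = {v :: 'k ^ 'n. \<forall>i. v $ i \<noteq> 0 \<longrightarrow> c i \<le> l}" for l
 have W: "vec.subspace (W l)" for l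
  unfolding vec.subspace_def W_def by auto (metis add.right_neutral)
 have pW: "(*v) p ` W l \<subseteq> W l" for l
 proof clarify
  fix v assume v: "v \<in> W l"
  have "c i \<le> l" if "(p *v v) $ i \<noteq> 0" for i
  proof -
   have "\<exists>k. p $ i $ k * v $ k \<noteq> 0"
   proof (rule ccontr)
    assume "\<not> ?thesis"
    then have "(p *v v) $ i = 0" unfolding matrix_vector_mult_def vec_lambda_beta
     by (intro sum.neutral) blast
    then show False using that by simp
   qed
   then obtain k where "p $ i $ k \<noteq> 0" "v $ k \<noteq> 0" by auto
   then have "c i \<le> c k" "c k \<le> l" using p v unfolding parabolic_def W_def by blast+
   then show ?thesis by simp
  qed
  then show "p *v v \<in> W l" unfolding W_def by blast
 qed
 have "inj ((*v) p)" using p inj_matrix_vector_mult unfolding parabolic_def by blast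
 then have "vec.dim ((*v) p ` W l) = vec.dim (W l)" for l
  by (intro vec.dim_image_eq) (auto intro: inj_on_subset)
 then have eq: "(*v) p ` W l = W l" for l
  using vec.subspace_dim_equal[OF vec.subspace_image[OF W] W pW] by simp
 have qW: "q *v v \<in> W l" if v: "v \<in> W l" for v l
 proof -
  have "v \<in> (*v) p ` W l" unfolding eq by (rule v)
  then obtain w where "w \<in> W l" "v = p *v w" by blast
  then show ?thesis by (simp add: matrix_vector_mul_assoc q)
 qed
 have "c i \<le> c j" if "q $ i $ j \<noteq> 0" for i j
 proof -
  have "q *v axis j 1 \<in> W (c j)" by (rule qW) (auto simp: W_def axis_def)
  moreover have "(q *v axis j 1) $ i = q $ i $ j"
   by (simp add: matrix_vector_mult_def axis_def if_distrib[of "\<lambda>x. _ * x"] cong: if_cong)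
  ultimately show ?thesis using that unfolding W_def by auto
 qed
 moreover have "invertible q" using q unfolding invertible_right_inverse by blast
 ultimately show ?thesis unfolding parabolic_def by blast
qed

text \<open>In a minimal parabolic subgroup modulo the Borel subgroup only the line spanned by
  column \<open>i\<close> counts. Here it has \<open>a\<close> in row \<open>i\<close> and 1 in row
  \<open>i'\<close>, the affine chart of a projective line; \<open>shear\<close> has 1 in row
  \<open>i\<close> and \<open>a\<close> in row \<open>i'\<close>, the chart around the missing
  point.\<close>

definition swap_shear :: "'n \<Rightarrow> 'n \<Rightarrow> 'k::field \<Rightarrow> 'k ^ 'n ^ 'n" where
 "swap_shear i i' a = (\<chi> x y. if x = i then (if y = i then a else if y = i' then 1 else 0)
  else if x = i' then (if y = i then 1 else 0) else if x = y then 1 else 0)"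

definition shear :: "'n \<Rightarrow> 'n \<Rightarrow> 'k::field \<Rightarrow> 'k ^ 'n ^ 'n" where
 "shear i i' a = (\<chi> x y. if x = i' \<and> y = i then a else if x = y then 1 else 0)"

lemma swap_shear_mult:
 assumes "i \<noteq> i'"
 shows "(swap_shear i i' a ** X) $ x $ y = (if x = i then a * X $ i $ y + X $ i' $ y
  else if x = i' then X $ i $ y else X $ x $ y)"
proof -
 have "(\<Sum>z\<in>UNIV. (if z = i then a else if z = i' then 1 else 0) * X $ z $ y)
   = (\<Sum>z\<in>UNIV. (if z = i then a * X $ i $ y else 0) + (if z = i' then X $ i' $ y else 0))"
  by (rule sum.cong) (use assms in auto)
 then show ?thesis
  by (simp add: matrix_matrix_mult_def swap_shear_def sum.distrib if_distrib[of "\<lambda>x. x * _"] cong: if_cong)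
qed

lemma shear_mult:
 assumes "i \<noteq> i'"
 shows "(shear i i' a ** X) $ x $ y = (if x = i' then a * X $ i $ y + X $ i' $ y else X $ x $ y)"
proof -
 have "(\<Sum>z\<in>UNIV. (if z = i then a else if i' = z then 1 else 0) * X $ z $ y)
   = (\<Sum>z\<in>UNIV. (if z = i then a * X $ i $ y else 0) + (if z = i' then X $ i' $ y else 0))"
  by (rule sum.cong) (use assms in auto)
 then show ?thesis
  by (simp add: matrix_matrix_mult_def shear_def sum.distrib if_distrib[of "\<lambda>x. x * _"] cong: if_cong)
qed

lemma mult_swap_shear:
 assumes "i \<noteq> i'"
 shows "(X ** swap_shear i i' a) $ x $ y = (if y = i then a * X $ x $ i + X $ x $ i'
  else if y = i' then X $ x $ i else X $ x $ y)"
proof -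
 have "(\<Sum>z\<in>UNIV. X $ x $ z * (if z = i then a else if z = i' then 1 else 0))
   = (\<Sum>z\<in>UNIV. (if z = i then a * X $ x $ i else 0) + (if z = i' then X $ x $ i' else 0))"
  by (rule sum.cong) (use assms in auto)
 moreover have "swap_shear i i' a $ z $ y = (if y = i then (if z = i then a else if z = i' then 1 else 0)
   else if y = i' then (if z = i then 1 else 0) else if z = y then 1 else 0)" for z
  using assms by (auto simp: swap_shear_def)
 ultimately show ?thesis
  by (auto simp: matrix_matrix_mult_def sum.distrib if_distrib[of "\<lambda>x. _ * x"] cong: if_cong)
qed

lemma mult_shear:
 assumes "i \<noteq> i'"
 shows "(X ** shear i i' a) $ x $ y = (if y = i then X $ x $ i + a * X $ x $ i' else X $ x $ y)"
proof -
 have "(\<Sum>z\<in>UNIV. X $ x $ z * (if z = i' then a else if z = i then 1 else 0))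
   = (\<Sum>z\<in>UNIV. (if z = i then X $ x $ i else 0) + (if z = i' then a * X $ x $ i' else 0))"
  by (rule sum.cong) (use assms in auto)
 then show ?thesis
  by (simp add: matrix_matrix_mult_def shear_def sum.distrib if_distrib[of "\<lambda>x. _ * x"] cong: if_cong)
qed

lemma invertible_swap_shear:
 assumes "i \<noteq> i'"
 shows "invertible (swap_shear i i' a)"
proof -
 define Y where "Y = (\<chi> x y. if x = i then (if y = i' then 1 else 0)
  else if x = i' then (if y = i then 1 else if y = i' then - a else 0) else if x = y then 1 else 0)"
 have "swap_shear i i' a ** Y = mat 1"
  using assms by (auto simp: vec_eq_iff swap_shear_mult Y_def mat_def)
 then show ?thesis unfolding invertible_right_inverse by blast
qed

lemma invertible_shear:
 assumes "i \<noteq> i'"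
 shows "invertible (shear i i' a)"
proof -
 have "shear i i' a ** shear i i' (- a) = mat 1"
 proof (subst vec_eq_iff, subst vec_eq_iff, intro allI)
  fix x y
  show "(shear i i' a ** shear i i' (- a)) $ x $ y = mat 1 $ x $ y"
   unfolding shear_mult[OF assms] using assms
   by (cases "y = i"; cases "x = i'") (simp_all add: shear_def mat_def)
 qed
 then show ?thesis unfolding invertible_right_inverse by blast
qed

lemma invertible_right_factor:
 fixes A B :: "'k::field ^ 'n ^ 'n"
 assumes "invertible (A ** B)"
 shows "invertible B"
proof -
 obtain C where "C ** (A ** B) = mat 1" using assms unfolding invertible_left_inverse by blast
 then have "(C ** A) ** B = mat 1" by (simp add: matrix_mul_assoc)
 then show ?thesis unfolding invertible_left_inverse by blast
qed

text \<open>
 The minimal parabolic subgroup that merges the levels \<open>l\<close> and \<open>l + 1\<close> of a bijective level function.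
\<close>

definition merge_levels :: "nat \<Rightarrow> ('n \<Rightarrow> nat) \<Rightarrow> 'n \<Rightarrow> nat" where
 "merge_levels l lv i = (if lv i = Suc l then l else lv i)"

lemma merge_levels_parabolic:
 fixes lv :: "'n::finite \<Rightarrow> nat"
 shows "parabolic lv \<subseteq> (parabolic (merge_levels l lv) :: ('k::field ^ 'n ^ 'n) set)"
proof
 fix p :: "'k ^ 'n ^ 'n" assume p: "p \<in> parabolic lv"
 have mono: "merge_levels l lv i \<le> merge_levels l lv j" if "lv i \<le> lv j" for i j
  using that unfolding merge_levels_def by auto
 show "p \<in> parabolic (merge_levels l lv)"
  using p mono unfolding parabolic_def by blast
qed

text \<open>The quotient by the Borel subgroup is the projective line of ratios of the entries of
  column \<open>i\<close> in rows \<open>i\<close> and \<open>i'\<close>. If the second entry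
  vanishes, \<open>p\<close> is in the Borel subgroup; otherwise the ratio is the affine coordinate
  \<open>a\<close>.\<close>

lemma minimal_parabolic_cases:
 assumes "inj lv" "lv i = l" "lv i' = Suc l" and p: "p \<in> parabolic (merge_levels l lv)"
 shows "p \<in> parabolic lv \<or> (\<exists>a. \<exists>\<beta>\<in>parabolic lv. p = swap_shear i i' a ** \<beta>)"
proof (cases "p $ i' $ i = 0")
 case True
 have "lv x \<le> lv y" if "p $ x $ y \<noteq> 0" for x y
 proof (rule ccontr)
  assume "\<not> lv x \<le> lv y"
  moreover have "merge_levels l lv x \<le> merge_levels l lv y" using p that unfolding parabolic_def by blast
  ultimately have "lv x = Suc l" "lv y = l" unfolding merge_levels_def by (auto split: if_splits)
  then have "x = i'" "y = i" using assms(1-3) by (metis injD)+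
  then show False using True that by simp
 qed
 then show ?thesis using p unfolding parabolic_def by blast
next
 case False
 have ii': "i \<noteq> i'" using assms by auto
 define a where "a = p $ i $ i / p $ i' $ i"
 define \<beta> where "\<beta> = (\<chi> x y. if x = i then p $ i' $ y else if x = i' then p $ i $ y - a * p $ i' $ y else p $ x $ y)"
 have eq: "p = swap_shear i i' a ** \<beta>"
  using ii' by (auto simp: vec_eq_iff swap_shear_mult \<beta>_def)
 have inv: "invertible \<beta>" using p invertible_right_factor[of "swap_shear i i' a" \<beta>] unfolding eq[symmetric] parabolic_def by blast
 have pl: "merge_levels l lv x \<le> merge_levels l lv y" if "p $ x $ y \<noteq> 0" for x y
  using p that unfolding parabolic_def by blast
 have "lv x \<le> lv y" if nz: "\<beta> $ x $ y \<noteq> 0" for x y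
 proof (rule ccontr)
  assume "\<not> lv x \<le> lv y"
  then have less: "lv y < lv x" by simp
  consider "x = i" | "x = i'" "y = i" | "x = i'" "y \<noteq> i" | "x \<noteq> i" "x \<noteq> i'" by blast
  then show False
  proof cases
   case 1
   then have "p $ i' $ y \<noteq> 0" using nz by (simp add: \<beta>_def)
   then show False using pl[of i' y] less 1 assms(2,3) by (auto simp: merge_levels_def split: if_splits)
  next
   case 2
   then show False using nz ii' False by (simp add: \<beta>_def a_def)
  next
   case 3
   then have "lv y < l" using less assms(1-3) by (metis injD less_SucE)
   then have "p $ i $ y = 0" "p $ i' $ y = 0"
    using pl[of i y] pl[of i' y] assms(2,3) by (auto simp: merge_levels_def split: if_splits)
   then show False using nz 3 ii' by (simp add: \<beta>_def)
  next
   case 4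
   then have "p $ x $ y \<noteq> 0" using nz by (simp add: \<beta>_def)
   moreover have "lv x \<noteq> Suc l" using 4 assms(1,3) by (metis injD)
   ultimately show False using pl[of x y] less by (auto simp: merge_levels_def split: if_splits)
  qed
 qed
 then have "\<beta> \<in> parabolic lv" using inv unfolding parabolic_def by blast
 then show ?thesis using eq by blast
qed

lemma swap_shear_parabolic:
 assumes "lv i = l" "lv i' = Suc l"
 shows "swap_shear i i' a \<in> parabolic (merge_levels l lv)"
proof -
 have "i \<noteq> i'" using assms by auto
 then show ?thesis using invertible_swap_shear[of i i' a] assms
  unfolding parabolic_def by (auto simp: swap_shear_def merge_levels_def split: if_splits)
qed

text \<open>The coordinate change from \<open>a\<close> to \<open>1 / a\<close> between the two
  charts.\<close>

lemma shear_eq_swap_shear: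
 assumes "inj lv" "lv i = l" "lv i' = Suc l" "a \<noteq> 0"
 obtains \<gamma> where "\<gamma> \<in> parabolic lv" "shear i i' (1 / a) = swap_shear i i' a ** \<gamma>"
proof -
 have ii': "i \<noteq> i'" using assms by auto
 define \<gamma> where "\<gamma> = (\<chi> x y. if x = i then (if y = i then 1 / a else if y = i' then 1 else 0)
  else if x = i' then (if y = i' then - a else 0) else if x = y then 1 else 0)"
 have eq: "shear i i' (1 / a) = swap_shear i i' a ** \<gamma>"
  using ii' assms(4) by (auto simp: vec_eq_iff swap_shear_mult \<gamma>_def shear_def)
 have "invertible (swap_shear i i' a ** \<gamma>)" using invertible_shear[OF ii', of "1 / a"] unfolding eq .
 then have "invertible \<gamma>" by (rule invertible_right_factor)
 moreover have "lv x \<le> lv y" if "\<gamma> $ x $ y \<noteq> 0" for x y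
  using that assms(2,3) unfolding \<gamma>_def by (auto split: if_splits)
 ultimately have "\<gamma> \<in> parabolic lv" unfolding parabolic_def by blast
 then show ?thesis using that eq by blast
qed

section \<open>Completeness of the flag variety\<close>

definition right_invariant :: "nat \<Rightarrow> ('k::field ^ 'n ^ 'n) set \<Rightarrow> (nat \<Rightarrow> 'k ^ 'n ^ 'n) set \<Rightarrow> bool" where
 "right_invariant m B Z \<longleftrightarrow> (\<forall>g\<in>Z. \<forall>\<beta>\<in>B. g(m := g m ** \<beta>) \<in> Z)"

text \<open>For a group \<open>P\<close>, the union of the \<open>P\<close>-cosets in slot
  \<open>m\<close> that meet \<open>Z\<close>.\<close>

definition saturate :: "nat set \<Rightarrow> nat \<Rightarrow> ('k::field ^ 'n ^ 'n) set \<Rightarrow> (nat \<Rightarrow> 'k ^ 'n ^ 'n) set \<Rightarrow> (nat \<Rightarrow> 'k ^ 'n ^ 'n) set" where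
 "saturate I m P Z = {g \<in> GL_tuples I. \<exists>p\<in>P. g(m := g m ** p) \<in> Z}"

lemma GL_tuples_update: "g \<in> GL_tuples I \<Longrightarrow> invertible p \<Longrightarrow> g(m := g m ** p) \<in> GL_tuples I"
 unfolding GL_tuples_def by (auto intro: invertible_mult)

lemma saturate_right_invariant:
 assumes "B \<subseteq> parabolic c" "\<And>\<beta>. \<beta> \<in> B \<Longrightarrow> invertible \<beta>"
 shows "right_invariant m B (saturate I m (parabolic c) Z)"
 unfolding right_invariant_def
proof (intro ballI)
 fix g \<beta> assume "g \<in> saturate I m (parabolic c) Z" "\<beta> \<in> B"
 then obtain p where g: "g \<in> GL_tuples I" "p \<in> parabolic c" "g(m := g m ** p) \<in> Z" unfolding saturate_def by blast
 obtain q where q: "\<beta> ** q = mat 1" "q ** \<beta> = mat 1"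
  using assms(2)[OF \<open>\<beta> \<in> B\<close>] unfolding invertible_def by blast
 have "q ** p \<in> parabolic c"
  using parabolic_left_inverse[OF _ q(2)] assms(1) \<open>\<beta> \<in> B\<close> g(2) by (blast intro: parabolic_mult)
 moreover have "(g m ** \<beta>) ** (q ** p) = g m ** p"
  by (metis matrix_mul_assoc matrix_mul_rid q(1))
 ultimately show "g(m := g m ** \<beta>) \<in> saturate I m (parabolic c) Z"
  unfolding saturate_def using g GL_tuples_update[OF g(1) assms(2)[OF \<open>\<beta> \<in> B\<close>], of m]
  by (intro CollectI conjI bexI[of _ "q ** p"]) simp_all
qed

text \<open>
 The fibre of \<open>saturate\<close> over \<open>Z\<close> is a projective line, covered by the matrices \<open>swap_shear i i' a\<close>
 and, near infinity, \<open>shear i i' c\<close>. A point outside is separated from it by the resultant of a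
 polynomial \<open>G\<close> that is constantly 1 there with one that does not vanish at infinity there.
\<close>

lemma saturate_zclosed:
 fixes Z :: "(nat \<Rightarrow> 'k::alg_closed_field ^ 'n ^ 'n) set"
 assumes Z: "zclosed (tuple_coords I) (GL_tuples I) Z" and inv: "right_invariant m (parabolic lv) Z"
  and lv: "inj lv" "lv i = l" "lv i' = Suc l"
 shows "zclosed (tuple_coords I) (GL_tuples I) (saturate I m (parabolic (merge_levels l lv)) Z)"
  (is "zclosed ?X ?S ?Y")
 unfolding zclosed_iff
proof (intro conjI ballI)
 show "?Y \<subseteq> ?S" unfolding saturate_def by blast
 fix g0 assume g0: "g0 \<in> ?S - ?Y"
 have ii': "i \<noteq> i'" using lv by auto
 define T where "T g a = g(m := g m ** swap_shear i i' a)" for g :: "nat \<Rightarrow> 'k ^ 'n ^ 'n" and a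
 define V where "V g a = g(m := g m ** shear i i' a)" for g :: "nat \<Rightarrow> 'k ^ 'n ^ 'n" and a
 have YE: "g \<in> Z \<or> (\<exists>a. T g a \<in> Z)" if gY: "g \<in> ?Y" for g
 proof -
  obtain p where p: "p \<in> parabolic (merge_levels l lv)" "g(m := g m ** p) \<in> Z"
   using gY unfolding saturate_def by blast
  from minimal_parabolic_cases[OF lv p(1)] show ?thesis
  proof
   assume "p \<in> parabolic lv"
   moreover obtain q where "q ** p = mat 1" "p ** q = mat 1" using p(1) unfolding parabolic_def invertible_def by blast
   ultimately have "(g(m := g m ** p))(m := (g(m := g m ** p)) m ** q) \<in> Z"
    using inv p(2) parabolic_left_inverse unfolding right_invariant_def by blast
   then have "g(m := g m ** (p ** q)) \<in> Z" by (simp add: matrix_mul_assoc)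
   then show ?thesis using \<open>p ** q = mat 1\<close> by simp
  next
   assume "\<exists>a. \<exists>\<beta>\<in>parabolic lv. p = swap_shear i i' a ** \<beta>"
   then obtain a \<beta> where \<beta>: "\<beta> \<in> parabolic lv" "p = swap_shear i i' a ** \<beta>" by blast
   obtain q where q: "q ** \<beta> = mat 1" "\<beta> ** q = mat 1" using \<beta>(1) unfolding parabolic_def invertible_def by blast
   have "(g(m := g m ** p))(m := (g(m := g m ** p)) m ** q) \<in> Z"
    using inv p(2) parabolic_left_inverse[OF \<beta>(1) q(1)] unfolding right_invariant_def by blast
   moreover have "g m ** p ** q = g m ** swap_shear i i' a"
    unfolding \<beta>(2) by (metis matrix_mul_assoc matrix_mul_rid q(2))
   ultimately show ?thesis unfolding T_def by auto
  qed
 qed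
 have YI: "g \<in> ?Y" if "g \<in> ?S" "g \<in> Z \<or> T g a \<in> Z" for g a
 proof (cases "g \<in> Z")
  case True
  then show ?thesis using that(1) one_parabolic unfolding saturate_def by (auto intro!: bexI[of _ "mat 1"])
 next
  case False
  then show ?thesis using that swap_shear_parabolic[OF lv(2,3)] unfolding saturate_def T_def by blast
 qed
 have TV: "V g (1 / a) \<in> Z" if gT: "T g a \<in> Z" and a: "a \<noteq> 0" for g a
 proof -
  obtain \<gamma> where \<gamma>: "\<gamma> \<in> parabolic lv" "shear i i' (1 / a) = swap_shear i i' a ** \<gamma>"
   using shear_eq_swap_shear[OF lv a] by blast
  have "(T g a)(m := T g a m ** \<gamma>) \<in> Z" using inv gT \<gamma>(1) unfolding right_invariant_def by blast
  then show ?thesis unfolding T_def V_def \<gamma>(2) by (simp add: matrix_mul_assoc)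
 qed
 define A where "A = insert snd ((\<lambda>x (p :: (nat \<Rightarrow> 'k ^ 'n ^ 'n) \<times> 'k). x (fst p)) ` ?X)"
 have xA: "(\<lambda>p. fst p s $ x $ y) \<in> PF A" if "s \<in> I" for s x y
  using that unfolding A_def by (intro PF_coord) (auto simp: tuple_coords_def image_iff)
 have sA: "snd \<in> PF A" unfolding A_def by (intro PF_coord) auto
 have TA: "(\<lambda>p. T (fst p) (snd p) s $ x $ y) \<in> PF A" if "s \<in> I" for s x y
  using that sA xA unfolding T_def by (cases "s = m") (auto simp: mult_swap_shear[OF ii'] intro!: PF_intros)
 have VA: "(\<lambda>p. V (fst p) (snd p) s $ x $ y) \<in> PF A" if "s \<in> I" for s x y
  using that sA xA unfolding V_def by (cases "s = m") (auto simp: mult_shear[OF ii'] intro!: PF_intros)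
 have substT: "\<exists>\<pi> D. (\<forall>j. cf \<pi> j \<in> PF ?X) \<and> (\<forall>w. degree (\<pi> w) \<le> D) \<and>
   (\<forall>w a. f (T w a) = poly (\<pi> w) a)" if "f \<in> PF ?X" for f
  by (rule PF_parameter) (use PF_tuple_subst[OF that TA] in \<open>simp add: A_def\<close>)
 have substV: "\<exists>\<pi> D. (\<forall>j. cf \<pi> j \<in> PF ?X) \<and> (\<forall>w. degree (\<pi> w) \<le> D) \<and>
   (\<forall>w a. f (V w a) = poly (\<pi> w) a)" if "f \<in> PF ?X" for f
  by (rule PF_parameter) (use PF_tuple_subst[OF that VA] in \<open>simp add: A_def\<close>)
 \<comment> \<open>Families of polynomials in \<open>a\<close> that vanish on the incidence set of
   pairs of \<open>w\<close> and \<open>a\<close> with \<open>T w a\<close> in \<open>Z\<close>.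
   Their values at \<open>g0\<close> form an ideal \<open>J\<close> without common root, because no
   \<open>T g0 a\<close> lies in \<open>Z\<close>.\<close>
 define adm where "adm \<pi> \<longleftrightarrow> (\<forall>j. cf \<pi> j \<in> PF ?X) \<and> (\<exists>D. \<forall>w. degree (\<pi> w) \<le> D) \<and>
  (\<forall>w a. T w a \<in> Z \<longrightarrow> poly (\<pi> w) a = 0)" for \<pi> :: "(nat \<Rightarrow> 'k ^ 'n ^ 'n) \<Rightarrow> 'k poly"
 define J where "J = {\<pi> g0 | \<pi>. adm \<pi>}"
 have JI: "\<pi> g0 \<in> J" if "adm \<pi>" for \<pi> using that unfolding J_def by blast
 have "1 \<in> J"
 proof (rule poly_ideal_one)
  fix p q assume "p \<in> J" "q \<in> J"
  then obtain \<pi> \<rho> where *: "adm \<pi>" "adm \<rho>" "p = \<pi> g0" "q = \<rho> g0" unfolding J_def by blast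
  then obtain D E where DE: "\<And>w. degree (\<pi> w) \<le> D" "\<And>w. degree (\<rho> w) \<le> E" unfolding adm_def by blast
  have "degree (\<pi> w + \<rho> w) \<le> max D E" for w
   using DE[of w] by (intro degree_add_le) auto
  then have "adm (\<lambda>w. \<pi> w + \<rho> w)" using *(1,2) unfolding adm_def
   by (auto intro: PF_intros)
  from JI[OF this] show "p + q \<in> J" unfolding * .
 next
  fix p q assume "p \<in> J"
  then obtain \<pi> where *: "adm \<pi>" "p = \<pi> g0" unfolding J_def by blast
  then obtain D where D: "\<And>w. degree (\<pi> w) \<le> D" unfolding adm_def by blast
  have deg: "degree (q * \<pi> w) \<le> degree q + D" for w
   using degree_mult_le[of q "\<pi> w"] D[of w] by linarith
  have "(\<lambda>w. coeff (q * \<pi> w) j) \<in> PF ?X" for j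
   unfolding coeff_mult using *(1) unfolding adm_def by (intro PF_intros) auto
  then have "adm (\<lambda>w. q * \<pi> w)" using *(1) deg unfolding adm_def by auto
  from JI[OF this] show "q * p \<in> J" unfolding * .
 next
  fix a
  have "T g0 a \<in> ?S" using g0 GL_tuples_update[OF _ invertible_swap_shear[OF ii']] unfolding T_def by blast
  moreover have "T g0 a \<notin> Z" using YI g0 by blast
  ultimately obtain f where f: "f \<in> PF ?X" "f (T g0 a) \<noteq> 0" "\<forall>w\<in>Z. f w = 0"
   using zclosed_separate[OF Z] by blast
  obtain \<pi> D where \<pi>: "\<forall>j. cf \<pi> j \<in> PF ?X" "\<forall>w. degree (\<pi> w) \<le> D"
   "\<forall>w a. f (T w a) = poly (\<pi> w) a" using substT[OF f(1)] by blast
  have "adm \<pi>" unfolding adm_def using \<pi> f(3) by metis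
  moreover have "poly (\<pi> g0) a \<noteq> 0" using \<pi>(3) f(2) by metis
  ultimately show "\<exists>p\<in>J. poly p a \<noteq> 0" using JI by blast
 qed
 then obtain G where G: "adm G" "G g0 = 1" unfolding J_def by auto
 then obtain D where D: "\<And>w. degree (G w) \<le> D" unfolding adm_def by blast
 have GPF: "cf G j \<in> PF ?X" for j using G(1) unfolding adm_def by blast
 have "g0 \<notin> Z" using YI g0 by blast
 then obtain f where f: "f \<in> PF ?X" "f g0 \<noteq> 0" "\<forall>w\<in>Z. f w = 0"
  using zclosed_separate[OF Z] g0 by blast
 obtain \<rho> E where \<rho>: "\<And>j. cf \<rho> j \<in> PF ?X" "\<And>w. degree (\<rho> w) \<le> E"
  "\<And>w a. f (V w a) = poly (\<rho> w) a" using substV[OF f(1)] by blast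
 \<comment> \<open>\<open>\<rho>\<close> read backwards, as the second chart has coordinate
   \<open>1 / a\<close>. The top coefficient at \<open>g0\<close> is the value of \<open>f\<close>
   at \<open>V g0 0 = g0\<close>, hence nonzero.\<close>
 define R where "R w = (\<Sum>j\<le>E. monom (coeff (\<rho> w) (E - j)) j)" for w
 have coeffR: "coeff (R w) j = (if j \<le> E then coeff (\<rho> w) (E - j) else 0)" for w j
  unfolding R_def by (simp add: coeff_sum coeff_monom)
 have degR: "degree (R w) \<le> E" for w by (intro degree_le) (simp add: coeffR)
 have RPF: "cf R j \<in> PF ?X" for j
  unfolding coeffR by (intro PF_if \<rho> PF_const)
 have "shear i i' 0 = (mat 1 :: 'k ^ 'n ^ 'n)" using ii' by (auto simp: shear_def mat_def vec_eq_iff)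
 then have "V g0 0 = g0" unfolding V_def by simp
 then have "coeff (\<rho> g0) 0 \<noteq> 0" using \<rho>(3)[of g0 0] f(2) by (simp add: poly_0_coeff_0)
 then have "coeff (R g0) E \<noteq> 0" by (simp add: coeffR)
 have "\<exists>Q\<in>PF ?X. Q g0 \<noteq> 0 \<and> (\<forall>w. Q w \<noteq> 0 \<longrightarrow> \<not> (\<exists>a. poly (G w) a = 0 \<and> poly (R w) a = 0))"
  by (rule no_common_root_open[where D = D and E = E]) (fact GPF D G(2) RPF degR \<open>coeff (R g0) E \<noteq> 0\<close>)+
 then obtain Q where Q: "Q \<in> PF ?X" "Q g0 \<noteq> 0"
  and Q': "\<forall>w. Q w \<noteq> 0 \<longrightarrow> \<not> (\<exists>a. poly (G w) a = 0 \<and> poly (R w) a = 0)"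
  by (elim bexE conjE)
 have Q3: "poly (R w) a \<noteq> 0" if "Q w \<noteq> 0" "poly (G w) a = 0" for w a
  using spec[OF Q', of w] that by simp
 have polyR: "poly (R w) a = a ^ E * poly (\<rho> w) (1 / a)" if "a \<noteq> 0" for w a
 proof -
  have "poly (R w) a = (\<Sum>j\<le>E. coeff (\<rho> w) (E - j) * a ^ j)"
   unfolding poly_of_coeffs[OF degR] by (simp add: coeffR)
  also have "\<dots> = (\<Sum>j\<le>E. coeff (\<rho> w) j * a ^ (E - j))"
   by (rule sum.reindex_bij_witness[of _ "\<lambda>j. E - j" "\<lambda>j. E - j"]) auto
  also have "\<dots> = (\<Sum>j\<le>E. a ^ E * (coeff (\<rho> w) j * (1 / a) ^ j))"
   by (rule sum.cong) (use that in \<open>auto simp: power_diff power_one_over field_simps\<close>)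
  finally show ?thesis unfolding poly_of_coeffs[OF \<rho>(2)] by (simp add: sum_distrib_left)
 qed
 \<comment> \<open>One factor for each way in which \<open>w\<close> can belong to the saturation:
   \<open>f\<close> for \<open>w\<close> in \<open>Z\<close>, the constant coefficient of
   \<open>G\<close> for \<open>T w 0\<close> in \<open>Z\<close>, and \<open>Q\<close> for
   \<open>T w a\<close> in \<open>Z\<close> with \<open>a\<close> nonzero.\<close>
 define F where "F w = f w * (coeff (G w) 0 * Q w)" for w
 have "F \<in> PF ?X" unfolding F_def[abs_def] by (intro PF_intros f GPF Q)
 moreover have "F g0 \<noteq> 0" unfolding F_def using f(2) G(2) Q(2) by simp
 moreover have "F w = 0" if wY: "w \<in> ?Y" for w
 proof (cases "w \<in> Z")
  case True
  then show ?thesis unfolding F_def using f(3) by simp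
 next
  case False
  then obtain a where a: "T w a \<in> Z" using YE[OF wY] by blast
  then have Ga: "poly (G w) a = 0" using G(1) unfolding adm_def by blast
  show ?thesis
  proof (cases "a = 0")
   case True
   then show ?thesis using Ga unfolding F_def by (simp add: poly_0_coeff_0)
  next
   case False
   then have "f (V w (1 / a)) = 0" using TV[OF a] f(3) by blast
   then have "poly (R w) a = 0" using polyR[OF False] \<rho>(3) by simp
   then show ?thesis using Q3[of w a] Ga unfolding F_def by auto
  qed
 qed
 ultimately show "\<exists>f\<in>PF ?X. f g0 \<noteq> 0 \<and> (\<forall>w\<in>?Y. f w = 0)" by blast
qed

section \<open>Products of minimal parabolic subgroups\<close>

primrec products :: "('n \<Rightarrow> nat) \<Rightarrow> nat list \<Rightarrow> ('k::field ^ 'n ^ 'n) set" where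
 "products lv [] = {mat 1}"
| "products lv (l # ls) = {p ** q | p q. p \<in> parabolic (merge_levels l lv) \<and> q \<in> products lv ls}"

lemma products_append:
 "p \<in> products lv ls \<Longrightarrow> q \<in> products lv ls' \<Longrightarrow> p ** q \<in> products lv (ls @ ls')"
proof (induction ls arbitrary: p)
 case (Cons l ls)
 then obtain a b where ab: "p = a ** b" "a \<in> parabolic (merge_levels l lv)" "b \<in> products lv ls" by auto
 then have "b ** q \<in> products lv (ls @ ls')" using Cons by blast
 then show ?case using ab by (auto simp: matrix_mul_assoc[symmetric])
qed simp

text \<open>Gaussian elimination with adjacent rows, column by column and from the bottom row upwards.\<close>

lemma products_generate:
 fixes lv :: "'n::finite \<Rightarrow> nat"
 assumes lv: "bij_betw lv UNIV {..<CARD('n)}"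
 shows "\<exists>ls. set ls \<subseteq> {l. Suc l < CARD('n)} \<and> (\<forall>b :: 'k::field ^ 'n ^ 'n. invertible b \<longrightarrow>
  (\<exists>q\<in>products lv ls. \<exists>\<beta>\<in>parabolic lv. b = q ** \<beta>))"
proof -
 define n where "n = CARD('n)"
 have inj: "inj lv" using lv unfolding bij_betw_def by blast
 have lt: "lv x < n" for x using lv unfolding n_def by (auto dest: bij_betwE)
 \<comment> \<open>\<open>cols y\<close>: the columns of level below \<open>y\<close> are zero below
   the diagonal. \<open>low y r\<close>: the column of level \<open>y\<close> is zero in the rows of
   level at least \<open>r\<close>. The inner induction lowers \<open>r\<close>, the outer one
   raises \<open>y\<close>.\<close>
 define cols where "cols y b \<longleftrightarrow> (\<forall>x z. lv z < y \<longrightarrow> lv z < lv x \<longrightarrow> b $ x $ z = 0)" for y and b :: "'k ^ 'n ^ 'n"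
 define low where "low y r b \<longleftrightarrow> (\<forall>x z. lv z = y \<longrightarrow> r \<le> lv x \<longrightarrow> b $ x $ z = 0)" for y r and b :: "'k ^ 'n ^ 'n"
 define L where "L = {l. Suc l < n}"
 have inner: "\<exists>ls. set ls \<subseteq> L \<and> (\<forall>b. invertible b \<longrightarrow> cols y b \<longrightarrow>
   (\<exists>q\<in>products lv ls. \<exists>b'. b = q ** b' \<and> invertible b' \<and> cols y b' \<and> low y (n - k) b'))"
  if "y < n - k" "k < n" for y k
  using that
 proof (induction k)
  case 0
  have "low y n b" for b unfolding low_def using lt by (metis not_le)
  then show ?case by (intro exI[of _ "[]"]) auto
 next
  case (Suc k)
  then obtain ls where ls: "set ls \<subseteq> L" "\<And>b. invertible b \<Longrightarrow> cols y b \<Longrightarrow>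
   \<exists>q\<in>products lv ls. \<exists>b'. b = q ** b' \<and> invertible b' \<and> cols y b' \<and> low y (n - k) b'" by fastforce
  define l where "l = n - Suc (Suc k)"
  have l: "n - Suc k = Suc l" "Suc l < n" "y \<le> l" "n - k = Suc (Suc l)" using Suc.prems unfolding l_def by auto
  obtain i where i: "lv i = l" using lv l(2) unfolding n_def bij_betw_def by (metis Suc_lessD lessThan_iff imageE)
  obtain i' where i': "lv i' = Suc l" using lv l(2) unfolding n_def bij_betw_def by (metis lessThan_iff imageE)
  have ii': "i \<noteq> i'" using i i' by auto
  obtain z where z: "lv z = y" using lv l(2,3) unfolding n_def bij_betw_def
   by (metis lessThan_iff imageE le_less_trans Suc_lessD)
  have step: "\<exists>p\<in>parabolic (merge_levels l lv). \<exists>b'. b = p ** b' \<and> invertible b' \<and> cols y b' \<and> low y (Suc l) b'"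
   if b: "invertible b" "cols y b" "low y (Suc (Suc l)) b" for b
  proof (cases "b $ i' $ z = 0")
   case True
   have "b $ x $ z' = 0" if "lv z' = y" "Suc l \<le> lv x" for x z'
   proof -
    have "z' = z" using that(1) z inj by (metis injD)
    show ?thesis
    proof (cases "lv x = Suc l")
     case True
     then have "x = i'" using i' inj by (metis injD)
     then show ?thesis using \<open>b $ i' $ z = 0\<close> \<open>z' = z\<close> by simp
    next
     case False
     then show ?thesis using b(3) that unfolding low_def by auto
    qed
   qed
   then have "low y (Suc l) b" unfolding low_def by blast
   then show ?thesis using b one_parabolic by (intro bexI[of _ "mat 1"] exI[of _ b]) auto
  next
   case False
   define a where "a = b $ i $ z / b $ i' $ z"
   define b' where "b' = (\<chi> x w. if x = i then b $ i' $ w else if x = i' then b $ i $ w - a * b $ i' $ w else b $ x $ w)"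
   have eq: "b = swap_shear i i' a ** b'" using ii' by (auto simp: vec_eq_iff swap_shear_mult b'_def)
   have "invertible b'" using b(1) invertible_right_factor unfolding eq by blast
   moreover have "cols y b'" unfolding cols_def
   proof (intro allI impI)
    fix x w assume w: "lv w < y" "lv w < lv x"
    have "b $ i $ w = 0" "b $ i' $ w = 0" using b(2) w(1) l(3) i i' unfolding cols_def by auto
    moreover have "b $ x $ w = 0" using b(2) w unfolding cols_def by blast
    ultimately show "b' $ x $ w = 0" unfolding b'_def by simp
   qed
   moreover have "low y (Suc l) b'" unfolding low_def
   proof (intro allI impI)
    fix x w assume w: "lv w = y" "Suc l \<le> lv x"
    have "w = z" using w(1) z inj by (metis injD)
    have "x \<noteq> i" using w(2) i by auto
    show "b' $ x $ w = 0"
    proof (cases "x = i'")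
     case True
     then show ?thesis using ii' False \<open>w = z\<close> by (simp add: b'_def a_def)
    next
     case False
     then have "lv x \<noteq> Suc l" using i' inj by (metis injD)
     then have "b $ x $ w = 0" using b(3) w unfolding low_def by auto
     then show ?thesis using False \<open>x \<noteq> i\<close> by (simp add: b'_def)
    qed
   qed
   ultimately show ?thesis using eq swap_shear_parabolic[of lv i l i' a] i i' by blast
  qed
  have "\<exists>q\<in>products lv (ls @ [l]). \<exists>b'. b = q ** b' \<and> invertible b' \<and> cols y b' \<and> low y (n - Suc k) b'"
   if b: "invertible b" "cols y b" for b
  proof -
   obtain q b1 where q: "q \<in> products lv ls" "b = q ** b1" "invertible b1" "cols y b1" "low y (n - k) b1"
    using ls(2)[OF b] by blast
   obtain p b' where p: "p \<in> parabolic (merge_levels l lv)" "b1 = p ** b'" "invertible b'" "cols y b'" "low y (Suc l) b'"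
    using step[of b1] q(3-5) l(4) by auto
   have "p \<in> products lv [l]" using p(1) by auto
   then have "q ** p \<in> products lv (ls @ [l])" by (rule products_append[OF q(1)])
   moreover have "b = (q ** p) ** b'" using q(2) p(2) by (simp add: matrix_mul_assoc)
   ultimately show ?thesis using p(3-5) l(1) by auto
  qed
  then show ?case using ls(1) l(2) unfolding L_def by (intro exI[of _ "ls @ [l]"]) auto
 qed
 have outer: "\<exists>ls. set ls \<subseteq> L \<and> (\<forall>b. invertible b \<longrightarrow>
   (\<exists>q\<in>products lv ls. \<exists>b'. b = q ** b' \<and> invertible b' \<and> cols y b'))" if "y \<le> n" for y
  using that
 proof (induction y)
  case 0
  show ?case by (intro exI[of _ "[]"]) (auto simp: cols_def)
 next
  case (Suc y)
  then obtain ls where ls: "set ls \<subseteq> L" "\<And>b. invertible b \<Longrightarrow>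
   \<exists>q\<in>products lv ls. \<exists>b'. b = q ** b' \<and> invertible b' \<and> cols y b'" by auto
  define k where "k = n - Suc y"
  have k: "y < n - k" "k < n" "n - k = Suc y" using Suc.prems unfolding k_def by auto
  obtain ls' where ls': "set ls' \<subseteq> L" "\<And>b. invertible b \<Longrightarrow> cols y b \<Longrightarrow>
   \<exists>q\<in>products lv ls'. \<exists>b'. b = q ** b' \<and> invertible b' \<and> cols y b' \<and> low y (Suc y) b'"
   using inner[OF k(1,2)] unfolding k(3) by blast
  have cs: "cols (Suc y) b" if "cols y b" "low y (Suc y) b" for b
   using that unfolding cols_def low_def by (metis Suc_leI less_SucE)
  have "\<exists>q\<in>products lv (ls @ ls'). \<exists>b'. b = q ** b' \<and> invertible b' \<and> cols (Suc y) b'" if b: "invertible b" for b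
  proof -
   obtain q b1 where q: "q \<in> products lv ls" "b = q ** b1" "invertible b1" "cols y b1" using ls(2)[OF b] by blast
   obtain p b' where p: "p \<in> products lv ls'" "b1 = p ** b'" "invertible b'" "cols y b'" "low y (Suc y) b'"
    using ls'(2)[OF q(3,4)] by blast
   have "b = (q ** p) ** b'" using q(2) p(2) by (simp add: matrix_mul_assoc)
   then show ?thesis using products_append[OF q(1) p(1)] cs[OF p(4,5)] p(3) by blast
  qed
  then show ?case using ls(1) ls'(1) by (intro exI[of _ "ls @ ls'"]) auto
 qed
 obtain ls where ls: "set ls \<subseteq> L" "\<And>b. invertible b \<Longrightarrow>
   \<exists>q\<in>products lv ls. \<exists>b'. b = q ** b' \<and> invertible b' \<and> cols n b'" using outer[of n] by blast
 have "b' \<in> parabolic lv" if b': "invertible b'" "cols n b'" for b'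
 proof -
  have "lv i \<le> lv j" if "b' $ i $ j \<noteq> 0" for i j
  proof (rule ccontr)
   assume "\<not> lv i \<le> lv j"
   then show False using b'(2) lt[of j] that unfolding cols_def by auto
  qed
  then show ?thesis using b'(1) unfolding parabolic_def by blast
 qed
 then show ?thesis using ls unfolding L_def n_def by (intro exI[of _ ls]) blast
qed

text \<open>By \<open>products_generate\<close> every invertible \<open>b\<close> is the product of
  a fixed word in minimal parabolic subgroups and an element of the Borel subgroup. Saturation along
  this word keeps \<open>Z\<close> closed, and afterwards the existence of \<open>b\<close> can be
  tested by putting the identity into slot \<open>m\<close>.\<close>

theorem projection_zclosed:
 fixes Z :: "(nat \<Rightarrow> 'k::alg_closed_field ^ 'n ^ 'n) set"
 assumes Z: "zclosed (tuple_coords (insert m I)) (GL_tuples (insert m I)) Z" and "m \<notin> I"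
  and inv: "right_invariant m (parabolic lv) Z" and lv: "bij_betw lv UNIV {..<CARD('n)}"
 shows "zclosed (tuple_coords I) (GL_tuples I) {g \<in> GL_tuples I. \<exists>b. g(m := b) \<in> Z}"
proof -
 define X :: "((nat \<Rightarrow> 'k ^ 'n ^ 'n) \<Rightarrow> 'k) set" where "X = tuple_coords (insert m I)"
 define S :: "(nat \<Rightarrow> 'k ^ 'n ^ 'n) set" where "S = GL_tuples (insert m I)"
 have inj: "inj lv" using lv unfolding bij_betw_def by blast
 define sat where "sat ls = {g \<in> S. \<exists>q\<in>products lv ls. g(m := g m ** q) \<in> Z}" for ls
 have ZS: "Z \<subseteq> S" using zclosed_subset[OF Z] unfolding S_def .
 have sat: "zclosed X S (sat ls) \<and> right_invariant m (parabolic lv) (sat ls)"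
  if "set ls \<subseteq> {l. Suc l < CARD('n)}" for ls
  using that
 proof (induction ls)
  case Nil
  have "sat [] = Z" unfolding sat_def using ZS by auto
  then show ?case using Z inv unfolding X_def S_def by simp
 next
  case (Cons l ls)
  then have IH: "zclosed X S (sat ls)" "right_invariant m (parabolic lv) (sat ls)" and l: "Suc l < CARD('n)" by auto
  obtain i where i: "lv i = l" using lv l unfolding bij_betw_def by (metis Suc_lessD lessThan_iff imageE)
  obtain i' where i': "lv i' = Suc l" using lv l unfolding bij_betw_def by (metis lessThan_iff imageE)
  have "sat (l # ls) = saturate (insert m I) m (parabolic (merge_levels l lv)) (sat ls)"
  proof (intro equalityI subsetI)
   fix g assume "g \<in> sat (l # ls)"
   then obtain p q where g: "g \<in> S" "p \<in> parabolic (merge_levels l lv)" "q \<in> products lv ls" "g(m := g m ** (p ** q)) \<in> Z"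
    unfolding sat_def by auto
   have "g(m := g m ** p) \<in> S"
    using g(1,2) GL_tuples_update unfolding S_def parabolic_def by blast
   moreover have "\<exists>q\<in>products lv ls. (g(m := g m ** p))(m := (g(m := g m ** p)) m ** q) \<in> Z"
    by (rule bexI[OF _ g(3)]) (use g(4) in \<open>simp add: matrix_mul_assoc\<close>)
   ultimately have "g(m := g m ** p) \<in> sat ls" unfolding sat_def by simp
   then show "g \<in> saturate (insert m I) m (parabolic (merge_levels l lv)) (sat ls)"
    unfolding saturate_def using g(1,2) S_def by blast
  next
   fix g assume "g \<in> saturate (insert m I) m (parabolic (merge_levels l lv)) (sat ls)"
   then obtain p q where g: "g \<in> S" "p \<in> parabolic (merge_levels l lv)" "q \<in> products lv ls"
    "g(m := g m ** p ** q) \<in> Z" unfolding saturate_def sat_def S_def by auto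
   then have "p ** q \<in> products lv (l # ls)" by auto
   then show "g \<in> sat (l # ls)" unfolding sat_def using g by (auto simp: matrix_mul_assoc simp del: products.simps intro!: bexI[of _ "p ** q"])
  qed
  moreover have "right_invariant m (parabolic lv) (saturate (insert m I) m (parabolic (merge_levels l lv)) (sat ls))"
   by (rule saturate_right_invariant[OF merge_levels_parabolic]) (simp add: parabolic_def)
  ultimately show ?case
   using saturate_zclosed[OF IH[unfolded X_def S_def] inj i i'] unfolding X_def S_def by simp
 qed
 obtain ls where ls: "set ls \<subseteq> {l. Suc l < CARD('n)}" "\<And>b :: 'k ^ 'n ^ 'n. invertible b \<Longrightarrow>
  \<exists>q\<in>products lv ls. \<exists>\<beta>\<in>parabolic lv. b = q ** \<beta>"
  using products_generate[OF lv] by blast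
 have key: "g(m := mat 1) \<in> sat ls" if g: "g \<in> GL_tuples I" "g(m := b) \<in> Z" for g b
 proof -
  have "invertible b" using g(2) ZS unfolding S_def GL_tuples_def by fastforce
  then obtain q \<beta> where q: "q \<in> products lv ls" "\<beta> \<in> parabolic lv" "b = q ** \<beta>" using ls(2) by blast
  obtain \<gamma> where \<gamma>: "\<beta> ** \<gamma> = mat 1" "\<gamma> ** \<beta> = mat 1" using q(2) unfolding parabolic_def invertible_def by blast
  have "(g(m := b))(m := (g(m := b)) m ** \<gamma>) \<in> Z"
   using inv g(2) parabolic_left_inverse[OF q(2) \<gamma>(2)] unfolding right_invariant_def by blast
  moreover have "b ** \<gamma> = q" unfolding q(3) by (metis matrix_mul_assoc matrix_mul_rid \<gamma>(1))
  ultimately have "g(m := q) \<in> Z" by simp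
  moreover have "g(m := mat 1) \<in> S"
   using g(1) \<open>m \<notin> I\<close> unfolding S_def GL_tuples_def by (auto simp: invertible_one)
  ultimately show ?thesis unfolding sat_def using q(1) by auto
 qed
 show ?thesis
  unfolding zclosed_iff
 proof (intro conjI ballI)
  fix g assume g: "g \<in> GL_tuples I - {g \<in> GL_tuples I. \<exists>b. g(m := b) \<in> Z}"
  have "g(m := mat 1) \<in> S"
   using g \<open>m \<notin> I\<close> unfolding S_def GL_tuples_def by (auto simp: invertible_one)
  moreover have "g(m := mat 1) \<notin> sat ls" using g unfolding sat_def by auto
  ultimately obtain f where f: "f \<in> PF X" "f (g(m := mat 1)) \<noteq> 0" "\<forall>w\<in>sat ls. f w = 0"
   using zclosed_separate[OF conjunct1[OF sat[OF ls(1)]]] by auto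
  have "(\<lambda>g. f (g(m := mat 1))) \<in> PF (tuple_coords I)"
  proof (rule PF_tuple_subst[OF f(1)[unfolded X_def]])
   fix s i j assume "s \<in> insert m I"
   then show "(\<lambda>g. (g(m := mat 1)) s $ i $ j) \<in> PF (tuple_coords I)"
    by (cases "s = m") (simp_all add: PF_tuple_entry PF_const)
  qed
  then show "\<exists>f\<in>PF (tuple_coords I). f g \<noteq> 0 \<and> (\<forall>w\<in>{g \<in> GL_tuples I. \<exists>b. g(m := b) \<in> Z}. f w = 0)"
   using f key by (intro bexI[of _ "\<lambda>g. f (g(m := mat 1))"]) auto
 qed auto
qed

section \<open>Unipotent groups of matrices\<close>

abbreviation mpow :: "'k::field ^ 'n ^ 'n \<Rightarrow> nat \<Rightarrow> 'k ^ 'n ^ 'n" where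
 "mpow x m \<equiv> (((**) x) ^^ m) (mat 1)"

lemma mpow_add: "mpow x (a + b) = mpow x a ** mpow x b"
 by (induction a) (auto simp: matrix_mul_assoc)

lemma mpow_commute: "x ** mpow x m = mpow x m ** x"
proof (induction m)
 case (Suc m)
 have "x ** mpow x (Suc m) = x ** (mpow x m ** x)" using Suc by simp
 then show ?case by (simp add: matrix_mul_assoc)
qed simp

lemma mpow_zero_le: "mpow x m = 0 \<Longrightarrow> m \<le> n \<Longrightarrow> mpow x n = 0"
 using mpow_add[where x = x and a = m and b = "n - m"] by simp

lemma matrix_vector_diff_vec: "(A :: 'k::field ^ 'n ^ 'm) *v (x - y) = A *v x - A *v y"
 by (simp add: vec.diff)

lemma matrix_vector_axis: "((A :: 'k::field ^ 'n ^ 'm) *v axis j 1) $ i = A $ i $ j"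
 by (simp add: matrix_vector_mult_def axis_def if_distrib[of "\<lambda>x. _ * x"] cong: if_cong)

lemma dim_image_less:
 fixes A :: "'k::field ^ 'n ^ 'm"
 assumes "vec.subspace S" "w \<in> S" "w \<noteq> 0" "A *v w = 0"
 shows "vec.dim ((*v) A ` S) < vec.dim S"
proof -
 have "vec.independent {w}" using assms(3) by simp
 then obtain B where B: "{w} \<subseteq> B" "B \<subseteq> S" "vec.independent B" "S \<subseteq> vec.span B"
  using vec.maximal_independent_subset_extend[of "{w}" S] assms(2) by blast
 have fin: "finite B" using B(3) by (rule vec.finiteI_independent)
 have "(*v) A ` S \<subseteq> (*v) A ` vec.span B" using B(4) by blast
 also have "\<dots> = vec.span ((*v) A ` B)" by (rule vec.span_image[symmetric])
 also have "(*v) A ` B = insert 0 ((*v) A ` (B - {w}))" using B(1) assms(4) by auto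
 finally have "(*v) A ` S \<subseteq> vec.span ((*v) A ` (B - {w}))" by simp
 then have "vec.dim ((*v) A ` S) \<le> card ((*v) A ` (B - {w}))"
  using fin by (intro vec.dim_le_card) auto
 also have "\<dots> \<le> card (B - {w})" using fin by (intro card_image_le) auto
 also have "\<dots> < card B" using fin B(1) by (intro psubset_card_mono) auto
 also have "card B = vec.dim S" using B by (intro vec.basis_card_eq_dim)
 finally show ?thesis .
qed

text \<open>A basis of \<open>W\<close>, sent to 0, is extended to a basis of \<open>W'\<close>,
  whose new members are fixed. The image of \<open>f\<close> is a complement of \<open>W\<close> in
  \<open>W'\<close>, so that matrices \<open>f z f\<close> represent operators on the
  quotient.\<close>

lemma projection_matrix:
 fixes W W' :: "('k::field ^ 'n) set"
 assumes W: "vec.subspace W" and W': "vec.subspace W'" and sub: "W \<subseteq> W'"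
 obtains f :: "'k ^ 'n ^ 'n" where "\<And>w. w \<in> W \<Longrightarrow> f *v w = 0" "\<And>x. f *v x \<in> W'"
  "\<And>x. x \<in> W' \<Longrightarrow> x - f *v x \<in> W" "\<And>x. f *v (f *v x) = f *v x"
proof -
 obtain B where B: "B \<subseteq> W" "vec.independent B" "W \<subseteq> vec.span B"
  by (rule vec.basis_exists[of W]) (rule that)
 have "B \<subseteq> W'" using B(1) sub by blast
 then obtain C where C: "B \<subseteq> C" "C \<subseteq> W'" "vec.independent C" "W' \<subseteq> vec.span C"
  using B(2) by (rule vec.maximal_independent_subset_extend) (rule that)
 define h where "h x = (if x \<in> B then 0 else x)" for x :: "'k ^ 'n"
 obtain g where g: "Vector_Spaces.linear (*s) (*s) g" "\<forall>x\<in>C. g x = h x" "range g = vec.span (h ` C)"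
  using vec.linear_independent_extend_subspace[OF C(3), of h] by blast
 define f where "f = matrix g"
 have f: "f *v x = g x" for x unfolding f_def by (rule matrix_works[OF g(1)])
 have hC: "h ` C \<subseteq> W'" using C(2) vec.subspace_0[OF W'] unfolding h_def by auto
 have 1: "f *v x \<in> W'" for x
 proof -
  have "f *v x \<in> vec.span (h ` C)" unfolding f using g(3) by blast
  then show ?thesis using vec.span_minimal[OF hC W'] by blast
 qed
 have 2: "f *v w = 0" if "w \<in> W" for w
 proof -
  have "w \<in> vec.span B" using B(3) that by blast
  then show ?thesis
  proof (induction rule: vec.span_induct_alt)
   case base
   show ?case by simp
  next
   case (step c x y)
   have "f *v x = 0" unfolding f using g(2) C(1) step(1) by (auto simp: h_def)
   then show ?case using step by (simp add: vec.add vec.scale)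
  qed
 qed
 have 3: "x - f *v x \<in> W" if "x \<in> W'" for x
 proof -
  have "x \<in> vec.span C" using C(4) that by blast
  then show ?thesis
  proof (induction rule: vec.span_induct_alt)
   case base
   show ?case using vec.subspace_0[OF W] by simp
  next
   case (step c x y)
   have "x - f *v x \<in> W" unfolding f using g(2) step(1) B(1) vec.subspace_0[OF W] by (auto simp: h_def)
   then have "c *s (x - f *v x) + (y - f *v y) \<in> W"
    using step by (intro vec.subspace_add[OF W] vec.subspace_scale[OF W])
   then show ?case by (simp add: vec.add vec.scale vec.scale_right_diff_distrib algebra_simps)
  qed
 qed
 have 4: "f *v (f *v x) = f *v x" for x
 proof -
  have "f *v x \<in> vec.span (h ` C)" unfolding f using g(3) by blast
  then show ?thesis
  proof (induction rule: vec.span_induct_alt)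
   case base
   show ?case by simp
  next
   case (step c y z)
   then obtain x where x: "x \<in> C" "y = h x" by auto
   have "f *v y = y"
   proof (cases "x \<in> B")
    case True
    then show ?thesis using x by (simp add: h_def)
   next
    case False
    then show ?thesis unfolding f using x g(2) by (simp add: h_def)
   qed
   then show ?case using step by (simp add: vec.add vec.scale)
  qed
 qed
 show ?thesis using that[OF 2 1 3 4] .
qed

lemma range_mult: "range ((*v) ((A :: 'k::field ^ 'n ^ 'n) ** B)) = (*v) A ` range ((*v) B)"
 by (auto simp: matrix_vector_mul_assoc[symmetric])

lemma subspace_range: "vec.subspace (range ((*v) (A :: 'k::field ^ 'n ^ 'n)))"
 using vec.subspace_image[of UNIV A] by simp

lemma matrix_eq0: "(\<And>x. (A :: 'k::field ^ 'n ^ 'n) *v x = 0) \<Longrightarrow> A = 0"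
 by (simp add: matrix_eq)

text \<open>Induction on the rank. With a projection \<open>p\<close> onto the range of
  \<open>x\<close>, the trace of \<open>x = p x\<close> equals that of \<open>x p\<close>, which is
  again nilpotent and has smaller rank.\<close>

lemma trace_nilpotent:
 fixes x :: "'k::field ^ 'n ^ 'n"
 assumes "mpow x m = 0"
 shows "trace x = 0"
 using assms
proof (induction "vec.dim (range ((*v) x))" arbitrary: x m rule: less_induct)
 case less
 show ?case
 proof (cases "x = 0")
  case True
  then show ?thesis by (simp add: trace_def)
 next
  case False
  define S where "S = range ((*v) x)"
  have S: "vec.subspace S" unfolding S_def by (rule subspace_range)
  have "vec.subspace {0 :: 'k ^ 'n}" "{0} \<subseteq> S" using vec.subspace_0[OF S] by simp_all
  then obtain p :: "'k ^ 'n ^ 'n" where p: "\<And>y. p *v y \<in> S" "\<And>y. y \<in> S \<Longrightarrow> y - p *v y \<in> {0}"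
   using projection_matrix[OF _ S, of "{0}"] by metis
  have px: "p ** x = x"
   using p(2) by (auto simp: matrix_eq matrix_vector_mul_assoc[symmetric] S_def)
  have "range ((*v) p) = S"
  proof
   show "range ((*v) p) \<subseteq> S" using p(1) by blast
   show "S \<subseteq> range ((*v) p)"
   proof
    fix y assume "y \<in> S"
    then have "y = p *v y" using p(2)[of y] by simp
    then show "y \<in> range ((*v) p)" by blast
   qed
  qed
  then have range: "range ((*v) (x ** p)) = (*v) x ` S" by (simp add: range_mult)
  have pow: "mpow (x ** p) (Suc k) = mpow x (Suc k) ** p" for k
  proof (induction k)
   case 0
   show ?case by simp
  next
   case (Suc k)
   have "mpow (x ** p) (Suc (Suc k)) = (x ** p) ** (mpow x (Suc k) ** p)" using Suc by simp
   also have "\<dots> = x ** (p ** x) ** mpow x k ** p" by (simp add: matrix_mul_assoc)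
   finally show ?case unfolding px by (simp add: matrix_mul_assoc)
  qed
  have "mpow (x ** p) (Suc m) = 0" unfolding pow using less.prems by simp
  moreover have "vec.dim ((*v) x ` S) < vec.dim S"
  proof (rule ccontr)
   assume "\<not> ?thesis"
   then have eq: "(*v) x ` S = S"
    using vec.subspace_image[OF S] S by (intro vec.subspace_dim_equal) (auto simp: S_def)
   have "(*v) (mpow x k) ` S = S" for k
   proof (induction k)
    case (Suc k)
    have "(*v) (mpow x (Suc k)) ` S = (*v) x ` ((*v) (mpow x k) ` S)"
     by (simp add: image_image matrix_vector_mul_assoc)
    then show ?case using Suc eq by simp
   qed simp
   from this[of m] have "S = (\<lambda>_. 0) ` S" using less.prems by simp
   then have "x *v y = 0" for y unfolding S_def by blast
   then show False using False matrix_eq0 by blast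
  qed
  ultimately have "trace (x ** p) = 0"
   using less.hyps[of "x ** p" "Suc m"] unfolding range S_def by simp
  then show ?thesis using trace_mul_sym[of x p] px by simp
 qed
qed

text \<open>The ranges of the powers descend strictly until they are zero. The uniform exponent
  makes unipotency a closed condition.\<close>

lemma nilpotent_index:
 fixes x :: "'k::field ^ 'n ^ 'n"
 assumes "mpow x m = 0"
 shows "mpow x CARD('n) = 0"
proof -
 define R where "R i = range ((*v) (mpow x i))" for i
 have R: "vec.subspace (R i)" for i unfolding R_def by (rule subspace_range)
 have RSuc: "R (Suc i) = (*v) x ` R i" for i
  unfolding R_def using range_mult[of x "mpow x i"] by simp
 have dec: "R (Suc i) \<subseteq> R i" for i
 proof -
  have "R (Suc i) = (*v) (mpow x i) ` range ((*v) x)"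
   unfolding R_def funpow.simps comp_apply mpow_commute by (rule range_mult)
  then show ?thesis unfolding R_def by blast
 qed
 have stat: "R i = {0}" if "R (Suc i) = R i" for i
 proof -
  have "R (i + k) = R i" for k
  proof (induction k)
   case (Suc k)
   then show ?case using that RSuc[of "i + k"] RSuc[of i] by simp
  qed simp
  then have "R i = R (i + m)" by simp
  moreover have "mpow x (i + m) = 0" by (rule mpow_zero_le[OF assms]) simp
  ultimately show ?thesis unfolding R_def by (simp add: image_constant_conv)
 qed
 have "R i = {0} \<or> vec.dim (R i) + i \<le> CARD('n)" for i
 proof (induction i)
  case 0
  show ?case using vec.dim_subset_UNIV[of "R 0"] by (simp add: card_cart_basis vec.dimension_def)
 next
  case (Suc i)
  show ?case
  proof (cases "R (Suc i) = R i")
   case True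
   then show ?thesis using stat by simp
  next
   case False
   then have "vec.dim (R (Suc i)) < vec.dim (R i)"
    using vec.subspace_dim_equal[OF R R dec, of i] by linarith
   moreover have "R i \<noteq> {0}"
   proof
    assume "R i = {0}"
    then have "R (Suc i) = R i" unfolding RSuc by simp
    then show False using False by simp
   qed
   ultimately show ?thesis using Suc by linarith
  qed
 qed
 from this[of "CARD('n)"] have "R CARD('n) \<subseteq> {0}"
  by (auto simp del: subset_singleton_iff)
 then show ?thesis unfolding R_def by (intro matrix_eq0) blast
qed

text \<open>A polynomial of least degree annihilating the single vector \<open>w0\<close> has a root
  \<open>\<mu>\<close>. With the factor of this root removed, it no longer annihilates
  \<open>w0\<close> but sends it to an eigenvector.\<close>

lemma eigenvector_on_subspace:
 fixes T :: "'k::alg_closed_field ^ 'n ^ 'n"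
 assumes E: "vec.subspace E" and stable: "\<And>x. x \<in> E \<Longrightarrow> T *v x \<in> E" and w0: "w0 \<in> E" "w0 \<noteq> 0"
 obtains w \<mu> where "w \<in> E" "w \<noteq> 0" "T *v w = \<mu> *s w"
proof -
 \<comment> \<open>\<open>p\<close> evaluated at \<open>T\<close> and applied to \<open>w0\<close>;
   the summation bound \<open>N\<close> is independent of \<open>p\<close>, which makes the
   expression linear in \<open>p\<close>.\<close>
 define ev where "ev N p = (\<Sum>i\<le>N. coeff p i *s (mpow T i *v w0))" for N and p :: "'k poly"
 have ev_le: "ev N p = ev M p" if "degree p \<le> N" "N \<le> M" for N M p
  unfolding ev_def by (rule sum.mono_neutral_left) (use that in \<open>auto simp: coeff_eq_0\<close>)
 define ann where "ann p \<longleftrightarrow> p \<noteq> 0 \<and> ev (degree p) p = 0" for p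
 have "card (UNIV :: 'n set) < card {..CARD('n)}" by simp
 then obtain l where l: "\<exists>i\<in>{..CARD('n)}. l i \<noteq> 0"
  "\<And>b. (\<Sum>i\<le>CARD('n). l i * (mpow T i *v w0) $ b) = 0"
  using homogeneous_system[of UNIV "{..CARD('n)}" "\<lambda>i b. (mpow T i *v w0) $ b"] by auto
 define p where "p = (\<Sum>i\<le>CARD('n). monom (l i) i)"
 have coeffp: "coeff p i = (if i \<le> CARD('n) then l i else 0)" for i
  unfolding p_def by (simp add: coeff_sum coeff_monom)
 have "p \<noteq> 0" using l(1) coeffp by (metis atMost_iff coeff_0)
 moreover have "ev CARD('n) p = 0"
  unfolding ev_def vec_eq_iff using l(2) by (simp add: coeffp)
 moreover have "degree p \<le> CARD('n)" by (intro degree_le) (simp add: coeffp)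
 ultimately have "ann p" unfolding ann_def using ev_le[OF order.refl] by simp
 then have "\<exists>p. ann p \<and> (\<forall>q. ann q \<longrightarrow> degree p \<le> degree q)" by (rule ex_has_least_nat)
 then obtain p where p: "ann p" and min: "\<And>q. degree q < degree p \<Longrightarrow> \<not> ann q"
  by (meson not_le)
 have "degree p \<noteq> 0"
 proof
  assume d: "degree p = 0"
  then have "coeff p 0 *s w0 = 0" using p unfolding ann_def ev_def by simp
  moreover have "coeff p 0 \<noteq> 0" using p d unfolding ann_def by (metis leading_coeff_0_iff)
  ultimately show False using w0 by simp
 qed
 then obtain \<mu> where "poly p \<mu> = 0" using alg_closed_imp_poly_has_root[of p] by auto
 then obtain q where q: "p = [:- \<mu>, 1:] * q" using poly_eq_0_iff_dvd by blast
 then have "q \<noteq> 0" using p unfolding ann_def by auto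
 then have dq: "degree p = Suc (degree q)" unfolding q by (subst degree_mult_eq) auto
 define N where "N = degree q"
 define w where "w = ev N q"
 have "\<not> ann q" using min dq by simp
 then have "w \<noteq> 0" unfolding w_def N_def ann_def using \<open>q \<noteq> 0\<close> by simp
 moreover have TE: "mpow T i *v w0 \<in> E" for i
  by (induction i) (use w0 stable in \<open>auto simp: matrix_vector_mul_assoc[symmetric]\<close>)
 then have "w \<in> E" unfolding w_def ev_def
  by (intro vec.subspace_sum[OF E] vec.subspace_scale[OF E])
 moreover have "T *v w = \<mu> *s w"
 proof -
  have "ev (Suc N) p = ev (Suc N) (pCons 0 q) - ev (Suc N) (smult \<mu> q)"
  proof -
   have "coeff p i = coeff (pCons 0 q) i - coeff (smult \<mu> q) i" for i unfolding q by simp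
   then show ?thesis unfolding ev_def sum_subtractf[symmetric]
    by (simp only: vec.scale_left_diff_distrib)
  qed
  also have "ev (Suc N) (smult \<mu> q) = \<mu> *s ev (Suc N) q"
   unfolding ev_def by (simp add: vec.scale_sum_right)
  also have "ev (Suc N) q = w" unfolding w_def using ev_le[of q N "Suc N"] by (simp add: N_def)
  also have "ev (Suc N) (pCons 0 q) = T *v w"
   unfolding ev_def w_def sum.atMost_Suc_shift
   by (simp add: vec.sum vec.scale matrix_vector_mul_assoc)
  also have "ev (Suc N) p = 0" using p dq unfolding ann_def N_def by simp
  finally show ?thesis by simp
 qed
 ultimately show ?thesis using that by blast
qed

section \<open>Kolchin's theorem\<close>

definition msc :: "'k::field \<Rightarrow> 'k ^ 'n ^ 'n \<Rightarrow> 'k ^ 'n ^ 'n" where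
 "msc c A = (\<chi> i j. c * A $ i $ j)"

lemma msc_vec: "msc c A *v x = c *s (A *v x)"
 by (simp add: msc_def matrix_vector_mult_def vec_eq_iff sum_distrib_left mult.assoc)

lemma trace_msc: "trace (msc c A) = c * trace A"
 by (simp add: msc_def trace_def sum_distrib_left)

lemma msc_mult_left: "msc c A ** B = msc c (A ** B)"
 by (simp add: msc_def matrix_matrix_mult_def vec_eq_iff sum_distrib_left mult.assoc)

lemma msc_mult_right: "A ** msc c B = msc c (A ** B)"
 by (simp add: msc_def matrix_matrix_mult_def vec_eq_iff sum_distrib_left mult.left_commute)

lemma matrix_diff_ldistrib: "(A :: 'k::field ^ 'n ^ 'n) ** (B - C) = A ** B - A ** C"
 by (simp add: matrix_eq matrix_vector_mul_assoc[symmetric] matrix_vector_mult_diff_rdistrib vec.diff)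

lemma matrix_diff_rdistrib: "((B :: 'k::field ^ 'n ^ 'n) - C) ** A = B ** A - C ** A"
 by (simp add: matrix_eq matrix_vector_mul_assoc[symmetric] matrix_vector_mult_diff_rdistrib)

lemma matrix_add_rdistrib': "((B :: 'k::field ^ 'n ^ 'n) + C) ** A = B ** A + C ** A"
 by (simp add: matrix_eq matrix_vector_mul_assoc[symmetric] matrix_vector_mult_add_rdistrib)

text \<open>The augmentation ideal. For \<open>U\<close> closed under multiplication it is closed
  under products, as (u - 1)(v - 1) = (uv - 1) - (u - 1) - (v - 1); linear statements such as
  vanishing of traces need checking on the generators only.\<close>

inductive_set nspan :: "('k::field ^ 'n ^ 'n) set \<Rightarrow> ('k ^ 'n ^ 'n) set" for U where
 zero: "0 \<in> nspan U"
| base: "u \<in> U \<Longrightarrow> u - mat 1 \<in> nspan U"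
| add: "A \<in> nspan U \<Longrightarrow> B \<in> nspan U \<Longrightarrow> A + B \<in> nspan U"
| scale: "A \<in> nspan U \<Longrightarrow> msc c A \<in> nspan U"

lemma nspan_diff: "A \<in> nspan U \<Longrightarrow> B \<in> nspan U \<Longrightarrow> A - B \<in> nspan U"
proof -
 assume "A \<in> nspan U" "B \<in> nspan U"
 then have "A + msc (- 1) B \<in> nspan U" by (intro nspan.add nspan.scale)
 moreover have "A + msc (- 1) B = A - B" by (simp add: msc_def vec_eq_iff)
 ultimately show ?thesis by simp
qed

lemma nspan_mult:
 assumes U: "\<And>u v. u \<in> U \<Longrightarrow> v \<in> U \<Longrightarrow> u ** v \<in> U" and A: "A \<in> nspan U" and B: "B \<in> nspan U"
 shows "A ** B \<in> nspan U"
 using A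
proof (induction rule: nspan.induct)
 case zero
 show ?case using nspan.zero by (simp add: matrix_eq0 matrix_vector_mul_assoc[symmetric])
next
 case (base u)
 show ?case using B
 proof (induction rule: nspan.induct)
  case zero
  show ?case using nspan.zero by (simp add: matrix_eq0 matrix_vector_mul_assoc[symmetric])
 next
  case (base v)
  have "(u - mat 1) ** (v - mat 1) = (u ** v - mat 1) - (u - mat 1) - (v - mat 1)"
   by (simp add: matrix_diff_ldistrib matrix_diff_rdistrib)
  then show ?case using U \<open>u \<in> U\<close> base by (metis nspan.base nspan_diff)
 next
  case (add A B)
  then show ?case by (simp add: matrix_add_ldistrib nspan.add)
 next
  case (scale A c)
  then show ?case by (simp add: msc_mult_right nspan.scale)
 qed
next
 case (add A B)
 then show ?case by (simp add: matrix_add_rdistrib' nspan.add)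
next
 case (scale A c)
 then show ?case by (simp add: msc_mult_left nspan.scale)
qed

text \<open>
 Kolchin's theorem for the quotient by \<open>W\<close>. If the conclusion fails, \<open>nspan U\<close> acts irreducibly
 on a quotient \<open>W' / W\<close>, modelled by the corner \<open>f z f\<close> of a projection \<open>f\<close>. All these corners have
 trace zero, but a nonzero one of minimal rank has rank one by Burnside's argument, and then some
 product of corners is an idempotent of rank one.
\<close>

theorem kolchin:
 fixes U :: "('k::alg_closed_field ^ 'n ^ 'n) set"
 assumes mult: "\<And>u v. u \<in> U \<Longrightarrow> v \<in> U \<Longrightarrow> u ** v \<in> U"
  and unip: "\<And>u. u \<in> U \<Longrightarrow> \<exists>m. mpow (u - mat 1) m = 0"
  and W: "vec.subspace W" and stable: "\<And>u w. u \<in> U \<Longrightarrow> w \<in> W \<Longrightarrow> u *v w \<in> W" and "W \<noteq> UNIV"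
 shows "\<exists>v. v \<notin> W \<and> (\<forall>u\<in>U. u *v v - v \<in> W)"
proof (rule ccontr)
 assume no: "\<not> ?thesis"
 \<comment> \<open>\<open>W'\<close> will be a stable subspace of least dimension properly
   containing \<open>W\<close>, so that the quotient is irreducible.\<close>
 define P where "P V \<longleftrightarrow> vec.subspace V \<and> W \<subset> V \<and> (\<forall>u\<in>U. \<forall>v\<in>V. u *v v \<in> V)" for V
 have "P UNIV" unfolding P_def using \<open>W \<noteq> UNIV\<close> by auto
 then obtain W' where "P W'" and min: "\<And>V. P V \<Longrightarrow> vec.dim W' \<le> vec.dim V"
  using ex_has_least_nat[of P UNIV vec.dim] by blast
 then have W': "vec.subspace W'" "W \<subset> W'" "\<And>u v. u \<in> U \<Longrightarrow> v \<in> W' \<Longrightarrow> u *v v \<in> W'" unfolding P_def by auto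
 obtain f :: "'k ^ 'n ^ 'n" where fW: "\<And>w. w \<in> W \<Longrightarrow> f *v w = 0" and fW': "\<And>x. f *v x \<in> W'"
  and fdiff: "\<And>x. x \<in> W' \<Longrightarrow> x - f *v x \<in> W" and ff: "\<And>x. f *v (f *v x) = f *v x"
  using projection_matrix[OF W W'(1)] W'(2) by (metis psubsetE)
 define N where "N = nspan U"
 have NW: "z *v x \<in> V" if "z \<in> N" "x \<in> V" "vec.subspace V" "\<And>u v. u \<in> U \<Longrightarrow> v \<in> V \<Longrightarrow> u *v v \<in> V" for z x V
  using that(1) unfolding N_def
 proof (induction rule: nspan.induct)
  case zero
  show ?case using vec.subspace_0[OF that(3)] by simp
 next
  case (base u)
  show ?case using vec.subspace_diff[OF that(3) that(4)[OF base that(2)] that(2)]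
   by (simp add: matrix_vector_mult_diff_rdistrib)
 next
  case (add A B)
  then show ?case using vec.subspace_add[OF that(3)] by (simp add: matrix_vector_mult_add_rdistrib)
 next
  case (scale A c)
  then show ?case using vec.subspace_scale[OF that(3)] by (simp add: msc_vec)
 qed
 have NW1: "z *v x \<in> W" if "z \<in> N" "x \<in> W" for z x using NW[OF that W stable] by blast
 have NW2: "z *v x \<in> W'" if "z \<in> N" "x \<in> W'" for z x using NW[OF that W'(1,3)] by blast
 define F where "F z = f ** z ** f" for z
 have Fv: "F z *v x = f *v (z *v (f *v x))" for z x
  unfolding F_def by (simp add: matrix_vector_mul_assoc matrix_mul_assoc)
 have fzf: "f *v (z *v (f *v y)) = f *v (z *v y)" if "z \<in> N" "y \<in> W'" for z y
 proof -
  have "f *v (z *v (y - f *v y)) = 0" using fW NW1[OF that(1) fdiff[OF that(2)]] by blast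
  then show ?thesis by (simp add: matrix_vector_diff_vec)
 qed
 have Fmult: "F z ** F z' = F (z ** z')" if "z \<in> N" "z' \<in> N" for z z'
  unfolding matrix_eq
  by (simp add: matrix_vector_mul_assoc[symmetric] Fv ff fzf[OF that(1)] NW2[OF that(2)] fW')
 have Nmult: "z ** z' \<in> N" if "z \<in> N" "z' \<in> N" for z z' using nspan_mult[OF mult] that unfolding N_def by blast
 have trace0: "trace (F z) = 0" if "z \<in> N" for z
  using that unfolding N_def
 proof (induction rule: nspan.induct)
  case zero
  have "F 0 = 0" by (rule matrix_eq0) (simp add: Fv)
  then show ?case by (simp add: trace_def)
 next
  case (base u)
  then have uN: "u - mat 1 \<in> N" unfolding N_def by (rule nspan.base)
  obtain m where m: "mpow (u - mat 1) m = 0" using unip base by blast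
  have W'pow: "mpow (u - mat 1) k *v y \<in> W'" if "y \<in> W'" for k y
   by (induction k) (use that NW2[OF uN] in \<open>auto simp: matrix_vector_mul_assoc[symmetric]\<close>)
  have "mpow (F (u - mat 1)) (Suc k) *v x = f *v (mpow (u - mat 1) (Suc k) *v (f *v x))" for k x
  proof (induction k)
   case 0
   show ?case by (simp add: Fv)
  next
   case (Suc k)
   have "mpow (F (u - mat 1)) (Suc (Suc k)) *v x = F (u - mat 1) *v (mpow (F (u - mat 1)) (Suc k) *v x)"
    by (simp add: matrix_vector_mul_assoc)
   also have "\<dots> = f *v ((u - mat 1) *v (f *v (mpow (u - mat 1) (Suc k) *v (f *v x))))"
    unfolding Suc Fv ff ..
   also have "\<dots> = f *v ((u - mat 1) *v (mpow (u - mat 1) (Suc k) *v (f *v x)))"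
    by (rule fzf[OF uN W'pow[OF fW']])
   finally show ?case by (simp add: matrix_vector_mul_assoc matrix_mul_assoc)
  qed
  moreover have "mpow (u - mat 1) (Suc m) = 0" by (rule mpow_zero_le[OF m]) simp
  ultimately have "mpow (F (u - mat 1)) (Suc m) = 0" by (intro matrix_eq0) simp
  then show ?case by (rule trace_nilpotent)
 next
  case (add A B)
  have "F (A + B) = F A + F B" unfolding F_def by (simp add: matrix_add_ldistrib matrix_add_rdistrib')
  then show ?case using add by (simp add: trace_add)
 next
  case (scale A c)
  have "F (msc c A) = msc c (F A)" unfolding F_def by (simp add: msc_mult_left msc_mult_right)
  then show ?case using scale by (simp add: trace_msc)
 qed
 \<comment> \<open>Irreducibility at work: \<open>N x + W\<close> is stable, and larger than
   \<open>W\<close> because \<open>x\<close> would otherwise be a vector excluded by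
   \<open>no\<close>; hence it is all of \<open>W'\<close>.\<close>
 have trans: "\<exists>z\<in>N. F z *v x = f *v y" if x: "f *v x = x" "x \<noteq> 0" for x y
 proof -
  have "x \<in> W'" using fW'[of x] x by simp
  have "x \<notin> W" using fW x by auto
  define V where "V = {z *v x + w | z w. z \<in> N \<and> w \<in> W}"
  have VI: "z *v x + w \<in> V" if "z \<in> N" "w \<in> W" for z w using that unfolding V_def by blast
  have V: "vec.subspace V"
   unfolding vec.subspace_def
  proof (intro conjI ballI allI)
   show "0 \<in> V" using VI[of 0 0] vec.subspace_0[OF W] nspan.zero[of U] by (simp add: N_def)
  next
   fix a b assume "a \<in> V" "b \<in> V"
   then obtain z w z' w' where "a = z *v x + w" "b = z' *v x + w'" "z \<in> N" "w \<in> W" "z' \<in> N" "w' \<in> W"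
    unfolding V_def by blast
   then show "a + b \<in> V"
    using VI[of "z + z'" "w + w'"] vec.subspace_add[OF W] nspan.add[of z U z']
    by (simp add: N_def matrix_vector_mult_add_rdistrib algebra_simps)
  next
   fix c a assume "a \<in> V"
   then obtain z w where "a = z *v x + w" "z \<in> N" "w \<in> W" unfolding V_def by blast
   then show "c *s a \<in> V"
    using VI[of "msc c z" "c *s w"] vec.subspace_scale[OF W] nspan.scale[of z U c]
    by (simp add: N_def msc_vec vec.scale_right_distrib)
  qed
  have WV: "W \<subseteq> V"
  proof
   fix w assume "w \<in> W"
   then show "w \<in> V" using VI[of 0 w] nspan.zero[of U] by (simp add: N_def)
  qed
  have "V \<subseteq> W'"
   unfolding V_def using NW2 \<open>x \<in> W'\<close> W'(2) vec.subspace_add[OF W'(1)] by blast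
  have stab: "u *v a \<in> V" if u: "u \<in> U" and "a \<in> V" for u a
  proof -
   obtain z w where a: "a = z *v x + w" "z \<in> N" "w \<in> W" using \<open>a \<in> V\<close> unfolding V_def by blast
   have "(u - mat 1) ** z + z \<in> N"
    using Nmult[of "u - mat 1" z] nspan.base[OF u] nspan.add a(2) unfolding N_def by blast
   moreover have "u *v a = ((u - mat 1) ** z + z) *v x + u *v w"
    unfolding a by (simp add: matrix_vector_mult_add_rdistrib matrix_diff_rdistrib
      matrix_vector_mult_diff_rdistrib vec.add matrix_vector_mul_assoc)
   ultimately show ?thesis using VI stable[OF u a(3)] by simp
  qed
  have "\<exists>u\<in>U. u *v x - x \<notin> W" using no \<open>x \<notin> W\<close> by blast
  then obtain u where u: "u \<in> U" "u *v x - x \<notin> W" by blast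
  have "(u - mat 1) *v x + 0 \<in> V"
   using VI[of "u - mat 1" 0] nspan.base[OF u(1)] vec.subspace_0[OF W] unfolding N_def by blast
  then have "V \<noteq> W" using u(2) by (auto simp: matrix_vector_mult_diff_rdistrib)
  then have "P V" unfolding P_def using V WV stab by auto
  then have "V = W'" using min \<open>V \<subseteq> W'\<close> V W'(1) by (intro vec.subspace_dim_equal)
  then obtain z w where z: "f *v y = z *v x + w" "z \<in> N" "w \<in> W" using fW'[of y] unfolding V_def by blast
  have "F z *v x = f *v (z *v x + w)" unfolding Fv x(1) using fW[OF z(3)] by (simp add: vec.add)
  also have "\<dots> = f *v y" unfolding z(1)[symmetric] by (rule ff)
  finally show ?thesis using z(2) by blast
 qed
 obtain x0 where "x0 \<in> W'" "x0 \<notin> W" using W'(2) by blast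
 then have "f *v x0 \<noteq> 0" using fdiff[of x0] by auto
 then obtain z0 where "z0 \<in> N" "F z0 *v (f *v x0) = f *v x0" using trans[OF ff] by blast
 then have z0: "z0 \<in> N \<and> F z0 \<noteq> 0" using \<open>f *v x0 \<noteq> 0\<close> by auto
 obtain z1 where "z1 \<in> N \<and> F z1 \<noteq> 0"
  and rmin: "\<And>z. z \<in> N \<and> F z \<noteq> 0 \<Longrightarrow> vec.dim (range ((*v) (F z1))) \<le> vec.dim (range ((*v) (F z)))"
  using ex_has_least_nat[of "\<lambda>z. z \<in> N \<and> F z \<noteq> 0" z0 "\<lambda>z. vec.dim (range ((*v) (F z)))", OF z0] by blast
 then have z1: "z1 \<in> N" "F z1 \<noteq> 0" by auto
 define j where "j = F z1"
 obtain e1 where e1: "j *v e1 \<noteq> 0" using z1(2) matrix_eq0 unfolding j_def by blast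
 define y1 where "y1 = j *v e1"
 have fy1: "f *v y1 = y1" unfolding y1_def j_def Fv ff ..
 have jf: "j *v (f *v x) = j *v x" for x unfolding j_def Fv ff ..
 have y1: "y1 \<noteq> 0" using e1 unfolding y1_def .
 show False
 proof (cases "\<forall>e. \<exists>c. j *v e = c *s y1")
  case True
  \<comment> \<open>Rank one: \<open>z2\<close> sends \<open>y1\<close> back to \<open>f e1\<close>,
    so \<open>M\<close> fixes \<open>y1\<close>, and a matrix whose range is the line of a fixed
    nonzero vector has trace 1.\<close>
  obtain z2 where z2: "z2 \<in> N" "F z2 *v y1 = f *v e1" using trans[OF fy1 y1] by blast
  define M where "M = j ** F z2"
  have My1: "M *v y1 = y1"
   unfolding M_def by (simp add: matrix_vector_mul_assoc[symmetric] z2(2) jf) (simp add: y1_def)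
  have "\<exists>c. M *v e = c *s y1" for e
   unfolding M_def using True by (simp add: matrix_vector_mul_assoc[symmetric])
  then have "\<forall>b. \<exists>c. M *v axis b 1 = c *s y1" by blast
  then obtain c where "\<forall>b. M *v axis b 1 = c b *s y1" by (rule choice[THEN exE])
  then have c: "M *v axis b 1 = c b *s y1" for b by blast
  have entry: "M $ a $ b = c b * y1 $ a" for a b
   using arg_cong[OF c[of b], of "\<lambda>v. v $ a"] by (simp add: matrix_vector_axis)
  have "M *v y1 = (\<Sum>b\<in>UNIV. c b * y1 $ b) *s y1"
   by (simp add: vec_eq_iff matrix_vector_mult_def entry sum_distrib_left ac_simps)
  then have "((\<Sum>b\<in>UNIV. c b * y1 $ b) - 1) *s y1 = 0"
   unfolding My1 by (simp only: vec.scale_left_diff_distrib vec.scale_one) simp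
  then have "(\<Sum>b\<in>UNIV. c b * y1 $ b) - 1 = 0" using y1 vec.scale_eq_0_iff by blast
  then have "(\<Sum>b\<in>UNIV. c b * y1 $ b) = 1" by simp
  then have "trace M = 1" unfolding trace_def entry .
  moreover have "trace M = 0" unfolding M_def j_def Fmult[OF z1(1) z2(1)] by (intro trace0 Nmult z1 z2)
  ultimately show False by simp
 next
  case False
  then obtain e2 where e2: "\<And>c. j *v e2 \<noteq> c *s y1" by blast
  obtain z2 where z2: "z2 \<in> N" "F z2 *v y1 = f *v e2" using trans[OF fy1 y1] by blast
  \<comment> \<open>\<open>T\<close> maps the range of \<open>j\<close> into itself and has an
    eigenvalue \<open>\<mu>\<close> there, so \<open>T - \<mu>\<close> after \<open>j\<close> has
    smaller rank than \<open>j\<close>. It is nonzero because \<open>T y1 = j e2\<close> is not a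
    multiple of \<open>y1\<close>, and it is the corner of a member \<open>z3\<close> of
    \<open>N\<close>, against the choice of \<open>z1\<close>.\<close>
  define T where "T = j ** F z2"
  define E where "E = range ((*v) j)"
  have E: "vec.subspace E" unfolding E_def by (rule subspace_range)
  have "T *v x \<in> E" for x unfolding T_def E_def by (simp add: matrix_vector_mul_assoc[symmetric])
  moreover have "y1 \<in> E" unfolding E_def y1_def by blast
  ultimately obtain w \<mu> where w: "w \<in> E" "w \<noteq> 0" "T *v w = \<mu> *s w"
   using y1 by (rule eigenvector_on_subspace[OF E])
  define z3 where "z3 = z1 ** z2 ** z1 - msc \<mu> z1"
  have z3: "z3 \<in> N" using nspan_diff[of "z1 ** z2 ** z1" U "msc \<mu> z1"] nspan.scale[of z1 U \<mu>]
    Nmult[OF Nmult[OF z1(1) z2(1)] z1(1)] z1(1) unfolding z3_def N_def by blast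
  have "F z3 = F (z1 ** z2 ** z1) - msc \<mu> (F z1)"
   unfolding z3_def F_def by (simp add: matrix_diff_ldistrib matrix_diff_rdistrib msc_mult_left msc_mult_right)
  also have "F (z1 ** z2 ** z1) = T ** j"
   unfolding T_def j_def using Fmult Nmult z1(1) z2(1) by simp
  finally have Fz3: "F z3 = (T - msc \<mu> (mat 1)) ** j"
   unfolding j_def by (simp add: matrix_diff_rdistrib msc_mult_left)
  have "T *v y1 = j *v e2" unfolding T_def by (simp add: matrix_vector_mul_assoc[symmetric] z2(2) jf)
  then have "F z3 *v e1 = j *v e2 - \<mu> *s y1"
   unfolding Fz3 by (simp add: matrix_vector_mul_assoc[symmetric] y1_def[symmetric]
     matrix_vector_mult_diff_rdistrib msc_vec)
  then have "F z3 \<noteq> 0" using e2[of \<mu>] by auto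
  then have "vec.dim E \<le> vec.dim (range ((*v) (F z3)))" unfolding E_def j_def using rmin z3 by blast
  moreover have "range ((*v) (F z3)) = (*v) (T - msc \<mu> (mat 1)) ` E"
   unfolding Fz3 E_def by (rule range_mult)
  moreover have "vec.dim ((*v) (T - msc \<mu> (mat 1)) ` E) < vec.dim E"
   by (rule dim_image_less[OF E w(1,2)]) (simp add: matrix_vector_mult_diff_rdistrib msc_vec w(3))
  ultimately show False by simp
 qed
qed

section \<open>The flag of successive fixed spaces\<close>

primrec fixed_flag :: "('k::field ^ 'n ^ 'n) set \<Rightarrow> nat \<Rightarrow> ('k ^ 'n) set" where
 "fixed_flag U 0 = {0}"
| "fixed_flag U (Suc i) = {v. \<forall>u\<in>U. u *v v - v \<in> fixed_flag U i}"

lemma subspace_fixed_flag: "vec.subspace (fixed_flag U i)"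
proof (induction i)
 case (Suc i)
 show ?case
  unfolding vec.subspace_def
 proof (intro conjI ballI allI)
  show "0 \<in> fixed_flag U (Suc i)" using vec.subspace_0[OF Suc] by simp
 next
  fix x y assume "x \<in> fixed_flag U (Suc i)" "y \<in> fixed_flag U (Suc i)"
  then have "(u *v x - x) + (u *v y - y) \<in> fixed_flag U i" if "u \<in> U" for u
   using vec.subspace_add[OF Suc] that by auto
  then show "x + y \<in> fixed_flag U (Suc i)" by (simp add: vec.add algebra_simps)
 next
  fix c x assume "x \<in> fixed_flag U (Suc i)"
  then have "c *s (u *v x - x) \<in> fixed_flag U i" if "u \<in> U" for u
   by (intro vec.subspace_scale[OF Suc]) (use that in auto)
  then show "c *s x \<in> fixed_flag U (Suc i)" by (simp add: vec.scale vec.scale_right_diff_distrib)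
 qed
qed simp

lemma fixed_flag_mono: "fixed_flag U i \<subseteq> fixed_flag U (Suc i)"
proof (induction i)
 case 0
 show ?case by simp
next
 case (Suc i)
 then show ?case by auto
qed

lemma fixed_flag_stable:
 assumes "\<And>u. u \<in> U \<Longrightarrow> \<exists>u'\<in>U. u ** k = k ** u'" "v \<in> fixed_flag U i"
 shows "k *v v \<in> fixed_flag U i"
 using assms(2)
proof (induction i arbitrary: v)
 case (Suc i)
 have "u *v (k *v v) - k *v v \<in> fixed_flag U i" if u: "u \<in> U" for u
 proof -
  obtain u' where u': "u' \<in> U" "u ** k = k ** u'" using assms(1) u by blast
  then have "u *v (k *v v) - k *v v = k *v (u' *v v - v)"
   by (simp add: matrix_vector_mul_assoc matrix_vector_diff_vec)
  then show ?thesis using Suc u'(1) by simp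
 qed
 then show ?case by simp
qed simp

lemma fixed_flag_UNIV:
 fixes U :: "('k::alg_closed_field ^ 'n ^ 'n) set"
 assumes mult: "\<And>u v. u \<in> U \<Longrightarrow> v \<in> U \<Longrightarrow> u ** v \<in> U"
  and unip: "\<And>u. u \<in> U \<Longrightarrow> \<exists>m. mpow (u - mat 1) m = 0"
 shows "fixed_flag U CARD('n) = UNIV"
proof -
 have "fixed_flag U i = UNIV \<or> i \<le> vec.dim (fixed_flag U i)" for i
 proof (induction i)
  case (Suc i)
  show ?case
  proof (cases "fixed_flag U i = UNIV")
   case True
   then show ?thesis by simp
  next
   case False
   have "u *v w \<in> fixed_flag U i" if "u \<in> U" "w \<in> fixed_flag U i" for u w
   proof -
    have "u *v w - w \<in> fixed_flag U i"
     using fixed_flag_mono[of U i] that by auto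
    then have "(u *v w - w) + w \<in> fixed_flag U i"
     using vec.subspace_add[OF subspace_fixed_flag] that(2) by blast
    then show ?thesis by simp
   qed
   then obtain v where v: "v \<notin> fixed_flag U i" "\<forall>u\<in>U. u *v v - v \<in> fixed_flag U i"
    using kolchin[OF mult unip subspace_fixed_flag _ False] by blast
   then have "fixed_flag U (Suc i) \<noteq> fixed_flag U i" by auto
   then have "vec.dim (fixed_flag U i) < vec.dim (fixed_flag U (Suc i))"
    using vec.subspace_dim_equal[OF subspace_fixed_flag subspace_fixed_flag fixed_flag_mono, of U i]
    by (metis not_le)
   then show ?thesis using Suc False by linarith
  qed
 qed simp
 from this[of "CARD('n)"] show ?thesis
  using vec.subspace_dim_equal[OF subspace_fixed_flag[of U "CARD('n)"] vec.subspace_UNIV]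
  by (auto simp: card_cart_basis)
qed

text \<open>\<open>y\<close> normalizes \<open>U\<close> and hence preserves its flag, while
  \<open>x\<close> acts trivially on the successive quotients. There \<open>x y\<close> and
  \<open>y\<close> induce the same map, so the \<open>m\<close>-th power of \<open>x y - 1\<close>
  moves each space of the flag one step down.\<close>

lemma unipotent_mult:
 fixes U :: "('k::alg_closed_field ^ 'n ^ 'n) set"
 assumes mult: "\<And>u v. u \<in> U \<Longrightarrow> v \<in> U \<Longrightarrow> u ** v \<in> U"
  and unip: "\<And>u. u \<in> U \<Longrightarrow> \<exists>m. mpow (u - mat 1) m = 0"
  and norm: "\<And>u. u \<in> U \<Longrightarrow> \<exists>u'\<in>U. u ** y = y ** u'" and x: "x \<in> U" and y: "mpow (y - mat 1) m = 0"
 shows "\<exists>m. mpow (x ** y - mat 1) m = 0"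
proof -
 have cong: "mpow (x ** y - mat 1) l *v v - mpow (y - mat 1) l *v v \<in> fixed_flag U i
   \<and> mpow (x ** y - mat 1) l *v v \<in> fixed_flag U (Suc i)"
  if v: "v \<in> fixed_flag U (Suc i)" for v i l
 proof (induction l)
  case 0
  show ?case using v vec.subspace_0[OF subspace_fixed_flag, of U i] by simp
 next
  case (Suc l)
  define a where "a = mpow (x ** y - mat 1) l *v v"
  define b where "b = mpow (y - mat 1) l *v v"
  have ab: "a - b \<in> fixed_flag U i" "a \<in> fixed_flag U (Suc i)" using Suc unfolding a_def b_def by auto
  have ya: "y *v a \<in> fixed_flag U (Suc i)" by (rule fixed_flag_stable[OF norm ab(2)])
  then have 1: "x *v (y *v a) - y *v a \<in> fixed_flag U i" using x by simp
  have "y *v (a - b) \<in> fixed_flag U i" by (rule fixed_flag_stable[OF norm ab(1)])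
  then have 2: "y *v (a - b) - (a - b) \<in> fixed_flag U i"
   using ab(1) by (rule vec.subspace_diff[OF subspace_fixed_flag])
  have eqa: "mpow (x ** y - mat 1) (Suc l) *v v = x *v (y *v a) - a"
   unfolding a_def by (simp add: matrix_vector_mul_assoc[symmetric] matrix_vector_mult_diff_rdistrib)
  have eqb: "mpow (y - mat 1) (Suc l) *v v = y *v b - b"
   unfolding b_def by (simp add: matrix_vector_mul_assoc[symmetric] matrix_vector_mult_diff_rdistrib)
  have "(x *v (y *v a) - y *v a) + (y *v (a - b) - (a - b)) \<in> fixed_flag U i"
   using 1 2 by (rule vec.subspace_add[OF subspace_fixed_flag])
  moreover have "x *v (y *v a) - a \<in> fixed_flag U (Suc i)"
  proof -
   have "x *v (y *v a) - y *v a \<in> fixed_flag U (Suc i)" using 1 fixed_flag_mono by blast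
   then have "(x *v (y *v a) - y *v a) + (y *v a - a) \<in> fixed_flag U (Suc i)"
    using vec.subspace_diff[OF subspace_fixed_flag ya ab(2)]
    by (rule vec.subspace_add[OF subspace_fixed_flag])
   then show ?thesis by simp
  qed
  ultimately show ?case unfolding eqa eqb by (simp add: matrix_vector_diff_vec algebra_simps)
 qed
 have "mpow (x ** y - mat 1) (m * i) *v v \<in> fixed_flag U (CARD('n) - i)" if "i \<le> CARD('n)" for i v
  using that
 proof (induction i)
  case 0
  show ?case using fixed_flag_UNIV[OF mult unip] by simp
 next
  case (Suc i)
  define a where "a = mpow (x ** y - mat 1) (m * i) *v v"
  have eq: "CARD('n) - i = Suc (CARD('n) - Suc i)" using Suc.prems by simp
  have "a \<in> fixed_flag U (Suc (CARD('n) - Suc i))" using Suc unfolding a_def eq[symmetric] by simp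
  then have "mpow (x ** y - mat 1) m *v a - mpow (y - mat 1) m *v a \<in> fixed_flag U (CARD('n) - Suc i)"
   using cong by blast
  then show ?case unfolding a_def by (simp add: y mpow_add matrix_vector_mul_assoc)
 qed
 from this[of "CARD('n)"] have "mpow (x ** y - mat 1) (m * CARD('n)) = 0"
  by (intro matrix_eq0) simp
 then show ?thesis by blast
qed

text \<open>Bases of the successive spaces are chosen to extend each other; \<open>c j\<close> is
  the first index whose basis contains the \<open>j\<close>-th vector. As the first space is zero,
  levels start at 1.\<close>

lemma adapted_basis:
 fixes W :: "nat \<Rightarrow> ('k::field ^ 'n) set"
 assumes W: "\<And>i. vec.subspace (W i)" "\<And>i. W i \<subseteq> W (Suc i)" "W 0 = {0}" "W m = UNIV"
 obtains b :: "'k ^ 'n ^ 'n" and c :: "'n \<Rightarrow> nat" where "invertible b" "\<And>j. c j > 0"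
  "\<And>l y. b *v y \<in> W l \<longleftrightarrow> (\<forall>j. y $ j \<noteq> 0 \<longrightarrow> c j \<le> l)"
proof -
 define good where "good l B \<longleftrightarrow> vec.independent B \<and> B \<subseteq> W l \<and> W l \<subseteq> vec.span B" for l B
 have "\<exists>B. \<forall>l. good l (B l) \<and> B l \<subseteq> B (Suc l)"
 proof (rule dependent_nat_choice)
  show "\<exists>B. good 0 B" unfolding good_def by (intro exI[of _ "{}"]) (auto simp: W vec.independent_empty)
  fix B l assume "good l B"
  then have "B \<subseteq> W (Suc l)" "vec.independent B" using W(2) unfolding good_def by auto
  then obtain C where "B \<subseteq> C" "C \<subseteq> W (Suc l)" "vec.independent C" "W (Suc l) \<subseteq> vec.span C"
   by (rule vec.maximal_independent_subset_extend) (rule that)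
  then show "\<exists>C. good (Suc l) C \<and> B \<subseteq> C" unfolding good_def by blast
 qed
 then obtain B where B: "\<And>l. vec.independent (B l)" "\<And>l. B l \<subseteq> W l" "\<And>l. W l \<subseteq> vec.span (B l)"
  "\<And>l. B l \<subseteq> B (Suc l)" unfolding good_def by blast
 have Bmono: "B i \<subseteq> B k" if "i \<le> k" for i k by (rule lift_Suc_mono_le[of B, OF B(4) that])
 have fin: "finite (B l)" for l by (rule vec.finiteI_independent[OF B(1)])
 have Bm: "vec.span (B m) = UNIV" using B(3)[of m] W(4) by auto
 \<comment> \<open>Beyond \<open>m\<close> the bases cannot grow, since that of the whole space is
   already maximal.\<close>
 have Bsub: "B l \<subseteq> B m" for l
 proof (cases "l \<le> m")
  case True
  then show ?thesis by (rule Bmono)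
 next
  case False
  then have sub: "B m \<subseteq> B l" by (intro Bmono) auto
  have "v \<in> B m" if "v \<in> B l" for v
  proof (rule ccontr)
   assume "v \<notin> B m"
   then have "B m \<subseteq> B l - {v}" using sub by blast
   then have "v \<in> vec.span (B l - {v})" using Bm vec.span_mono by blast
   then show False using B(1)[of l] that unfolding vec.dependent_def by blast
  qed
  then show ?thesis by blast
 qed
 have "card (B m) = CARD('n)"
  using vec.dim_span_eq_card_independent[OF B(1)[of m]] by (simp add: Bm card_cart_basis)
 then obtain \<beta> where \<beta>: "bij_betw \<beta> (UNIV :: 'n set) (B m)"
  using finite_same_card_bij[OF finite fin[of m]] by metis
 define b :: "'k ^ 'n ^ 'n" where "b = (\<chi> i j. \<beta> j $ i)"
 have bv: "b *v y = (\<Sum>j\<in>UNIV. y $ j *s \<beta> j)" for y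
  by (simp add: b_def matrix_vector_mult_def vec_eq_iff mult.commute)
 have sum\<beta>: "(\<Sum>j\<in>UNIV. F (\<beta> j)) = sum F (B m)" for F :: "'k ^ 'n \<Rightarrow> 'k ^ 'n"
  by (rule sum.reindex_bij_betw[OF \<beta>])
 have inj: "inj ((*v) b)"
 proof (rule injI)
  fix x y assume "b *v x = b *v y"
  then have 0: "b *v (x - y) = 0" by (simp add: matrix_vector_diff_vec)
  define r where "r v = (x - y) $ inv_into UNIV \<beta> v" for v
  have "r (\<beta> j) = (x - y) $ j" for j
   unfolding r_def using \<beta> by (simp add: bij_betw_def)
  then have "(\<Sum>v\<in>B m. r v *s v) = 0"
   using 0 unfolding bv sum\<beta>[of "\<lambda>v. r v *s v", symmetric] by simp
  then have "r v = 0" if "v \<in> B m" for v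
   using vec.independentD[OF B(1)[of m] fin[of m] order.refl] that by blast
  then have "(x - y) $ j = 0" for j
   using \<open>r (\<beta> j) = (x - y) $ j\<close> \<beta> by (metis UNIV_I bij_betwE)
  then show "x = y" by (simp add: vec_eq_iff)
 qed
 then have inv: "invertible b"
  using matrix_left_invertible_injective[of b] invertible_left_inverse by blast
 define c where "c j = (LEAST l. \<beta> j \<in> B l)" for j
 have \<beta>m: "\<beta> j \<in> B m" for j using \<beta> by (auto dest: bij_betwE)
 have c1: "\<beta> j \<in> B (c j)" for j unfolding c_def by (rule LeastI[of _ m]) (rule \<beta>m)
 have c2: "\<beta> j \<in> B l \<longleftrightarrow> c j \<le> l" for j l
  using c1[of j] Bmono[of "c j" l] Least_le[of "\<lambda>l. \<beta> j \<in> B l" l] unfolding c_def by blast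
 have "0 \<notin> B 0" using B(1)[of 0] vec.dependent_zero by blast
 then have "B 0 = {}" using B(2)[of 0] W(3) by auto
 then have c0: "c j > 0" for j using c1[of j] by (cases "c j") auto
 have "b *v y \<in> W l \<longleftrightarrow> (\<forall>j. y $ j \<noteq> 0 \<longrightarrow> c j \<le> l)" for l y
 proof
  assume "\<forall>j. y $ j \<noteq> 0 \<longrightarrow> c j \<le> l"
  then have "y $ j *s \<beta> j \<in> W l" for j
   using c2[of j l] B(2)[of l] vec.subspace_scale[OF W(1)] vec.subspace_0[OF W(1)]
   by (cases "y $ j = 0") auto
  then show "b *v y \<in> W l" unfolding bv by (intro vec.subspace_sum[OF W(1)])
 next
  assume "b *v y \<in> W l"
  then have "b *v y \<in> vec.span (B l)" using B(3) by blast
  then obtain a where a: "b *v y = (\<Sum>v\<in>B l. a v *s v)" using vec.span_finite[OF fin[of l]] by auto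
  define y' where "y' = (\<chi> j. if \<beta> j \<in> B l then a (\<beta> j) else 0)"
  have "b *v y' = (\<Sum>v\<in>B m. (if v \<in> B l then a v else 0) *s v)"
   unfolding bv y'_def sum\<beta>[symmetric] by simp
  also have "\<dots> = (\<Sum>v\<in>B l. a v *s v)"
   by (rule sum.mono_neutral_cong_right) (use fin Bsub in auto)
  finally have "y = y'" using a inj by (metis injD)
  then show "\<forall>j. y $ j \<noteq> 0 \<longrightarrow> c j \<le> l" unfolding y'_def using c2 by auto
 qed
 then show ?thesis using that inv c0 by blast
qed

lemma matrix_inv_invertible:
 "invertible (b :: 'k::field ^ 'n ^ 'n) \<Longrightarrow> b ** minv b = mat 1 \<and> minv b ** b = mat 1"
 unfolding invertible_def matrix_inv_def by (rule someI_ex)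

text \<open>In a basis adapted to the fixed flag of \<open>U\<close>, elements normalizing
  \<open>U\<close> preserve the flag and become block triangular, while elements of \<open>U\<close>
  act trivially on its quotients and become block unitriangular.\<close>

theorem unipotent_block_form:
 fixes U K :: "('k::alg_closed_field ^ 'n ^ 'n) set"
 assumes mult: "\<And>u v. u \<in> U \<Longrightarrow> v \<in> U \<Longrightarrow> u ** v \<in> U"
  and unip: "\<And>u. u \<in> U \<Longrightarrow> \<exists>m. mpow (u - mat 1) m = 0"
  and norm: "\<And>u k. u \<in> U \<Longrightarrow> k \<in> K \<Longrightarrow> \<exists>u'\<in>U. u ** k = k ** u'"
 obtains b :: "'k ^ 'n ^ 'n" and c :: "'n \<Rightarrow> nat" where "invertible b"
  "\<And>k i j. k \<in> K \<Longrightarrow> (minv b ** k ** b) $ i $ j \<noteq> 0 \<Longrightarrow> c i \<le> c j"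
  "\<And>u i j. u \<in> U \<Longrightarrow> (minv b ** u ** b - mat 1) $ i $ j \<noteq> 0 \<Longrightarrow> c i < c j"
proof -
 obtain b :: "'k ^ 'n ^ 'n" and c where b: "invertible b" "\<And>j. c j > 0"
  "\<And>l y. b *v y \<in> fixed_flag U l \<longleftrightarrow> (\<forall>j. y $ j \<noteq> 0 \<longrightarrow> c j \<le> l)"
  by (rule adapted_basis[of "fixed_flag U" "CARD('n)", OF subspace_fixed_flag fixed_flag_mono
     fixed_flag.simps(1) fixed_flag_UNIV[OF mult unip]]) (assumption | rule that)+
 note inv = matrix_inv_invertible[OF b(1)]
 have entry: "A $ i $ j = (A *v axis j 1) $ i" for A :: "'k ^ 'n ^ 'n" and i j
  by (simp add: matrix_vector_axis)
 have ax: "b *v axis j 1 \<in> fixed_flag U (c j)" for j unfolding b(3) by (simp add: axis_def)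
 have cancel: "b *v (minv b *v x) = x" for x by (simp add: matrix_vector_mul_assoc inv)
 have 1: "c i \<le> c j" if "k \<in> K" "(minv b ** k ** b) $ i $ j \<noteq> 0" for k i j
 proof -
  have "k *v (b *v axis j 1) \<in> fixed_flag U (c j)"
   by (rule fixed_flag_stable[OF norm[OF _ that(1)] ax])
  then have "b *v (minv b *v (k *v (b *v axis j 1))) \<in> fixed_flag U (c j)" unfolding cancel .
  then show ?thesis using that(2) unfolding b(3) entry by (simp add: matrix_vector_mul_assoc matrix_mul_assoc)
 qed
 have 2: "c i < c j" if "u \<in> U" "(minv b ** u ** b - mat 1) $ i $ j \<noteq> 0" for u i j
 proof -
  obtain l where l: "c j = Suc l" using b(2)[of j] by (cases "c j") auto
  have "u *v (b *v axis j 1) - b *v axis j 1 \<in> fixed_flag U l"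
   using ax[of j] that(1) unfolding l by simp
  then have "b *v (minv b *v (u *v (b *v axis j 1) - b *v axis j 1)) \<in> fixed_flag U l"
   unfolding cancel .
  moreover have "minv b *v (u *v (b *v axis j 1) - b *v axis j 1)
    = (minv b ** u ** b - mat 1) *v axis j 1"
   by (simp add: matrix_vector_diff_vec matrix_vector_mul_assoc matrix_mul_assoc matrix_vector_mult_diff_rdistrib inv)
  ultimately show ?thesis using that(2) unfolding b(3) l entry by (metis le_imp_less_Suc)
 qed
 show ?thesis using that[OF b(1) 1 2] .
qed

section \<open>Coordinates on the general linear group\<close>

lemma alg_indep_Plus:
 fixes h :: "'i \<Rightarrow> 'v \<Rightarrow> 'k::field"
 assumes "alg_indep S h I" "free_over S (h ` I) Y" "finite I" "finite Y"
 shows "alg_indep S (case_sum h (\<lambda>y. y)) (I <+> Y)"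
 unfolding alg_indep_def
proof
 fix D
 have bij: "bij_betw (\<lambda>(\<mu>, \<nu>). case_sum \<mu> \<nu>) (exponents I D \<times> exponents Y D) (exponents (I <+> Y) D)"
 proof (rule bij_betwI[of _ _ _ "\<lambda>e. (e \<circ> Inl, e \<circ> Inr)"])
  fix e assume "e \<in> exponents (I <+> Y) D"
  show "(\<lambda>(\<mu>, \<nu>). case_sum \<mu> \<nu>) (e \<circ> Inl, e \<circ> Inr) = e"
   by (auto simp: fun_eq_iff split: sum.split)
 qed (fastforce simp: exponents_def split: sum.splits)+
 have mono: "monomial (I <+> Y) (case_sum h (\<lambda>y. y)) (case_sum \<mu> \<nu>) v = monomial I h \<mu> v * monomial Y (\<lambda>y. y) \<nu> v"
  for \<mu> \<nu> v
  unfolding monomial_def by (subst prod.Plus) (simp_all add: assms(3,4))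
 show "lin_indep S (exponents (I <+> Y) D) (monomial (I <+> Y) (case_sum h (\<lambda>y. y)))"
  unfolding lin_indep_def
 proof (intro allI impI)
  fix l assume l: "\<forall>v\<in>S. (\<Sum>e\<in>exponents (I <+> Y) D. l e * monomial (I <+> Y) (case_sum h (\<lambda>y. y)) e v) = 0"
  have ind: "lin_indep S (exponents I D \<times> exponents Y D)
   (\<lambda>(\<mu>, \<nu>) v. monomial I h \<mu> v * monomial Y (\<lambda>y. y) \<nu> v)"
   by (rule lin_indep_monomials_free) (use assms in \<open>auto simp: alg_indep_def\<close>)
  have "\<forall>v\<in>S. (\<Sum>e\<in>exponents I D \<times> exponents Y D. l (case e of (\<mu>, \<nu>) \<Rightarrow> case_sum \<mu> \<nu>) *
   (case e of (\<mu>, \<nu>) \<Rightarrow> \<lambda>v. monomial I h \<mu> v * monomial Y (\<lambda>y. y) \<nu> v) v) = 0"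
  proof
   fix v assume "v \<in> S"
   have "(\<Sum>e\<in>exponents (I <+> Y) D. l e * monomial (I <+> Y) (case_sum h (\<lambda>y. y)) e v) = 0"
    using l \<open>v \<in> S\<close> by blast
   then show "(\<Sum>e\<in>exponents I D \<times> exponents Y D. l (case e of (\<mu>, \<nu>) \<Rightarrow> case_sum \<mu> \<nu>) *
   (case e of (\<mu>, \<nu>) \<Rightarrow> \<lambda>v. monomial I h \<mu> v * monomial Y (\<lambda>y. y) \<nu> v) v) = 0"
    by (simp add: sum.reindex_bij_betw[OF bij, symmetric] split_def mono)
  qed
  then have "\<forall>e\<in>exponents I D \<times> exponents Y D. l (case e of (\<mu>, \<nu>) \<Rightarrow> case_sum \<mu> \<nu>) = 0"
   by (rule ind[unfolded lin_indep_def, THEN spec, THEN mp])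
  then show "\<forall>e\<in>exponents (I <+> Y) D. l e = 0"
   unfolding bij_betw_imp_surj_on[OF bij, symmetric] by blast
 qed
qed

lemma irreducible_on_prod:
 fixes X :: "('v \<Rightarrow> 'k::idom) set"
 assumes "irreducible_on X S" "finite J" "\<And>j. j \<in> J \<Longrightarrow> q j \<in> PF X" "\<And>j. j \<in> J \<Longrightarrow> \<exists>v\<in>S. q j v \<noteq> 0"
 shows "\<exists>v\<in>S. (\<Prod>j\<in>J. q j v) \<noteq> 0"
 using assms(2-)
proof (induction J rule: finite_induct)
 case empty
 then show ?case using assms(1) unfolding irreducible_on_def by auto
next
 case (insert j J)
 have "(\<lambda>v. \<Prod>j\<in>J. q j v) \<in> PF X" by (rule PF_prod) (use insert in blast)
 moreover have "\<exists>v\<in>S. (\<Prod>j\<in>J. q j v) \<noteq> 0" by (rule insert.IH) (use insert.prems in blast)+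
 moreover have "q j \<in> PF X" "\<exists>v\<in>S. q j v \<noteq> 0" using insert.prems by blast+
 ultimately have "\<exists>v\<in>S. q j v \<noteq> 0 \<and> (\<Prod>j\<in>J. q j v) \<noteq> 0"
  by (intro irreducible_onD[OF assms(1)])
 then show ?case using insert.hyps by (metis prod.insert mult_eq_0_iff)
qed

text \<open>\<open>growth_pullback\<close> with the common degree bound supplied by finiteness of
  \<open>Z\<close>.\<close>

lemma growth_pullback_PF:
 assumes "growth W X d" "\<psi> ` K \<subseteq> W" "finite Z"
  and "\<And>z. z \<in> Z \<Longrightarrow> \<exists>\<zeta>\<in>PF X. \<forall>k\<in>K. z k = \<zeta> (\<psi> k)"
 shows "growth K Z d"
proof -
 obtain \<zeta> where \<zeta>: "\<forall>z\<in>Z. \<zeta> z \<in> PF X \<and> (\<forall>k\<in>K. z k = \<zeta> z (\<psi> k))"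
  using bchoice[of Z "\<lambda>z \<zeta>. \<zeta> \<in> PF X \<and> (\<forall>k\<in>K. z k = \<zeta> (\<psi> k))"] assms(4) by blast
 have "\<exists>N. \<forall>f\<in>\<zeta> ` Z. poly_degree X N f"
  by (rule finite_poly_degree) (use \<zeta> assms(3) in auto)
 then obtain \<delta> where "\<forall>f\<in>\<zeta> ` Z. poly_degree X \<delta> f" by blast
 then show ?thesis
  using \<zeta> by (intro growth_pullback[OF assms(1,2)]) blast
qed

lemma PF_inverse_denominator:
 fixes q :: "'v \<Rightarrow> 'k::field"
 assumes "f \<in> PF (insert (\<lambda>v. inverse (q v)) X)" "q \<in> PF X"
 shows "\<exists>m. \<exists>g\<in>PF X. \<forall>v. q v \<noteq> 0 \<longrightarrow> f v * q v ^ m = g v"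
 using assms(1)
proof (induction rule: polynomial_functions.induct)
 case (const c)
 show ?case by (intro exI[of _ 0] bexI[of _ "\<lambda>_. c"]) (auto intro: PF_const)
next
 case (coord f)
 then show ?case
 proof
  assume "f = (\<lambda>v. inverse (q v))"
  then show ?case by (intro exI[of _ 1] bexI[of _ "\<lambda>_. 1"]) (auto intro: PF_const)
 next
  assume "f \<in> X"
  then show ?case by (intro exI[of _ 0] bexI[of _ f]) (auto intro: PF_coord)
 qed
next
 case (add f g)
 then obtain m f' n g' where *: "f' \<in> PF X" "\<forall>v. q v \<noteq> 0 \<longrightarrow> f v * q v ^ m = f' v"
  "g' \<in> PF X" "\<forall>v. q v \<noteq> 0 \<longrightarrow> g v * q v ^ n = g' v" by blast
 show ?case
 proof (intro exI[of _ "m + n"] bexI[of _ "\<lambda>v. f' v * q v ^ n + g' v * q v ^ m"] allI impI)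
  fix v assume "q v \<noteq> 0"
  then have "f' v = f v * q v ^ m" "g' v = g v * q v ^ n" using *(2,4) by simp_all
  then show "(f v + g v) * q v ^ (m + n) = f' v * q v ^ n + g' v * q v ^ m"
   by (simp add: power_add algebra_simps)
 qed (intro PF_intros * assms(2))
next
 case (mult f g)
 then obtain m f' n g' where *: "f' \<in> PF X" "\<forall>v. q v \<noteq> 0 \<longrightarrow> f v * q v ^ m = f' v"
  "g' \<in> PF X" "\<forall>v. q v \<noteq> 0 \<longrightarrow> g v * q v ^ n = g' v" by blast
 show ?case
 proof (intro exI[of _ "m + n"] bexI[of _ "\<lambda>v. f' v * g' v"] allI impI)
  fix v assume "q v \<noteq> 0"
  then have "f' v = f v * q v ^ m" "g' v = g v * q v ^ n" using *(2,4) by simp_all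
  then show "(f v * g v) * q v ^ (m + n) = f' v * g' v" by (simp add: power_add algebra_simps)
 qed (intro PF_intros *)
qed

text \<open>Multiplication by a power of \<open>q\<close>, which has no zero on \<open>S\<close>,
  removes denominators without changing zero sets in \<open>S\<close>.\<close>

lemma zclosed_inverse:
 fixes q :: "'v \<Rightarrow> 'k::field"
 assumes "q \<in> PF X" "\<forall>v\<in>S. q v \<noteq> 0"
 shows "zclosed (insert (\<lambda>v. inverse (q v)) X) S C \<longleftrightarrow> zclosed X S C"
proof
 assume "zclosed X S C"
 then show "zclosed (insert (\<lambda>v. inverse (q v)) X) S C"
  unfolding zclosed_iff by (elim conjE, intro conjI ballI) (assumption, drule (1) bspec, elim bexE, rule bexI, assumption, rule PF_mono, assumption, rule subset_insertI)
next
 assume *: "zclosed (insert (\<lambda>v. inverse (q v)) X) S C"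
 show "zclosed X S C"
  unfolding zclosed_iff
 proof (intro conjI ballI)
  show "C \<subseteq> S" using zclosed_subset[OF *] .
  fix v assume v: "v \<in> S - C"
  then obtain f where f: "f \<in> PF (insert (\<lambda>v. inverse (q v)) X)" "f v \<noteq> 0" "\<forall>w\<in>C. f w = 0"
   using zclosed_separate[OF *] by blast
  obtain m g where g: "g \<in> PF X" "\<forall>v. q v \<noteq> 0 \<longrightarrow> f v * q v ^ m = g v"
   using PF_inverse_denominator[OF f(1) assms(1)] by blast
  have qv: "q v \<noteq> 0" "\<And>w. w \<in> C \<Longrightarrow> q w \<noteq> 0" using assms(2) v \<open>C \<subseteq> S\<close> by auto
  have "g v \<noteq> 0" using g(2) f(2) qv(1) by (metis mult_eq_0_iff power_eq_0_iff)
  moreover have "\<forall>w\<in>C. g w = 0" using g(2) f(3) qv(2) by (metis mult_zero_left)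
  ultimately show "\<exists>f\<in>PF X. f v \<noteq> 0 \<and> (\<forall>w\<in>C. f w = 0)" using g(1) by blast
 qed
qed

text \<open>The trick of Rabinowitsch: the relation between \<open>q\<close> and its reciprocal
  forces \<open>q\<close> to be nonzero at the point found.\<close>

lemma affine_on_inverse:
 fixes q :: "'v \<Rightarrow> 'k::field"
 assumes aff: "affine_on X S" and q: "q \<in> PF X"
 shows "affine_on (insert (\<lambda>v. inverse (q v)) X) {v \<in> S. q v \<noteq> 0}"
 unfolding affine_on_def
proof (intro allI impI)
 define y where "y v = inverse (q v)" for v
 have *: "a = inverse b" if "a * b = 1" for a b :: 'k using that by (metis inverse_unique inverse_inverse_eq mult.commute)
 fix p assume "consistent ((\<lambda>v x. x v) ` {v \<in> S. q v \<noteq> 0}) (insert (\<lambda>v. inverse (q v)) X) p"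
 then have p: "consistent ((\<lambda>v x. x v) ` {v \<in> S. q v \<noteq> 0}) (insert y X) p" unfolding y_def[abs_def] .
 have sub: "PF (coords X) \<subseteq> PF (coords (insert y X))" using PF_mono unfolding coords_insert by blast
 have "F p = 0" if "F \<in> PF (coords X)" "\<forall>v\<in>S. F (\<lambda>x. x v) = 0" for F
  by (rule consistentD[OF p subsetD[OF sub that(1)]]) (use that(2) in auto)
 then obtain v where v: "v \<in> S" "\<And>x. x \<in> X \<Longrightarrow> x v = p x" using affine_onE[OF aff, of p] by blast
 have "q \<in> PF ((\<lambda>x. x) ` X)" using q by simp
 then obtain Q where Q: "Q \<in> PF (coords X)" "\<And>v. Q (\<lambda>x. x v) = q v" by (rule PF_lift) (rule that)
 have "(\<lambda>p. p y * Q p - 1) \<in> PF (coords (insert y X))"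
  by (intro PF_intros subsetD[OF sub Q(1)] PF_coord) (simp add: coords_insert)
 then have "p y * Q p - 1 = 0"
  by (rule consistentD[OF p]) (auto simp: Q(2) y_def)
 moreover have "Q p = q v"
  unfolding Q(2)[symmetric] by (rule PF_eq[OF Q(1)]) (use v(2) in \<open>auto simp: coords_def\<close>)
 ultimately have "p y * q v = 1" by simp
 then have "q v \<noteq> 0" by auto
 moreover have "p y = y v" unfolding y_def[of v] by (rule *) fact
 ultimately show "\<exists>v\<in>{v \<in> S. q v \<noteq> 0}. \<forall>x\<in>insert (\<lambda>v. inverse (q v)) X. x v = p x"
  using v unfolding y_def[abs_def] by (intro bexI[of _ v]) auto
qed

definition entry_coords :: "('k ^ 'n ^ 'n \<Rightarrow> 'k) set" where
 "entry_coords = range (\<lambda>(i, j) A. A $ i $ j)"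

text \<open>The reciprocal of the determinant makes the general linear group, which is open in the
  space of matrices, an affine set.\<close>

definition GL_coords :: "('k::field ^ 'n ^ 'n \<Rightarrow> 'k) set" where
 "GL_coords = insert (\<lambda>A. inverse (det A)) entry_coords"

text \<open>One reciprocal serves the whole tuple: that of a single determinant is the common one
  times the other determinants.\<close>

definition tuple_GL_coords :: "nat set \<Rightarrow> ((nat \<Rightarrow> 'k::field ^ 'n ^ 'n) \<Rightarrow> 'k) set" where
 "tuple_GL_coords I = insert (\<lambda>\<gamma>. inverse (\<Prod>s\<in>I. det (\<gamma> s))) (tuple_coords I)"

lemma finite_GL_coords: "finite (GL_coords :: ('k::field ^ 'n ^ 'n \<Rightarrow> 'k) set)"
 unfolding GL_coords_def entry_coords_def by simp

lemma finite_tuple_GL_coords: "finite I \<Longrightarrow> finite (tuple_GL_coords I)"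
 unfolding tuple_GL_coords_def by (simp add: finite_tuple_coords)

lemma PF_det:
 fixes A :: "'w \<Rightarrow> 'k::field ^ 'n ^ 'n"
 shows "(\<And>i j. (\<lambda>w. A w $ i $ j) \<in> PF X) \<Longrightarrow> (\<lambda>w. det (A w)) \<in> PF X"
 unfolding det_def by (intro PF_intros)

definition matrix_PF :: "('w \<Rightarrow> 'k::field) set \<Rightarrow> ('w \<Rightarrow> 'k ^ 'n ^ 'n) \<Rightarrow> bool" where
 "matrix_PF X A \<longleftrightarrow> (\<forall>i j. (\<lambda>w. A w $ i $ j) \<in> PF X)"

lemma matrix_PF_mult: "matrix_PF X A \<Longrightarrow> matrix_PF X B \<Longrightarrow> matrix_PF X (\<lambda>w. A w ** B w)"
 unfolding matrix_PF_def by (intro allI PF_matrix_mult) blast+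

lemma matrix_PF_const: "matrix_PF X (\<lambda>_. C)"
 unfolding matrix_PF_def by (simp add: PF_const)

lemma matrix_PF_det: "matrix_PF X A \<Longrightarrow> (\<lambda>w. det (A w)) \<in> PF X"
 unfolding matrix_PF_def by (intro PF_det) blast

lemma entry_coords_PF: "matrix_PF X A \<Longrightarrow> x \<in> entry_coords \<Longrightarrow> (\<lambda>w. x (A w)) \<in> PF X"
 unfolding matrix_PF_def entry_coords_def by auto

text \<open>On singular matrices \<open>matrix_inv\<close> is an arbitrary choice, whereas
  membership in \<open>PF\<close> concerns all matrices. The entries of this formula are in
  \<open>PF GL_coords\<close>, and it agrees with \<open>matrix_inv\<close> on invertible
  matrices.\<close>

definition cramer_inverse :: "'k::field ^ 'n ^ 'n \<Rightarrow> 'k ^ 'n ^ 'n" where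
 "cramer_inverse A = (\<chi> i j. det (\<chi> a b. if b = i then mat 1 $ a $ j else A $ a $ b) * inverse (det A))"

lemma cramer_inverse:
 fixes A :: "'k::field ^ 'n ^ 'n"
 shows "invertible A \<Longrightarrow> cramer_inverse A = minv A"
proof -
 assume A: "invertible A"
 have "minv A *v axis j 1 = (\<chi> k. det (\<chi> i l. if l = k then axis j 1 $ i else A $ i $ l) / det A)" for j
 proof (subst cramer[symmetric])
  show "det A \<noteq> 0" using A by (simp add: invertible_det_nz)
  show "A *v (minv A *v axis j 1) = axis j 1"
   using matrix_inv_invertible[OF A] by (simp add: matrix_vector_mul_assoc)
 qed
 then have "(minv A *v axis j 1) $ i = det (\<chi> a l. if l = i then axis j 1 $ a else A $ a $ l) * inverse (det A)" for i j
  by (simp add: divide_inverse)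
 moreover have ax: "axis j 1 $ a = (mat 1 :: 'k ^ 'n ^ 'n) $ a $ j" for a j by (simp add: axis_def mat_def)
 ultimately show ?thesis unfolding cramer_inverse_def matrix_vector_axis ax by (simp add: vec_eq_iff)
qed

lemma matrix_PF_cramer_inverse:
 assumes "matrix_PF X A" "(\<lambda>w. inverse (det (A w))) \<in> PF X"
 shows "matrix_PF X (\<lambda>w. cramer_inverse (A w))"
 unfolding matrix_PF_def
proof (intro allI)
 fix i j
 have "matrix_PF X (\<lambda>w. \<chi> a b. if b = i then mat 1 $ a $ j else A w $ a $ b)"
  unfolding matrix_PF_def
 proof (intro allI)
  fix a b
  show "(\<lambda>w. (\<chi> a b. if b = i then mat 1 $ a $ j else A w $ a $ b) $ a $ b) \<in> PF X"
   using assms(1) unfolding matrix_PF_def by (cases "b = i") (simp_all add: PF_const)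
 qed
 then show "(\<lambda>w. cramer_inverse (A w) $ i $ j) \<in> PF X"
  unfolding cramer_inverse_def vec_lambda_beta by (intro PF_intros matrix_PF_det assms(2))
qed

lemma PF_entry: "(\<lambda>A. A $ i $ j) \<in> PF entry_coords"
 by (rule PF_coord) (auto simp: entry_coords_def image_iff)

lemma matrix_PF_GL: "matrix_PF GL_coords (\<lambda>A. A)"
 unfolding matrix_PF_def GL_coords_def using PF_mono[OF PF_entry subset_insertI] by blast

lemma PF_inverse_det_GL: "(\<lambda>A. inverse (det A)) \<in> PF GL_coords"
 unfolding GL_coords_def by (auto intro: PF_coord)

lemma matrix_PF_GL_inverse: "matrix_PF GL_coords cramer_inverse"
 using matrix_PF_cramer_inverse[OF matrix_PF_GL PF_inverse_det_GL] .

lemma matrix_PF_tuple: "s \<in> I \<Longrightarrow> matrix_PF (tuple_GL_coords I) (\<lambda>\<gamma>. \<gamma> s)"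
 unfolding matrix_PF_def tuple_GL_coords_def
 using PF_mono[OF PF_tuple_entry subset_insertI] by blast

lemma GL_coords_PF:
 assumes "matrix_PF X A" "(\<lambda>w. inverse (det (A w))) \<in> PF X" "f \<in> PF GL_coords"
 shows "(\<lambda>w. f (A w)) \<in> PF X"
 by (rule PF_comp[OF assms(3)]) (use assms(1,2) in \<open>auto simp: GL_coords_def intro: entry_coords_PF\<close>)

lemma PF_entry_det: "det \<in> PF (entry_coords :: ('k::field ^ 'n ^ 'n \<Rightarrow> 'k) set)"
 by (rule PF_det) (rule PF_entry)

lemma PF_tuple_det: "finite I \<Longrightarrow> (\<lambda>\<gamma>. \<Prod>s\<in>I. det (\<gamma> s :: 'k::field ^ 'n ^ 'n)) \<in> PF (tuple_coords I)"
 by (intro PF_prod PF_det PF_tuple_entry)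

lemma affine_on_entries: "affine_on (entry_coords :: ('k::field ^ 'n ^ 'n \<Rightarrow> 'k) set) UNIV"
 unfolding affine_on_def entry_coords_def
 by (auto intro!: exI[of _ "\<chi> i j. p (\<lambda>A. A $ i $ j)" for p])

lemma affine_on_tuples: "affine_on (tuple_coords I :: ((nat \<Rightarrow> 'k::field ^ 'n ^ 'n) \<Rightarrow> 'k) set) UNIV"
 unfolding affine_on_def tuple_coords_def
 by (auto intro!: exI[of _ "\<lambda>s. \<chi> i j. p (\<lambda>g. g s $ i $ j)" for p])

lemma affine_on_GL: "affine_on (GL_coords :: ('k::field ^ 'n ^ 'n \<Rightarrow> 'k) set) (Collect invertible)"
 using affine_on_inverse[OF affine_on_entries PF_entry_det]
 unfolding GL_coords_def invertible_det_nz[abs_def] by simp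

lemma affine_on_GL_tuples:
 "finite I \<Longrightarrow> affine_on (tuple_GL_coords I :: ((nat \<Rightarrow> 'k::field ^ 'n ^ 'n) \<Rightarrow> 'k) set) (GL_tuples I)"
 using affine_on_inverse[OF affine_on_tuples PF_tuple_det]
 by (simp add: tuple_GL_coords_def GL_tuples_def invertible_det_nz)

lemma zclosed_GL_coords:
 "S \<subseteq> Collect invertible \<Longrightarrow> zclosed GL_coords S C \<longleftrightarrow> zclosed entry_coords S C"
 unfolding GL_coords_def by (rule zclosed_inverse[OF PF_entry_det]) (auto simp: invertible_det_nz)

section \<open>Families of intersections with conjugates\<close>

definition closed_group :: "('k::field ^ 'n ^ 'n) set \<Rightarrow> bool" where
 "closed_group K \<longleftrightarrow> mat 1 \<in> K \<and> (\<forall>a\<in>K. \<forall>b\<in>K. a ** b \<in> K) \<and>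
  (\<forall>a\<in>K. invertible a \<and> minv a \<in> K) \<and> zclosed entry_coords (Collect invertible) K"

lemma closed_groupD:
 assumes "closed_group K"
 shows "mat 1 \<in> K" "a \<in> K \<Longrightarrow> b \<in> K \<Longrightarrow> a ** b \<in> K" "a \<in> K \<Longrightarrow> invertible a"
  "a \<in> K \<Longrightarrow> minv a \<in> K" "zclosed entry_coords (Collect invertible) K"
 using assms unfolding closed_group_def by blast+

lemma matrix_inv_cancel:
 fixes a :: "'k::field ^ 'n ^ 'n"
 assumes "invertible a"
 shows "minv a ** (a ** b) = b" "a ** (minv a ** b) = b"
  "minv a ** a = mat 1" "a ** minv a = mat 1"
 using matrix_inv_invertible[OF assms] by (simp_all add: matrix_mul_assoc)

lemmas matrix_inv_simps = matrix_mul_assoc[symmetric] matrix_inv_cancel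

lemma matrix_inv_unique':
 fixes a :: "'k::field ^ 'n ^ 'n"
 assumes "a ** b = mat 1"
 shows "minv a = b"
proof -
 have "invertible a" using assms unfolding invertible_right_inverse by blast
 then show ?thesis using matrix_inv_cancel(1)[of a b] assms by simp
qed

lemma invertible_matrix_inv: "invertible (a :: 'k::field ^ 'n ^ 'n) \<Longrightarrow> invertible (minv a)"
 using matrix_inv_cancel(3) unfolding invertible_right_inverse by blast

lemma matrix_inv_mult:
 fixes a b :: "'k::field ^ 'n ^ 'n"
 shows "invertible a \<Longrightarrow> invertible b \<Longrightarrow> minv (a ** b) = minv b ** minv a"
 by (rule matrix_inv_unique') (simp add: matrix_inv_simps)

lemma matrix_inv_involutive: "invertible (a :: 'k::field ^ 'n ^ 'n) \<Longrightarrow> minv (minv a) = a"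
 by (rule matrix_inv_unique') (rule matrix_inv_cancel)

lemma matrix_inv_one: "minv (mat 1 :: 'k::field ^ 'n ^ 'n) = mat 1"
 by (rule matrix_inv_unique') simp

text \<open>For singular \<open>k\<close> both sides are 0, by the convention
  \<open>inverse 0 = 0\<close>. As an identity on all matrices it can rewrite functions in
  \<open>PF\<close>.\<close>

lemma inverse_det_cramer: "inverse (det (cramer_inverse k)) = det (k :: 'k::field ^ 'n ^ 'n)"
proof (cases "invertible k")
 case True
 then have "det (minv k) * det k = 1" using matrix_inv_cancel(3)[OF True] by (metis det_mul det_I)
 then show ?thesis unfolding cramer_inverse[OF True] by (metis inverse_unique)
next
 case False
 then have "det k = 0" by (simp add: invertible_det_nz)
 then have "cramer_inverse k = 0" unfolding cramer_inverse_def by (simp add: vec_eq_iff)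
 moreover have "\<not> invertible (0 :: 'k ^ 'n ^ 'n)"
 proof
  assume "invertible (0 :: 'k ^ 'n ^ 'n)"
  then have "(0 :: 'k ^ 'n ^ 'n) = mat 1" unfolding invertible_right_inverse by simp
  then have "(0 :: 'k ^ 'n ^ 'n) $ i $ i = mat 1 $ i $ i" for i by simp
  then show False by (simp add: mat_def)
 qed
 ultimately show ?thesis using \<open>det k = 0\<close> by (simp add: invertible_det_nz)
qed

text \<open>Free of inverses; for invertible \<open>g s\<close> the condition puts \<open>k\<close>
  into the conjugate of \<open>H s\<close> by \<open>g s\<close>. An arbitrary index set leaves room
  for a further factor, the parabolic subgroup.\<close>

definition conj_stab :: "nat set \<Rightarrow> ('k::field ^ 'n ^ 'n) set \<Rightarrow> (nat \<Rightarrow> ('k ^ 'n ^ 'n) set) \<Rightarrow>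
  (nat \<Rightarrow> 'k ^ 'n ^ 'n) \<Rightarrow> ('k ^ 'n ^ 'n) set" where
 "conj_stab I M H g = {k \<in> M. \<forall>s\<in>I. \<exists>h\<in>H s. k ** g s = g s ** h}"

text \<open>Index 0 is reserved for \<open>M\<close>, so that an element of the acting group, the
  product of \<open>M\<close> and all \<open>H s\<close>, is one tuple of matrices indexed by
  \<open>insert 0 I\<close>.\<close>

locale conjugate_family =
 fixes M :: "('k::alg_closed_field ^ 'n ^ 'n) set" and H :: "nat \<Rightarrow> ('k ^ 'n ^ 'n) set" and I :: "nat set"
 assumes finite_I: "finite I" and zero_notin: "0 \<notin> I" and group_M: "closed_group M"
  and group_H: "\<And>s. s \<in> I \<Longrightarrow> closed_group (H s)"
begin

definition "\<Gamma> = {\<gamma>. \<gamma> 0 \<in> M \<and> (\<forall>s\<in>I. \<gamma> s \<in> H s)}"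

definition X :: "((nat \<Rightarrow> 'k ^ 'n ^ 'n) \<Rightarrow> 'k) set" where
 "X = tuple_GL_coords (insert 0 I)"

abbreviation "K g \<equiv> conj_stab I M H g"

definition orbit_entry :: "(nat \<Rightarrow> 'k ^ 'n ^ 'n) \<Rightarrow> nat \<times> 'n \<times> 'n \<Rightarrow> (nat \<Rightarrow> 'k ^ 'n ^ 'n) \<Rightarrow> 'k" where
 "orbit_entry g e \<gamma> = (case e of (s, i, j) \<Rightarrow> (\<gamma> 0 ** g s ** \<gamma> s) $ i $ j)"

text \<open>For a point \<open>c\<close>, the fibre of the orbit map through \<open>c\<close> is parametrized by \<open>K g\<close>.\<close>

definition fibre_point :: "(nat \<Rightarrow> 'k ^ 'n ^ 'n) \<Rightarrow> (nat \<Rightarrow> 'k ^ 'n ^ 'n) \<Rightarrow> 'k ^ 'n ^ 'n \<Rightarrow> nat \<Rightarrow> 'k ^ 'n ^ 'n" where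
 "fibre_point g c k s = (if s = 0 then c 0 ** k else minv (g s) ** cramer_inverse k ** g s ** c s)"

lemmas groupM = closed_groupD[OF group_M]

lemmas groupH = closed_groupD[OF group_H]

lemmas cancel = matrix_inv_simps

lemma finite_X: "finite X"
 unfolding X_def using finite_tuple_GL_coords finite_I by blast

lemma X_cong:
 assumes "\<And>s. s \<in> insert 0 I \<Longrightarrow> \<gamma> s = \<gamma>' s" "x \<in> X"
 shows "x \<gamma> = x \<gamma>'"
proof -
 have "(\<Prod>s\<in>insert 0 I. det (\<gamma> s)) = (\<Prod>s\<in>insert 0 I. det (\<gamma>' s))"
  by (rule prod.cong) (simp_all add: assms(1))
 then show ?thesis using assms unfolding X_def tuple_GL_coords_def tuple_coords_def by auto
qed

lemma PF_X_cong: "f \<in> PF X \<Longrightarrow> (\<And>s. s \<in> insert 0 I \<Longrightarrow> \<gamma> s = \<gamma>' s) \<Longrightarrow> f \<gamma> = f \<gamma>'"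
 by (rule PF_eq[of f X]) (auto intro: X_cong)

lemma K_invertible: "k \<in> K g \<Longrightarrow> invertible k"
 unfolding conj_stab_def using groupM(3) by blast

lemma K_one: "mat 1 \<in> K g"
 unfolding conj_stab_def using groupM(1) groupH(1) by (auto intro!: bexI[of _ "mat 1"])

lemma K_mult: "k \<in> K g \<Longrightarrow> l \<in> K g \<Longrightarrow> k ** l \<in> K g"
proof -
 assume k: "k \<in> K g" and l: "l \<in> K g"
 have "\<exists>h\<in>H s. (k ** l) ** g s = g s ** h" if "s \<in> I" for s
 proof -
  obtain h1 h2 where h: "h1 \<in> H s" "k ** g s = g s ** h1" "h2 \<in> H s" "l ** g s = g s ** h2"
   using k l \<open>s \<in> I\<close> unfolding conj_stab_def by blast
  have "(k ** l) ** g s = k ** (l ** g s)" by (simp add: matrix_mul_assoc)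
  also have "\<dots> = (k ** g s) ** h2" unfolding h(4) by (simp add: matrix_mul_assoc)
  also have "\<dots> = g s ** (h1 ** h2)" unfolding h(2) by (simp add: matrix_mul_assoc)
  finally show ?thesis using groupH(2)[OF \<open>s \<in> I\<close> h(1,3)] by blast
 qed
 then show ?thesis using k l groupM(2) unfolding conj_stab_def by blast
qed

lemma K_inv: "k \<in> K g \<Longrightarrow> minv k \<in> K g"
proof -
 assume k: "k \<in> K g"
 have "\<exists>h\<in>H s. minv k ** g s = g s ** h" if "s \<in> I" for s
 proof -
  obtain h where h: "h \<in> H s" "k ** g s = g s ** h" using k \<open>s \<in> I\<close> unfolding conj_stab_def by blast
  have "minv k ** g s = minv k ** ((g s ** h) ** minv h)"
   using groupH(3)[OF \<open>s \<in> I\<close> h(1)] by (simp add: cancel)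
  also have "\<dots> = g s ** minv h"
   unfolding h(2)[symmetric] using K_invertible[OF k] by (simp add: cancel)
  finally show ?thesis using groupH(4)[OF \<open>s \<in> I\<close> h(1)] by blast
 qed
 then show ?thesis using k groupM(4) unfolding conj_stab_def by blast
qed

lemma \<Gamma>_invertible: "c \<in> \<Gamma> \<Longrightarrow> s \<in> insert 0 I \<Longrightarrow> invertible (c s)"
 unfolding \<Gamma>_def using groupM(3) groupH(3) by blast

lemma fibre_point_in:
 assumes "\<And>s. s \<in> I \<Longrightarrow> invertible (g s)" "c \<in> \<Gamma>" "k \<in> K g"
 shows "fibre_point g c k \<in> \<Gamma>"
  and "e \<in> I \<times> UNIV \<Longrightarrow> orbit_entry g e (fibre_point g c k) = orbit_entry g e c"
proof -
 have k: "invertible k" using K_invertible assms(3) .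
 have "minv (g s) ** cramer_inverse k ** g s \<in> H s" if "s \<in> I" for s
 proof -
  obtain h where h: "h \<in> H s" "minv k ** g s = g s ** h"
   using K_inv[OF assms(3)] \<open>s \<in> I\<close> unfolding conj_stab_def by blast
  have "minv (g s) ** cramer_inverse k ** g s = minv (g s) ** (minv k ** g s)"
   unfolding cramer_inverse[OF k] by (simp add: matrix_mul_assoc)
  also have "\<dots> = h" unfolding h(2) using assms(1)[OF that] by (simp add: cancel)
  finally show ?thesis using h(1) by simp
 qed
 then show "fibre_point g c k \<in> \<Gamma>"
  using assms(2,3) groupM(2) groupH(2) zero_notin
  unfolding \<Gamma>_def fibre_point_def conj_stab_def by auto
 have "(c 0 ** k) ** g s ** (minv (g s) ** cramer_inverse k ** g s ** c s) = c 0 ** g s ** c s" if "s \<in> I" for s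
  unfolding cramer_inverse[OF k] using assms(1)[OF that] k by (simp add: cancel)
 then show "orbit_entry g e (fibre_point g c k) = orbit_entry g e c" if "e \<in> I \<times> UNIV"
  using that zero_notin unfolding orbit_entry_def fibre_point_def by (auto split: prod.split)
qed

text \<open>The parametrization is inverted by \<open>minv (c 0) ** \<gamma> 0\<close>: equality of
  the orbit points makes this matrix an element of \<open>K g\<close>.\<close>

lemma fibre_point_surj:
 assumes g: "\<And>s. s \<in> I \<Longrightarrow> invertible (g s)" and c: "c \<in> \<Gamma>" and \<gamma>: "\<gamma> \<in> \<Gamma>"
  and eq: "\<And>e. e \<in> I \<times> UNIV \<Longrightarrow> orbit_entry g e \<gamma> = orbit_entry g e c"
 shows "minv (c 0) ** \<gamma> 0 \<in> K g"
  and "s \<in> insert 0 I \<Longrightarrow> fibre_point g c (minv (c 0) ** \<gamma> 0) s = \<gamma> s"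
proof -
 define k where "k = minv (c 0) ** \<gamma> 0"
 have c0: "invertible (c 0)" "invertible (\<gamma> 0)" using \<Gamma>_invertible c \<gamma> by auto
 have k: "invertible k" unfolding k_def using c0 by (intro invertible_mult invertible_matrix_inv)
 have e: "\<gamma> 0 ** g s ** \<gamma> s = c 0 ** g s ** c s" if "s \<in> I" for s
  unfolding vec_eq_iff using eq[of "(s, i, j)" for i j] that unfolding orbit_entry_def by auto
 have e2: "k ** g s ** \<gamma> s = g s ** c s" if "s \<in> I" for s
 proof -
  have "k ** g s ** \<gamma> s = minv (c 0) ** (\<gamma> 0 ** g s ** \<gamma> s)"
   unfolding k_def by (simp add: matrix_mul_assoc)
  also have "\<dots> = g s ** c s" unfolding e[OF that] using c0 by (simp add: cancel)
  finally show ?thesis .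
 qed
 have "\<exists>h\<in>H s. k ** g s = g s ** h" if "s \<in> I" for s
 proof
  have \<gamma>s: "invertible (\<gamma> s)" using \<Gamma>_invertible \<gamma> that by blast
  then have "k ** g s = (k ** g s ** \<gamma> s) ** minv (\<gamma> s)" by (simp add: cancel)
  also have "\<dots> = g s ** (c s ** minv (\<gamma> s))" unfolding e2[OF that] by (simp add: matrix_mul_assoc)
  finally show "k ** g s = g s ** (c s ** minv (\<gamma> s))" .
  show "c s ** minv (\<gamma> s) \<in> H s"
   using c \<gamma> that groupH(2,4) unfolding \<Gamma>_def by blast
 qed
 moreover have "k \<in> M" unfolding k_def using c \<gamma> groupM(2,4) unfolding \<Gamma>_def by blast
 ultimately show "minv (c 0) ** \<gamma> 0 \<in> K g" unfolding conj_stab_def k_def by blast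
 have "minv (g s) ** cramer_inverse k ** g s ** c s = \<gamma> s" if "s \<in> I" for s
 proof -
  have "minv (g s) ** cramer_inverse k ** g s ** c s = minv (g s) ** (cramer_inverse k ** (g s ** c s))"
   by (simp add: matrix_mul_assoc)
  also have "\<dots> = \<gamma> s"
   unfolding e2[OF that, symmetric] cramer_inverse[OF k] using k g[OF that] by (simp add: cancel)
  finally show ?thesis .
 qed
 then show "fibre_point g c (minv (c 0) ** \<gamma> 0) s = \<gamma> s" if "s \<in> insert 0 I"
  using that zero_notin c0 unfolding fibre_point_def k_def[symmetric]
  by (auto simp: k_def cancel)
qed

lemma PF_fibre_point:
 assumes "f \<in> PF X"
 shows "(\<lambda>k. f (fibre_point g c k)) \<in> PF GL_coords"
proof (rule PF_comp[OF assms])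
 have fp: "matrix_PF GL_coords (\<lambda>k. fibre_point g c k s)" for s
  unfolding fibre_point_def
  by (cases "s = 0") (auto intro!: matrix_PF_mult matrix_PF_const matrix_PF_GL matrix_PF_GL_inverse)
 fix x :: "(nat \<Rightarrow> 'k ^ 'n ^ 'n) \<Rightarrow> 'k" assume "x \<in> X"
 then consider "x = (\<lambda>\<gamma>. inverse (\<Prod>s\<in>insert 0 I. det (\<gamma> s)))"
  | s i j where "x = (\<lambda>\<gamma>. \<gamma> s $ i $ j)" unfolding X_def tuple_GL_coords_def tuple_coords_def by auto
 then show "(\<lambda>k. x (fibre_point g c k)) \<in> PF GL_coords"
 proof cases
  case 1
  have "x (fibre_point g c k) = inverse (det (c 0)) * inverse (det k) *
   (\<Prod>s\<in>I. inverse (det (minv (g s))) * det k * inverse (det (g s)) * inverse (det (c s)))" for k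
  proof -
   have "det (fibre_point g c k s) = det (minv (g s)) * det (cramer_inverse k) * det (g s) * det (c s)" if "s \<in> I" for s
    using that zero_notin unfolding fibre_point_def by (auto simp: det_mul)
   then have "inverse (\<Prod>s\<in>I. det (fibre_point g c k s)) =
    (\<Prod>s\<in>I. inverse (det (minv (g s))) * det k * inverse (det (g s)) * inverse (det (c s)))"
    unfolding prod_inversef[symmetric] comp_def
    by (intro prod.cong) (simp_all add: inverse_det_cramer)
   moreover have "det (fibre_point g c k 0) = det (c 0) * det k" unfolding fibre_point_def by (simp add: det_mul)
   ultimately show ?thesis unfolding 1 using finite_I zero_notin by simp
  qed
  then show ?thesis
   by (simp only:) (intro PF_intros PF_inverse_det_GL matrix_PF_det[OF matrix_PF_GL])
 next
  case 2
  then show ?thesis using fp unfolding matrix_PF_def by blast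
 qed
qed

lemma PF_orbit_entry: "e \<in> I \<times> UNIV \<Longrightarrow> orbit_entry g e \<in> PF X"
proof -
 assume "e \<in> I \<times> UNIV"
 then obtain s i j where e: "e = (s, i, j)" "s \<in> I" by auto
 have "matrix_PF X (\<lambda>\<gamma>. \<gamma> 0 ** g s ** \<gamma> s)"
  unfolding X_def using e(2) by (intro matrix_PF_mult matrix_PF_const matrix_PF_tuple) auto
 then show ?thesis unfolding matrix_PF_def e(1) orbit_entry_def[abs_def] by simp
qed

text \<open>The degree 2 does not depend on \<open>g\<close>, which is the uniformity that
  \<open>uniform_relations\<close> asks for.\<close>

lemma poly_degree_orbit_entry:
 assumes "e \<in> I \<times> UNIV"
 shows "poly_degree X 2 (orbit_entry g e)"
proof -
 obtain s i j where e: "e = (s, i, j)" "s \<in> I" using assms by auto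
 have x: "poly_degree X 1 (\<lambda>\<gamma>. \<gamma> r $ a $ b)" if "r \<in> insert 0 I" for r a b
 proof -
  have "(\<lambda>\<gamma>. \<gamma> r $ a $ b) \<in> X"
   unfolding X_def tuple_GL_coords_def tuple_coords_def
   by (rule insertI2, rule image_eqI[of _ _ "(r, a, b)"]) (use that in auto)
  then show ?thesis using poly_degree.coord[of "\<lambda>\<gamma>. \<gamma> r $ a $ b" X 0] by simp
 qed
 have "poly_degree X 2 (\<lambda>\<gamma>. \<Sum>b\<in>UNIV. (\<Sum>a\<in>UNIV. \<gamma> 0 $ i $ a * g s $ a $ b) * \<gamma> s $ b $ j)"
 proof (rule poly_degree_sum)
  fix b
  have "poly_degree X (1 + 0) (\<lambda>\<gamma>. \<gamma> 0 $ i $ a * g s $ a $ b)" for a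
   by (rule poly_degree.mult[OF x poly_degree.const]) simp
  then have "poly_degree X (1 + 1) (\<lambda>\<gamma>. (\<Sum>a\<in>UNIV. \<gamma> 0 $ i $ a * g s $ a $ b) * \<gamma> s $ b $ j)"
   using e(2) by (intro poly_degree.mult poly_degree_sum x) auto
  then show "poly_degree X 2 (\<lambda>\<gamma>. (\<Sum>a\<in>UNIV. \<gamma> 0 $ i $ a * g s $ a $ b) * \<gamma> s $ b $ j)"
   by (simp add: numeral_2_eq_2)
 qed
 then show ?thesis unfolding e(1) orbit_entry_def[abs_def] by (simp add: matrix_matrix_mult_def)
qed

lemma zclosed_\<Gamma>: "zclosed X (GL_tuples (insert 0 I)) \<Gamma>"
 unfolding zclosed_iff
proof (intro conjI ballI)
 show "\<Gamma> \<subseteq> GL_tuples (insert 0 I)" using \<Gamma>_invertible unfolding GL_tuples_def by blast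
 define L where "L s = (if s = 0 then M else H s)" for s
 fix \<gamma> assume \<gamma>: "\<gamma> \<in> GL_tuples (insert 0 I) - \<Gamma>"
 have "L 0 = M" "\<And>s. s \<in> I \<Longrightarrow> L s = H s" using zero_notin unfolding L_def by auto
 then have "\<Gamma> = {\<gamma>. \<forall>s\<in>insert 0 I. \<gamma> s \<in> L s}" unfolding \<Gamma>_def by simp
 then obtain s where s: "s \<in> insert 0 I" "\<gamma> s \<notin> L s" using \<gamma> by blast
 have L: "zclosed entry_coords (Collect invertible) (L s)" using s groupM(5) groupH(5) unfolding L_def by auto
 have "\<gamma> s \<in> Collect invertible" using \<gamma> s(1) unfolding GL_tuples_def by blast
 then obtain f where f: "f \<in> PF entry_coords" "f (\<gamma> s) \<noteq> 0" "\<forall>w\<in>L s. f w = 0"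
  using zclosed_separate[OF L _ s(2)] by auto
 have fs: "(\<lambda>\<gamma>. f (\<gamma> s)) \<in> PF X"
  by (rule PF_comp[OF f(1)]) (rule entry_coords_PF, unfold X_def, rule matrix_PF_tuple[OF s(1)])
 have "\<forall>w\<in>\<Gamma>. f (w s) = 0" using f(3) s(1) unfolding \<open>\<Gamma> = {\<gamma>. \<forall>s\<in>insert 0 I. \<gamma> s \<in> L s}\<close> by blast
 then show "\<exists>f\<in>PF X. f \<gamma> \<noteq> 0 \<and> (\<forall>w\<in>\<Gamma>. f w = 0)" using f(2) by (intro bexI[OF _ fs]) simp
qed

lemma affine_\<Gamma>: "affine_on X \<Gamma>"
 by (rule affine_on_zclosed[OF _ zclosed_\<Gamma>]) (unfold X_def, rule affine_on_GL_tuples, simp add: finite_I)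

end

section \<open>Semicontinuity of the dimension\<close>

text \<open>The dimension is computed on one irreducible component \<open>S\<close> of the acting
  group. Points of \<open>\<Gamma>\<close> where \<open>q\<^sub>0\<close> is nonzero lie in
  \<open>S\<close>, so that near a generic point of \<open>S\<close> the fibre of the orbit map does
  not leave \<open>S\<close>; \<open>card Y\<^sub>0\<close> is the dimension of
  \<open>S\<close>.\<close>

locale conjugate_family_component = conjugate_family M H I
 for M :: "('k::alg_closed_field ^ 'n ^ 'n) set" and H I +
 fixes S q\<^sub>0 Y\<^sub>0
 assumes irr: "irreducible_on X S" and affS: "affine_on X S" and sub: "S \<subseteq> \<Gamma>"
  and q\<^sub>0: "q\<^sub>0 \<in> PF X" "\<exists>v\<in>S. q\<^sub>0 v \<noteq> 0" "\<And>v. v \<in> \<Gamma> \<Longrightarrow> q\<^sub>0 v \<noteq> 0 \<Longrightarrow> v \<in> S"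
  and Y\<^sub>0: "Y\<^sub>0 \<subseteq> X" "alg_indep S (\<lambda>y. y) Y\<^sub>0" "growth S X (card Y\<^sub>0)"
begin

lemma orbit_image_PF: "J \<subseteq> I \<times> UNIV \<Longrightarrow> orbit_entry g ` J \<subseteq> PF X"
 using PF_orbit_entry by blast

lemma finite_indices: "finite (I \<times> (UNIV :: ('n \<times> 'n) set))"
 using finite_I by simp

lemma fibre_growth:
 assumes g: "\<And>s. s \<in> I \<Longrightarrow> invertible (g s)" and growth: "growth (K g) GL_coords e"
  and P: "P \<subseteq> \<Gamma>" and const: "\<And>\<gamma> c i. \<gamma> \<in> P \<Longrightarrow> c \<in> P \<Longrightarrow> i \<in> I \<times> UNIV \<Longrightarrow> orbit_entry g i \<gamma> = orbit_entry g i c"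
 shows "growth P X e"
proof (cases "P = {}")
 case True
 then show ?thesis by (simp add: growth_empty)
next
 case False
 then obtain c where c: "c \<in> P" by blast
 show ?thesis
 proof (rule growth_pullback_PF[OF growth _ finite_X, where \<psi> = "\<lambda>\<gamma>. minv (c 0) ** \<gamma> 0"])
  show "(\<lambda>\<gamma>. minv (c 0) ** \<gamma> 0) ` P \<subseteq> K g"
  proof
   fix k assume "k \<in> (\<lambda>\<gamma>. minv (c 0) ** \<gamma> 0) ` P"
   then obtain \<gamma> where \<gamma>: "\<gamma> \<in> P" "k = minv (c 0) ** \<gamma> 0" by blast
   show "k \<in> K g" unfolding \<gamma>(2)
    by (rule fibre_point_surj(1)[OF g subsetD[OF P c] subsetD[OF P \<gamma>(1)] const[OF \<gamma>(1) c]])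
  qed
  fix x assume x: "x \<in> X"
  show "\<exists>\<zeta>\<in>PF GL_coords. \<forall>\<gamma>\<in>P. x \<gamma> = \<zeta> (minv (c 0) ** \<gamma> 0)"
  proof (intro bexI[of _ "\<lambda>k. x (fibre_point g c k)"] ballI)
   show "(\<lambda>k. x (fibre_point g c k)) \<in> PF GL_coords"
    by (rule PF_fibre_point) (rule PF_coord[OF x])
   fix \<gamma> assume \<gamma>: "\<gamma> \<in> P"
   have "fibre_point g c (minv (c 0) ** \<gamma> 0) s = \<gamma> s" if "s \<in> insert 0 I" for s
    by (rule fibre_point_surj(2)[OF g subsetD[OF P c] subsetD[OF P \<gamma>] const[OF \<gamma> c] that])
   then show "x \<gamma> = x (fibre_point g c (minv (c 0) ** \<gamma> 0))"
    by (intro X_cong[OF _ x]) simp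
  qed
 qed
qed

text \<open>A maximal independent set \<open>J\<close> of orbit entries is completed by
  \<open>Y\<close> to at least \<open>card Y\<^sub>0\<close> functions. On a generic slice where the
  entries in \<open>J\<close> are constant, the other entries are roots of fixed nonzero
  polynomials, so the slice meets only finitely many fibres of the orbit map. On one of these
  \<open>Y\<close> is still independent, and a fibre has dimension at most \<open>e\<close>.\<close>

lemma orbit_dimension_ge:
 assumes g: "\<And>s. s \<in> I \<Longrightarrow> invertible (g s)" and growth: "growth (K g) GL_coords e"
 obtains J where "J \<subseteq> I \<times> UNIV" "alg_indep S (orbit_entry g) J" "card Y\<^sub>0 \<le> card J + e"
proof -
 have S0: "S \<noteq> {}" using irr unfolding irreducible_on_def by blast
 obtain J where J: "J \<subseteq> I \<times> UNIV" "alg_indep S (orbit_entry g) J"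
  and alg: "\<And>i. i \<in> (I \<times> UNIV) - J \<Longrightarrow> algebraic_over S (orbit_entry g ` J) (orbit_entry g i)"
  by (rule maximal_alg_indep[OF finite_indices S0]) (rule that)
 have finJ: "finite J" using J(1) finite_indices finite_subset by blast
 have RX: "orbit_entry g ` J \<union> X \<subseteq> PF X"
  using orbit_image_PF[OF J(1)] by (auto intro: PF_coord)
 obtain Y where Y: "Y \<subseteq> X" "free_over S (orbit_entry g ` J) Y"
  "\<forall>d. growth S (orbit_entry g ` J) d \<longrightarrow> growth S (orbit_entry g ` J \<union> X) (d + card Y)"
  by (rule relative_basis_growth[OF irr finite_X RX]) (rule that)
 have finY: "finite Y" using Y(1) finite_X finite_subset by blast
 have "growth S (orbit_entry g ` J \<union> X) (card J + card Y)"
  using Y(3) growth_base[OF finJ] by blast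
 then have "growth S X (card J + card Y)" by (rule growth_subset) auto
 then have le: "card Y\<^sub>0 \<le> card J + card Y"
  using Y\<^sub>0(1,2) finite_subset[OF Y\<^sub>0(1) finite_X]
  by (intro alg_indep_growth[of S "\<lambda>y. y" _ X]) (auto intro: PF_coord)
 define h where "h = case_sum (orbit_entry g) (\<lambda>y. y)"
 have ind: "alg_indep S h (Inl ` J \<union> Inr ` Y)"
  using alg_indep_Plus[OF J(2) Y(2) finJ finY] unfolding h_def Plus_def .
 have hPF: "h i \<in> PF X" if "i \<in> Inl ` J \<union> Inr ` Y" for i
  using that RX Y(1) unfolding h_def by auto
 define R where "R = (I \<times> (UNIV :: ('n \<times> 'n) set)) - J"
 have "\<forall>i\<in>R. \<exists>\<pi> l. (\<forall>j. cf \<pi> j \<in> PF (orbit_entry g ` J)) \<and>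
  (\<forall>v\<in>S. poly (\<pi> v) (orbit_entry g i v) = 0) \<and> (\<exists>v\<in>S. coeff (\<pi> v) l \<noteq> 0)"
 proof
  fix i assume "i \<in> R"
  note alg[OF this[unfolded R_def], unfolded algebraic_over_def]
  then obtain \<pi> where \<pi>: "\<forall>j. cf \<pi> j \<in> PF (orbit_entry g ` J)"
   "\<forall>v\<in>S. poly (\<pi> v) (orbit_entry g i v) = 0" "\<exists>v\<in>S. \<pi> v \<noteq> 0"
   by (elim exE conjE)
  then obtain v where v: "v \<in> S" "\<pi> v \<noteq> 0" by blast
  then have "coeff (\<pi> v) (degree (\<pi> v)) \<noteq> 0" by simp
  then show "\<exists>\<pi> l. (\<forall>j. cf \<pi> j \<in> PF (orbit_entry g ` J)) \<and>
  (\<forall>v\<in>S. poly (\<pi> v) (orbit_entry g i v) = 0) \<and> (\<exists>v\<in>S. coeff (\<pi> v) l \<noteq> 0)"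
   using \<pi>(1,2) v(1) by (intro exI[of _ \<pi>] exI[of _ "degree (\<pi> v)"] conjI bexI[of _ v])
 qed
 from bchoice[OF this] obtain \<pi> where "\<forall>i\<in>R. \<exists>l. (\<forall>j. (\<lambda>v. coeff (\<pi> i v) j) \<in> PF (orbit_entry g ` J)) \<and>
  (\<forall>v\<in>S. poly (\<pi> i v) (orbit_entry g i v) = 0) \<and> (\<exists>v\<in>S. coeff (\<pi> i v) l \<noteq> 0)" by (elim exE)
 from bchoice[OF this] obtain l where l: "\<forall>i\<in>R. (\<forall>j. (\<lambda>v. coeff (\<pi> i v) j) \<in> PF (orbit_entry g ` J)) \<and>
  (\<forall>v\<in>S. poly (\<pi> i v) (orbit_entry g i v) = 0) \<and> (\<exists>v\<in>S. coeff (\<pi> i v) (l i) \<noteq> 0)" by (elim exE)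
 have \<pi>: "(\<lambda>v. coeff (\<pi> i v) j) \<in> PF (orbit_entry g ` J)" "v \<in> S \<Longrightarrow> poly (\<pi> i v) (orbit_entry g i v) = 0"
  "\<exists>v\<in>S. coeff (\<pi> i v) (l i) \<noteq> 0" if "i \<in> R" for i j v
  using bspec[OF l that] by auto
 \<comment> \<open>Where \<open>q\<close> is nonzero, the equation of every remaining orbit entry is
   a nonzero polynomial and has finitely many roots.\<close>
 define q where "q v = (\<Prod>i\<in>R. coeff (\<pi> i v) (l i))" for v
 have finR: "finite R" unfolding R_def using finite_indices by blast
 have cPF: "(\<lambda>v. coeff (\<pi> i v) j) \<in> PF X" if "i \<in> R" for i j
  using PF_trans[OF \<pi>(1)[OF that]] orbit_image_PF[OF J(1)] by blast
 have q: "q \<in> PF X" "\<exists>v\<in>S. q v \<noteq> 0"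
 proof -
  show "q \<in> PF X" unfolding q_def[abs_def] by (rule PF_prod) (rule cPF)
  show "\<exists>v\<in>S. q v \<noteq> 0"
   unfolding q_def by (rule irreducible_on_prod[OF irr finR cPF \<pi>(3)])
 qed
 have disj: "Inl ` J \<inter> Inr ` Y = {}" by auto
 obtain c where c: "alg_indep {v \<in> S. q v \<noteq> 0 \<and> (\<forall>i\<in>Inl ` J. h i v = c i)} h (Inr ` Y)"
  by (rule alg_indep_slice[OF irr affS finite_X finite_imageI[OF finJ] finite_imageI[OF finY] hPF ind disj q]) (assumption | rule that)+
 define W where "W = {v \<in> S. q v \<noteq> 0 \<and> (\<forall>i\<in>Inl ` J. h i v = c i)}"
 have const: "orbit_entry g i v = orbit_entry g i w" if "i \<in> J" "v \<in> W" "w \<in> W" for i v w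
  using that unfolding W_def h_def by (metis (mono_tags, lifting) imageI mem_Collect_eq old.sum.simps(5))
 have fin: "finite (orbit_entry g i ` W)" if i: "i \<in> I \<times> UNIV" for i
 proof (cases "i \<in> J")
  case True
  show ?thesis
  proof (cases "W = {}")
   case False
   then obtain w where "w \<in> W" by blast
   then have "orbit_entry g i ` W \<subseteq> {orbit_entry g i w}" using const[OF True] by blast
   then show ?thesis using finite_subset by blast
  qed simp
 next
  case False
  then have iR: "i \<in> R" using i unfolding R_def by blast
  show ?thesis
  proof (cases "W = {}")
   case False
   then obtain w where w: "w \<in> W" by blast
   have "\<pi> i v = \<pi> i w" if v: "v \<in> W" for v
   proof (rule poly_eqI)
    fix j
    show "coeff (\<pi> i v) j = coeff (\<pi> i w) j"
    proof (rule PF_eq[OF \<pi>(1)[OF iR, of j]])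
     fix x assume "x \<in> orbit_entry g ` J"
     then obtain i' where "i' \<in> J" "x = orbit_entry g i'" by blast
     then show "x v = x w" using const[of i' v w] v w by simp
    qed
   qed
   then have "orbit_entry g i ` W \<subseteq> {x. poly (\<pi> i w) x = 0}"
    using \<pi>(2)[OF iR] unfolding W_def by fastforce
   moreover have "q w \<noteq> 0" using w unfolding W_def by blast
   then have "coeff (\<pi> i w) (l i) \<noteq> 0" using finR iR unfolding q_def by auto
   then have "\<pi> i w \<noteq> 0" by auto
   then have "finite {x. poly (\<pi> i w) x = 0}" by (rule poly_roots_finite)
   ultimately show ?thesis using finite_subset by blast
  qed simp
 qed
 \<comment> \<open>The orbit point reached from \<open>v\<close>; it takes finitely many values on
   \<open>W\<close>, and its level sets lie in fibres of the orbit map.\<close>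
 define \<Phi> where "\<Phi> v = restrict (\<lambda>i. orbit_entry g i v) (I \<times> (UNIV :: ('n \<times> 'n) set))" for v
 have "\<Phi> ` W \<subseteq> (\<Pi>\<^sub>E i\<in>I \<times> UNIV. orbit_entry g i ` W)"
  unfolding \<Phi>_def image_subset_iff restrict_PiE_iff by (intro ballI imageI)
 then have fin\<Phi>: "finite (\<Phi> ` W)" by (rule finite_subset) (rule finite_PiE[OF finite_indices fin])
 have "W = \<Union>((\<lambda>p. {v \<in> W. \<Phi> v = p}) ` \<Phi> ` W)" by blast
 then have "alg_indep (\<Union>((\<lambda>p. {v \<in> W. \<Phi> v = p}) ` \<Phi> ` W)) h (Inr ` Y)"
  using c unfolding W_def[symmetric] by simp
 then have "\<exists>D\<in>(\<lambda>p. {v \<in> W. \<Phi> v = p}) ` \<Phi> ` W. alg_indep D h (Inr ` Y)"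
  by (rule alg_indep_Union) (use fin\<Phi> finY in auto)
 then obtain p where p: "alg_indep {v \<in> W. \<Phi> v = p} h (Inr ` Y)" by blast
 have "growth {v \<in> W. \<Phi> v = p} X e"
 proof (rule fibre_growth[OF g growth])
  show "{v \<in> W. \<Phi> v = p} \<subseteq> \<Gamma>" using sub unfolding W_def by blast
  fix \<gamma> c i assume *: "\<gamma> \<in> {v \<in> W. \<Phi> v = p}" "c \<in> {v \<in> W. \<Phi> v = p}" "i \<in> I \<times> (UNIV :: ('n \<times> 'n) set)"
  then have "\<Phi> \<gamma> i = \<Phi> c i" by simp
  then show "orbit_entry g i \<gamma> = orbit_entry g i c" using *(3) unfolding \<Phi>_def by simp
 qed
 then have "card (Inr ` Y :: (nat \<times> 'n \<times> 'n + ((nat \<Rightarrow> 'k ^ 'n ^ 'n) \<Rightarrow> 'k)) set) \<le> e"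
  by (intro alg_indep_growth[OF p]) (use finY hPF in auto)
 then have "card Y \<le> e" by (simp add: card_image)
 then show ?thesis using that[OF J] le by simp
qed

text \<open>Near a generic point \<open>c\<close> of \<open>S\<close> the fibre of the orbit map has
  dimension at most \<open>card Y\<close>: the entries in \<open>J\<close> are constant on it, and
  \<open>Y\<close> controls the remaining coordinates. As \<open>K g\<close> parametrizes the fibre,
  a neighbourhood of the identity in \<open>K g\<close> inherits the bound, and finitely many
  translates of it cover \<open>K g\<close>.\<close>

lemma orbit_dimension_le:
 assumes g: "\<And>s. s \<in> I \<Longrightarrow> invertible (g s)"
  and J: "J \<subseteq> I \<times> UNIV" "alg_indep S (orbit_entry g) J" and le: "card Y\<^sub>0 \<le> card J + e"
 shows "growth (K g) GL_coords e"
proof -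
 have finJ: "finite J" using J(1) finite_indices finite_subset by blast
 have RX: "orbit_entry g ` J \<union> X \<subseteq> PF X"
  using orbit_image_PF[OF J(1)] by (auto intro: PF_coord)
 obtain Y q where Y: "Y \<subseteq> X" "free_over S (orbit_entry g ` J) Y" and q: "q \<in> PF X" "\<exists>v\<in>S. q v \<noteq> 0"
  and gr: "\<And>W d. W \<subseteq> S \<Longrightarrow> \<forall>v\<in>W. q v \<noteq> 0 \<Longrightarrow> growth W (orbit_entry g ` J) d \<Longrightarrow>
   growth W (orbit_entry g ` J \<union> X) (d + card Y)"
  by (rule relative_basis_growth[OF irr finite_X RX]) (rule that)
 have "card J + card Y \<le> card Y\<^sub>0"
  by (rule free_over_card_le[OF J(2) finJ Y(2) _ _ _ Y\<^sub>0(3)])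
   (use Y(1) finite_X finite_subset RX in auto)
 then have Ye: "card Y \<le> e" using le by simp
 obtain c where c: "c \<in> S" "q c \<noteq> 0" "q\<^sub>0 c \<noteq> 0"
  using irreducible_onD[OF irr q(1) q\<^sub>0(1) q(2) q\<^sub>0(2)] by blast
 have c\<Gamma>: "c \<in> \<Gamma>" using c(1) sub by blast
 have c0: "invertible (c 0)" using \<Gamma>_invertible[OF c\<Gamma>] by blast
 \<comment> \<open>Cuts out a part of \<open>K g\<close> that is mapped into \<open>S\<close> and
   avoids the zeros of \<open>q\<close>. It contains the identity, as both factors are nonzero at
   \<open>c\<close>.\<close>
 define Q where "Q k = q (fibre_point g c k) * q\<^sub>0 (fibre_point g c k)" for k
 have QPF: "Q \<in> PF GL_coords" unfolding Q_def[abs_def] by (intro PF_intros PF_fibre_point q q\<^sub>0)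
 define W where "W = {\<gamma> \<in> S. q \<gamma> \<noteq> 0 \<and> (\<forall>i\<in>I \<times> UNIV. orbit_entry g i \<gamma> = orbit_entry g i c)}"
 have "growth W (orbit_entry g ` J) 0"
  by (rule growth_constant) (use J(1) in \<open>auto simp: W_def\<close>)
 then have "growth W (orbit_entry g ` J \<union> X) (0 + card Y)"
  by (intro gr) (auto simp: W_def)
 then have WX: "growth W X e" by (rule growth_mono[OF growth_subset]) (use Ye in auto)
 define K' where "K' = {k \<in> K g. Q k \<noteq> 0}"
 have K': "growth K' GL_coords e"
 proof (rule growth_pullback_PF[OF WX _ finite_GL_coords, where \<psi> = "fibre_point g c"])
  show "fibre_point g c ` K' \<subseteq> W"
  proof
   fix \<gamma> assume "\<gamma> \<in> fibre_point g c ` K'"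
   then obtain k where k: "k \<in> K g" "Q k \<noteq> 0" "\<gamma> = fibre_point g c k" unfolding K'_def by blast
   then have "q \<gamma> \<noteq> 0" "q\<^sub>0 \<gamma> \<noteq> 0" unfolding Q_def by auto
   moreover have "\<gamma> \<in> \<Gamma>" unfolding k(3) by (rule fibre_point_in(1)[OF g c\<Gamma> k(1)])
   moreover have "orbit_entry g i \<gamma> = orbit_entry g i c" if "i \<in> I \<times> UNIV" for i
    unfolding k(3) by (rule fibre_point_in(2)[OF g c\<Gamma> k(1) that])
   ultimately show "\<gamma> \<in> W" unfolding W_def using q\<^sub>0(3) by blast
  qed
  fix x :: "'k ^ 'n ^ 'n \<Rightarrow> 'k" assume x: "x \<in> GL_coords"
  have M0: "matrix_PF X (\<lambda>\<gamma>. minv (c 0) ** \<gamma> 0)"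
   unfolding X_def by (intro matrix_PF_mult matrix_PF_const matrix_PF_tuple) simp
  have eq: "minv (c 0) ** fibre_point g c k 0 = k" for k
   unfolding fibre_point_def using c0 by (simp add: matrix_inv_cancel)
  from x consider "x = (\<lambda>A. inverse (det A))" | "x \<in> entry_coords" unfolding GL_coords_def by blast
  then show "\<exists>\<zeta>\<in>PF X. \<forall>k\<in>K'. x k = \<zeta> (fibre_point g c k)"
  proof cases
   case 1
   \<comment> \<open>The reciprocal of the determinant of \<open>\<gamma> 0\<close> is the common
     reciprocal times the determinants with index in \<open>I\<close>.\<close>
   define \<zeta> where "\<zeta> \<gamma> = inverse (det (minv (c 0))) * (inverse (\<Prod>s\<in>insert 0 I. det (\<gamma> s)) * (\<Prod>s\<in>I. det (\<gamma> s)))"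
    for \<gamma> :: "nat \<Rightarrow> 'k ^ 'n ^ 'n"
   have "(\<lambda>\<gamma>. inverse (\<Prod>s\<in>insert 0 I. det (\<gamma> s))) \<in> PF X"
    by (rule PF_coord) (simp add: X_def tuple_GL_coords_def)
   then have "\<zeta> \<in> PF X"
    unfolding \<zeta>_def[abs_def]
    by (intro PF_intros matrix_PF_det) (auto simp: X_def intro: matrix_PF_tuple)
   moreover have "x k = \<zeta> (fibre_point g c k)" if "k \<in> K'" for k
   proof -
    define \<gamma> where "\<gamma> = fibre_point g c k"
    have "\<gamma> \<in> \<Gamma>" unfolding \<gamma>_def by (rule fibre_point_in(1)[OF g c\<Gamma>]) (use that K'_def in auto)
    then have "(\<Prod>s\<in>I. det (\<gamma> s)) \<noteq> 0"
     using \<Gamma>_invertible finite_I by (auto simp: invertible_det_nz)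
    then have "\<zeta> \<gamma> = inverse (det (minv (c 0) ** \<gamma> 0))"
     unfolding \<zeta>_def using finite_I zero_notin by (simp add: det_mul)
    then show ?thesis unfolding \<gamma>_def eq 1 by simp
   qed
   ultimately show ?thesis by blast
  next
   case 2
   have "(\<lambda>\<gamma>. x (minv (c 0) ** \<gamma> 0)) \<in> PF X" by (rule entry_coords_PF[OF M0 2])
   then show ?thesis using eq by (intro bexI[of _ "\<lambda>\<gamma>. x (minv (c 0) ** \<gamma> 0)"]) auto
  qed
 qed
 have translate: "matrix_PF GL_coords (\<lambda>k. a ** k)" "(\<lambda>k. inverse (det (a ** k))) \<in> PF GL_coords"
  for a :: "'k ^ 'n ^ 'n"
 proof -
  show "matrix_PF GL_coords (\<lambda>k. a ** k)" by (intro matrix_PF_mult matrix_PF_const matrix_PF_GL)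
  show "(\<lambda>k. inverse (det (a ** k))) \<in> PF GL_coords"
   unfolding det_mul inverse_mult_distrib by (intro PF_intros PF_inverse_det_GL)
 qed
 have Q1: "Q (mat 1) \<noteq> 0"
 proof -
  have "fibre_point g c (mat 1) s = c s" if "s \<in> insert 0 I" for s
   using that g zero_notin unfolding fibre_point_def
   by (auto simp: cramer_inverse[OF invertible_one] matrix_inv_one matrix_inv_cancel)
  then have "q (fibre_point g c (mat 1)) = q c" "q\<^sub>0 (fibre_point g c (mat 1)) = q\<^sub>0 c"
   using PF_X_cong q(1) q\<^sub>0(1) by blast+
  then show ?thesis unfolding Q_def using c by simp
 qed
 have QT: "(\<lambda>k. Q (minv v ** k)) \<in> PF GL_coords" for v
  by (rule GL_coords_PF[OF translate QPF])
 have Qv: "Q (minv v ** v) \<noteq> 0" if "v \<in> K g" for v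
  using Q1 K_invertible[OF that] by (simp add: matrix_inv_cancel)
 obtain T where T: "finite T" "T \<subseteq> K g" "\<And>v. v \<in> K g \<Longrightarrow> \<exists>w\<in>T. Q (minv w ** v) \<noteq> 0"
  by (rule finite_open_cover[of GL_coords "K g" "\<lambda>w v. Q (minv w ** v)"])
   (rule finite_GL_coords, rule QT, rule Qv, assumption, rule that)
 have "growth (\<Union>w\<in>T. {k \<in> K g. Q (minv w ** k) \<noteq> 0}) GL_coords e"
 proof (rule growth_UN[OF T(1)])
  fix w assume "w \<in> T"
  then have w: "w \<in> K g" using T(2) by blast
  show "growth {k \<in> K g. Q (minv w ** k) \<noteq> 0} GL_coords e"
  proof (rule growth_pullback_PF[OF K' _ finite_GL_coords, where \<psi> = "\<lambda>k. minv w ** k"])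
   show "(**) (minv w) ` {k \<in> K g. Q (minv w ** k) \<noteq> 0} \<subseteq> K'"
    unfolding K'_def using K_mult K_inv[OF w] by blast
   fix x :: "'k ^ 'n ^ 'n \<Rightarrow> 'k" assume x: "x \<in> GL_coords"
   have "(\<lambda>k. x (w ** k)) \<in> PF GL_coords"
    by (rule GL_coords_PF[OF translate PF_coord[OF x]])
   then show "\<exists>\<zeta>\<in>PF GL_coords. \<forall>k\<in>{k \<in> K g. Q (minv w ** k) \<noteq> 0}. x k = \<zeta> (minv w ** k)"
    using K_invertible[OF w] by (intro bexI[of _ "\<lambda>k. x (w ** k)"]) (auto simp: matrix_inv_cancel)
  qed
 qed
 then show ?thesis by (rule growth_subset) (use T(3) in auto)
qed

text \<open>By \<open>uniform_relations\<close>, independence of the orbit entries in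
  \<open>J\<close> amounts to the trivial kernel of one linear system, with an unknown for each of
  finitely many monomials and an equation for each point of \<open>S\<close>. Triviality of this
  kernel persists near \<open>g\<^sub>0\<close>.\<close>

lemma stabilizer_dimension_open:
 assumes g: "g\<^sub>0 \<in> GL_tuples I" and growth: "growth (K g\<^sub>0) GL_coords e"
 shows "\<exists>P\<in>PF (tuple_coords I). P g\<^sub>0 \<noteq> 0 \<and>
  (\<forall>g\<in>GL_tuples I. P g \<noteq> 0 \<longrightarrow> growth (K g) GL_coords e)"
proof -
 have inv: "\<And>s. s \<in> I \<Longrightarrow> invertible (g s)" if "g \<in> GL_tuples I" for g
  using that unfolding GL_tuples_def by blast
 obtain J where J: "J \<subseteq> I \<times> UNIV" "alg_indep S (orbit_entry g\<^sub>0) J" "card Y\<^sub>0 \<le> card J + e"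
  by (rule orbit_dimension_ge[OF inv[OF g] growth]) (assumption | rule that)+
 have finJ: "finite J" using J(1) finite_indices finite_subset by blast
 obtain D where D: "\<forall>h. (\<forall>i\<in>J. poly_degree X 2 (h i)) \<longrightarrow> lin_indep S (exponents J D) (monomial J h) \<longrightarrow> alg_indep S h J"
  using uniform_relations[OF irr finite_X finJ, of 2] by (elim exE)
 define \<psi> where "\<psi> \<gamma> lv g = monomial J (orbit_entry g) lv \<gamma>" for \<gamma> lv g
 have \<psi>PF: "\<psi> \<gamma> lv \<in> PF (tuple_coords I)" for \<gamma> lv
 proof -
  have "(\<lambda>g. orbit_entry g i \<gamma>) \<in> PF (tuple_coords I)" if "i \<in> J" for i
  proof -
   obtain s a b where i: "i = (s, a, b)" "s \<in> I" using \<open>i \<in> J\<close> J(1) by auto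
   have "(\<lambda>g. (\<gamma> 0 ** g s ** \<gamma> s) $ a $ b) \<in> PF (tuple_coords I)"
    by (intro PF_matrix_mult PF_const PF_tuple_entry i(2))
   then show ?thesis unfolding i(1) orbit_entry_def by simp
  qed
  then show ?thesis unfolding \<psi>_def[abs_def] monomial_def by (intro PF_prod PF_power)
 qed
 have "\<exists>P\<in>PF (tuple_coords I). P g\<^sub>0 \<noteq> 0 \<and> (\<forall>w. P w \<noteq> 0 \<longrightarrow>
  (\<forall>\<theta>. (\<forall>\<gamma>\<in>S. (\<Sum>lv\<in>exponents J D. \<theta> lv * \<psi> \<gamma> lv w) = 0) \<longrightarrow> (\<forall>lv\<in>exponents J D. \<theta> lv = 0)))"
 proof (rule trivial_kernel_open)
  show "finite (exponents J D)" using finJ by (rule finite_exponents)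
  show "\<psi> \<gamma> lv \<in> PF (tuple_coords I)" for \<gamma> lv by (rule \<psi>PF)
  fix \<theta> assume "\<And>\<gamma>. \<gamma> \<in> S \<Longrightarrow> (\<Sum>lv\<in>exponents J D. \<theta> lv * \<psi> \<gamma> lv g\<^sub>0) = 0"
  then have "\<forall>\<gamma>\<in>S. (\<Sum>lv\<in>exponents J D. \<theta> lv * monomial J (orbit_entry g\<^sub>0) lv \<gamma>) = 0" unfolding \<psi>_def by (rule ballI)
  then show "\<forall>lv\<in>exponents J D. \<theta> lv = 0"
   by (rule J(2)[unfolded alg_indep_def lin_indep_def, THEN spec, THEN spec, THEN mp])
 qed
 then obtain P where P: "P \<in> PF (tuple_coords I)" "P g\<^sub>0 \<noteq> 0" "\<forall>w. P w \<noteq> 0 \<longrightarrow>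
  (\<forall>\<theta>. (\<forall>\<gamma>\<in>S. (\<Sum>lv\<in>exponents J D. \<theta> lv * \<psi> \<gamma> lv w) = 0) \<longrightarrow> (\<forall>lv\<in>exponents J D. \<theta> lv = 0))"
  by (elim bexE conjE)
 have "growth (K w) GL_coords e" if w: "w \<in> GL_tuples I" "P w \<noteq> 0" for w
 proof (rule orbit_dimension_le[OF inv[OF w(1)] J(1) _ J(3)])
  have "lin_indep S (exponents J D) (monomial J (orbit_entry w))"
   unfolding lin_indep_def by (rule P(3)[THEN spec, THEN mp, OF w(2), unfolded \<psi>_def])
  then show "alg_indep S (orbit_entry w) J"
   by (rule D[THEN spec, THEN mp, THEN mp, rotated]) (use poly_degree_orbit_entry J(1) in blast)
 qed
 then show ?thesis using P(1,2) by blast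
qed

end

theorem (in conjugate_family) stabilizer_dimension_zclosed:
 "zclosed (tuple_coords I) (GL_tuples I) {g \<in> GL_tuples I. \<not> growth (K g) GL_coords e}"
proof -
 have "(\<lambda>_. mat 1) \<in> \<Gamma>" unfolding \<Gamma>_def using groupM(1) groupH(1) by blast
 then have "\<Gamma> \<noteq> {}" by blast
 then obtain S q where S: "zclosed X \<Gamma> S" "irreducible_on X S" "q \<in> PF X" "\<exists>v\<in>S. q v \<noteq> 0"
  "\<And>v. v \<in> \<Gamma> \<Longrightarrow> q v \<noteq> 0 \<Longrightarrow> v \<in> S"
  by (rule irreducible_component[OF finite_X]) (rule that)
 obtain Y where Y: "Y \<subseteq> X" "alg_indep S (\<lambda>y. y) Y" "growth S X (card Y)"
  by (rule transcendence_basis[OF S(2) finite_X]) (rule that)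
 interpret conjugate_family_component M H I S q Y
  by unfold_locales (use S Y zclosed_subset affine_on_zclosed[OF affine_\<Gamma>] in blast)+
 show ?thesis
  unfolding zclosed_iff
 proof (intro conjI ballI)
  fix g assume "g \<in> GL_tuples I - {g \<in> GL_tuples I. \<not> growth (K g) GL_coords e}"
  then have "g \<in> GL_tuples I" "growth (K g) GL_coords e" by auto
  from stabilizer_dimension_open[OF this]
  show "\<exists>f\<in>PF (tuple_coords I). f g \<noteq> 0 \<and> (\<forall>w\<in>{g \<in> GL_tuples I. \<not> growth (K g) GL_coords e}. f w = 0)"
   by blast
 qed blast
qed

section \<open>Identity components and unipotent radicals\<close>

lemma closedin_matrix_zariski:
 "K \<subseteq> Collect invertible \<Longrightarrow> closedin (subtopology matrix_zariski K) C \<longleftrightarrow> zclosed GL_coords K C"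
 unfolding matrix_zariski_def entry_coords_def[symmetric] closedin_zariski_subtopology by (simp add: zclosed_GL_coords)

lemma zclosed_preimage:
 assumes "zclosed X S C" "\<psi> ` T \<subseteq> S" "\<And>x. x \<in> X \<Longrightarrow> (\<lambda>v. x (\<psi> v)) \<in> PF Y"
 shows "zclosed Y T {v \<in> T. \<psi> v \<in> C}"
proof -
 obtain P where P: "P \<subseteq> PF X" "C = {v \<in> S. \<forall>f\<in>P. f v = 0}" using assms(1) unfolding zclosed_def by blast
 show ?thesis
 proof (rule zclosedI[of "(\<lambda>f v. f (\<psi> v)) ` P"])
  show "(\<lambda>f v. f (\<psi> v)) ` P \<subseteq> PF Y"
  proof
   fix g assume "g \<in> (\<lambda>f v. f (\<psi> v)) ` P"
   then obtain f where f: "f \<in> P" "g = (\<lambda>v. f (\<psi> v))" by blast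
   show "g \<in> PF Y" unfolding f(2) by (rule PF_comp[OF subsetD[OF P(1) f(1)] assms(3)])
  qed
  show "{v \<in> T. \<psi> v \<in> C} = {v \<in> T. \<forall>f\<in>(\<lambda>f v. f (\<psi> v)) ` P. f v = 0}"
   unfolding P(2) using assms(2) by auto
 qed
qed

lemma closed_group_GL_coords:
 "closed_group K \<Longrightarrow> zclosed GL_coords (Collect invertible) K"
 using closed_groupD(5) zclosed_GL_coords by blast

lemma closed_groupI:
 fixes K :: "('k::field ^ 'n ^ 'n) set"
 assumes "mat 1 \<in> K" "\<And>a b. a \<in> K \<Longrightarrow> b \<in> K \<Longrightarrow> a ** b \<in> K" "\<And>a. a \<in> K \<Longrightarrow> invertible a"
  "\<And>a. a \<in> K \<Longrightarrow> minv a \<in> K" "zclosed GL_coords (Collect invertible) K"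
 shows "closed_group K"
 using assms zclosed_GL_coords[of "Collect invertible" K] unfolding closed_group_def by blast

lemma closed_group_subset:
 fixes K :: "('k::field ^ 'n ^ 'n) set"
 assumes "closed_group K" "L \<subseteq> K" "mat 1 \<in> L" "\<And>a b. a \<in> L \<Longrightarrow> b \<in> L \<Longrightarrow> a ** b \<in> L"
  "\<And>a. a \<in> L \<Longrightarrow> minv a \<in> L" "zclosed GL_coords K L"
 shows "closed_group L"
 by (rule closed_groupI)
  (use assms closed_groupD(3)[OF assms(1)] zclosed_trans[OF closed_group_GL_coords[OF assms(1)] assms(6)] in blast)+

lemma closed_group_Int:
 fixes K L :: "('k::field ^ 'n ^ 'n) set"
 assumes "closed_group K" "closed_group L"
 shows "closed_group (K \<inter> L)"
 by (rule closed_groupI)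
  (use closed_groupD[OF assms(1)] closed_groupD[OF assms(2)]
   zclosed_Int[OF closed_group_GL_coords[OF assms(1)] closed_group_GL_coords[OF assms(2)]] in auto)

section \<open>Translations and identity components\<close>

definition translate :: "'k::field ^ 'n ^ 'n \<Rightarrow> 'k ^ 'n ^ 'n \<Rightarrow> 'k ^ 'n ^ 'n \<Rightarrow> 'k ^ 'n ^ 'n" where
 "translate a b k = a ** k ** b"

lemma PF_translate: "f \<in> PF GL_coords \<Longrightarrow> (\<lambda>k. f (translate a b k)) \<in> PF GL_coords"
proof (rule GL_coords_PF)
 show "matrix_PF GL_coords (translate a b)"
  unfolding translate_def[abs_def] by (intro matrix_PF_mult matrix_PF_const matrix_PF_GL)
 show "(\<lambda>k. inverse (det (translate a b k))) \<in> PF GL_coords"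
  unfolding translate_def det_mul inverse_mult_distrib by (intro PF_intros PF_inverse_det_GL)
qed

lemma PF_translate_coord: "x \<in> GL_coords \<Longrightarrow> (\<lambda>k. x (translate a b k)) \<in> PF GL_coords"
 by (intro PF_translate PF_coord)

lemma translate_inverse:
 fixes a b :: "'k::field ^ 'n ^ 'n"
 assumes "invertible a" "invertible b"
 shows "translate a b (translate (minv a) (minv b) k) = k"
  "translate (minv a) (minv b) (translate a b k) = k"
 using assms unfolding translate_def by (simp_all add: matrix_inv_simps)

lemma translate_irreducible: "irreducible_on GL_coords Z \<Longrightarrow> irreducible_on GL_coords (translate a b ` Z)"
 by (rule irreducible_on_image, assumption) (rule PF_translate_coord)

lemma translate_image:
 fixes a b :: "'k::field ^ 'n ^ 'n"
 assumes "invertible a" "invertible b" "translate a b ` K \<subseteq> K" "Z \<subseteq> K"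
 shows "translate a b ` Z = {v \<in> K. translate (minv a) (minv b) v \<in> Z}"
proof (intro equalityI subsetI)
 fix v assume "v \<in> translate a b ` Z"
 then show "v \<in> {v \<in> K. translate (minv a) (minv b) v \<in> Z}"
  using assms translate_inverse(2)[OF assms(1,2)] by auto
next
 fix v assume "v \<in> {v \<in> K. translate (minv a) (minv b) v \<in> Z}"
 then show "v \<in> translate a b ` Z"
  using translate_inverse(1)[OF assms(1,2), of v] by (metis (mono_tags, lifting) imageI mem_Collect_eq)
qed

lemma translate_zclosed:
 fixes a b :: "'k::field ^ 'n ^ 'n"
 assumes "invertible a" "invertible b" "translate a b ` K \<subseteq> K"
  "translate (minv a) (minv b) ` K \<subseteq> K" "zclosed GL_coords K Z"
 shows "zclosed GL_coords K (translate a b ` Z)"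
 unfolding translate_image[OF assms(1-3) zclosed_subset[OF assms(5)]]
 by (rule zclosed_preimage[OF assms(5,4)]) (rule PF_translate_coord)

lemma translate_growth:
 fixes a b :: "'k::field ^ 'n ^ 'n"
 assumes "invertible a" "invertible b" "growth W GL_coords e"
 shows "growth (translate a b ` W) GL_coords e"
proof (rule growth_pullback_PF[OF assms(3) _ finite_GL_coords, where \<psi> = "translate (minv a) (minv b)"])
 show "translate (minv a) (minv b) ` translate a b ` W \<subseteq> W"
  using translate_inverse(2)[OF assms(1,2)] by auto
 fix x :: "'k ^ 'n ^ 'n \<Rightarrow> 'k" assume "x \<in> GL_coords"
 then show "\<exists>\<zeta>\<in>PF GL_coords. \<forall>k\<in>translate a b ` W. x k = \<zeta> (translate (minv a) (minv b) k)"
  using translate_inverse(1)[OF assms(1,2)]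
  by (intro bexI[OF _ PF_translate_coord[of x a b]]) auto
qed

text \<open>The members of the union are not assumed closed; that the union is irreducible and
  closed comes from \<open>id_component_neighbourhood\<close>.\<close>

definition id_component :: "('k::field ^ 'n ^ 'n) set \<Rightarrow> ('k ^ 'n ^ 'n) set" where
 "id_component K = \<Union>{Z. Z \<subseteq> K \<and> irreducible_on GL_coords Z \<and> mat 1 \<in> Z}"

lemma id_component_mono: "L \<subseteq> K \<Longrightarrow> id_component L \<subseteq> id_component K"
 unfolding id_component_def by blast

lemma id_component_largest:
 "Z \<subseteq> K \<Longrightarrow> irreducible_on GL_coords Z \<Longrightarrow> mat 1 \<in> Z \<Longrightarrow> Z \<subseteq> id_component K"
 unfolding id_component_def by blast

lemma id_component_subset: "id_component K \<subseteq> K"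
 unfolding id_component_def by blast

text \<open>
 Translating an irreducible component by a point at which it contains a neighbourhood gives an
 irreducible closed neighbourhood of the identity.
\<close>

lemma id_component_neighbourhood:
 fixes K :: "('k::alg_closed_field ^ 'n ^ 'n) set"
 assumes K: "closed_group K"
 obtains q where "irreducible_on GL_coords (id_component K)" "zclosed GL_coords K (id_component K)"
  "mat 1 \<in> id_component K" "q \<in> PF GL_coords" "q (mat 1) \<noteq> 0"
  "\<And>v. v \<in> K \<Longrightarrow> q v \<noteq> 0 \<Longrightarrow> v \<in> id_component K"
proof -
 note K' = closed_groupD[OF K]
 have "K \<noteq> {}" using K'(1) by blast
 then obtain D q where D: "zclosed GL_coords K D" "irreducible_on GL_coords D" "q \<in> PF GL_coords" "\<exists>v\<in>D. q v \<noteq> 0"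
  "\<And>v. v \<in> K \<Longrightarrow> q v \<noteq> 0 \<Longrightarrow> v \<in> D"
  by (rule irreducible_component[OF finite_GL_coords]) (rule that)
 then obtain a where a: "a \<in> D" "q a \<noteq> 0" by blast
 have aK: "a \<in> K" using a(1) zclosed_subset[OF D(1)] by blast
 have ia: "invertible a" "invertible (minv a)" using K'(3) aK invertible_matrix_inv by blast+
 define D' where "D' = translate (minv a) (mat 1) ` D"
 have one: "mat 1 \<in> D'" unfolding D'_def translate_def using a(1) ia by (auto simp: image_iff matrix_inv_cancel intro!: bexI[of _ a])
 have irr: "irreducible_on GL_coords D'" unfolding D'_def by (rule translate_irreducible[OF D(2)])
 have cl: "zclosed GL_coords K D'" unfolding D'_def
  by (rule translate_zclosed[OF ia(2) invertible_one _ _ D(1)])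
   (use K'(2,4) aK in \<open>auto simp: translate_def matrix_inv_one matrix_inv_involutive[OF ia(1)]\<close>)
 have D'K: "D' \<subseteq> K" using zclosed_subset[OF cl] .
 define q' where "q' v = q (translate a (mat 1) v)" for v
 have q'PF: "q' \<in> PF GL_coords" unfolding q'_def[abs_def] by (rule PF_translate[OF D(3)])
 have q'1: "q' (mat 1) \<noteq> 0" unfolding q'_def translate_def using a(2) by simp
 have q'D: "v \<in> D'" if v: "v \<in> K" "q' v \<noteq> 0" for v
 proof -
  have "a ** v \<in> D" using D(5)[of "a ** v"] K'(2)[OF aK v(1)] v(2) unfolding q'_def translate_def by simp
  then show ?thesis unfolding D'_def translate_def using ia by (auto simp: image_iff matrix_inv_cancel intro!: bexI[of _ "a ** v"])
 qed
 have "Z \<subseteq> D'" if Z: "Z \<subseteq> K" "irreducible_on GL_coords Z" "mat 1 \<in> Z" for Z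
 proof
  fix z assume z: "z \<in> Z"
  show "z \<in> D'"
  proof (rule ccontr)
   assume "z \<notin> D'"
   moreover have "z \<in> K" using z Z(1) by blast
   ultimately obtain f where f: "f \<in> PF GL_coords" "f z \<noteq> 0" "\<forall>w\<in>D'. f w = 0"
    using zclosed_separate[OF cl] by auto
   have "\<forall>v\<in>Z. f v = 0"
    by (rule irreducible_on_dense[OF Z(2) f(1) q'PF]) (use q'1 Z(1,3) f(3) q'D in blast)+
   then show False using f(2) z by blast
  qed
 qed
 then have "id_component K = D'" unfolding id_component_def using irr one D'K by blast
 then show ?thesis using that[of q'] irr one cl q'PF q'1 q'D by simp
qed

context
 fixes K :: "('k::alg_closed_field ^ 'n ^ 'n) set"
 assumes K: "closed_group K"
begin

lemma id_component_irreducible: "irreducible_on GL_coords (id_component K)"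
 by (rule id_component_neighbourhood[OF K])

lemma id_component_zclosed: "zclosed GL_coords K (id_component K)"
 by (rule id_component_neighbourhood[OF K])

lemma one_id_component: "mat 1 \<in> id_component K"
 by (rule id_component_neighbourhood[OF K])

lemma id_component_translate:
 assumes "\<And>k. k \<in> K \<Longrightarrow> translate a b k \<in> K" "mat 1 \<in> translate a b ` id_component K"
 shows "translate a b ` id_component K \<subseteq> id_component K"
proof (rule id_component_largest)
 show "translate a b ` id_component K \<subseteq> K" using assms(1) id_component_subset by blast
 show "irreducible_on GL_coords (translate a b ` id_component K)"
  by (rule translate_irreducible[OF id_component_irreducible])
qed (rule assms(2))

lemma id_component_left_quotient:
 assumes "a \<in> id_component K" "b \<in> id_component K"
 shows "minv a ** b \<in> id_component K"
proof -
 note K' = closed_groupD[OF K]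
 have a: "a \<in> K" "invertible a" using assms(1) id_component_subset K'(3) by blast+
 have "translate (minv a) (mat 1) ` id_component K \<subseteq> id_component K"
 proof (rule id_component_translate)
  show "translate (minv a) (mat 1) k \<in> K" if "k \<in> K" for k
   unfolding translate_def using K'(2)[OF K'(4)[OF a(1)] that] by simp
  show "mat 1 \<in> translate (minv a) (mat 1) ` id_component K"
   by (rule image_eqI[OF _ assms(1)]) (simp add: translate_def matrix_inv_cancel a(2))
 qed
 then have "translate (minv a) (mat 1) b \<in> id_component K" using assms(2) by blast
 then show ?thesis unfolding translate_def by simp
qed

lemma id_component_group: "closed_group (id_component K)"
proof (rule closed_group_subset[OF K id_component_subset one_id_component _ _ id_component_zclosed])
 show inv: "minv a \<in> id_component K" if "a \<in> id_component K" for a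
  using id_component_left_quotient[OF that one_id_component] by simp
 show "a ** b \<in> id_component K" if "a \<in> id_component K" "b \<in> id_component K" for a b
 proof -
  have "invertible a" using that(1) id_component_subset closed_groupD(3)[OF K] by blast
  then show ?thesis
   using id_component_left_quotient[OF inv[OF that(1)] that(2)] by (simp add: matrix_inv_involutive)
 qed
qed

lemma id_component_conj:
 assumes "\<And>k. k \<in> K \<Longrightarrow> x ** k ** minv x \<in> K" "invertible x" "k \<in> id_component K"
 shows "x ** k ** minv x \<in> id_component K"
proof -
 have "translate x (minv x) ` id_component K \<subseteq> id_component K"
 proof (rule id_component_translate)
  show "mat 1 \<in> translate x (minv x) ` id_component K"
   by (rule image_eqI[OF _ one_id_component]) (simp add: translate_def matrix_inv_cancel assms(2))
 qed (use assms(1) in \<open>simp add: translate_def\<close>)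
 then show ?thesis using assms(3) unfolding translate_def by blast
qed

text \<open>By quasi-compactness finitely many cosets of the identity component cover the
  group.\<close>

lemma id_component_growth:
 assumes "growth (id_component K) GL_coords e"
 shows "growth K GL_coords e"
proof -
 note K' = closed_groupD[OF K]
 obtain q where q: "q \<in> PF GL_coords" "q (mat 1) \<noteq> 0" "\<And>v. v \<in> K \<Longrightarrow> q v \<noteq> 0 \<Longrightarrow> v \<in> id_component K"
  by (rule id_component_neighbourhood[OF K]) (rule that)
 have Qv: "q (translate (minv v) (mat 1) v) \<noteq> 0" if "v \<in> K" for v
  using q(2) K'(3)[OF that] by (simp add: translate_def matrix_inv_cancel)
 obtain T where T: "finite T" "T \<subseteq> K" "\<And>v. v \<in> K \<Longrightarrow> \<exists>w\<in>T. q (translate (minv w) (mat 1) v) \<noteq> 0"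
  by (rule finite_open_cover[of GL_coords K "\<lambda>w v. q (translate (minv w) (mat 1) v)"])
   (rule finite_GL_coords, rule PF_translate[OF q(1)], rule Qv, assumption, rule that)
 have "growth (\<Union>w\<in>T. translate w (mat 1) ` id_component K) GL_coords e"
  by (rule growth_UN[OF T(1)]) (use T(2) K'(3) translate_growth[OF _ invertible_one assms] in blast)
 moreover have "K \<subseteq> (\<Union>w\<in>T. translate w (mat 1) ` id_component K)"
 proof
  fix v assume v: "v \<in> K"
  then obtain w where w: "w \<in> T" "q (translate (minv w) (mat 1) v) \<noteq> 0" using T(3) by blast
  have wK: "w \<in> K" "invertible w" using w(1) T(2) K'(3) by blast+
  have "translate (minv w) (mat 1) v \<in> K" using K'(2)[OF K'(4)[OF wK(1)] v] by (simp add: translate_def)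
  then have "translate (minv w) (mat 1) v \<in> id_component K" using q(3) w(2) by blast
  moreover have "v = translate w (mat 1) (translate (minv w) (mat 1) v)"
   using wK(2) by (simp add: translate_def matrix_inv_cancel)
  ultimately show "v \<in> (\<Union>w\<in>T. translate w (mat 1) ` id_component K)" using w(1) by blast
 qed
 ultimately show ?thesis by (rule growth_subset) simp
qed

lemma id_component_clopen: "zclosed GL_coords K (K - id_component K)"
proof -
 note K' = closed_groupD[OF K] and I' = closed_groupD[OF id_component_group]
 obtain q where q: "q \<in> PF GL_coords" "q (mat 1) \<noteq> 0" "\<And>v. v \<in> K \<Longrightarrow> q v \<noteq> 0 \<Longrightarrow> v \<in> id_component K"
  by (rule id_component_neighbourhood[OF K]) (rule that)
 show ?thesis
  unfolding zclosed_iff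
 proof (intro conjI ballI)
  fix v assume "v \<in> K - (K - id_component K)"
  then have v: "v \<in> K" "v \<in> id_component K" by auto
  show "\<exists>f\<in>PF GL_coords. f v \<noteq> 0 \<and> (\<forall>w\<in>K - id_component K. f w = 0)"
  proof (intro bexI[OF _ PF_translate[OF q(1), of "minv v" "mat 1"]] conjI ballI)
   show "q (translate (minv v) (mat 1) v) \<noteq> 0"
    using q(2) K'(3)[OF v(1)] by (simp add: translate_def matrix_inv_cancel)
   fix w assume w: "w \<in> K - id_component K"
   show "q (translate (minv v) (mat 1) w) = 0"
   proof (rule ccontr)
    assume "q (translate (minv v) (mat 1) w) \<noteq> 0"
    moreover have "minv v ** w \<in> K" using K'(2,4) v(1) w by blast
    ultimately have "minv v ** w \<in> id_component K" using q(3) by (simp add: translate_def)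
    then have "v ** (minv v ** w) \<in> id_component K" using I'(2) v(2) by blast
    then show False using w K'(3)[OF v(1)] by (simp add: matrix_inv_cancel)
   qed
  qed
 qed blast
qed

text \<open>The identity component is open and closed, so a connected group coincides with it.
  Conversely an irreducible set is no union of two disjoint nonempty closed subsets.\<close>

lemma connected_iff_irreducible: "connectedin matrix_zariski K \<longleftrightarrow> irreducible_on GL_coords K"
proof -
 have inv: "K \<subseteq> Collect invertible" using closed_groupD(3)[OF K] by blast
 have top: "topspace (matrix_zariski :: ('k ^ 'n ^ 'n) topology) = UNIV" unfolding matrix_zariski_def topspace_zariski ..
 have "connectedin matrix_zariski K \<longleftrightarrow> \<not> (\<exists>E1 E2. zclosed GL_coords K E1 \<and> zclosed GL_coords K E2 \<and>
  K \<subseteq> E1 \<union> E2 \<and> E1 \<inter> E2 = {} \<and> E1 \<noteq> {} \<and> E2 \<noteq> {})" (is "_ \<longleftrightarrow> \<not> ?split")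
  unfolding connectedin_def connected_space_closedin closedin_matrix_zariski[OF inv] by (simp add: top)
 also have "\<dots> \<longleftrightarrow> irreducible_on GL_coords K"
 proof
  assume no: "\<not> ?split"
  have "K - id_component K = {}"
  proof (rule ccontr)
   assume "K - id_component K \<noteq> {}"
   with no show False
    using id_component_zclosed id_component_clopen one_id_component
    by (elim notE, intro exI[of _ "id_component K"] exI[of _ "K - id_component K"]) blast
  qed
  then have "K = id_component K" using id_component_subset by blast
  then show "irreducible_on GL_coords K" using id_component_irreducible by simp
 next
  assume irr: "irreducible_on GL_coords K"
  show "\<not> ?split"
  proof
   assume ?split
   then obtain E1 E2 where E: "zclosed GL_coords K E1" "zclosed GL_coords K E2" "K \<subseteq> E1 \<union> E2" "E1 \<inter> E2 = {}" "E1 \<noteq> {}" "E2 \<noteq> {}"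
    by (elim exE conjE)
   have "\<exists>D\<in>{E1, E2}. K \<subseteq> D"
    by (rule irreducible_on_subset_Union[OF irr _ _ subset_refl]) (use E in auto)
   then show False using E zclosed_subset[OF E(1)] zclosed_subset[OF E(2)] by blast
  qed
 qed
 finally show ?thesis .
qed

end

lemma irreducible_dimension_eq:
 fixes Z Z' :: "('k::alg_closed_field ^ 'n ^ 'n) set"
 assumes "irreducible_on GL_coords Z" "irreducible_on GL_coords Z'" "zclosed GL_coords Z' Z"
  "growth Z' GL_coords d" "\<And>e. e < d \<Longrightarrow> \<not> growth Z GL_coords e"
 shows "Z = Z'"
proof (rule ccontr)
 assume "Z \<noteq> Z'"
 then obtain v where v: "v \<in> Z'" "v \<notin> Z" using zclosed_subset[OF assms(3)] by blast
 obtain f where f: "f \<in> PF GL_coords" "f v \<noteq> 0" "\<forall>w\<in>Z. f w = 0"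
  using zclosed_separate[OF assms(3) v] by auto
 have "\<exists>v\<in>Z'. f v \<noteq> 0" using f(2) v(1) by (rule bexI)
 from growth_proper_subset[OF finite_GL_coords assms(1,2) zclosed_subset[OF assms(3)] f(1,3) this assms(4)]
 obtain e where "Suc e \<le> d" "growth Z GL_coords e" by (elim exE conjE)
 then show False using assms(5)[of e] by simp
qed

lemma zclosed_singleton:
 fixes a :: "'k::field ^ 'n ^ 'n"
 assumes "a \<in> S"
 shows "zclosed GL_coords S {a}"
proof (rule zclosedI)
 show "(\<lambda>(i, j) A. A $ i $ j - a $ i $ j) ` UNIV \<subseteq> PF GL_coords"
  using matrix_PF_GL unfolding matrix_PF_def by (auto intro!: PF_diff PF_const)
 show "{a} = {v \<in> S. \<forall>f\<in>(\<lambda>(i, j) A. A $ i $ j - a $ i $ j) ` UNIV. f v = 0}"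
  using assms by (auto simp: vec_eq_iff)
qed

lemma irreducible_growth_zero:
 fixes U :: "('k::alg_closed_field ^ 'n ^ 'n) set"
 assumes "irreducible_on GL_coords U" "a \<in> U" "growth U GL_coords 0"
 shows "U = {a}"
proof -
 have "irreducible_on GL_coords {a}" unfolding irreducible_on_def by auto
 then have "{a} = U" by (rule irreducible_dimension_eq[OF _ assms(1) zclosed_singleton[OF assms(2)] assms(3)]) simp
 then show ?thesis ..
qed

lemma id_component_subset_full_dimension:
 fixes K L :: "('k::alg_closed_field ^ 'n ^ 'n) set"
 assumes K: "closed_group K" and L: "closed_group L" "L \<subseteq> K"
  and "growth K GL_coords d" "\<And>e. e < d \<Longrightarrow> \<not> growth L GL_coords e"
 shows "id_component K \<subseteq> L"
proof -
 have "id_component L = id_component K"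
 proof (rule irreducible_dimension_eq[OF id_component_irreducible[OF L(1)] id_component_irreducible[OF K]])
  have sub: "id_component L \<subseteq> id_component K" by (rule id_component_mono[OF L(2)])
  have "zclosed GL_coords (Collect invertible) (id_component L)"
   by (rule closed_group_GL_coords[OF id_component_group[OF L(1)]])
  then show "zclosed GL_coords (id_component K) (id_component L)"
   by (rule zclosed_superset[OF _ sub])
    (use closed_groupD(3)[OF K] id_component_subset[of K] in blast)
  show "growth (id_component K) GL_coords d"
   by (rule growth_subset[OF assms(4) id_component_subset]) simp
  show "\<not> growth (id_component L) GL_coords e" if "e < d" for e
   using id_component_growth[OF L(1)] assms(5)[OF that] by blast
 qed
 then show ?thesis using id_component_subset[of L] by simp
qed

section \<open>Closures of groups of matrices\<close>

definition zclosure :: "('k::field ^ 'n ^ 'n) set \<Rightarrow> ('k ^ 'n ^ 'n) set \<Rightarrow> ('k ^ 'n ^ 'n) set" where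
 "zclosure K A = {v \<in> K. \<forall>f\<in>PF GL_coords. (\<forall>a\<in>A. f a = 0) \<longrightarrow> f v = 0}"

lemma zclosed_zclosure: "zclosed GL_coords K (zclosure K A)"
 by (rule zclosedI[of "{f \<in> PF GL_coords. \<forall>a\<in>A. f a = 0}"]) (auto simp: zclosure_def)

lemma subset_zclosure: "A \<subseteq> K \<Longrightarrow> A \<subseteq> zclosure K A"
 unfolding zclosure_def by blast

lemma zclosureD: "v \<in> zclosure K A \<Longrightarrow> f \<in> PF GL_coords \<Longrightarrow> (\<And>a. a \<in> A \<Longrightarrow> f a = 0) \<Longrightarrow> f v = 0"
 unfolding zclosure_def by blast

lemma zclosure_map:
 assumes "v \<in> zclosure K A" "\<And>f. f \<in> PF GL_coords \<Longrightarrow> (\<lambda>v. f (\<psi> v)) \<in> PF GL_coords"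
  "\<psi> v \<in> K" "\<And>a. a \<in> A \<Longrightarrow> \<psi> a \<in> zclosure K A"
 shows "\<psi> v \<in> zclosure K A"
 unfolding zclosure_def
proof (intro CollectI conjI ballI impI)
 fix f assume f: "f \<in> PF GL_coords" "\<forall>a\<in>A. f a = 0"
 show "f (\<psi> v) = 0"
  by (rule zclosureD[OF assms(1) assms(2)[OF f(1)]]) (rule zclosureD[OF assms(4) f(1)], assumption, use f(2) in blast)
qed (rule assms(3))

text \<open>Left translations by elements of \<open>A\<close> preserve \<open>A\<close>, hence its
  closure. So right translation by an element of the closure maps \<open>A\<close> into the closure,
  and by continuity also the closure of \<open>A\<close>.\<close>

lemma zclosure_group:
 fixes K A :: "('k::field ^ 'n ^ 'n) set"
 assumes K: "closed_group K" and A: "A \<subseteq> K" "mat 1 \<in> A" "\<And>a b. a \<in> A \<Longrightarrow> b \<in> A \<Longrightarrow> a ** b \<in> A"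
  "\<And>a. a \<in> A \<Longrightarrow> minv a \<in> A"
 shows "closed_group (zclosure K A)"
proof -
 note K' = closed_groupD[OF K]
 have sub: "zclosure K A \<subseteq> K" unfolding zclosure_def by blast
 have AC: "A \<subseteq> zclosure K A" by (rule subset_zclosure[OF A(1)])
 have left: "a ** b \<in> zclosure K A" if a: "a \<in> A" and b: "b \<in> zclosure K A" for a b
 proof -
  have "translate a (mat 1) b \<in> zclosure K A"
  proof (rule zclosure_map[OF b PF_translate])
   show "translate a (mat 1) b \<in> K" using K'(2)[of a b] a b A(1) sub by (auto simp: translate_def)
   show "translate a (mat 1) x \<in> zclosure K A" if "x \<in> A" for x
    using A(3)[OF a that] AC by (auto simp: translate_def)
  qed
  then show ?thesis by (simp add: translate_def)
 qed
 have mult: "a ** b \<in> zclosure K A" if a: "a \<in> zclosure K A" and b: "b \<in> zclosure K A" for a b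
 proof -
  have "translate (mat 1) b a \<in> zclosure K A"
  proof (rule zclosure_map[OF a PF_translate])
   show "translate (mat 1) b a \<in> K" using K'(2)[of a b] a b sub by (auto simp: translate_def)
   show "translate (mat 1) b x \<in> zclosure K A" if "x \<in> A" for x
    using left[OF that b] by (simp add: translate_def)
  qed
  then show ?thesis by (simp add: translate_def)
 qed
 have inv: "minv a \<in> zclosure K A" if a: "a \<in> zclosure K A" for a
 proof -
  have cr: "cramer_inverse x = minv x" if "x \<in> K" for x by (rule cramer_inverse[OF K'(3)[OF that]])
  have "cramer_inverse a \<in> zclosure K A"
  proof (rule zclosure_map[OF a])
   show "(\<lambda>v. f (cramer_inverse v)) \<in> PF GL_coords" if "f \<in> PF GL_coords" for f :: "'k ^ 'n ^ 'n \<Rightarrow> 'k"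
    by (rule GL_coords_PF[OF matrix_PF_GL_inverse _ that])
     (unfold inverse_det_cramer, rule matrix_PF_det[OF matrix_PF_GL])
   show "cramer_inverse a \<in> K" using a sub K'(4) cr by auto
   show "cramer_inverse x \<in> zclosure K A" if x: "x \<in> A" for x
   proof -
    have "x \<in> K" using x A(1) by blast
    then show ?thesis using A(4)[OF x] AC cr by auto
   qed
  qed
  then show ?thesis using a sub cr by auto
 qed
 show ?thesis
  by (rule closed_group_subset[OF K sub _ mult inv zclosed_zclosure]) (use A(2) AC in blast)
qed

lemma matrix_PF_mpow: "matrix_PF X A \<Longrightarrow> matrix_PF X (\<lambda>w. mpow (A w) m)"
 by (induction m) (auto intro: matrix_PF_const matrix_PF_mult)

text \<open>The exponent \<open>CARD('n)\<close> serves all of \<open>A\<close>, so these equations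
  pass to the closure.\<close>

lemma zclosure_unipotent:
 fixes A :: "('k::field ^ 'n ^ 'n) set"
 assumes "\<And>a. a \<in> A \<Longrightarrow> unipotent a" "v \<in> zclosure K A"
 shows "unipotent v"
proof -
 have "matrix_PF GL_coords (\<lambda>v. v - mat 1 :: 'k ^ 'n ^ 'n)"
  using matrix_PF_GL unfolding matrix_PF_def by (auto intro!: PF_diff PF_const)
 then have PFm: "matrix_PF GL_coords (\<lambda>v. mpow (v - mat 1 :: 'k ^ 'n ^ 'n) CARD('n))" by (rule matrix_PF_mpow)
 have "mpow (v - mat 1) CARD('n) $ i $ j = 0" for i j
 proof (rule zclosureD[OF assms(2)])
  show "(\<lambda>v. mpow (v - mat 1 :: 'k ^ 'n ^ 'n) CARD('n) $ i $ j) \<in> PF GL_coords"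
   using PFm unfolding matrix_PF_def by blast
  fix a assume "a \<in> A"
  then obtain m where "mpow (a - mat 1) m = 0" using assms(1) unfolding unipotent_def by blast
  then show "mpow (a - mat 1) CARD('n) $ i $ j = 0" by (simp add: nilpotent_index)
 qed
 then have "mpow (v - mat 1) CARD('n) = 0" by (simp add: vec_eq_iff)
 then show ?thesis unfolding unipotent_def by blast
qed

text \<open>Irreducibility stands for connectedness, by
  \<open>connected_iff_irreducible\<close>.\<close>

definition normal_unipotent :: "('k::field ^ 'n ^ 'n) set \<Rightarrow> ('k ^ 'n ^ 'n) set \<Rightarrow> bool" where
 "normal_unipotent K U \<longleftrightarrow> closed_group U \<and> U \<subseteq> K \<and>
  (\<forall>x\<in>K. \<forall>u\<in>U. x ** u ** minv x \<in> U) \<and> irreducible_on GL_coords U \<and> (\<forall>u\<in>U. unipotent u)"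

lemma normal_unipotentD:
 assumes "normal_unipotent K U"
 shows "closed_group U" "U \<subseteq> K" "x \<in> K \<Longrightarrow> u \<in> U \<Longrightarrow> x ** u ** minv x \<in> U"
  "irreducible_on GL_coords U" "u \<in> U \<Longrightarrow> unipotent u" "mat 1 \<in> U"
 using assms closed_groupD(1) unfolding normal_unipotent_def by blast+

lemma normal_unipotent_component:
 fixes K C :: "('k::alg_closed_field ^ 'n ^ 'n) set"
 assumes "closed_group K" "closed_group C" "C \<subseteq> K"
  "\<And>x u. x \<in> K \<Longrightarrow> u \<in> C \<Longrightarrow> x ** u ** minv x \<in> C" "\<And>u. u \<in> C \<Longrightarrow> unipotent u"
 shows "normal_unipotent K (id_component C)"
 unfolding normal_unipotent_def
proof (intro conjI ballI)
 show "closed_group (id_component C)" by (rule id_component_group[OF assms(2)])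
 show "id_component C \<subseteq> K" using id_component_subset assms(3) by blast
 show "irreducible_on GL_coords (id_component C)" by (rule id_component_irreducible[OF assms(2)])
 show "unipotent u" if "u \<in> id_component C" for u
  using that id_component_subset assms(5) by blast
 show "x ** u ** minv x \<in> id_component C" if "x \<in> K" "u \<in> id_component C" for x u
  by (rule id_component_conj[OF assms(2)]) (use assms(4) that closed_groupD(3)[OF assms(1)] in blast)+
qed

text \<open>The product set of \<open>U\<close> and \<open>V\<close> is a group because
  \<open>U\<close> is normal, and it is unipotent by \<open>unipotent_mult\<close>. \<open>W\<close>
  is the identity component of its closure; it contains \<open>U\<close> and \<open>V\<close> since
  these are irreducible and pass through the identity.\<close>

lemma normal_unipotent_join:
 fixes K U V :: "('k::alg_closed_field ^ 'n ^ 'n) set"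
 assumes K: "closed_group K" and U: "normal_unipotent K U" and V: "normal_unipotent K V"
 obtains W where "normal_unipotent K W" "U \<subseteq> W" "V \<subseteq> W"
proof -
 note K' = closed_groupD[OF K]
 note U1 = normal_unipotentD[OF U] and V1 = normal_unipotentD[OF V]
 note U2 = closed_groupD[OF U1(1)] and V2 = closed_groupD[OF V1(1)]
 have U3: "minv x ** u ** x \<in> U" if "x \<in> K" "u \<in> U" for x u
  using U1(3)[OF K'(4)[OF that(1)] that(2)] K'(3)[OF that(1)] by (simp add: matrix_inv_involutive)
 define A where "A = {u ** v | u v. u \<in> U \<and> v \<in> V}"
 have UA: "U \<subseteq> A"
 proof
  fix u assume "u \<in> U"
  then show "u \<in> A" unfolding A_def using V2(1) by (intro CollectI exI[of _ u] exI[of _ "mat 1"]) simp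
 qed
 have VA: "V \<subseteq> A"
 proof
  fix v assume "v \<in> V"
  then show "v \<in> A" unfolding A_def using U2(1) by (intro CollectI exI[of _ "mat 1"] exI[of _ v]) simp
 qed
 have AK: "A \<subseteq> K" unfolding A_def using U1(2) V1(2) K'(2) by blast
 have A1: "mat 1 \<in> A" using UA U2(1) by blast
 have Am: "a ** b \<in> A" if ab: "a \<in> A" "b \<in> A" for a b
 proof -
  obtain u v u' v' where *: "a = u ** v" "b = u' ** v'" "u \<in> U" "v \<in> V" "u' \<in> U" "v' \<in> V"
   using ab unfolding A_def by blast
  have "v \<in> K" using *(4) V1(2) by blast
  have "a ** b = (u ** (v ** u' ** minv v)) ** (v ** v')"
   unfolding *(1,2) using V2(3)[OF *(4)] by (simp add: matrix_inv_simps)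
  moreover have "u ** (v ** u' ** minv v) \<in> U" using U2(2) U1(3) *(3,5) \<open>v \<in> K\<close> by blast
  moreover have "v ** v' \<in> V" using V2(2) * by blast
  ultimately show ?thesis unfolding A_def by blast
 qed
 have Ai: "minv a \<in> A" if a: "a \<in> A" for a
 proof -
  obtain u v where *: "a = u ** v" "u \<in> U" "v \<in> V" using a unfolding A_def by blast
  have "v \<in> K" using *(3) V1(2) by blast
  have "minv a = (minv v ** minv u ** v) ** minv v"
   unfolding *(1) using V2(3)[OF *(3)] U2(3)[OF *(2)]
   by (simp add: matrix_inv_mult matrix_inv_simps)
  moreover have "minv v ** minv u ** v \<in> U" using U3[OF \<open>v \<in> K\<close> U2(4)[OF *(2)]] .
  ultimately show ?thesis unfolding A_def using V2(4)[OF *(3)] by blast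
 qed
 have Ac: "x ** a ** minv x \<in> A" if x: "x \<in> K" and a: "a \<in> A" for x a
 proof -
  obtain u v where *: "a = u ** v" "u \<in> U" "v \<in> V" using a unfolding A_def by blast
  have "x ** a ** minv x = (x ** u ** minv x) ** (x ** v ** minv x)"
   unfolding *(1) using K'(3)[OF x] by (simp add: matrix_inv_simps)
  then show ?thesis unfolding A_def using U1(3)[OF x *(2)] V1(3)[OF x *(3)] by blast
 qed
 have Au: "unipotent a" if a: "a \<in> A" for a
 proof -
  obtain u v where *: "a = u ** v" "u \<in> U" "v \<in> V" using a unfolding A_def by blast
  have "v \<in> K" using *(3) V1(2) by blast
  obtain m where m: "mpow (v - mat 1) m = 0" using V1(5)[OF *(3)] unfolding unipotent_def by blast
  show ?thesis unfolding unipotent_def *(1)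
  proof (rule unipotent_mult[where U = U, OF _ _ _ *(2) m])
   show "a ** b \<in> U" if "a \<in> U" "b \<in> U" for a b by (rule U2(2)[OF that])
   show "\<exists>m. mpow (w - mat 1) m = 0" if "w \<in> U" for w using U1(5)[OF that] unfolding unipotent_def .
   show "\<exists>u'\<in>U. w ** v = v ** u'" if "w \<in> U" for w
    by (rule bexI[OF _ U3[OF \<open>v \<in> K\<close> that]])
     (use V2(3)[OF *(3)] in \<open>simp add: matrix_inv_simps\<close>)
  qed
 qed
 define C where "C = zclosure K A"
 have C: "closed_group C" unfolding C_def by (rule zclosure_group[OF K AK A1 Am Ai])
 have AC: "A \<subseteq> C" unfolding C_def by (rule subset_zclosure[OF AK])
 have CK: "C \<subseteq> K" unfolding C_def zclosure_def by blast
 have "normal_unipotent K (id_component C)"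
 proof (rule normal_unipotent_component[OF K C CK])
  show "unipotent u" if "u \<in> C" for u by (rule zclosure_unipotent[OF Au that[unfolded C_def]])
  show "x ** u ** minv x \<in> C" if x: "x \<in> K" and u: "u \<in> C" for x u
  proof -
   have "translate x (minv x) u \<in> C" unfolding C_def
   proof (rule zclosure_map[OF u[unfolded C_def] PF_translate])
    show "translate x (minv x) u \<in> K"
     unfolding translate_def using K'(2,4) x u CK by blast
    show "translate x (minv x) a \<in> zclosure K A" if "a \<in> A" for a
     using Ac[OF x that] AC unfolding C_def translate_def by blast
   qed
   then show ?thesis unfolding translate_def .
  qed
 qed
 moreover have "U \<subseteq> id_component C"
  by (rule id_component_largest[OF _ U1(4) U2(1)]) (use UA AC in blast)
 moreover have "V \<subseteq> id_component C"
  by (rule id_component_largest[OF _ V1(4) V2(1)]) (use VA AC in blast)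
 ultimately show ?thesis by (rule that)
qed

lemma unipotent_one: "unipotent (mat 1)"
 unfolding unipotent_def by (intro exI[of _ 1]) simp

lemma normal_unipotent_one:
 fixes K :: "('k::alg_closed_field ^ 'n ^ 'n) set"
 assumes K: "closed_group K"
 shows "normal_unipotent K {mat 1}"
 unfolding normal_unipotent_def
proof (intro conjI ballI)
 show "closed_group {mat 1 :: 'k ^ 'n ^ 'n}"
  by (rule closed_groupI) (auto simp: invertible_one matrix_inv_one intro: zclosed_singleton)
 show "{mat 1} \<subseteq> K" using closed_groupD(1)[OF K] by blast
 show "irreducible_on GL_coords {mat 1 :: 'k ^ 'n ^ 'n}" unfolding irreducible_on_def by auto
 show "unipotent u" if "u \<in> {mat 1}" for u :: "'k ^ 'n ^ 'n" using that unipotent_one by simp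
 show "x ** u ** minv x \<in> {mat 1}" if "x \<in> K" "u \<in> {mat 1}" for x u
  using that closed_groupD(3)[OF K that(1)] by (simp add: matrix_inv_cancel)
qed

text \<open>A member of maximal dimension is the greatest one, since any two have a common upper bound.\<close>

lemma greatest_normal_unipotent:
 fixes K :: "('k::alg_closed_field ^ 'n ^ 'n) set"
 assumes K: "closed_group K"
 obtains R where "normal_unipotent K R" "\<And>U. normal_unipotent K U \<Longrightarrow> U \<subseteq> R"
proof -
 define d where "d U = (LEAST e. growth U GL_coords e)" for U :: "('k ^ 'n ^ 'n) set"
 have bound: "growth U GL_coords (card (GL_coords :: ('k ^ 'n ^ 'n \<Rightarrow> 'k) set))" for U :: "('k ^ 'n ^ 'n) set"
  using growth_base[OF finite_GL_coords, of U "\<lambda>x. x"] by simp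
 have d: "growth U GL_coords (d U)" for U unfolding d_def by (rule LeastI[of "growth U GL_coords", OF bound])
 have dle: "d U \<le> e" if "growth U GL_coords e" for U e unfolding d_def by (rule Least_le) (rule that)
 have "\<exists>R. normal_unipotent K R \<and> (\<forall>U. normal_unipotent K U \<longrightarrow> d U \<le> d R)"
  by (rule ex_has_greatest_nat[of "normal_unipotent K" "{mat 1}" d "Suc (card (GL_coords :: ('k ^ 'n ^ 'n \<Rightarrow> 'k) set))"])
   (use normal_unipotent_one[OF K] dle[OF bound] in \<open>auto simp: less_Suc_eq_le\<close>)
 then obtain R where R: "normal_unipotent K R" "\<forall>U. normal_unipotent K U \<longrightarrow> d U \<le> d R" by blast
 have "U \<subseteq> R" if U: "normal_unipotent K U" for U
 proof -
  obtain W where W: "normal_unipotent K W" "R \<subseteq> W" "U \<subseteq> W"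
   by (rule normal_unipotent_join[OF K R(1) U]) (rule that)
  have "R = W"
  proof (rule irreducible_dimension_eq)
   show "irreducible_on GL_coords R" "irreducible_on GL_coords W" using R(1) W(1) unfolding normal_unipotent_def by blast+
   have "closed_group R" "closed_group W" using R(1) W(1) unfolding normal_unipotent_def by blast+
   then show "zclosed GL_coords W R"
    using zclosed_superset[OF closed_group_GL_coords W(2)] closed_groupD(3) by blast
   show "growth W GL_coords (d W)" by (rule d)
   show "\<not> growth R GL_coords e" if e: "e < d W" for e
    using dle[of R e] R(2) W(1) e by (meson leD le_trans)
  qed
  then show ?thesis using W(3) by simp
 qed
 with R(1) show ?thesis by (rule that)
qed

section \<open>Comparison with the definitions of algebraic and reductive groups\<close>

lemma inv_in_GL:
 fixes K :: "('k::field ^ 'n ^ 'n) set"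
 assumes "K \<subseteq> Collect invertible" "x \<in> K" "minv x \<in> K"
 shows "inv\<^bsub>GL\<lparr>carrier := K\<rparr>\<^esub> x = minv x"
proof -
 have x: "invertible x" using assms by blast
 show ?thesis
  unfolding m_inv_def
 proof (rule the_equality)
  show "minv x \<in> carrier (GL\<lparr>carrier := K\<rparr>) \<and> x \<otimes>\<^bsub>GL\<lparr>carrier := K\<rparr>\<^esub> minv x = \<one>\<^bsub>GL\<lparr>carrier := K\<rparr>\<^esub> \<and>
   minv x \<otimes>\<^bsub>GL\<lparr>carrier := K\<rparr>\<^esub> x = \<one>\<^bsub>GL\<lparr>carrier := K\<rparr>\<^esub>"
   using assms(3) x by (simp add: GL_def matrix_inv_cancel)
  fix y assume "y \<in> carrier (GL\<lparr>carrier := K\<rparr>) \<and> x \<otimes>\<^bsub>GL\<lparr>carrier := K\<rparr>\<^esub> y = \<one>\<^bsub>GL\<lparr>carrier := K\<rparr>\<^esub> \<and>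
   y \<otimes>\<^bsub>GL\<lparr>carrier := K\<rparr>\<^esub> x = \<one>\<^bsub>GL\<lparr>carrier := K\<rparr>\<^esub>"
  then have "x ** y = mat 1" by (simp add: GL_def)
  then show "y = minv x" by (simp add: matrix_inv_unique')
 qed
qed

lemma closed_subgroup_iff:
 fixes K :: "('k::field ^ 'n ^ 'n) set"
 assumes K: "closed_group K"
 shows "closed_subgroup K L \<longleftrightarrow> L \<subseteq> K \<and> closed_group L"
proof -
 note K' = closed_groupD[OF K]
 have inv: "K \<subseteq> Collect invertible" using K'(3) by blast
 have inv_eq: "inv\<^bsub>GL\<lparr>carrier := K\<rparr>\<^esub> a = minv a" if "a \<in> K" for a
  by (rule inv_in_GL[OF inv that]) (rule K'(4)[OF that])
 have sub: "subgroup L (GL\<lparr>carrier := K\<rparr>) \<longleftrightarrow> L \<subseteq> K \<and> mat 1 \<in> L \<and> (\<forall>a\<in>L. \<forall>b\<in>L. a ** b \<in> L) \<and> (\<forall>a\<in>L. minv a \<in> L)"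
  (is "_ \<longleftrightarrow> ?group")
 proof
  assume L: "subgroup L (GL\<lparr>carrier := K\<rparr>)"
  then have LK: "L \<subseteq> K" using subgroup.subset by fastforce
  have "minv a \<in> L" if a: "a \<in> L" for a
   using subgroup.m_inv_closed[OF L a] inv_eq[OF subsetD[OF LK a]] by simp
  then show ?group
   using subgroup.one_closed[OF L] subgroup.m_closed[OF L] LK by (simp add: GL_def)
 next
  assume L: ?group
  show "subgroup L (GL\<lparr>carrier := K\<rparr>)"
  proof
   show "inv\<^bsub>GL\<lparr>carrier := K\<rparr>\<^esub> x \<in> L" if "x \<in> L" for x using L that inv_eq[of x] by auto
  qed (use L in \<open>auto simp: GL_def\<close>)
 qed
 show ?thesis
  unfolding closed_subgroup_def sub closedin_matrix_zariski[OF inv]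
 proof
  assume *: "?group \<and> zclosed GL_coords K L"
  have "closed_group L" by (rule closed_group_subset[OF K]) (use * in auto)
  then show "L \<subseteq> K \<and> closed_group L" using * by simp
 next
  assume *: "L \<subseteq> K \<and> closed_group L"
  then have "zclosed GL_coords K L"
   by (intro zclosed_superset[OF closed_group_GL_coords[of L] _ inv]) blast+
  then show "?group \<and> zclosed GL_coords K L"
   using * closed_groupD[of L] by blast
 qed
qed

lemma GL_closed: "closed_group (Collect invertible :: ('k::field ^ 'n ^ 'n) set)"
 by (rule closed_groupI) (auto simp: invertible_one invertible_matrix_inv intro: invertible_mult zclosed_refl)

lemma linear_algebraic_group_iff: "linear_algebraic_group K \<longleftrightarrow> closed_group K"
proof -
 have "carrier GL = (Collect invertible :: ('k::field ^ 'n ^ 'n) set)" by (simp add: GL_def)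
 then show ?thesis
  unfolding linear_algebraic_group_def using closed_subgroup_iff[OF GL_closed, of K] closed_groupD(3)[of K] by auto
qed

lemma group_of_closed_matrix_group:
 fixes K :: "('k::field ^ 'n ^ 'n) set"
 assumes "closed_group K"
 shows "group (GL\<lparr>carrier := K\<rparr>)"
proof -
 have "closed_subgroup (carrier GL) K" using assms linear_algebraic_group_iff linear_algebraic_group_def by blast
 then have "subgroup K (GL\<lparr>carrier := carrier GL\<rparr>)" unfolding closed_subgroup_def by blast
 then have "subgroup K GL" by simp
 then show ?thesis by (rule group.subgroup_imp_group[OF group_GL])
qed

lemma normal_unipotent_iff:
 fixes K :: "('k::alg_closed_field ^ 'n ^ 'n) set"
 assumes K: "closed_group K"
 shows "closed_subgroup K U \<and> U \<lhd> GL\<lparr>carrier := K\<rparr> \<and> connectedin matrix_zariski U \<and> (\<forall>u\<in>U. unipotent u) \<longleftrightarrow>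
  normal_unipotent K U"
proof -
 have inv: "K \<subseteq> Collect invertible" using closed_groupD(3)[OF K] by blast
 interpret group "GL\<lparr>carrier := K\<rparr>" by (rule group_of_closed_matrix_group[OF K])
 have "U \<lhd> GL\<lparr>carrier := K\<rparr> \<longleftrightarrow> (\<forall>x\<in>K. \<forall>u\<in>U. x ** u ** minv x \<in> U)" if U: "closed_subgroup K U"
 proof -
  have "subgroup U (GL\<lparr>carrier := K\<rparr>)" using U unfolding closed_subgroup_def by blast
  then have "U \<lhd> GL\<lparr>carrier := K\<rparr> \<longleftrightarrow>
   (\<forall>x\<in>K. \<forall>u\<in>U. x ** u ** inv\<^bsub>GL\<lparr>carrier := K\<rparr>\<^esub> x \<in> U)"
   unfolding normal_inv_iff by (simp add: GL_def)
  then show ?thesis using inv_in_GL[OF inv] closed_groupD(4)[OF K] by simp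
 qed
 then show ?thesis
  unfolding normal_unipotent_def using closed_subgroup_iff[OF K, of U] connected_iff_irreducible[of U] by blast
qed

text \<open>\<open>GREATEST\<close> in \<open>unipotent_radical\<close> denotes an actual greatest
  element, by \<open>greatest_normal_unipotent\<close>.\<close>

lemma reductive_group_iff:
 fixes K :: "('k::alg_closed_field ^ 'n ^ 'n) set"
 shows "reductive_group K \<longleftrightarrow> closed_group K \<and> (\<forall>U. normal_unipotent K U \<longrightarrow> U = {mat 1})"
proof (cases "closed_group K")
 case True
 obtain R where R: "normal_unipotent K R" "\<And>U. normal_unipotent K U \<Longrightarrow> U \<subseteq> R"
  by (rule greatest_normal_unipotent[OF True]) (rule that)
 have rad: "unipotent_radical K = R"
  unfolding unipotent_radical_def normal_unipotent_iff[OF True]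
  by (rule Greatest_equality) (rule R(1), rule R(2))
 have "R = {mat 1} \<longleftrightarrow> (\<forall>U. normal_unipotent K U \<longrightarrow> U = {mat 1})"
 proof
  assume R1: "R = {mat 1}"
  show "\<forall>U. normal_unipotent K U \<longrightarrow> U = {mat 1}"
  proof (intro allI impI)
   fix U assume U: "normal_unipotent K U"
   then have "mat 1 \<in> U" using closed_groupD(1) unfolding normal_unipotent_def by blast
   then show "U = {mat 1}" using R(2)[OF U] R1 by blast
  qed
 qed (use R(1) in blast)
 then show ?thesis unfolding reductive_group_def rad linear_algebraic_group_iff using True by simp
next
 case False
 then show ?thesis unfolding reductive_group_def linear_algebraic_group_iff by simp
qed

section \<open>Non-reductivity via parabolic subgroups\<close>

text \<open>The unipotent radical of \<open>parabolic c\<close>: the matrices acting trivially on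
  the quotients of its flag.\<close>

definition unipotent_block :: "('n \<Rightarrow> nat) \<Rightarrow> ('k::field ^ 'n ^ 'n) set" where
 "unipotent_block c = {p. \<forall>i j. (p - mat 1) $ i $ j \<noteq> 0 \<longrightarrow> c i < c j}"

lemma matrix_mult_nonzero:
 fixes A :: "'k::field ^ 'm ^ 'l" and B :: "'k ^ 'n ^ 'm"
 assumes "(A ** B) $ i $ j \<noteq> 0"
 shows "\<exists>k. A $ i $ k \<noteq> 0 \<and> B $ k $ j \<noteq> 0"
proof (rule ccontr)
 assume "\<not> ?thesis"
 then have "A $ i $ k * B $ k $ j = 0" for k by auto
 then have "(\<Sum>k\<in>UNIV. A $ i $ k * B $ k $ j) = 0" by (intro sum.neutral ballI)
 then show False using assms by (simp only: matrix_matrix_mult_def vec_lambda_beta simp_thms)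
qed

lemma strict_mult_left:
 fixes p x :: "'k::field ^ 'n ^ 'n"
 assumes "\<And>i j. p $ i $ j \<noteq> 0 \<Longrightarrow> c i \<le> c j" "\<And>i j. x $ i $ j \<noteq> 0 \<Longrightarrow> c i < (c j :: nat)" "(p ** x) $ i $ j \<noteq> 0"
 shows "c i < c j"
 using matrix_mult_nonzero[OF assms(3)] assms(1,2) le_less_trans by blast

lemma strict_mult_right:
 fixes p x :: "'k::field ^ 'n ^ 'n"
 assumes "\<And>i j. p $ i $ j \<noteq> 0 \<Longrightarrow> c i \<le> c j" "\<And>i j. x $ i $ j \<noteq> 0 \<Longrightarrow> c i < (c j :: nat)" "(x ** p) $ i $ j \<noteq> 0"
 shows "c i < c j"
 using matrix_mult_nonzero[OF assms(3)] assms(1,2) less_le_trans by blast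

lemma parabolic_inv: "p \<in> parabolic c \<Longrightarrow> minv p \<in> parabolic (c :: 'n \<Rightarrow> nat)" for p :: "'k::field ^ 'n ^ 'n"
 by (rule parabolic_left_inverse, assumption) (simp add: parabolic_def matrix_inv_cancel)

lemma zclosed_vanishing_entries:
 "zclosed GL_coords S {p \<in> S. \<forall>(i, j)\<in>E. (p :: 'k::field ^ 'n ^ 'n) $ i $ j = a $ i $ j}"
proof (rule zclosedI)
 show "(\<lambda>(i, j) p. p $ i $ j - a $ i $ j) ` E \<subseteq> PF GL_coords"
  using matrix_PF_GL unfolding matrix_PF_def by (auto intro!: PF_diff PF_const)
qed auto

lemma parabolic_group: "closed_group (parabolic c :: ('k::field ^ 'n ^ 'n) set)"
proof (rule closed_groupI)
 have "parabolic c = {p \<in> Collect invertible. \<forall>(i, j)\<in>{(i, j). \<not> c i \<le> c j}. (p :: 'k ^ 'n ^ 'n) $ i $ j = (0 :: 'k ^ 'n ^ 'n) $ i $ j}"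
  unfolding parabolic_def by auto
 then show "zclosed GL_coords (Collect invertible) (parabolic c :: ('k ^ 'n ^ 'n) set)"
  by (rule ssubst) (rule zclosed_vanishing_entries)
qed (auto simp: one_parabolic intro: parabolic_mult parabolic_inv, simp add: parabolic_def)

lemma unipotent_block_mpow:
 assumes "p \<in> unipotent_block c" "mpow (p - mat 1) m $ i $ j \<noteq> 0"
 shows "c i + m \<le> c j"
 using assms(2)
proof (induction m arbitrary: i)
 case 0
 then show ?case by (simp add: mat_def split: if_splits)
next
 case (Suc m)
 then obtain k where k: "(p - mat 1) $ i $ k \<noteq> 0" "mpow (p - mat 1) m $ k $ j \<noteq> 0"
  using matrix_mult_nonzero[of "p - mat 1" "mpow (p - mat 1) m" i j] by auto
 have "c i < c k" using assms(1) k(1) unfolding unipotent_block_def by blast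
 then show ?case using Suc.IH[OF k(2)] by simp
qed

lemma unipotent_block_unipotent:
 fixes p :: "'k::field ^ 'n ^ 'n"
 assumes "p \<in> unipotent_block c"
 shows "unipotent p"
proof -
 have "mpow (p - mat 1) (Suc (Max (range c))) $ i $ j = 0" for i j
 proof (rule ccontr)
  assume "mpow (p - mat 1) (Suc (Max (range c))) $ i $ j \<noteq> 0"
  then have "c i + Suc (Max (range c)) \<le> c j" by (rule unipotent_block_mpow[OF assms])
  moreover have "c j \<le> Max (range c)" by (rule Max_ge) auto
  ultimately show False by simp
 qed
 then have "mpow (p - mat 1) (Suc (Max (range c))) = 0" unfolding vec_eq_iff by simp
 then show ?thesis unfolding unipotent_def by (rule exI)
qed

lemma unipotent_conj:
 fixes u x :: "'k::field ^ 'n ^ 'n"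
 assumes "unipotent u" and x: "invertible x"
 shows "unipotent (x ** u ** minv x)"
proof -
 obtain m where m: "mpow (u - mat 1) m = 0" using assms(1) unfolding unipotent_def by blast
 have e: "x ** u ** minv x - mat 1 = x ** (u - mat 1) ** minv x"
  using x by (simp add: matrix_diff_ldistrib matrix_diff_rdistrib matrix_inv_cancel)
 have "mpow (x ** w ** minv x) l = x ** mpow w l ** minv x" for w l
  by (induction l) (use x in \<open>simp_all add: matrix_inv_simps\<close>)
 then have "mpow (x ** u ** minv x - mat 1) m = 0" unfolding e using m by simp
 then show ?thesis unfolding unipotent_def by blast
qed

text \<open>On a kernel vector of \<open>p\<close> the nilpotent matrix \<open>p - 1\<close> acts as
  \<open>-1\<close>, which forces the vector to be zero.\<close>

lemma unipotent_invertible: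
 fixes p :: "'k::field ^ 'n ^ 'n"
 assumes "unipotent p"
 shows "invertible p"
 unfolding invertible_left_inverse matrix_left_invertible_ker
proof (intro allI impI)
 fix v :: "'k ^ 'n" assume v: "p *v v = 0"
 obtain m where m: "mpow (p - mat 1) m = 0" using assms unfolding unipotent_def by blast
 have step: "(p - mat 1) *v v = (- 1) *s v"
  using v by (simp add: matrix_vector_mult_diff_rdistrib matrix_vector_mult_diff_distrib vec_eq_iff matrix_vector_mult_def mat_def left_diff_distrib sum_subtractf if_distrib[of "\<lambda>x. x * _"] cong: if_cong)
 have "mpow (p - mat 1) l *v v = (- 1) ^ l *s v" for l
 proof (induction l)
  case 0
  then show ?case by simp
 next
  case (Suc l)
  have "mpow (p - mat 1) (Suc l) *v v = (p - mat 1) *v (mpow (p - mat 1) l *v v)"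
   by (simp add: matrix_vector_mul_assoc)
  also have "\<dots> = (- 1) ^ l *s ((p - mat 1) *v v)"
   unfolding Suc by (simp add: vec.scale)
  finally show ?case unfolding step by (simp add: vec_eq_iff)
 qed
 from this[of m] show "v = 0" unfolding m by (simp add: vec_eq_iff matrix_vector_mult_def)
qed

lemma unipotent_block_parabolic: "unipotent_block c \<subseteq> (parabolic c :: ('k::field ^ 'n ^ 'n) set)"
proof
 fix p :: "'k ^ 'n ^ 'n" assume p: "p \<in> unipotent_block c"
 have "c i \<le> c j" if "p $ i $ j \<noteq> 0" for i j
 proof (cases "i = j")
  case False
  then have "(p - mat 1) $ i $ j \<noteq> 0" using that by (simp add: mat_def)
  then show ?thesis using p unfolding unipotent_block_def by (simp add: less_imp_le)
 qed simp
 then show "p \<in> parabolic c"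
  using unipotent_invertible[OF unipotent_block_unipotent[OF p]] unfolding parabolic_def by blast
qed

lemma unipotent_block_conj:
 fixes p x :: "'k::field ^ 'n ^ 'n"
 assumes "p \<in> parabolic c" "x \<in> unipotent_block c"
 shows "p ** x ** minv p \<in> unipotent_block c"
 unfolding unipotent_block_def
proof (intro CollectI allI impI)
 have P: "\<And>i j. p $ i $ j \<noteq> 0 \<Longrightarrow> c i \<le> c j" "\<And>i j. minv p $ i $ j \<noteq> 0 \<Longrightarrow> c i \<le> c j"
  "\<And>i j. (x - mat 1) $ i $ j \<noteq> 0 \<Longrightarrow> c i < c j"
  using assms(1) parabolic_inv[OF assms(1)] assms(2) unfolding parabolic_def unipotent_block_def by blast+
 have "invertible p" using assms(1) unfolding parabolic_def by blast
 then have eq: "p ** x ** minv p - mat 1 = (p ** (x - mat 1)) ** minv p"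
  by (simp add: matrix_diff_ldistrib matrix_diff_rdistrib matrix_inv_cancel)
 fix i j assume "(p ** x ** minv p - mat 1) $ i $ j \<noteq> 0"
 then show "c i < c j"
  unfolding eq by (rule strict_mult_right[rotated 2]) (erule P(2), rule strict_mult_left[OF P(1) P(3)])
qed

lemma unipotent_block_group: "closed_group (unipotent_block c :: ('k::field ^ 'n ^ 'n) set)"
proof (rule closed_groupI)
 show inv: "invertible a" if "a \<in> unipotent_block c" for a :: "'k ^ 'n ^ 'n"
  by (rule unipotent_invertible[OF unipotent_block_unipotent[OF that]])
 have "unipotent_block c = {p \<in> Collect invertible. \<forall>(i, j)\<in>{(i, j). \<not> c i < c j}. (p :: 'k ^ 'n ^ 'n) $ i $ j = mat 1 $ i $ j}"
  using inv unfolding unipotent_block_def by fastforce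
 then show "zclosed GL_coords (Collect invertible) (unipotent_block c :: ('k ^ 'n ^ 'n) set)"
  by (rule ssubst) (rule zclosed_vanishing_entries)
 show "mat 1 \<in> (unipotent_block c :: ('k ^ 'n ^ 'n) set)" unfolding unipotent_block_def by simp
 have W: "\<And>i j. a $ i $ j \<noteq> 0 \<Longrightarrow> c i \<le> c j" "\<And>i j. minv a $ i $ j \<noteq> 0 \<Longrightarrow> c i \<le> c j"
  "\<And>i j. (a - mat 1) $ i $ j \<noteq> 0 \<Longrightarrow> c i < c j"
  if a: "a \<in> unipotent_block c" for a :: "'k ^ 'n ^ 'n"
  using subsetD[OF unipotent_block_parabolic a] parabolic_inv[OF subsetD[OF unipotent_block_parabolic a]] a
  unfolding parabolic_def unipotent_block_def by blast+
 show "a ** b \<in> unipotent_block c" if a: "a \<in> unipotent_block c" and b: "b \<in> unipotent_block c" for a b :: "'k ^ 'n ^ 'n"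
  unfolding unipotent_block_def
 proof (intro CollectI allI impI)
  have eq: "a ** b - mat 1 = a ** (b - mat 1) + (a - mat 1)" by (simp add: matrix_diff_ldistrib)
  fix i j assume "(a ** b - mat 1) $ i $ j \<noteq> 0"
  then have "(a ** (b - mat 1)) $ i $ j \<noteq> 0 \<or> (a - mat 1) $ i $ j \<noteq> 0" unfolding eq by auto
  then show "c i < c j"
   using strict_mult_left[of a c "b - mat 1" i j, OF W(1)[OF a] W(3)[OF b]] W(3)[OF a, of i j] by blast
 qed
 show "minv a \<in> unipotent_block c" if a: "a \<in> unipotent_block c" for a :: "'k ^ 'n ^ 'n"
  unfolding unipotent_block_def
 proof (intro CollectI allI impI)
  have eq: "minv a ** (a - mat 1) = - (minv a - mat 1)"
   using inv[OF a] by (simp add: matrix_diff_ldistrib matrix_inv_cancel)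
  fix i j assume "(minv a - mat 1) $ i $ j \<noteq> 0"
  then have "(minv a ** (a - mat 1)) $ i $ j \<noteq> 0" unfolding eq by simp
  then show "c i < c j"
   using strict_mult_left[of "minv a" c "a - mat 1" i j, OF W(2)[OF a] W(3)[OF a]] by blast
 qed
qed

text \<open>The intersection of \<open>K\<close> with the conjugate of \<open>L\<close> by
  \<open>b\<close>, written as a preimage of \<open>L\<close>.\<close>

definition conj_part :: "('k::field ^ 'n ^ 'n) set \<Rightarrow> ('k ^ 'n ^ 'n) set \<Rightarrow> 'k ^ 'n ^ 'n \<Rightarrow> ('k ^ 'n ^ 'n) set" where
 "conj_part K L b = {k \<in> K. minv b ** k ** b \<in> L}"

lemma conj_part_group:
 fixes K L :: "('k::field ^ 'n ^ 'n) set"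
 assumes K: "closed_group K" and L: "closed_group L" and b: "invertible b"
 shows "closed_group (conj_part K L b)"
proof (rule closed_group_subset[OF K])
 note K' = closed_groupD[OF K] and L' = closed_groupD[OF L]
 show "conj_part K L b \<subseteq> K" unfolding conj_part_def by blast
 show "mat 1 \<in> conj_part K L b" unfolding conj_part_def using K'(1) L'(1) b by (simp add: matrix_inv_cancel)
 show "x ** y \<in> conj_part K L b" if "x \<in> conj_part K L b" "y \<in> conj_part K L b" for x y
 proof -
  have "minv b ** (x ** y) ** b = (minv b ** x ** b) ** (minv b ** y ** b)"
   using b by (simp add: matrix_inv_simps)
  then show ?thesis using that K'(2) L'(2) unfolding conj_part_def by simp
 qed
 show "minv x \<in> conj_part K L b" if x: "x \<in> conj_part K L b" for x
 proof -
  have ix: "invertible x" using x K'(3) unfolding conj_part_def by blast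
  have "minv b ** minv x ** b = minv (minv b ** x ** b)"
   by (rule matrix_inv_unique'[symmetric]) (use b ix in \<open>simp add: matrix_inv_simps\<close>)
  then show ?thesis using x K'(4) L'(4) unfolding conj_part_def by simp
 qed
 have "conj_part K L b = {v \<in> K. translate (minv b) b v \<in> L}" unfolding conj_part_def translate_def ..
 moreover have "zclosed GL_coords K {v \<in> K. translate (minv b) b v \<in> L}"
 proof (rule zclosed_preimage[OF closed_group_GL_coords[OF L]])
  show "translate (minv b) b ` K \<subseteq> Collect invertible"
   using K'(3) b invertible_matrix_inv[OF b] unfolding translate_def by (auto intro!: invertible_mult)
 qed (rule PF_translate_coord)
 ultimately show "zclosed GL_coords K (conj_part K L b)" by simp
qed

text \<open>The greatest such subgroup of the identity component is normalized by the whole group.\<close>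

lemma not_reductive_id_component:
 fixes K :: "('k::alg_closed_field ^ 'n ^ 'n) set"
 assumes K: "closed_group K" and V: "normal_unipotent (id_component K) V" "V \<noteq> {mat 1}"
 shows "\<not> reductive_group K"
proof -
 note K' = closed_groupD[OF K]
 define K0 where "K0 = id_component K"
 have K0: "closed_group K0" unfolding K0_def by (rule id_component_group[OF K])
 have K0K: "K0 \<subseteq> K" unfolding K0_def by (rule id_component_subset)
 obtain R where R: "normal_unipotent K0 R" "\<And>U. normal_unipotent K0 U \<Longrightarrow> U \<subseteq> R"
  by (rule greatest_normal_unipotent[OF K0]) (rule that)
 note R1 = normal_unipotentD[OF R(1)]
 have K0conj: "x ** k ** minv x \<in> K0" if x: "x \<in> K" and k: "k \<in> K0" for x k
  unfolding K0_def
  by (rule id_component_conj[OF K]) (use x k K' in \<open>auto simp: K0_def\<close>)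
 have "normal_unipotent K R"
  unfolding normal_unipotent_def
 proof (intro conjI ballI)
  show "R \<subseteq> K" using R1(2) K0K by blast
  fix x u assume x: "x \<in> K" and u: "u \<in> R"
  have ix: "invertible x" "minv x \<in> K" using K'(3,4) x by blast+
  \<comment> \<open>The conjugate of \<open>R\<close> by \<open>x\<close>. It is again a connected
    normal unipotent subgroup of the identity component, hence contained in the greatest one,
    \<open>R\<close>.\<close>
  define R' where "R' = conj_part (Collect invertible) R x"
  have R'eq: "R' = translate x (minv x) ` R"
  proof -
   have "translate x (minv x) ` R = {v \<in> Collect invertible. translate (minv x) (minv (minv x)) v \<in> R}"
    by (rule translate_image) (use ix(1) closed_groupD(3)[OF R1(1)] in
     \<open>auto simp: translate_def intro!: invertible_mult invertible_matrix_inv\<close>)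
   then show ?thesis unfolding R'_def conj_part_def translate_def by (simp add: matrix_inv_involutive[OF ix(1)])
  qed
  have "normal_unipotent K0 R'"
   unfolding normal_unipotent_def
  proof (intro conjI ballI)
   show "closed_group R'" unfolding R'_def
    by (rule conj_part_group[OF GL_closed R1(1) ix(1)])
   show "R' \<subseteq> K0" unfolding R'eq translate_def using K0conj[OF x] R1(2) by blast
   show "irreducible_on GL_coords R'" unfolding R'eq by (rule translate_irreducible[OF R1(4)])
   show "unipotent v" if "v \<in> R'" for v
    using \<open>v \<in> R'\<close> R1(5) unipotent_conj[OF _ ix(1)] unfolding R'eq translate_def by blast
   show "y ** v ** minv y \<in> R'" if y: "y \<in> K0" and v: "v \<in> R'" for y v
   proof -
    obtain w where w: "w \<in> R" "v = x ** w ** minv x" using v unfolding R'eq translate_def by blast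
    define z where "z = minv x ** y ** x"
    have iy: "invertible y" using y K0K K'(3) by blast
    have z: "z \<in> K0" using K0conj[OF ix(2) y] unfolding z_def by (simp add: matrix_inv_involutive[OF ix(1)])
    have mz: "minv z = minv x ** minv y ** x"
     unfolding z_def by (rule matrix_inv_unique') (use ix(1) iy in \<open>simp add: matrix_inv_simps\<close>)
    have "y ** v ** minv y = translate x (minv x) (z ** w ** minv z)"
     unfolding w(2) mz unfolding z_def translate_def using ix(1) by (simp add: matrix_inv_simps)
    then show ?thesis unfolding R'eq using R1(3)[OF z w(1)] by blast
   qed
  qed
  then have "R' \<subseteq> R" by (rule R(2))
  then show "x ** u ** minv x \<in> R" using u unfolding R'eq translate_def by blast
 qed (use R1 in auto)
 moreover have "R \<noteq> {mat 1}"
 proof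
  assume "R = {mat 1}"
  moreover have "V \<subseteq> R" using R(2) V(1) unfolding K0_def by blast
  moreover have "mat 1 \<in> V" using V(1) closed_groupD(1) unfolding normal_unipotent_def by blast
  ultimately show False using V(2) by blast
 qed
 ultimately show ?thesis unfolding reductive_group_iff by blast
qed

text \<open>Both conditions bound a dimension from below, by \<open>d\<close> for the parabolic part
  and by 1 for the unipotent part; such bounds define closed sets in families.\<close>

definition degenerate_at :: "nat \<Rightarrow> ('k::field ^ 'n ^ 'n) set \<Rightarrow> ('n \<Rightarrow> nat) \<Rightarrow> 'k ^ 'n ^ 'n \<Rightarrow> bool" where
 "degenerate_at d K c b \<longleftrightarrow> invertible b \<and> (\<forall>e<d. \<not> growth (conj_part K (parabolic c) b) GL_coords e) \<and>
  \<not> growth (conj_part K (unipotent_block c) b) GL_coords 0"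

lemma not_reductive_iff:
 fixes K :: "('k::alg_closed_field ^ 'n ^ 'n) set"
 assumes K: "closed_group K" and d: "growth K GL_coords d" "\<And>e. e < d \<Longrightarrow> \<not> growth K GL_coords e"
 shows "\<not> reductive_group K \<longleftrightarrow> (\<exists>b c. degenerate_at d K c b)"
proof
 note K' = closed_groupD[OF K]
 assume "\<not> reductive_group K"
 then obtain U where U: "normal_unipotent K U" "U \<noteq> {mat 1}" unfolding reductive_group_iff using K by blast
 note U1 = normal_unipotentD[OF U(1)]
 obtain b :: "'k ^ 'n ^ 'n" and c :: "'n \<Rightarrow> nat" where b: "invertible b"
  "\<And>k i j. k \<in> K \<Longrightarrow> (minv b ** k ** b) $ i $ j \<noteq> 0 \<Longrightarrow> c i \<le> c j"
  "\<And>u i j. u \<in> U \<Longrightarrow> (minv b ** u ** b - mat 1) $ i $ j \<noteq> 0 \<Longrightarrow> c i < c j"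
 proof (rule unipotent_block_form[of U K])
  show "u ** v \<in> U" if "u \<in> U" "v \<in> U" for u v by (rule closed_groupD(2)[OF U1(1) that])
  show "\<exists>m. mpow (u - mat 1) m = 0" if "u \<in> U" for u using U1(5)[OF that] unfolding unipotent_def .
  show "\<exists>u'\<in>U. u ** k = k ** u'" if u: "u \<in> U" and k: "k \<in> K" for u k
  proof (rule bexI)
   show "minv k ** u ** k \<in> U"
    using U1(3)[OF K'(4)[OF k] u] K'(3)[OF k] by (simp add: matrix_inv_involutive)
   show "u ** k = k ** (minv k ** u ** k)"
    using K'(3)[OF k] by (simp add: matrix_inv_simps)
  qed
 next
  fix b :: "'k ^ 'n ^ 'n" and c :: "'n \<Rightarrow> nat"
  assume *: "invertible b" "\<And>k i j. k \<in> K \<Longrightarrow> (minv b ** k ** b) $ i $ j \<noteq> 0 \<Longrightarrow> c i \<le> c j"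
   "\<And>u i j. u \<in> U \<Longrightarrow> (minv b ** u ** b - mat 1) $ i $ j \<noteq> 0 \<Longrightarrow> c i < c j"
  show thesis by (rule that[of b c]) (fact *)+
 qed
 have "invertible (minv b ** k ** b)" if "k \<in> K" for k
  using b(1) K'(3)[OF that] invertible_matrix_inv by (intro invertible_mult) auto
 then have "conj_part K (parabolic c) b = K" unfolding conj_part_def parabolic_def using b(2) by blast
 moreover have "U \<subseteq> conj_part K (unipotent_block c) b"
  unfolding conj_part_def unipotent_block_def using b(3) U1(2) by blast
 then have "\<not> growth (conj_part K (unipotent_block c) b) GL_coords 0"
  using irreducible_growth_zero[OF U1(4) closed_groupD(1)[OF U1(1)]] U(2) growth_subset[OF _ _ subset_refl] by blast
 ultimately show "\<exists>b c. degenerate_at d K c b"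
  using b(1) d(2) unfolding degenerate_at_def by (intro exI[of _ b] exI[of _ c]) simp
next
 assume "\<exists>b c. degenerate_at d K c b"
 then obtain b :: "'k ^ 'n ^ 'n" and c where b: "invertible b" "\<forall>e<d. \<not> growth (conj_part K (parabolic c) b) GL_coords e"
  "\<not> growth (conj_part K (unipotent_block c) b) GL_coords 0" unfolding degenerate_at_def by blast
 define L where "L = conj_part K (parabolic c) b"
 define V where "V = conj_part K (unipotent_block c) b"
 define K0 where "K0 = id_component K"
 have L: "closed_group L" "L \<subseteq> K" unfolding L_def using conj_part_group[OF K parabolic_group b(1)] by (auto simp: conj_part_def)
 have V: "closed_group V" "V \<subseteq> K" unfolding V_def using conj_part_group[OF K unipotent_block_group b(1)] by (auto simp: conj_part_def)
 have K0: "closed_group K0" unfolding K0_def by (rule id_component_group[OF K])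
 \<comment> \<open>A closed subgroup of full dimension contains the identity component, whose
   elements therefore normalize the unipotent part.\<close>
 have K0L: "K0 \<subseteq> L" unfolding K0_def
  by (rule id_component_subset_full_dimension[OF K L d(1)]) (use b(2) L_def in blast)
 have C: "closed_group (V \<inter> K0)" by (rule closed_group_Int[OF V(1) K0])
 have "normal_unipotent K0 (id_component (V \<inter> K0))"
 proof (rule normal_unipotent_component[OF K0 C])
  show "V \<inter> K0 \<subseteq> K0" by blast
  show "unipotent u" if "u \<in> V \<inter> K0" for u
  proof -
   have "minv b ** u ** b \<in> unipotent_block c" using that unfolding V_def conj_part_def by blast
   from unipotent_conj[OF unipotent_block_unipotent[OF this] b(1)]
   show ?thesis using b(1) by (simp add: matrix_inv_simps)
  qed
  show "x ** u ** minv x \<in> V \<inter> K0" if x: "x \<in> K0" and u: "u \<in> V \<inter> K0" for x u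
  proof
   note K0' = closed_groupD[OF K0]
   show xu: "x ** u ** minv x \<in> K0" using K0'(2,4) x u by blast
   have p: "minv b ** x ** b \<in> parabolic c" using x K0L unfolding L_def conj_part_def by blast
   have q: "minv b ** u ** b \<in> unipotent_block c" using u unfolding V_def conj_part_def by blast
   have "minv (minv b ** x ** b) = minv b ** minv x ** b"
    by (rule matrix_inv_unique') (use b(1) K0'(3)[OF x] in \<open>simp add: matrix_inv_simps\<close>)
   then have "minv b ** (x ** u ** minv x) ** b =
    (minv b ** x ** b) ** (minv b ** u ** b) ** minv (minv b ** x ** b)"
    using b(1) by (simp add: matrix_inv_simps)
   then have "minv b ** (x ** u ** minv x) ** b \<in> unipotent_block c"
    using unipotent_block_conj[OF p q] by simp
   moreover have "x ** u ** minv x \<in> K" using xu K0L L(2) by blast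
   ultimately show "x ** u ** minv x \<in> V" unfolding V_def conj_part_def by blast
  qed
 qed
 moreover have "id_component (V \<inter> K0) \<noteq> {mat 1}"
 proof
  assume one: "id_component (V \<inter> K0) = {mat 1}"
  \<comment> \<open>A trivial identity component would make \<open>V\<close>
    zero-dimensional.\<close>
  have "id_component V \<subseteq> K0" unfolding K0_def by (rule id_component_mono[OF V(2)])
  then have "id_component V \<subseteq> id_component (V \<inter> K0)"
   using id_component_subset[of V] id_component_irreducible[OF V(1)] one_id_component[OF V(1)]
   by (intro id_component_largest) auto
  then have sub: "id_component V \<subseteq> {mat 1}" unfolding one .
  have "growth (id_component V) GL_coords 0"
   by (rule growth_constant) (use sub in auto)
  then have "growth V GL_coords 0" by (rule id_component_growth[OF V(1)])
  then show False using b(3) unfolding V_def by blast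
 qed
 ultimately show "\<not> reductive_group K"
  using not_reductive_id_component[OF K] unfolding K0_def by blast
qed

section \<open>Openness of the reductive locus\<close>

lemma zclosed_finite_Union:
 fixes X :: "('v \<Rightarrow> 'k::field) set"
 assumes "finite \<D>" "\<And>D. D \<in> \<D> \<Longrightarrow> zclosed X S D"
 shows "zclosed X S (\<Union>\<D>)"
 unfolding zclosed_iff
proof (intro conjI ballI)
 show "\<Union>\<D> \<subseteq> S" using assms(2) zclosed_subset by blast
 fix v assume v: "v \<in> S - \<Union>\<D>"
 have "\<forall>D\<in>\<D>. \<exists>f. f \<in> PF X \<and> f v \<noteq> 0 \<and> (\<forall>w\<in>D. f w = 0)"
 proof
  fix D assume D: "D \<in> \<D>"
  have "\<exists>f\<in>PF X. f v \<noteq> 0 \<and> (\<forall>w\<in>D. f w = 0)"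
   by (rule zclosed_separate[OF assms(2)[OF D]]) (use v D in auto)
  then show "\<exists>f. f \<in> PF X \<and> f v \<noteq> 0 \<and> (\<forall>w\<in>D. f w = 0)" by (elim bexE) (rule exI, rule conjI)
 qed
 from bchoice[OF this] obtain f where f: "\<forall>D\<in>\<D>. f D \<in> PF X \<and> f D v \<noteq> 0 \<and> (\<forall>w\<in>D. f D w = 0)" by (elim exE)
 show "\<exists>g\<in>PF X. g v \<noteq> 0 \<and> (\<forall>w\<in>\<Union>\<D>. g w = 0)"
 proof (intro bexI[of _ "\<lambda>w. \<Prod>D\<in>\<D>. f D w"] conjI ballI)
  show "(\<Prod>D\<in>\<D>. f D v) \<noteq> 0" using f assms(1) by simp
  show "(\<lambda>w. \<Prod>D\<in>\<D>. f D w) \<in> PF X" using f by (intro PF_prod) blast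
  fix w assume "w \<in> \<Union>\<D>"
  then obtain D where "D \<in> \<D>" "w \<in> D" by blast
  then show "(\<Prod>D\<in>\<D>. f D w) = 0" using f assms(1) by (intro prod_zero bexI[of _ D]) auto
 qed
qed

lemma subtopology_matrix_zariski:
 fixes K :: "('k::field ^ 'n ^ 'n) set"
 assumes "K \<subseteq> Collect invertible"
 shows "subtopology matrix_zariski K = subtopology (zariski_topology GL_coords) K"
 unfolding topology_eq openin_closedin_eq closedin_matrix_zariski[OF assms] closedin_zariski_subtopology
 by (simp add: matrix_zariski_def topspace_zariski)

lemma group_dimension_le_iff:
 fixes K :: "('k::alg_closed_field ^ 'n ^ 'n) set"
 assumes K: "closed_group K"
 shows "group_dimension K \<le> enat d \<longleftrightarrow> growth K GL_coords d"
proof -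
 have "K \<subseteq> Collect invertible" using closed_groupD(3)[OF K] by blast
 then show ?thesis
  unfolding group_dimension_def
  by (simp add: subtopology_matrix_zariski krull_dimension_le_iff[OF finite_GL_coords
   affine_on_zclosed[OF affine_on_GL closed_group_GL_coords[OF K]]])
qed

lemma conj_iff:
 fixes g :: "'k::field ^ 'n ^ 'n"
 assumes "invertible g"
 shows "(\<exists>h\<in>H. k ** g = g ** h) \<longleftrightarrow> minv g ** k ** g \<in> H"
proof
 assume "\<exists>h\<in>H. k ** g = g ** h"
 then obtain h where h: "h \<in> H" "k ** g = g ** h" by blast
 have "minv g ** k ** g = minv g ** (k ** g)" by (simp add: matrix_mul_assoc)
 also have "\<dots> = h" unfolding h(2) using assms by (simp add: matrix_inv_cancel)
 finally show "minv g ** k ** g \<in> H" using h(1) by simp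
next
 assume "minv g ** k ** g \<in> H"
 moreover have "k ** g = g ** (minv g ** k ** g)"
  using assms by (simp add: matrix_inv_simps)
 ultimately show "\<exists>h\<in>H. k ** g = g ** h" by blast
qed

lemma conj_stab_iff:
 assumes "g \<in> GL_tuples I"
 shows "conj_stab I M H g = {k \<in> M. \<forall>s\<in>I. minv (g s) ** k ** g s \<in> H s}"
proof -
 have "invertible (g s)" if "s \<in> I" for s using assms that unfolding GL_tuples_def by blast
 then show ?thesis unfolding conj_stab_def using conj_iff by blast
qed

text \<open>The part of a stabilizer cut out by a conjugate of \<open>L\<close> is itself a
  stabilizer, with one more factor, so semicontinuity applies to it jointly in \<open>g\<close> and
  \<open>b\<close>.\<close>

lemma conj_stab_insert:
 assumes "m \<notin> I" "g \<in> GL_tuples I" "invertible b"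
 shows "conj_stab (insert m I) M (H(m := L)) (g(m := b)) = conj_part (conj_stab I M H g) L b"
proof -
 have "g(m := b) \<in> GL_tuples (insert m I)" using assms unfolding GL_tuples_def by auto
 then have "conj_stab (insert m I) M (H(m := L)) (g(m := b)) =
  {k \<in> M. \<forall>s\<in>insert m I. minv ((g(m := b)) s) ** k ** (g(m := b)) s \<in> (H(m := L)) s}"
  by (rule conj_stab_iff)
 also have "\<dots> = {k \<in> M. minv b ** k ** b \<in> L \<and> (\<forall>s\<in>I. minv (g s) ** k ** g s \<in> H s)}"
  using assms(1) by (intro Collect_cong) (auto split: if_splits)
 finally show ?thesis unfolding conj_part_def conj_stab_iff[OF assms(2)] by blast
qed

lemma (in conjugate_family) stabilizer_group:
 assumes g: "g \<in> GL_tuples I"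
 shows "closed_group (K g)"
proof (rule closed_group_subset[OF group_M])
 show "K g \<subseteq> M" unfolding conj_stab_def by blast
 have single: "zclosed GL_coords M {k \<in> M. translate (minv (g s)) (g s) k \<in> H s}" if s: "s \<in> I" for s
 proof (rule zclosed_preimage[OF closed_group_GL_coords[OF group_H[OF s]]])
  have "invertible (g s)" using g s unfolding GL_tuples_def by blast
  then show "translate (minv (g s)) (g s) ` M \<subseteq> Collect invertible"
   using groupM(3) invertible_matrix_inv unfolding translate_def by (auto intro!: invertible_mult)
 qed (rule PF_translate_coord)
 have "zclosed GL_coords M {k \<in> M. \<forall>s\<in>J. translate (minv (g s)) (g s) k \<in> H s}" if "J \<subseteq> I" for J
  using finite_subset[OF that finite_I] that
 proof (induction J rule: finite_induct)
  case empty
  then show ?case by (simp add: zclosed_refl)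
 next
  case (insert s J)
  have "{k \<in> M. \<forall>r\<in>insert s J. translate (minv (g r)) (g r) k \<in> H r} =
   {k \<in> M. translate (minv (g s)) (g s) k \<in> H s} \<inter> {k \<in> M. \<forall>s\<in>J. translate (minv (g s)) (g s) k \<in> H s}" by blast
  then show ?case using insert.IH insert.prems single by (simp add: zclosed_Int)
 qed
 from this[OF subset_refl] show "zclosed GL_coords M (K g)"
  unfolding conj_stab_iff[OF g] translate_def .
qed (rule K_one K_mult K_inv; assumption)+

text \<open>Conjugation by \<open>\<beta>\<close> preserves \<open>L\<close>, so only the coset of
  \<open>g m\<close> modulo such \<open>\<beta>\<close> counts.\<close>

lemma conj_stab_right_mult:
 fixes L :: "('k::field ^ 'n ^ 'n) set"
 assumes \<beta>: "invertible \<beta>" and conj: "\<And>h. h \<in> L \<Longrightarrow> \<beta> ** h ** minv \<beta> \<in> L" "\<And>h. h \<in> L \<Longrightarrow> minv \<beta> ** h ** \<beta> \<in> L"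
  and "m \<in> I" and g: "g \<in> GL_tuples I"
 shows "conj_stab I M (H(m := L)) (g(m := g m ** \<beta>)) = conj_stab I M (H(m := L)) g"
proof -
 have gm: "invertible (g m)" using g \<open>m \<in> I\<close> unfolding GL_tuples_def by blast
 have e: "minv (g m ** \<beta>) ** k ** (g m ** \<beta>) = minv \<beta> ** (minv (g m) ** k ** g m) ** \<beta>" for k
  using gm \<beta> by (simp add: matrix_inv_mult matrix_mul_assoc)
 have "minv \<beta> ** h ** \<beta> \<in> L \<longleftrightarrow> h \<in> L" for h
 proof
  assume "minv \<beta> ** h ** \<beta> \<in> L"
  then have "\<beta> ** (minv \<beta> ** h ** \<beta>) ** minv \<beta> \<in> L" by (rule conj(1))
  then show "h \<in> L" using \<beta> by (simp add: matrix_inv_simps)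
 qed (rule conj(2))
 then have "minv ((g(m := g m ** \<beta>)) s) ** k ** (g(m := g m ** \<beta>)) s \<in> (H(m := L)) s \<longleftrightarrow>
  minv (g s) ** k ** g s \<in> (H(m := L)) s" for s k
  by (cases "s = m") (simp_all add: e)
 then show ?thesis
  unfolding conj_stab_iff[OF g] conj_stab_iff[OF GL_tuples_update[OF g \<beta>]] by simp
qed

text \<open>The indices are numbered in an order sorted by \<open>c\<close>. The Borel subgroup of
  this numbering lies in \<open>parabolic c\<close>, and the completeness argument runs over minimal
  parabolic subgroups above a Borel subgroup.\<close>

lemma refine_to_bijection:
 fixes c :: "'n::finite \<Rightarrow> nat"
 obtains lv where "bij_betw lv (UNIV :: 'n set) {..<CARD('n)}" "\<And>i j. lv i \<le> lv j \<Longrightarrow> c i \<le> c j"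
proof -
 obtain xs :: "'n list" where xs: "set xs = UNIV" "distinct xs" "sorted (map c xs)"
 proof -
  obtain ys :: "'n list" where "set ys = UNIV" "distinct ys" using finite_distinct_list[of "UNIV :: 'n set"] by auto
  then show thesis by (intro that[of "sort_key c ys"]) auto
 qed
 have len: "length xs = CARD('n)" using distinct_card[OF xs(2)] xs(1) by simp
 have bij: "bij_betw ((!) xs) {..<CARD('n)} UNIV"
  using bij_betw_nth[OF xs(2), of "{..<CARD('n)}" UNIV] xs(1) len by simp
 define lv where "lv = the_inv_into {..<CARD('n)} ((!) xs)"
 have lv: "bij_betw lv UNIV {..<CARD('n)}" unfolding lv_def by (rule bij_betw_the_inv_into[OF bij])
 have nth: "xs ! lv i = i" for i
  unfolding lv_def using f_the_inv_into_f_bij_betw[OF bij] by simp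
 have "c i \<le> c j" if "lv i \<le> lv j" for i j
 proof -
  have lt: "lv k < length xs" for k using lv len unfolding bij_betw_def by auto
  have "map c xs ! lv i \<le> map c xs ! lv j" by (rule sorted_nth_mono[OF xs(3) that]) (simp add: lt)
  then show ?thesis using lt nth by simp
 qed
 with lv show ?thesis by (rule that)
qed

section \<open>Closedness of the degenerate locus\<close>

context conjugate_family
begin

lemma family_insert:
 assumes "m \<notin> I" "m \<noteq> 0" "closed_group L"
 shows "conjugate_family M (H(m := L)) (insert m I)"
 by unfold_locales (use finite_I zero_notin group_M group_H assms in auto)

lemma stabilizer_dimension_ge_zclosed:
 "zclosed (tuple_coords I) (GL_tuples I) {g \<in> GL_tuples I. \<forall>e<d. \<not> growth (K g) GL_coords e}"
proof (cases d)
 case 0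
 then show ?thesis by (simp add: zclosed_refl)
next
 case (Suc d')
 have "(\<forall>e<d. \<not> growth (K g) GL_coords e) \<longleftrightarrow> \<not> growth (K g) GL_coords d'" for g
  unfolding Suc less_Suc_eq_le using growth_mono by blast
 then show ?thesis using stabilizer_dimension_zclosed[of d'] by simp
qed

definition degenerate :: "nat \<Rightarrow> ('n \<Rightarrow> nat) \<Rightarrow> (nat \<Rightarrow> 'k ^ 'n ^ 'n) set" where
 "degenerate d c = {g \<in> GL_tuples I. \<exists>b. degenerate_at d (K g) c b}"

lemma degenerate_zclosed: "zclosed (tuple_coords I) (GL_tuples I) (degenerate d c)"
proof -
 \<comment> \<open>The index of the new factor also has to differ from 0, which belongs to
   \<open>M\<close>.\<close>
 have "\<exists>m. m \<notin> I \<and> m \<noteq> 0" using ex_new_if_finite[OF infinite_UNIV_nat, of "insert 0 I"] finite_I by auto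
 then obtain m where m: "m \<notin> I" "m \<noteq> 0" by blast
 obtain lv where lv: "bij_betw lv (UNIV :: 'n set) {..<CARD('n)}" "\<And>i j. lv i \<le> lv j \<Longrightarrow> c i \<le> c j"
  by (rule refine_to_bijection[of c]) (rule that)
 define J where "J = insert m I"
 define HP where "HP = H(m := parabolic c)"
 define HU where "HU = H(m := unipotent_block c)"
 interpret P: conjugate_family M HP J unfolding HP_def J_def by (rule family_insert[OF m parabolic_group])
 interpret U: conjugate_family M HU J unfolding HU_def J_def by (rule family_insert[OF m unipotent_block_group])
 \<comment> \<open>The matrix \<open>b\<close> sits in slot \<open>m\<close> of the tuple; the two
   families differ only in the subgroup attached to that slot.\<close>
 define Z where "Z = {g \<in> GL_tuples J. \<forall>e<d. \<not> growth (conj_stab J M HP g) GL_coords e} \<inter>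
  {g \<in> GL_tuples J. \<not> growth (conj_stab J M HU g) GL_coords 0}"
 have Z: "zclosed (tuple_coords J) (GL_tuples J) Z"
  unfolding Z_def by (rule zclosed_Int[OF P.stabilizer_dimension_ge_zclosed U.stabilizer_dimension_zclosed])
 have sub: "parabolic lv \<subseteq> (parabolic c :: ('k ^ 'n ^ 'n) set)" unfolding parabolic_def using lv(2) by blast
 have "right_invariant m (parabolic lv) Z"
  unfolding right_invariant_def
 proof (intro ballI)
  fix g and \<beta> :: "'k ^ 'n ^ 'n" assume g: "g \<in> Z" and "\<beta> \<in> parabolic lv"
  then have \<beta>: "\<beta> \<in> parabolic c" "minv \<beta> \<in> parabolic c" "invertible \<beta>"
   using sub parabolic_inv unfolding parabolic_def by blast+
  have gJ: "g \<in> GL_tuples J" using g unfolding Z_def by blast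
  have "conj_stab J M HP (g(m := g m ** \<beta>)) = conj_stab J M HP g"
   unfolding HP_def
   by (rule conj_stab_right_mult[OF \<beta>(3) _ _ _ gJ]) (use \<beta>(1,2) in \<open>auto simp: J_def intro: parabolic_mult\<close>)
  moreover have "conj_stab J M HU (g(m := g m ** \<beta>)) = conj_stab J M HU g"
   unfolding HU_def
  proof (rule conj_stab_right_mult[OF \<beta>(3) _ _ _ gJ])
   show "\<beta> ** h ** minv \<beta> \<in> unipotent_block c" if "h \<in> unipotent_block c" for h
    by (rule unipotent_block_conj[OF \<beta>(1) that])
   show "minv \<beta> ** h ** \<beta> \<in> unipotent_block c" if "h \<in> unipotent_block c" for h
    using unipotent_block_conj[OF \<beta>(2) that] by (simp add: matrix_inv_involutive[OF \<beta>(3)])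
  qed (simp add: J_def)
  ultimately show "g(m := g m ** \<beta>) \<in> Z"
   using g GL_tuples_update[OF gJ \<beta>(3)] unfolding Z_def by simp
 qed
 then have cl: "zclosed (tuple_coords I) (GL_tuples I) {g \<in> GL_tuples I. \<exists>b. g(m := b) \<in> Z}"
  using projection_zclosed[OF Z[unfolded J_def] m(1) _ lv(1)] by blast
 have "g(m := b) \<in> Z \<longleftrightarrow> degenerate_at d (K g) c b" if g: "g \<in> GL_tuples I" for g b
 proof (cases "invertible b")
  case True
  then have "g(m := b) \<in> GL_tuples J" using g m(1) unfolding GL_tuples_def J_def by auto
  then show ?thesis
   unfolding Z_def HP_def HU_def degenerate_at_def using True conj_stab_insert[OF m(1) g True] by (simp add: J_def)
 next
  case False
  then have "g(m := b) \<notin> GL_tuples J" unfolding GL_tuples_def J_def by auto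
  then show ?thesis unfolding Z_def degenerate_at_def using False by blast
 qed
 then have "degenerate d c = {g \<in> GL_tuples I. \<exists>b. g(m := b) \<in> Z}" unfolding degenerate_def by blast
 then show ?thesis using cl by simp
qed

text \<open>The level function enters only through the preorder it induces on the finite index
  type.\<close>

lemma finite_degenerate: "finite (range (degenerate d))"
proof -
 define rel where "rel c = {(i, j). c i \<le> c j}" for c :: "'n \<Rightarrow> nat"
 have "degenerate d c = degenerate d c'" if "rel c = rel c'" for c c'
 proof -
  have le: "c i \<le> c j \<longleftrightarrow> c' i \<le> c' j" for i j using that unfolding rel_def by auto
  then have "c i < c j \<longleftrightarrow> c' i < c' j" for i j unfolding not_le[symmetric] by simp
  then have "parabolic c = (parabolic c' :: ('k ^ 'n ^ 'n) set)" "unipotent_block c = (unipotent_block c' :: ('k ^ 'n ^ 'n) set)"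
   unfolding parabolic_def unipotent_block_def using le by simp_all
  then show ?thesis unfolding degenerate_def degenerate_at_def by simp
 qed
 moreover have "rel (inv_into UNIV rel (rel c)) = rel c" for c by (rule f_inv_into_f[of _ rel UNIV]) simp
 ultimately have "degenerate d (inv_into UNIV rel (rel c)) = degenerate d c" for c by blast
 then have "range (degenerate d) = (\<lambda>r. degenerate d (inv_into UNIV rel r)) ` range rel"
  by (simp add: image_image)
 moreover have "finite (range rel)" by simp
 ultimately show ?thesis by simp
qed

lemma not_reductive_stabilizer_iff:
 assumes g: "g \<in> GL_tuples I" and d: "growth (K g) GL_coords d" "\<And>e. e < d \<Longrightarrow> \<not> growth (K g) GL_coords e"
 shows "\<not> reductive_group (K g) \<longleftrightarrow> g \<in> \<Union>(range (degenerate d))"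
proof -
 have "\<not> reductive_group (K g) \<longleftrightarrow> (\<exists>b c. degenerate_at d (K g) c b)"
  by (rule not_reductive_iff[OF stabilizer_group[OF g] d(1)]) (rule d(2))
 then show ?thesis unfolding degenerate_def using g by blast
qed

end

section \<open>Translation to the notions of the theorem\<close>

lemma conjugate_intersection_eq:
 fixes M :: "('k::field ^ 'n ^ 'n) set"
 assumes g: "g \<in> GL_tuples {1..t}" and H: "\<And>s. s \<in> {1..t} \<Longrightarrow> H s \<subseteq> Collect invertible"
 shows "conjugate_intersection t M H g = conj_stab {1..t} M H g"
proof -
 have "conjugate_subgroup (g s) (H s) = {k. \<exists>h\<in>H s. k ** g s = g s ** h}" if s: "s \<in> {1..t}" for s
 proof -
  have gs: "invertible (g s)" using g s unfolding GL_tuples_def by blast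
  have GLU: "(GL :: ('k ^ 'n ^ 'n) monoid) = GL\<lparr>carrier := Collect invertible\<rparr>" by (simp add: GL_def)
  have inv: "inv\<^bsub>GL\<^esub> (g s) = minv (g s)"
   by (subst GLU, rule inv_in_GL) (use gs invertible_matrix_inv in auto)
  have "k = g s ** h ** minv (g s) \<longleftrightarrow> k ** g s = g s ** h" for k h
  proof
   assume "k = g s ** h ** minv (g s)"
   then show "k ** g s = g s ** h" using gs by (simp add: matrix_inv_simps)
  next
   assume "k ** g s = g s ** h"
   then have "(k ** g s) ** minv (g s) = g s ** h ** minv (g s)" by simp
   then show "k = g s ** h ** minv (g s)" using gs by (simp add: matrix_inv_simps)
  qed
  then show ?thesis unfolding conjugate_subgroup_def inv by (auto simp: GL_def)
 qed
 then show ?thesis unfolding conjugate_intersection_def conj_stab_def by auto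
qed

theorem theorem1p3:
  fixes G M :: "('k::alg_closed_field ^ 'n ^ 'n) set"
    and H :: "nat \<Rightarrow> ('k ^ 'n ^ 'n) set"
    and t :: nat
  assumes "reductive_group G"
    and "t > 0"
    and "closed_subgroup G M"
    and "\<And>s. s \<in> {1..t} \<Longrightarrow> closed_subgroup G (H s)"
    and "reductive_group M"
  shows "openin (subtopology (tuple_zariski t) ({1..t} \<rightarrow>\<^sub>E G))
    {g \<in> {1..t} \<rightarrow>\<^sub>E G.
       reductive_group (conjugate_intersection t M H g) \<and>
       (\<forall>x \<in> {1..t} \<rightarrow>\<^sub>E G. group_dimension (conjugate_intersection t M H g)
          \<le> group_dimension (conjugate_intersection t M H x))}"
proof -
 define I where "I = {1..t}"
 define T where "T = ({1..t} \<rightarrow>\<^sub>E G)"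
 have G: "closed_group G" using assms(1) unfolding reductive_group_iff by blast
 have M: "closed_group M" and Hs: "\<And>s. s \<in> I \<Longrightarrow> closed_group (H s)"
  using assms(3,4) closed_subgroup_iff[OF G] unfolding I_def by blast+
 interpret conjugate_family M H I
  by unfold_locales (use M Hs in \<open>auto simp: I_def\<close>)
 have TGL: "T \<subseteq> GL_tuples I"
  unfolding T_def GL_tuples_def I_def using closed_groupD(3)[OF G] by (auto simp: PiE_iff)
 have Kg: "conjugate_intersection t M H g = K g" if "g \<in> T" for g
  unfolding I_def
  by (rule conjugate_intersection_eq) (use that TGL Hs closed_groupD(3) in \<open>auto simp: I_def\<close>)
 have group: "closed_group (K g)" if "g \<in> T" for g using stabilizer_group TGL that by blast
 define \<delta> where "\<delta> g = group_dimension (conjugate_intersection t M H g)" for g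
 have dim: "\<delta> g \<le> enat e \<longleftrightarrow> growth (K g) GL_coords e" if "g \<in> T" for g e
  unfolding \<delta>_def Kg[OF that] by (rule group_dimension_le_iff[OF group[OF that]])
 \<comment> \<open>The minimal dimension over \<open>T\<close>; it is a natural number because every
   growth exponent is bounded by the number of coordinates.\<close>
 define d where "d = (LEAST e. \<exists>x\<in>T. growth (K x) GL_coords e)"
 have "(\<lambda>s\<in>{1..t}. mat 1) \<in> T" unfolding T_def using closed_groupD(1)[OF G] by auto
 moreover have bound: "growth (K x) GL_coords (card (GL_coords :: ('k ^ 'n ^ 'n \<Rightarrow> 'k) set))" for x
  using growth_base[OF finite_GL_coords, of "K x" "\<lambda>x. x"] by simp
 ultimately have "\<exists>e. \<exists>x\<in>T. growth (K x) GL_coords e" by blast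
 then have "\<exists>x\<in>T. growth (K x) GL_coords d" unfolding d_def by (rule LeastI_ex)
 then obtain x\<^sub>0 where x\<^sub>0: "x\<^sub>0 \<in> T" "growth (K x\<^sub>0) GL_coords d" by blast
 have d_le: "d \<le> e" if "x \<in> T" "growth (K x) GL_coords e" for x e
  unfolding d_def by (rule Least_le) (use that in blast)
 have minimal: "(\<forall>x\<in>T. \<delta> g \<le> \<delta> x)
   \<longleftrightarrow> growth (K g) GL_coords d" if g: "g \<in> T" for g
 proof
  assume "\<forall>x\<in>T. \<delta> g \<le> \<delta> x"
  then have "\<delta> g \<le> \<delta> x\<^sub>0"
   using x\<^sub>0(1) by blast
  also have "\<dots> \<le> enat d" using dim[OF x\<^sub>0(1)] x\<^sub>0(2) by blast
  finally show "growth (K g) GL_coords d" using dim[OF g] by blast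
 next
  assume gr: "growth (K g) GL_coords d"
  show "\<forall>x\<in>T. \<delta> g \<le> \<delta> x"
  proof
   fix x assume x: "x \<in> T"
   have "\<delta> x \<le> enat (card (GL_coords :: ('k ^ 'n ^ 'n \<Rightarrow> 'k) set))"
    using dim[OF x] bound by blast
   then obtain e where e: "\<delta> x = enat e"
    by (cases "\<delta> x") auto
   then have "growth (K x) GL_coords e" using dim[OF x, of e] by simp
   then have "enat d \<le> enat e" using d_le[OF x] by simp
   moreover have "\<delta> g \<le> enat d" using dim[OF g] gr by blast
   ultimately show "\<delta> g \<le> \<delta> x"
    unfolding e by (rule order_trans[rotated])
  qed
 qed
 define A where "A = {g \<in> T. reductive_group (conjugate_intersection t M H g) \<and>
  (\<forall>x\<in>T. \<delta> g \<le> \<delta> x)}"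
 \<comment> \<open>The closed bad sets. The degenerate loci detect failure of reductivity only for
   stabilizers of dimension exactly \<open>d\<close>; all larger dimensions are covered by the first
   member.\<close>
 define B where "B = {{g \<in> GL_tuples I. \<not> growth (K g) GL_coords d}} \<union> range (degenerate d)"
 have "zclosed (tuple_coords I) (GL_tuples I) (\<Union>B)"
  by (rule zclosed_finite_Union)
   (use stabilizer_dimension_zclosed degenerate_zclosed finite_degenerate in \<open>auto simp: B_def\<close>)
 \<comment> \<open>Passage from tuples of invertible matrices to tuples in \<open>G\<close>.\<close>
 then have "zclosed (tuple_coords I) T (\<Union>B \<inter> T)" by (rule zclosed_relative) (rule TGL)
 moreover have "\<Union>B \<inter> T = T - A"
 proof -
  have "g \<in> \<Union>B \<longleftrightarrow> g \<notin> A" if g: "g \<in> T" for g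
  proof (cases "growth (K g) GL_coords d")
   case True
   have "g \<in> \<Union>B \<longleftrightarrow> g \<in> \<Union>(range (degenerate d))" unfolding B_def using True by blast
   also have "\<dots> \<longleftrightarrow> \<not> reductive_group (K g)"
    by (rule not_reductive_stabilizer_iff[symmetric]) (use g TGL True d_le[OF g] in \<open>auto simp: leD\<close>)
   finally show ?thesis unfolding A_def using g True minimal[OF g] Kg[OF g] by simp
  next
   case False
   then show ?thesis unfolding A_def B_def using g TGL minimal[OF g] by blast
  qed
  then show ?thesis by blast
 qed
 ultimately have "zclosed (tuple_coords I) T (T - A)" by simp
 then have "closedin (subtopology (zariski_topology (tuple_coords I)) T) (T - A)"
  unfolding closedin_zariski_subtopology .
 moreover have "topspace (subtopology (zariski_topology (tuple_coords I)) T) = T"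
  by (simp add: topspace_zariski)
 moreover have "A \<subseteq> T" unfolding A_def by blast
 ultimately have "openin (subtopology (zariski_topology (tuple_coords I)) T) A"
  unfolding openin_closedin_eq by simp
 moreover have "tuple_zariski t = zariski_topology (tuple_coords I :: ((nat \<Rightarrow> 'k ^ 'n ^ 'n) \<Rightarrow> 'k) set)"
  unfolding tuple_zariski_def tuple_coords_def I_def ..
 ultimately show ?thesis unfolding A_def T_def \<delta>_def by simp
qed

end
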